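(* Let $d\ge1$ and let $\mu=\varrho(t,x)\,dt\,dx$ be a measure on $(0,1)\times\mathbb{R}^d$ such that for every $t\in[0,1)$ the function $x\mapsto\varrho(t,x)$ is a probability density on $\mathbb{R}^d$; put $\mu_t=\varrho(t,\cdot)\,dx$. Suppose that $\mu$ satisfies the weak parabolic equation $L^*\mu=0$ with initial condition $\mu_0=\varrho(0,\cdot)\,dx$ at $t=0$. Assume: (i) the matrix mapping $A=(a^{ij})$ is uniformly bounded, $A(t,x)\ge\alpha\cdot I$ for all $(t,x)$ with some constant $\alpha>0$, and the functions $x\mapsto a^{ij}(t,x)$ are Lipschitzian with constant $\lambda$ (for all $t$, $i,j$); (ii) $|b|\in L^2(\mu)$; (iii) the function $\Lambda(x):=\ln\max(|x|,1)$ is in $L^2(\mu)$; (iv) $\mu_0$ has finite entropy; (v) $|b|\in L^\beta(\mu)$ for some $\beta>d+2$, and $\varrho(0,\cdot)\in L^\infty(\mathbb{R}^d)$; (vi) either $\sup_{t\in[0,1)}\|b(t,\cdot)\|_{L^d(\mu_t)}<\infty$, or, with some $p>1$, $\varrho\in L^p([0,\tau]\times\mathbb{R}^d)$ for all $\tau<1$. Then $\varrho\in L^\infty([0,\tau]\times\mathbb{R}^d)$ for every $\tau<1$.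
   Context: The coefficients $a^{ij}$ and $b^i$ ($1\le i,j\le d$) are Borel functions on $[0,1]\times\mathbb{R}^d$, the matrix $A(t,x)=(a^{ij}(t,x))$ is symmetric and nonnegative, $b=(b^i)$, and (summation over repeated indices) $$Lu(t,x)=\frac{\partial u(t,x)}{\partial t}+a^{ij}(t,x)\partial_{x_i}\partial_{x_j}u(t,x)+b^i(t,x)\partial_{x_i}u(t,x).$$ A Borel probability measure $\mu(dt\,dx)=\mu_t(dx)\,dt$ on $(0,1)\times\mathbb{R}^d$, given by a family of Borel measures $(\mu_t)_{t\in[0,1)}$ on $\mathbb{R}^d$, satisfies the weak parabolic equation $L^*\mu=0$ if $a^{ij}$ and $b^i$ are $\mu$-integrable on every compact set in $(0,1)\times\mathbb{R}^d$ and $$\int_0^1\int_{\mathbb{R}^d}Lu(t,x)\,\mu_t(dx)\,dt=0\quad\text{for every }u\in C_0^\infty((0,1)\times\mathbb{R}^d).$$ It satisfies the initial condition $\mu_0=\nu$ at $t=0$ if $\lim_{t\to0}\int\zeta\,d\mu_t=\int\zeta\,d\nu$ for all $\zeta\in C_0^\infty(\mathbb{R}^d)$. A nonnegative measure $\mu_0=\varrho_0\,dx$ on $\mathbb{R}^d$ has finite entropy if $\varrho_0\ln\varrho_0\in L^1(\mathbb{R}^d)$, where $0\ln0:=0$. *)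

theory Defs
  imports "HOL-Analysis.Analysis"
begin

fun Ck :: "nat \<Rightarrow> ('a::real_normed_vector \<Rightarrow> real) \<Rightarrow> bool" where
  "Ck 0 f \<longleftrightarrow> continuous_on UNIV f"
| "Ck (Suc k) f \<longleftrightarrow> (\<forall>x. f differentiable (at x)) \<and>
     (\<forall>v. Ck k (\<lambda>x. frechet_derivative f (at x) v))"

text \<open>Compactly supported smooth functions on an open set are represented by their extensions
  by zero to the whole space.\<close>

definition test_function :: "'a::euclidean_space set \<Rightarrow> ('a \<Rightarrow> real) \<Rightarrow> bool" where
  "test_function U u \<longleftrightarrow>
     (\<forall>k. Ck k u) \<and> compact (closure {z. u z \<noteq> 0}) \<and> closure {z. u z \<noteq> 0} \<subseteq> U"

definition partial_t :: "(real \<times> (real^'n) \<Rightarrow> real) \<Rightarrow> real \<times> (real^'n) \<Rightarrow> real" where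
  "partial_t u = (\<lambda>(t, x). deriv (\<lambda>s. u (s, x)) t)"

definition partial_x :: "'n \<Rightarrow> (real \<times> (real^'n) \<Rightarrow> real) \<Rightarrow> real \<times> (real^'n) \<Rightarrow> real" where
  "partial_x i u = (\<lambda>(t, x). deriv (\<lambda>s. u (t, x + s *\<^sub>R axis i 1)) 0)"

definition parabolic_op ::
  "(real \<Rightarrow> real^'n \<Rightarrow> real^'n^'n) \<Rightarrow> (real \<Rightarrow> real^'n \<Rightarrow> real^'n) \<Rightarrow>
   (real \<times> (real^'n) \<Rightarrow> real) \<Rightarrow> real \<times> (real^'n) \<Rightarrow> real" where
  "parabolic_op A b u = (\<lambda>(t, x).
     partial_t u (t, x)
     + (\<Sum>i\<in>UNIV. \<Sum>j\<in>UNIV. A t x $ i $ j * partial_x i (partial_x j u) (t, x))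
     + (\<Sum>i\<in>UNIV. b t x $ i * partial_x i u (t, x)))"

definition prob_density :: "('a::euclidean_space \<Rightarrow> real) \<Rightarrow> bool" where
  "prob_density f \<longleftrightarrow>
     f \<in> borel_measurable borel \<and> (\<forall>x. 0 \<le> f x) \<and> (\<integral>\<^sup>+x. ennreal (f x) \<partial>lborel) = 1"

definition slice_measure :: "(real \<Rightarrow> real^'n \<Rightarrow> real) \<Rightarrow> real \<Rightarrow> (real^'n) measure" where
  "slice_measure \<rho> t = density lborel (\<lambda>x. ennreal (\<rho> t x))"

definition spacetime_measure :: "(real \<Rightarrow> real^'n \<Rightarrow> real) \<Rightarrow> (real \<times> (real^'n)) measure" where
  "spacetime_measure \<rho> =
     density (restrict_space lborel ({0<..<1} \<times> UNIV)) (\<lambda>(t, x). ennreal (\<rho> t x))"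

text \<open>The equation \<open>L\<^sup>* \<mu> = 0\<close> for \<open>\<mu> = \<rho> dt dx\<close>. The Bochner integral of a non-integrable
  function is 0 by convention, but the local integrability conditions and the compact support of
  \<open>u\<close> make the integrand \<open>\<mu>\<close>-integrable, so the convention only affects the inner integral on a
  null set of times.\<close>

definition weak_parabolic_solution ::
  "(real \<Rightarrow> real^'n \<Rightarrow> real^'n^'n) \<Rightarrow> (real \<Rightarrow> real^'n \<Rightarrow> real^'n) \<Rightarrow>
   (real \<Rightarrow> real^'n \<Rightarrow> real) \<Rightarrow> bool" where
  "weak_parabolic_solution A b \<rho> \<longleftrightarrow>
     (\<forall>K i j. compact K \<and> K \<subseteq> {0<..<1} \<times> UNIV \<longrightarrow>
        set_integrable (spacetime_measure \<rho>) K (\<lambda>(t, x). A t x $ i $ j)) \<and>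
     (\<forall>K i. compact K \<and> K \<subseteq> {0<..<1} \<times> UNIV \<longrightarrow>
        set_integrable (spacetime_measure \<rho>) K (\<lambda>(t, x). b t x $ i)) \<and>
     (\<forall>u. test_function ({0<..<1} \<times> UNIV) u \<longrightarrow>
        (LINT t:{0<..<1}|lborel. (LINT x|slice_measure \<rho> t. parabolic_op A b u (t, x))) = 0)"

definition initial_condition :: "(real \<Rightarrow> (real^'n) measure) \<Rightarrow> (real^'n) measure \<Rightarrow> bool" where
  "initial_condition m \<nu> \<longleftrightarrow>
     (\<forall>\<zeta>. test_function UNIV \<zeta> \<longrightarrow>
        ((\<lambda>t. LINT x|m t. \<zeta> x) \<longlongrightarrow> (LINT x|\<nu>. \<zeta> x)) (at_right 0))"

definition in_Lp :: "real \<Rightarrow> 'a measure \<Rightarrow> ('a \<Rightarrow> real) \<Rightarrow> bool" where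
  "in_Lp p M f \<longleftrightarrow> f \<in> borel_measurable M \<and> integrable M (\<lambda>x. \<bar>f x\<bar> powr p)"

definition Lp_norm :: "real \<Rightarrow> 'a measure \<Rightarrow> ('a \<Rightarrow> real) \<Rightarrow> real" where
  "Lp_norm p M f = (LINT x|M. \<bar>f x\<bar> powr p) powr (1 / p)"

definition in_Linf :: "'a measure \<Rightarrow> ('a \<Rightarrow> real) \<Rightarrow> bool" where
  "in_Linf M f \<longleftrightarrow> f \<in> borel_measurable M \<and> (\<exists>C. AE x in M. \<bar>f x\<bar> \<le> C)"

text \<open>Since \<open>ln 0 = 0\<close> here, the convention \<open>0 ln 0 = 0\<close> is automatic.\<close>

definition finite_entropy :: "('a::euclidean_space \<Rightarrow> real) \<Rightarrow> bool" where
  "finite_entropy f \<longleftrightarrow> in_Lp 1 lborel (\<lambda>x. f x * ln (f x))"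

end

theory Submission
  imports Defs
begin

text \<open>
  Write \<open>d = CARD('n)\<close> and mollify in space: \<open>u = \<rho>(t) * K\<close> with \<open>K(y) = c (\<epsilon>\<^sup>2 + \<bar>y\<bar>\<^sup>2)^(-d)\<close>. Then \<open>u\<close> solves
  \<open>\<partial>\<^sub>t u = div (A \<nabla>u + R)\<close>. Since \<open>\<bar>y\<bar> \<bar>\<nabla>K\<bar> \<le> 2 d K\<close>, the Lipschitz condition bounds the commutator part
  of \<open>R\<close> by a multiple of \<open>u\<close>, and Hoelder's inequality gives \<open>\<bar>R\<bar> \<le> C (u + g^(1/\<beta>) u^(1 - 1/\<beta>))\<close>, where
  \<open>g\<close> is the mollification of \<open>\<bar>b\<bar>^\<beta> \<rho>\<close>; the constant does not depend on \<open>\<epsilon>\<close>. Testing with \<open>u^k\<close> yields an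
  energy inequality whose right-hand side is controlled by a moment of \<open>u\<close> of order \<open>1 + k \<beta>/(\<beta> - 2)\<close>, while
  the left-hand side and the Sobolev inequality control all moments of order below \<open>(k + 1)(d + 2)/d\<close>. As
  \<open>\<beta> > d + 2\<close>, Moser's iteration closes; for \<open>k = 1\<close> it starts from the conserved mass alone. The resulting
  bound on \<open>u\<close> is uniform in \<open>\<epsilon>\<close> and passes to the limit.
\<close>

text \<open>Two kinds of bounds on u must be kept apart. Those that depend on \<epsilon> (the
  supremum of the kernel, the size of its derivatives relative to it) blow up as \<epsilon> tends to
  0; they only make integrals finite and justify Fubini and integration by parts. The quantitative
  estimates use mass 1, the bound of the initial density, ellipticity, the Lipschitz constant and
  the \<beta>-norm of b. A kernel with tails is not a test function, so it enters the weak equation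
  through cutoffs in space. Without mollification in time, u(t,x) is a time integral only outside a
  null set of times that depends on x; powers of u are therefore estimated by convexity along the
  primitive, and the null sets are exchanged by Fubini. The bounded initial density replaces
  localisation in time: every estimate runs over all of (0,1). The exponents fit because
  \<beta>/(\<beta> - 2) = 1 + 2/(\<beta> - 2) lies below 1 + 2/d exactly when \<beta> > d + 2; the
  gap gives the geometric growth of the exponents.\<close>

section \<open>Smooth functions\<close>

lemma Ck_continuous: "Ck k f \<Longrightarrow> continuous_on UNIV f"
proof (cases k)
  case (Suc m)
  assume "Ck k f"
  then have "\<And>x. f differentiable (at x)" using Suc by simp
  then show ?thesis
    by (simp add: continuous_on_eq_continuous_at differentiable_imp_continuous_within)
qed simp

text \<open>Uniqueness of the Frechet derivative lets any explicit formula stand in for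
  \<open>frechet_derivative\<close>, so smoothness follows from the usual differentiation
  rules.\<close>

lemma Ck_SucI:
  assumes "\<And>x. (f has_derivative f' x) (at x)" "\<And>v. Ck k (\<lambda>x. f' x v)"
  shows "Ck (Suc k) f"
proof -
  have "frechet_derivative f (at x) = f' x" for x
    using assms(1) frechet_derivative_at by metis
  then show ?thesis using assms by (auto simp: differentiable_def)
qed

lemma Ck_Suc_imp: "Ck (Suc k) f \<Longrightarrow> Ck k f"
proof (induction k arbitrary: f)
  case 0
  then show ?case using Ck_continuous by (metis Ck.simps(1))
next
  case (Suc k)
  then show ?case by (metis Ck.simps(2))
qed

lemma Ck_has_derivative:
  "Ck (Suc k) f \<Longrightarrow> (f has_derivative frechet_derivative f (at x)) (at x)"
  by (simp add: frechet_derivative_works)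

lemma Ck_const: "Ck k (\<lambda>x. c)"
proof (induction k arbitrary: c)
  case (Suc k)
  show ?case by (rule Ck_SucI[where f'="\<lambda>x v. 0"]) (auto simp: Suc)
qed simp

lemma Ck_bounded_linear: "bounded_linear f \<Longrightarrow> Ck k f"
proof (cases k)
  case (Suc m)
  assume "bounded_linear f"
  then show ?thesis unfolding Suc
    by (intro Ck_SucI[where f'="\<lambda>x. f"] bounded_linear_imp_has_derivative Ck_const)
qed (simp add: linear_continuous_on)

lemma Ck_add: "Ck k f \<Longrightarrow> Ck k g \<Longrightarrow> Ck k (\<lambda>x. f x + g x)"
proof (induction k arbitrary: f g)
  case 0
  then show ?case by (auto intro: continuous_on_add)
next
  case (Suc k)
  show ?case
  proof (rule Ck_SucI)
    show "((\<lambda>x. f x + g x) has_derivative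
      (\<lambda>v. frechet_derivative f (at x) v + frechet_derivative g (at x) v)) (at x)" for x
      using Suc.prems[THEN Ck_has_derivative] by (intro has_derivative_add)
  qed (use Suc in auto)
qed

lemma Ck_mult: "Ck k f \<Longrightarrow> Ck k g \<Longrightarrow> Ck k (\<lambda>x. f x * g x)"
proof (induction k arbitrary: f g)
  case 0
  then show ?case by (auto intro: continuous_on_mult)
next
  case (Suc k)
  show ?case
  proof (rule Ck_SucI)
    show "((\<lambda>x. f x * g x) has_derivative
      (\<lambda>v. f x * frechet_derivative g (at x) v + frechet_derivative f (at x) v * g x)) (at x)" for x
      using Suc.prems[THEN Ck_has_derivative] by (intro has_derivative_mult)
    show "Ck k (\<lambda>x. f x * frechet_derivative g (at x) v + frechet_derivative f (at x) v * g x)" for v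
      using Suc.prems by (intro Ck_add Suc.IH) (auto intro: Ck_Suc_imp)
  qed
qed

lemma Ck_compose_linear:
  assumes "bounded_linear L"
  shows "Ck k f \<Longrightarrow> Ck k (\<lambda>x. f (c + L x))"
proof (induction k arbitrary: f)
  case 0
  have "continuous_on UNIV (\<lambda>x. c + L x)"
    by (intro continuous_on_add continuous_on_const linear_continuous_on assms)
  then show ?case
    using 0 continuous_on_compose2[of UNIV f UNIV "\<lambda>x. c + L x"] by simp
next
  case (Suc k)
  show ?case
  proof (rule Ck_SucI)
    have "((\<lambda>x. c + L x) has_derivative L) (at x)" for x
      using bounded_linear_imp_has_derivative[OF assms] by (auto intro!: derivative_eq_intros)
    then show "((\<lambda>x. f (c + L x)) has_derivative
      (\<lambda>v. frechet_derivative f (at (c + L x)) (L v))) (at x)" for x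
      using has_derivative_compose Ck_has_derivative[OF Suc.prems] by blast
  qed (use Suc in auto)
qed

text \<open>The outer function comes as the sequence \<open>G\<close> of all its derivatives:
  differentiating \<open>G n\<close> after \<open>f\<close> produces \<open>G (Suc n)\<close> after
  \<open>f\<close>, so the induction stays inside one family. The set \<open>S\<close> admits outer
  functions such as powers, which are smooth only on the positive half-line.\<close>

lemma Ck_compose_real:
  fixes G :: "nat \<Rightarrow> real \<Rightarrow> real"
  assumes "\<And>n s. s \<in> S \<Longrightarrow> (G n has_real_derivative G (Suc n) s) (at s)" "\<And>x. f x \<in> S"
  shows "Ck k f \<Longrightarrow> Ck k (\<lambda>x. G n (f x))"
proof (induction k arbitrary: n)
  case 0
  have "isCont (G n) (f x)" for x using assms DERIV_isCont by blast
  moreover have "isCont f x" for x using 0 by (simp add: continuous_on_eq_continuous_at)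
  ultimately show ?case
    by (simp add: continuous_on_eq_continuous_at isCont_o2)
next
  case (Suc k)
  show ?case
  proof (rule Ck_SucI)
    show "((\<lambda>x. G n (f x)) has_derivative (\<lambda>v. frechet_derivative f (at x) v * G (Suc n) (f x))) (at x)" for x
      using has_derivative_compose[OF Ck_has_derivative[OF Suc.prems]
          assms(1)[OF assms(2), unfolded has_field_derivative_def]]
      by (simp add: mult.commute)
    show "Ck k (\<lambda>x. frechet_derivative f (at x) v * G (Suc n) (f x))" for v
      using Suc by (intro Ck_mult Suc.IH Ck_Suc_imp[OF Suc.prems]) auto
  qed
qed

lemma Ck_inner_self: "Ck k (\<lambda>x::'a::real_inner. x \<bullet> x)"
proof (cases k)
  case (Suc m)
  show ?thesis unfolding Suc
  proof (rule Ck_SucI)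
    show "((\<lambda>x. x \<bullet> x) has_derivative (\<lambda>v. 2 * (x \<bullet> v))) (at x)" for x :: 'a
      by (auto intro!: derivative_eq_intros simp: inner_commute)
    show "Ck m (\<lambda>x::'a. 2 * (x \<bullet> v))" for v
      by (intro Ck_mult Ck_const Ck_bounded_linear bounded_linear_inner_left)
  qed
qed (auto intro: continuous_intros)

lemma Ck_antiderivative:
  fixes f :: "real \<Rightarrow> real"
  assumes "\<And>k. Ck k f" "\<And>x. (F has_real_derivative f x) (at x)"
  shows "Ck k F"
proof (cases k)
  case 0
  then show ?thesis
    using assms(2) by (auto simp: continuous_on_eq_continuous_at intro: DERIV_isCont)
next
  case (Suc m)
  show ?thesis unfolding Suc
    by (rule Ck_SucI[where f'="\<lambda>x v. f x * v"])
      (use assms in \<open>auto simp: has_field_derivative_def intro!: Ck_mult Ck_const\<close>)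
qed

section \<open>Functions flat at zero: polynomials in 1/s times exp(-1/s)\<close>

definition flat_fun :: "real poly \<Rightarrow> real \<Rightarrow> real" where
  "flat_fun p s = (if s \<le> 0 then 0 else poly p (1 / s) * exp (- (1 / s)))"

text \<open>Differentiating p(1/s) exp(-1/s) replaces p(1/s) by (p - p')(1/s) / s^2; the polynomial
  \<open>[:0, 0, 1:]\<close> is the factor 1/s^2 written in the variable 1/s.\<close>

definition flat_step :: "real poly \<Rightarrow> real poly" where
  "flat_step p = [:0, 0, 1:] * (p - pderiv p)"

text \<open>The power \<open>s ^ n\<close> is carried along for the induction over the coefficients:
  the tail of \<open>pCons a p\<close> comes multiplied by one more power of s.\<close>

lemma tendsto_poly_exp: "((\<lambda>s::real. s ^ n * (poly p s * exp (- s))) \<longlongrightarrow> 0) at_top"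
proof (induction p arbitrary: n)
  case (pCons a p)
  have "((\<lambda>s::real. s ^ n * exp (- s)) \<longlongrightarrow> 0) at_top"
    using tendsto_power_div_exp_0[of n] by (simp add: exp_minus field_simps)
  then have "((\<lambda>s. a * (s ^ n * exp (- s)) + s ^ Suc n * (poly p s * exp (- s))) \<longlongrightarrow> a * 0 + 0) at_top"
    by (intro tendsto_add tendsto_mult tendsto_const pCons.IH)
  then show ?case by (simp add: algebra_simps)
qed simp

text \<open>Only s = 0 needs an argument. There the right difference quotient is X p evaluated at
  1/h times exp(-1/h), with X p written \<open>pCons 0 p\<close>, and the exponential wins; the left
  difference quotient is 0.\<close>

lemma flat_fun_deriv: "(flat_fun p has_real_derivative flat_fun (flat_step p) s) (at s)"
proof (cases s "0::real" rule: linorder_cases)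
  case less
  have "((\<lambda>s. 0) has_real_derivative 0) (at s)" by simp
  then have "(flat_fun p has_real_derivative 0) (at s)"
    by (rule DERIV_cong_ev[THEN iffD1, rotated -1])
      (use less in \<open>auto simp: flat_fun_def
        intro!: eventually_mono[OF eventually_nhds_in_open[of "{..<0}"]]\<close>)
  then show ?thesis using less by (simp add: flat_fun_def)
next
  case equal
  have "((\<lambda>h. flat_fun p h / h) \<longlongrightarrow> 0) (at_right 0)"
  proof -
    have "((\<lambda>h. poly (pCons 0 p) (inverse h) * exp (- inverse h)) \<longlongrightarrow> (0::real)) (at_right 0)"
      using filterlim_compose[OF tendsto_poly_exp[of 0 "pCons 0 p"] filterlim_inverse_at_top_right]
      by (simp only: power_0 mult_1_left)
    then show ?thesis
      by (rule Lim_transform_eventually)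
        (auto simp: flat_fun_def eventually_at_filter field_simps)
  qed
  moreover have "((\<lambda>h. flat_fun p h / h) \<longlongrightarrow> 0) (at_left 0)"
    by (rule Lim_transform_eventually[OF tendsto_const])
      (auto simp: flat_fun_def eventually_at_filter)
  ultimately have "((\<lambda>h. flat_fun p h / h) \<longlongrightarrow> 0) (at 0)"
    by (simp add: filterlim_at_split)
  then show ?thesis using equal by (simp add: DERIV_def flat_fun_def)
next
  case greater
  have "((\<lambda>s. poly p (1 / s) * exp (- (1 / s))) has_real_derivative flat_fun (flat_step p) s) (at s)"
    using greater
    by (auto intro!: derivative_eq_intros poly_DERIV[THEN DERIV_chain2]
        simp: flat_fun_def flat_step_def field_simps power2_eq_square)
  then show ?thesis
    by (rule DERIV_cong_ev[THEN iffD1, rotated -1])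
      (use greater in \<open>auto simp: flat_fun_def intro!: eventually_mono[OF eventually_nhds_in_open[of "{0<..}"]]\<close>)
qed

definition flat_deriv :: "nat \<Rightarrow> real \<Rightarrow> real" where
  "flat_deriv n = flat_fun ((flat_step ^^ n) 1)"

lemma flat_deriv_deriv: "(flat_deriv n has_real_derivative flat_deriv (Suc n) s) (at s)"
  unfolding flat_deriv_def by (simp add: flat_fun_deriv)

lemma flat_deriv_nonpos: "s \<le> 0 \<Longrightarrow> flat_deriv n s = 0"
  by (simp add: flat_deriv_def flat_fun_def)

lemma flat_deriv_0: "flat_deriv 0 s = (if s \<le> 0 then 0 else exp (- (1 / s)))"
  by (simp add: flat_deriv_def flat_fun_def)

lemma continuous_on_flat_deriv: "continuous_on S (flat_deriv n)"
  using flat_deriv_deriv by (meson DERIV_isCont continuous_at_imp_continuous_on)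

text \<open>The space cutoffs evaluate these functions at 1 minus a nonnegative quantity, hence the
  range s \<le> 1. Below 0 the functions vanish, so compactness of [0,1] suffices.\<close>

lemma flat_deriv_bounded: "\<exists>B\<ge>0. \<forall>s\<le>1. \<bar>flat_deriv n s\<bar> \<le> B"
proof -
  have "bounded (flat_deriv n ` {0..1})"
    by (intro compact_imp_bounded compact_continuous_image continuous_on_flat_deriv) simp
  then obtain B where B: "\<And>s. s \<in> {0..1} \<Longrightarrow> \<bar>flat_deriv n s\<bar> \<le> B"
    unfolding bounded_iff by fastforce
  have "0 \<le> B" using B[of 0] by simp
  moreover have "\<bar>flat_deriv n s\<bar> \<le> B" if "s \<le> 1" for s
    using B[of s] that \<open>0 \<le> B\<close> by (cases "s \<le> 0") (auto simp: flat_deriv_nonpos)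
  ultimately show ?thesis by blast
qed

lemma Ck_flat_deriv: "Ck k f \<Longrightarrow> Ck k (\<lambda>x. flat_deriv n (f x))"
  by (rule Ck_compose_real[where S=UNIV]) (auto simp: flat_deriv_deriv)

section \<open>Weak differential equations on the unit time interval\<close>

text \<open>A density on the whole line instead of a restricted space: integrands remain total
  functions of real time and measurability is plain Borel measurability.\<close>

definition unit_time :: "real measure" where
  "unit_time = density lborel (\<lambda>t. ennreal (indicator {0<..<1} t))"

lemma sets_unit_time [simp, measurable_cong]: "sets unit_time = sets borel"
  by (simp add: unit_time_def)

lemma space_unit_time [simp]: "space unit_time = UNIV"
  by (simp add: unit_time_def)

lemma AE_unit_time_iff: "(AE t in unit_time. P t) \<longleftrightarrow> (AE t in lborel. t \<in> {0<..<1} \<longrightarrow> P t)"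
  unfolding unit_time_def by (subst AE_density) (auto simp: indicator_def)

lemma AE_unit_time: "AE t in unit_time. t \<in> {0<..<1}"
  by (simp add: AE_unit_time_iff)

lemma emeasure_unit_time: "emeasure unit_time UNIV = 1"
  by (simp add: unit_time_def emeasure_density ennreal_indicator)

interpretation unit_time: finite_measure unit_time
  by standard (simp add: emeasure_unit_time)

lemma nn_integral_unit_time:
  "f \<in> borel_measurable borel \<Longrightarrow> (\<integral>\<^sup>+t. f t \<partial>unit_time) = (\<integral>\<^sup>+t. f t * indicator {0<..<1} t \<partial>lborel)"
  unfolding unit_time_def
  by (subst nn_integral_density) (auto simp: ennreal_indicator mult.commute)

lemma integral_unit_time:
  fixes f :: "real \<Rightarrow> real"
  shows "f \<in> borel_measurable borel \<Longrightarrow> (LINT t|unit_time. f t) = (LINT t|lborel. indicator {0<..<1} t * f t)"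
  unfolding unit_time_def by (subst integral_real_density) auto

section \<open>Smooth cutoffs in time that approximate indicators of intervals\<close>

definition bump :: "real \<Rightarrow> real \<Rightarrow> real \<Rightarrow> real" where
  "bump a b t = flat_deriv 0 (t - a) * flat_deriv 0 (b - t)"

lemma Ck_bump: "Ck k (bump a b)"
proof -
  have "Ck k (\<lambda>t::real. t + (-a))" "Ck k (\<lambda>t::real. b + (-1) * t)"
    by (intro Ck_add Ck_mult Ck_const Ck_bounded_linear bounded_linear_ident)+
  then have "Ck k (\<lambda>t::real. t - a)" "Ck k (\<lambda>t::real. b - t)" by simp_all
  then show ?thesis unfolding bump_def[abs_def] by (intro Ck_mult Ck_flat_deriv)
qed

lemma bump_nonneg: "0 \<le> bump a b t"
  by (simp add: bump_def flat_deriv_0)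

lemma bump_zero: "t \<notin> {a<..<b} \<Longrightarrow> bump a b t = 0"
  by (auto simp: bump_def flat_deriv_0)

lemma bump_pos: "t \<in> {a<..<b} \<Longrightarrow> 0 < bump a b t"
  by (auto simp: bump_def flat_deriv_0)

text \<open>As c grows, the exponential dies wherever \<open>bump a b\<close> is positive, so these
  functions increase to the indicator of the open interval while keeping values in [0,1] and support
  in [a,b].\<close>

definition plateau :: "real \<Rightarrow> real \<Rightarrow> real \<Rightarrow> real \<Rightarrow> real" where
  "plateau c a b t = 1 - exp (- (c * bump a b t))"

lemma Ck_plateau: "Ck k (plateau c a b)"
proof -
  have "Ck k (\<lambda>t. (- c) * bump a b t)" by (intro Ck_mult Ck_const Ck_bump)
  then have "Ck k (\<lambda>t. exp ((- c) * bump a b t))"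
    by (rule Ck_compose_real[where S=UNIV and G="\<lambda>n::nat. exp" and n=0, rotated 2]) auto
  then have "Ck k (\<lambda>t. 1 + (-1) * exp (- c * bump a b t))"
    by (intro Ck_add Ck_mult Ck_const) simp_all
  then show ?thesis by (simp add: plateau_def[abs_def])
qed

lemma plateau_range: "0 \<le> c \<Longrightarrow> 0 \<le> plateau c a b t \<and> plateau c a b t \<le> 1"
  by (simp add: plateau_def bump_nonneg)

lemma plateau_zero: "t \<notin> {a<..<b} \<Longrightarrow> plateau c a b t = 0"
  by (simp add: plateau_def bump_zero)

lemma Ck_borel_measurable [measurable_dest]:
  "(\<And>k. Ck k f) \<Longrightarrow> f \<in> borel_measurable borel"
  using Ck_continuous[of 0 f] by (intro borel_measurable_continuous_onI) simp

text \<open>The interval is shrunk by \<open>1 / Suc n\<close> at both ends so that the approximants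
  have compact support in (0,1) even for c = 0 and e = 1. Inside the interval the bumps of the
  shrunk intervals tend to a positive number, so their product with n still tends to
  infinity.\<close>

lemma plateau_tendsto:
  assumes "0 \<le> c" "e \<le> 1"
  shows "(\<lambda>n. plateau (real n) (c + 1 / Suc n) (e - 1 / Suc n) t) \<longlonglongrightarrow> indicator {c<..<e} t"
proof (cases "t \<in> {c<..<e}")
  case True
  have lim0: "(\<lambda>n. 1 / real (Suc n)) \<longlonglongrightarrow> 0"
    using LIMSEQ_inverse_real_of_nat by (simp add: inverse_eq_divide)
  have cont: "isCont (flat_deriv 0) x" for x
    using flat_deriv_deriv DERIV_isCont by blast
  have l: "(\<lambda>n. t - (c + 1 / Suc n)) \<longlonglongrightarrow> t - (c + 0)" "(\<lambda>n. (e - 1 / Suc n) - t) \<longlonglongrightarrow> (e - 0) - t"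
    by (intro tendsto_intros lim0)+
  then have "(\<lambda>n. bump (c + 1 / Suc n) (e - 1 / Suc n) t) \<longlonglongrightarrow> bump c e t"
    unfolding bump_def by (intro tendsto_mult isCont_tendsto_compose[OF cont]) (simp_all)
  moreover have "0 < bump c e t" using True by (rule bump_pos)
  ultimately have "LIM n sequentially. bump (c + 1 / Suc n) (e - 1 / Suc n) t * real n :> at_top"
    by (intro filterlim_tendsto_pos_mult_at_top filterlim_real_sequentially)
  then have "LIM n sequentially. - (real n * bump (c + 1 / Suc n) (e - 1 / Suc n) t) :> at_bot"
    by (simp add: filterlim_uminus_at_bot mult.commute)
  then have "(\<lambda>n. exp (- (real n * bump (c + 1 / Suc n) (e - 1 / Suc n) t))) \<longlonglongrightarrow> 0"
    by (rule filterlim_compose[OF exp_at_bot])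
  then have "(\<lambda>n. 1 - exp (- (real n * bump (c + 1 / Suc n) (e - 1 / Suc n) t))) \<longlonglongrightarrow> 1 - 0"
    by (intro tendsto_intros)
  then show ?thesis using True by (simp add: plateau_def)
next
  case False
  have "t \<notin> {c + 1 / Suc n <..< e - 1 / Suc n}" for n
  proof -
    have "0 < 1 / real (Suc n)" by simp
    then show ?thesis using False by (simp only: greaterThanLessThan_iff) linarith
  qed
  then show ?thesis using False by (simp add: plateau_zero)
qed

text \<open>The positive and the negative part of \<open>D\<close> are densities of two finite
  measures that agree on all half-lines and hence coincide; uniqueness of densities then equates the
  two parts.\<close>

lemma AE_zero_if_integrals_zero:
  fixes D :: "real \<Rightarrow> real"
  assumes int: "integrable unit_time D"
    and zero: "\<And>c e. 0 \<le> c \<Longrightarrow> e \<le> 1 \<Longrightarrow> (LINT t|unit_time. indicator {c<..<e} t * D t) = 0"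
  shows "AE t in unit_time. D t = 0"
proof -
  have [measurable]: "D \<in> borel_measurable borel"
    using borel_measurable_integrable[OF int] by simp
  let ?p = "\<lambda>t. max 0 (D t)" and ?m = "\<lambda>t. max 0 (- D t)"
  have ip: "integrable unit_time ?p" and im: "integrable unit_time ?m"
    using int by auto
  have ip': "integrable unit_time (\<lambda>t. ?p t * indicator {x<..} t)" 
    and im': "integrable unit_time (\<lambda>t. ?m t * indicator {x<..} t)" for x
    by (rule Bochner_Integration.integrable_bound[OF ip] Bochner_Integration.integrable_bound[OF im],
        simp, simp add: indicator_def)+
  have eq: "(LINT t|unit_time. ?p t * indicator {x<..} t) = (LINT t|unit_time. ?m t * indicator {x<..} t)" for x
  proof -
    have "(LINT t|unit_time. ?p t * indicator {x<..} t) - (LINT t|unit_time. ?m t * indicator {x<..} t)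
      = (LINT t|unit_time. D t * indicator {x<..} t)"
      by (subst Bochner_Integration.integral_diff[symmetric, OF ip' im'])
        (auto intro!: Bochner_Integration.integral_cong simp: max_def indicator_def)
    also have "\<dots> = (LINT t|unit_time. indicator {max x 0<..<1} t * D t)"
    proof (rule integral_cong_AE)
      show "AE t in unit_time. D t * indicator {x<..} t = indicator {max x 0<..<1} t * D t"
        using AE_unit_time by eventually_elim (auto simp: indicator_def)
    qed simp_all
    also have "\<dots> = 0" by (rule zero) auto
    finally show ?thesis by simp
  qed
  have em: "emeasure (density unit_time (\<lambda>t. ennreal (?p t))) {x<..} = ennreal (LINT t|unit_time. ?p t * indicator {x<..} t)"
    and em': "emeasure (density unit_time (\<lambda>t. ennreal (?m t))) {x<..} = ennreal (LINT t|unit_time. ?m t * indicator {x<..} t)" for x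
  proof -
    have "emeasure (density unit_time (\<lambda>t. ennreal (?p t))) {x<..} = (\<integral>\<^sup>+t. ennreal (?p t * indicator {x<..} t) \<partial>unit_time)"
      by (subst emeasure_density) (auto intro!: nn_integral_cong simp: indicator_def)
    also have "\<dots> = ennreal (LINT t|unit_time. ?p t * indicator {x<..} t)"
      by (rule nn_integral_eq_integral[OF ip']) auto
    finally show "emeasure (density unit_time (\<lambda>t. ennreal (?p t))) {x<..} = ennreal (LINT t|unit_time. ?p t * indicator {x<..} t)" .
    have "emeasure (density unit_time (\<lambda>t. ennreal (?m t))) {x<..} = (\<integral>\<^sup>+t. ennreal (?m t * indicator {x<..} t) \<partial>unit_time)"
      by (subst emeasure_density) (auto intro!: nn_integral_cong simp: indicator_def)
    also have "\<dots> = ennreal (LINT t|unit_time. ?m t * indicator {x<..} t)"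
      by (rule nn_integral_eq_integral[OF im']) auto
    finally show "emeasure (density unit_time (\<lambda>t. ennreal (?m t))) {x<..} = ennreal (LINT t|unit_time. ?m t * indicator {x<..} t)" .
  qed
  have "density unit_time (\<lambda>t. ennreal (?p t)) = density unit_time (\<lambda>t. ennreal (?m t))"
    by (rule measure_eqI_lessThan) (auto simp: em em' eq)
  then have "AE t in unit_time. ennreal (?p t) = ennreal (?m t)"
    by (subst (asm) unit_time.density_unique_iff) auto
  then show ?thesis
  proof eventually_elim
    case (elim t)
    then have "?p t = ?m t" by (subst (asm) ennreal_inj) auto
    then show ?case by (simp add: max_def split: if_splits)
  qed
qed

lemma continuous_has_antiderivative:
  fixes h :: "real \<Rightarrow> real"
  assumes "continuous_on UNIV h"
  obtains F where "\<And>x. (F has_real_derivative h x) (at x)"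
proof -
  have "\<exists>F. \<forall>x::real. -\<infinity> < ereal x \<longrightarrow> ereal x < \<infinity> \<longrightarrow> (F has_vector_derivative h x) (at x)"
    by (rule einterval_antiderivative) (use assms in \<open>auto simp: continuous_on_eq_continuous_at\<close>)
  then show ?thesis using that by (auto simp: has_real_derivative_iff_has_vector_derivative)
qed

text \<open>Integral zero is exactly what makes the primitive vanish again to the right of the
  support, so that it is an admissible test function in time.\<close>

lemma smooth_primitive:
  fixes h :: "real \<Rightarrow> real"
  assumes smooth: "\<And>k. Ck k h" and ab: "0 < a" "a < b" "b < 1"
    and supp: "\<And>t. t \<notin> {a..b} \<Longrightarrow> h t = 0" and zero: "(LINT t|unit_time. h t) = 0"
  obtains F where "\<And>k. Ck k F" "\<And>t. (F has_real_derivative h t) (at t)"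
    "\<And>t. t \<notin> {a..b} \<Longrightarrow> F t = 0" "\<And>t. t \<in> {0<..<1} \<Longrightarrow> F t = (LINT s|unit_time. indicator {..t} s * h s)"
proof -
  have cont: "continuous_on UNIV h" using Ck_continuous smooth by blast
  have [measurable]: "h \<in> borel_measurable borel"
    using cont by (rule borel_measurable_continuous_onI)
  obtain G where G: "\<And>x. (G has_real_derivative h x) (at x)"
    using continuous_has_antiderivative[OF cont] by blast
  define F where "F t = G t - G 0" for t
  have F: "(F has_real_derivative h t) (at t)" for t
    unfolding F_def using G by (auto intro!: derivative_eq_intros)
  have FI: "F t = (LINT s|lborel. h s * indicator {0..t} s)" if "0 \<le> t" for t
    using that by (subst integral_FTC_Icc_real[OF that G])
      (use cont in \<open>auto simp: F_def continuous_on_eq_continuous_at\<close>)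
  have FU: "F t = (LINT s|unit_time. indicator {..t} s * h s)" if "0 \<le> t" for t
    using FI[OF that] ab supp
    by (subst integral_unit_time)
      (auto intro!: Bochner_Integration.integral_cong simp: indicator_def,
        (metis atLeastAtMost_iff less_le_trans le_less_trans)+)
  have "F t = 0" if "t \<notin> {a..b}" for t
  proof (cases "t < a")
    case True
    have "\<exists>z. z > min t 0 \<and> z < max t 0 \<and> F (max t 0) - F (min t 0) = (max t 0 - min t 0) * h z" if "t \<noteq> 0"
      using that F by (intro MVT2) auto
    moreover have "h z = 0" if "z < max t 0" for z
      using that True ab by (intro supp) auto
    ultimately show ?thesis by (cases "t = 0") (auto simp: F_def max_def min_def split: if_splits)
  next
    case False
    then have "b < t" using that by auto
    then have "F t = (LINT s|unit_time. h s)"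
      using ab by (subst FU) (auto intro!: Bochner_Integration.integral_cong simp: indicator_def supp)
    then show ?thesis using zero by simp
  qed
  then show ?thesis
    using that[of F] F FU Ck_antiderivative[OF smooth F] by auto
qed

lemma (in pair_sigma_finite) integrable_product_mult:
  fixes f :: "_ \<Rightarrow> real" and g :: "_ \<Rightarrow> real"
  assumes [measurable]: "integrable M1 f" "integrable M2 g"
  shows "integrable (M1 \<Otimes>\<^sub>M M2) (\<lambda>(x, y). f x * g y)"
  by (rule Fubini_integrable) (use assms in \<open>auto simp: abs_mult\<close>)

lemma LINT_bump_pos:
  assumes "0 < a" "a < b" "b < 1"
  shows "0 < (LINT t|unit_time. bump a b t)"
proof -
  have cont: "continuous_on UNIV (bump a b)" using Ck_continuous Ck_bump by blast
  have [measurable]: "bump a b \<in> borel_measurable borel"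
    using cont by (rule borel_measurable_continuous_onI)
  obtain G where G: "\<And>x. (G has_real_derivative bump a b x) (at x)"
    using continuous_has_antiderivative[OF cont] by blast
  have "(LINT t|unit_time. bump a b t) = (LINT t|lborel. bump a b t * indicator {a..b} t)"
    using assms by (subst integral_unit_time)
      (auto intro!: Bochner_Integration.integral_cong simp: indicator_def bump_zero)
  also have "\<dots> = G b - G a"
    by (subst integral_FTC_Icc_real[OF _ G])
      (use cont assms in \<open>auto simp: continuous_on_eq_continuous_at\<close>)
  also have "\<exists>z. z > a \<and> z < b \<and> G b - G a = (b - a) * bump a b z"
    using G assms by (intro MVT2) auto
  then have "0 < G b - G a" using assms bump_pos by fastforce
  finally show ?thesis .
qed

lemma smooth_integrable_unit_time:
  assumes "\<And>k. Ck k (h::real \<Rightarrow> real)"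
  shows "integrable unit_time h"
proof -
  have cont: "continuous_on UNIV h" using Ck_continuous assms by blast
  have [measurable]: "h \<in> borel_measurable borel"
    using cont by (rule borel_measurable_continuous_onI)
  have "bounded (h ` {0..1})"
    by (intro compact_imp_bounded compact_continuous_image continuous_on_subset[OF cont]) auto
  then obtain B where "\<And>t. t \<in> {0..1} \<Longrightarrow> \<bar>h t\<bar> \<le> B"
    unfolding bounded_iff by fastforce
  then show ?thesis
    by (intro unit_time.integrable_const_bound[where B=B])
      (auto intro!: eventually_mono[OF AE_unit_time])
qed

text \<open>A du Bois-Reymond argument that also reads off the initial value. The test function is
  the primitive of \<open>l n - f\<close>, where \<open>l n\<close> is a bump near 0 with the same
  mass c as \<open>f\<close>. As the bumps concentrate at 0, the integral of \<open>l n\<close>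
  times \<open>M\<close> tends to c m, and the primitive tends to \<open>c - \<Phi> t\<close>, the
  mass of \<open>f\<close> beyond t. Fubini rewrites the integral of \<open>c - \<Phi>\<close> times
  \<open>N\<close> as the integral of \<open>f\<close> times the primitive of
  \<open>N\<close>.\<close>

lemma weak_ode_tested:
  assumes M: "integrable unit_time M" and N: "integrable unit_time N"
    and H: "\<And>\<psi> \<psi>' a b. \<lbrakk>\<And>k. Ck k \<psi>; \<And>t. (\<psi> has_real_derivative \<psi>' t) (at t); 0 < a; a < b; b < 1;
        \<And>t. t \<notin> {a..b} \<Longrightarrow> \<psi> t = 0\<rbrakk> \<Longrightarrow> (LINT t|unit_time. \<psi>' t * M t + \<psi> t * N t) = 0"
    and lim: "(M \<longlongrightarrow> m) (at_right 0)"
    and f: "\<And>k. Ck k f" "\<And>t. 0 \<le> f t" "\<And>t. f t \<le> 1" "0 < a" "a < b" "b < 1" "\<And>t. t \<notin> {a..b} \<Longrightarrow> f t = 0"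
  shows "(LINT t|unit_time. f t * (m - M t + (LINT s|unit_time. indicator {..<t} s * N s))) = 0"
proof -
  have Mm [measurable]: "M \<in> borel_measurable borel" and Nm [measurable]: "N \<in> borel_measurable borel"
    using borel_measurable_integrable[OF M] borel_measurable_integrable[OF N] by simp_all
  have fm [measurable]: "f \<in> borel_measurable borel" using f(1) by measurable
  define c where "c = (LINT t|unit_time. f t)"
  have c0: "0 \<le> c" unfolding c_def using f(2) by simp
  have fi: "integrable unit_time f" by (rule smooth_integrable_unit_time) (rule f)
  \<comment> \<open>The bumps live on (\<open>al n\<close>, \<open>be n\<close>), an interval that
    shrinks to 0 from the right; the offset 3 keeps \<open>be n\<close> below 1 already for n =
    0.\<close>
  define al be where "al n = 1 / real (n + 3)" and "be n = 2 / real (n + 3)" for n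
  have ab: "0 < al n" "al n < be n" "be n < 1" for n
    by (auto simp: al_def be_def field_simps)
  define l where "l n t = c / (LINT t|unit_time. bump (al n) (be n) t) * bump (al n) (be n) t" for n t
  have lS: "Ck k (l n)" for n k
    unfolding l_def[abs_def] by (intro Ck_mult Ck_const Ck_bump)
  have lm [measurable]: "l n \<in> borel_measurable borel" for n using lS by measurable
  have li: "integrable unit_time (l n)" for n by (rule smooth_integrable_unit_time) (rule lS)
  have lI: "(LINT t|unit_time. l n t) = c" for n
    using LINT_bump_pos[OF ab, of n] by (simp add: l_def)
  have l0: "0 \<le> l n t" for n t
    unfolding l_def using c0 LINT_bump_pos[OF ab, of n] by (simp add: bump_nonneg)
  have lz: "l n t = 0" if "t \<notin> {al n<..<be n}" for n t
    using bump_zero[OF that] by (simp add: l_def)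
  have be0: "be \<longlonglongrightarrow> 0"
    unfolding be_def using LIMSEQ_ignore_initial_segment[OF lim_const_over_n[of 2], of 3] by simp
  define \<Phi> where "\<Phi> t = (LINT s|unit_time. indicator {..t} s * f s)" for t
  have [measurable]: "\<Phi> \<in> borel_measurable borel"
    unfolding \<Phi>_def[abs_def] indicator_def atMost_iff by measurable
  have ex: "\<exists>F. (\<forall>t\<in>{0<..<1}. F t = (LINT s|unit_time. indicator {..t} s * l n s) - \<Phi> t) \<and> 
     integrable unit_time (\<lambda>t. F t * N t) \<and>
     (LINT t|unit_time. (l n t - f t) * M t + F t * N t) = 0" for n
  proof -
    let ?h = "\<lambda>t. l n t - f t"
    have "Ck k (\<lambda>t. l n t + (-1) * f t)" for k
      by (intro Ck_add lS Ck_mult Ck_const f)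
    then have hS: "Ck k ?h" for k by simp
    have supp: "?h t = 0" if "t \<notin> {min (al n) a..max (be n) b}" for t
    proof -
      have "t \<notin> {a..b}" "t \<notin> {al n<..<be n}" using that by auto
      then show ?thesis using f(7)[of t] lz[of t n] by simp
    qed
    have h0: "(LINT t|unit_time. ?h t) = 0"
      using li fi lI by (simp add: c_def)
    obtain F where F: "\<And>k. Ck k F" "\<And>t. (F has_real_derivative ?h t) (at t)"
      "\<And>t. t \<notin> {min (al n) a..max (be n) b} \<Longrightarrow> F t = 0"
      "\<And>t. t \<in> {0<..<1} \<Longrightarrow> F t = (LINT s|unit_time. indicator {..t} s * ?h s)"
    proof (rule smooth_primitive[OF hS _ _ _ supp h0])
      show "0 < min (al n) a" "min (al n) a < max (be n) b" "max (be n) b < 1"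
        using ab[of n] f(4-6) by auto
    qed blast+
    have "(LINT t|unit_time. ?h t * M t + F t * N t) = 0"
      by (rule H[OF F(1,2) _ _ _ F(3)]) (use ab[of n] f(4-6) in auto)
    moreover have "F t = (LINT s|unit_time. indicator {..t} s * l n s) - \<Phi> t" if "t \<in> {0<..<1}" for t
    proof -
      have "integrable unit_time (\<lambda>s. indicator {..t} s * l n s)" "integrable unit_time (\<lambda>s. indicator {..t} s * f s)"
        using integrable_mult_indicator[OF _ li[of n], of "{..t}"] integrable_mult_indicator[OF _ fi, of "{..t}"] by simp_all
      then show ?thesis using F(4)[OF that] by (simp add: \<Phi>_def right_diff_distrib)
    qed
    moreover have "integrable unit_time (\<lambda>t. F t * N t)"
    proof -
      have cF: "continuous_on UNIV F" using Ck_continuous F(1) by blast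
      have [measurable]: "F \<in> borel_measurable borel"
        using cF by (rule borel_measurable_continuous_onI)
      have "bounded (F ` {0..1})"
        by (intro compact_imp_bounded compact_continuous_image continuous_on_subset[OF cF]) auto
      then obtain B where B: "\<And>t. t \<in> {0..1} \<Longrightarrow> \<bar>F t\<bar> \<le> B"
        unfolding bounded_iff by fastforce
      have "AE t in unit_time. norm (F t * N t) \<le> norm (B * N t)"
        using AE_unit_time
      proof eventually_elim
        case (elim t)
        then have "\<bar>F t\<bar> \<le> \<bar>B\<bar>" using B[of t] by auto
        then show ?case by (simp add: abs_mult mult_right_mono)
      qed
      then show ?thesis
        by (rule Bochner_Integration.integrable_bound[rotated 2]) (use N in auto)
    qed
    ultimately show ?thesis by blast
  qed
  from choice[OF allI[OF ex]] obtain F where FF: "\<forall>n. (\<forall>t\<in>{0<..<1}. F n t = (LINT s|unit_time. indicator {..t} s * l n s) - \<Phi> t) \<and> 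
     integrable unit_time (\<lambda>t. F n t * N t) \<and>
     (LINT t|unit_time. (l n t - f t) * M t + F n t * N t) = 0" ..
  then have F: "\<And>n t. t \<in> {0<..<1} \<Longrightarrow> F n t = (LINT s|unit_time. indicator {..t} s * l n s) - \<Phi> t"
    "\<And>n. integrable unit_time (\<lambda>t. F n t * N t)"
    "\<And>n. (LINT t|unit_time. (l n t - f t) * M t + F n t * N t) = 0"
    by blast+
  have fM: "integrable unit_time (\<lambda>t. f t * M t)"
    by (rule Bochner_Integration.integrable_bound[OF M])
      (use f(2,3) in \<open>auto intro!: always_eventually simp: abs_mult mult_left_le_one_le\<close>)
  have lM: "integrable unit_time (\<lambda>t. l n t * M t)" for n
  proof -
    have "bounded (l n ` {0..1})"
      by (intro compact_imp_bounded compact_continuous_image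
          continuous_on_subset[OF Ck_continuous[OF lS[of 0]]]) auto
    then obtain B where B: "\<And>t. t \<in> {0..1} \<Longrightarrow> \<bar>l n t\<bar> \<le> B"
      unfolding bounded_iff by fastforce
    have "AE t in unit_time. norm (l n t * M t) \<le> norm (B * M t)"
      using AE_unit_time
    proof eventually_elim
      case (elim t)
      then have "\<bar>l n t\<bar> \<le> \<bar>B\<bar>" using B[of t] by auto
      then show ?case by (simp add: abs_mult mult_right_mono)
    qed
    then show ?thesis
      by (rule Bochner_Integration.integrable_bound[rotated 2]) (use M in auto)
  qed
  have eq: "(LINT t|unit_time. l n t * M t) - (LINT t|unit_time. f t * M t) + (LINT t|unit_time. F n t * N t) = 0" for n
    using F(3)[of n] lM[of n] fM F(2)[of n] by (simp add: left_diff_distrib)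
  have lim1: "(\<lambda>n. LINT t|unit_time. l n t * M t) \<longlonglongrightarrow> c * m"
  proof (rule LIMSEQ_I)
    fix r :: real assume "0 < r"
    define e where "e = r / (c + 1)"
    have e: "0 < e" "c * e < r" using \<open>0 < r\<close> c0 by (auto simp: e_def field_simps)
    from lim e(1) obtain d where d: "0 < d" "\<And>t. 0 < t \<Longrightarrow> t < d \<Longrightarrow> \<bar>M t - m\<bar> < e"
      unfolding tendsto_iff eventually_at_right_field dist_real_def by blast
    obtain n0 where n0: "\<And>n. n \<ge> n0 \<Longrightarrow> be n < d"
      using be0 d(1) ab by (metis eventually_sequentially order_tendstoD(2))
    have "norm ((LINT t|unit_time. l n t * M t) - c * m) < r" if "n \<ge> n0" for n
    proof -
      have i1: "integrable unit_time (\<lambda>t. l n t * (M t - m))"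
        using lM[of n] li[of n] by (simp add: right_diff_distrib)
      have "(LINT t|unit_time. l n t * M t) - c * m = (LINT t|unit_time. l n t * (M t - m))"
        using lM[of n] li[of n] lI[of n] by (simp add: right_diff_distrib)
      also have "norm \<dots> \<le> (LINT t|unit_time. norm (l n t * (M t - m)))"
        by (rule integral_norm_bound)
      also have "\<dots> \<le> (LINT t|unit_time. l n t * e)"
      proof (rule integral_mono)
        show "integrable unit_time (\<lambda>t. norm (l n t * (M t - m)))" using i1 by (rule integrable_norm)
        show "norm (l n t * (M t - m)) \<le> l n t * e" for t
        proof (cases "t \<in> {al n<..<be n}")
          case True
          then have "\<bar>M t - m\<bar> < e" using ab[of n] n0[OF that] by (intro d) auto
          then show ?thesis using l0[of n t] by (simp add: abs_mult mult_left_mono)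
        qed (simp add: lz)
      qed (use li in simp)
      also have "\<dots> = c * e" using lI by simp
      finally show ?thesis using e by linarith
    qed
    then show "\<exists>no. \<forall>n\<ge>no. norm ((LINT t|unit_time. l n t * M t) - c * m) < r" by blast
  qed
  have l_int: "integrable unit_time (\<lambda>s. indicator {..t} s * l n s)" for t n
    by (rule Bochner_Integration.integrable_bound[OF li[of n]]) (auto simp: indicator_def)
  have f_int: "integrable unit_time (\<lambda>s. indicator {..t} s * f s)" for t
    by (rule Bochner_Integration.integrable_bound[OF fi]) (auto simp: indicator_def)
  have \<Phi>_range: "0 \<le> \<Phi> t" "\<Phi> t \<le> c" for t
    unfolding \<Phi>_def c_def using f_int[of t] fi f(2)
    by (auto intro!: integral_nonneg integral_mono simp: indicator_def)
  have l_range: "0 \<le> (LINT s|unit_time. indicator {..t} s * l n s)" "(LINT s|unit_time. indicator {..t} s * l n s) \<le> c" for t n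
    unfolding lI[symmetric, of n] using l_int[of t n] li[of n] l0
    by (auto intro!: integral_nonneg integral_mono simp: indicator_def)
  have lim2: "(\<lambda>n. LINT t|unit_time. F n t * N t) \<longlonglongrightarrow> (LINT t|unit_time. (c - \<Phi> t) * N t)"
  proof (rule integral_dominated_convergence[where w="\<lambda>t. c * \<bar>N t\<bar>"])
    show "AE t in unit_time. (\<lambda>n. F n t * N t) \<longlonglongrightarrow> (c - \<Phi> t) * N t"
      using AE_unit_time
    proof eventually_elim
      case (elim t)
      obtain n0 where n0: "\<And>n. n \<ge> n0 \<Longrightarrow> be n < t"
        using be0 elim by (metis eventually_sequentially greaterThanLessThan_iff order_tendstoD(2))
      have "F n t * N t = (c - \<Phi> t) * N t" if "n \<ge> n0" for n
      proof -
        have "(LINT s|unit_time. indicator {..t} s * l n s) = (LINT s|unit_time. l n s)"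
          using n0[OF that] by (intro Bochner_Integration.integral_cong) (auto simp: indicator_def lz)
        then show ?thesis using F(1)[OF elim] lI by simp
      qed
      then show ?case by (intro tendsto_eventually eventually_sequentiallyI)
    qed
    show "AE t in unit_time. norm (F n t * N t) \<le> c * \<bar>N t\<bar>" for n
      using AE_unit_time
    proof eventually_elim
      case (elim t)
      have "\<bar>F n t\<bar> \<le> c" using F(1)[OF elim] \<Phi>_range[of t] l_range[of t n] by auto
      then show ?case by (simp add: abs_mult mult_right_mono)
    qed
    show "(\<lambda>t. F n t * N t) \<in> borel_measurable unit_time" for n
      using F(2) by (rule borel_measurable_integrable)
  qed (use N in auto)
  have "(\<lambda>n. (LINT t|unit_time. l n t * M t) - (LINT t|unit_time. f t * M t) + (LINT t|unit_time. F n t * N t))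
     \<longlonglongrightarrow> c * m - (LINT t|unit_time. f t * M t) + (LINT t|unit_time. (c - \<Phi> t) * N t)"
    by (intro tendsto_intros lim1 lim2)
  then have main: "c * m - (LINT t|unit_time. f t * M t) + (LINT t|unit_time. (c - \<Phi> t) * N t) = 0"
    unfolding eq using LIMSEQ_unique tendsto_const by blast
  interpret P: pair_sigma_finite unit_time unit_time ..
  \<comment> \<open>The majorant, a product of a function of t and a function of s, justifies the
    interchange of the two time integrals.\<close>
  have prod_int: "integrable (unit_time \<Otimes>\<^sub>M unit_time) (\<lambda>(t, s). indicator {t<..} s * f s * N t)"
  proof (rule Bochner_Integration.integrable_bound[where f="\<lambda>(t, s). 1 * N t * f s"])
    show "integrable (unit_time \<Otimes>\<^sub>M unit_time) (\<lambda>(t, s). 1 * N t * f s)"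
      using P.integrable_product_mult[OF N fi] by simp
  qed (auto simp: indicator_def case_prod_beta mult.commute)
  have "(LINT t|unit_time. (c - \<Phi> t) * N t) = (LINT t|unit_time. (LINT s|unit_time. indicator {t<..} s * f s * N t))"
  proof (rule Bochner_Integration.integral_cong)
    fix t
    have "c - \<Phi> t = (LINT s|unit_time. f s - indicator {..t} s * f s)"
      unfolding c_def \<Phi>_def using fi f_int by simp
    also have "\<dots> = (LINT s|unit_time. indicator {t<..} s * f s)"
      by (rule Bochner_Integration.integral_cong) (auto simp: indicator_def)
    finally show "(c - \<Phi> t) * N t = (LINT s|unit_time. indicator {t<..} s * f s * N t)" by simp
  qed simp
  also have "\<dots> = (LINT s|unit_time. (LINT t|unit_time. indicator {t<..} s * f s * N t))"
    by (rule P.Fubini_integral[symmetric]) (rule prod_int)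
  also have "\<dots> = (LINT s|unit_time. f s * (LINT t|unit_time. indicator {..<s} t * N t))"
  proof (rule Bochner_Integration.integral_cong)
    fix s
    have "(LINT t|unit_time. indicator {t<..} s * f s * N t) = (LINT t|unit_time. f s * (indicator {..<s} t * N t))"
      by (rule Bochner_Integration.integral_cong) (auto simp: indicator_def)
    then show "(LINT t|unit_time. indicator {t<..} s * f s * N t) = f s * (LINT t|unit_time. indicator {..<s} t * N t)"
      by simp
  qed simp
  finally have eq2: "(LINT t|unit_time. (c - \<Phi> t) * N t) = (LINT s|unit_time. f s * (LINT t|unit_time. indicator {..<s} t * N t))" .
  have fG: "integrable unit_time (\<lambda>s. f s * (LINT t|unit_time. indicator {..<s} t * N t))"
  proof (rule unit_time.integrable_const_bound[where B="LINT t|unit_time. \<bar>N t\<bar>"])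
    show "AE s in unit_time. norm (f s * (LINT t|unit_time. indicator {..<s} t * N t)) \<le> (LINT t|unit_time. \<bar>N t\<bar>)"
    proof (rule AE_I2)
      fix s
      have "\<bar>LINT t|unit_time. indicator {..<s} t * N t\<bar> \<le> (LINT t|unit_time. \<bar>N t\<bar>)"
        by (rule integral_abs_bound_integral)
          (use N in \<open>auto simp: indicator_def intro!: Bochner_Integration.integrable_bound[OF N]\<close>)
      then have "\<bar>f s\<bar> * \<bar>LINT t|unit_time. indicator {..<s} t * N t\<bar> \<le> 1 * (LINT t|unit_time. \<bar>N t\<bar>)"
        using f(2,3) by (intro mult_mono) auto
      then show "norm (f s * (LINT t|unit_time. indicator {..<s} t * N t)) \<le> (LINT t|unit_time. \<bar>N t\<bar>)"
        by (simp add: abs_mult)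
    qed
  qed (unfold indicator_def lessThan_iff, measurable)
  have "(LINT t|unit_time. f t * (m - M t + (LINT s|unit_time. indicator {..<t} s * N s)))
     = (LINT t|unit_time. f t * m - f t * M t + f t * (LINT s|unit_time. indicator {..<t} s * N s))"
    by (simp add: algebra_simps)
  also have "\<dots> = c * m - (LINT t|unit_time. f t * M t) + (LINT s|unit_time. f s * (LINT t|unit_time. indicator {..<s} t * N t))"
    using fi fM fG by (simp add: c_def)
  finally show ?thesis using main eq2 by simp
qed


lemma integrable_primitive:
  assumes N: "integrable unit_time N"
  shows "(\<lambda>t. LINT s|unit_time. indicator {..<t} s * N s) \<in> borel_measurable borel"
    and "\<bar>LINT s|unit_time. indicator {..<t} s * (N s::real)\<bar> \<le> (LINT s|unit_time. \<bar>N s\<bar>)"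
    and "integrable unit_time (\<lambda>t. LINT s|unit_time. indicator {..<t} s * N s)"
proof -
  have [measurable]: "N \<in> borel_measurable borel"
    using borel_measurable_integrable[OF N] by simp
  show m: "(\<lambda>t. LINT s|unit_time. indicator {..<t} s * N s) \<in> borel_measurable borel"
    unfolding indicator_def lessThan_iff by measurable
  show b: "\<bar>LINT s|unit_time. indicator {..<t} s * N s\<bar> \<le> (LINT s|unit_time. \<bar>N s\<bar>)" for t
    by (rule integral_abs_bound_integral)
      (use N in \<open>auto simp: indicator_def intro!: Bochner_Integration.integrable_bound[OF N]\<close>)
  show "integrable unit_time (\<lambda>t. LINT s|unit_time. indicator {..<t} s * N s)"
    by (rule unit_time.integrable_const_bound[where B="LINT s|unit_time. \<bar>N s\<bar>"]) (use b m in auto)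
qed

text \<open>The defect \<open>D\<close> of the integral identity has integral zero against all
  plateau functions by \<open>weak_ode_tested\<close>; in the limit it has integral zero over every
  subinterval and so vanishes almost everywhere.\<close>

lemma weak_ode:
  assumes M: "integrable unit_time M" and N: "integrable unit_time N"
    and H: "\<And>\<psi> \<psi>' a b. \<lbrakk>\<And>k. Ck k \<psi>; \<And>t. (\<psi> has_real_derivative \<psi>' t) (at t); 0 < a; a < b; b < 1;
        \<And>t. t \<notin> {a..b} \<Longrightarrow> \<psi> t = 0\<rbrakk> \<Longrightarrow> (LINT t|unit_time. \<psi>' t * M t + \<psi> t * N t) = 0"
    and lim: "(M \<longlongrightarrow> m) (at_right 0)"
  shows "AE t in unit_time. M t = m + (LINT s|unit_time. indicator {..<t} s * N s)"
proof -
  define D where "D t = m - M t + (LINT s|unit_time. indicator {..<t} s * N s)" for t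
  have [measurable]: "M \<in> borel_measurable borel"
    using borel_measurable_integrable[OF M] by simp
  have Di: "integrable unit_time D"
    unfolding D_def using M integrable_primitive(3)[OF N] by auto
  have [measurable]: "D \<in> borel_measurable borel"
    using borel_measurable_integrable[OF Di] by simp
  have "AE t in unit_time. D t = 0"
  proof (rule AE_zero_if_integrals_zero[OF Di])
    fix c e :: real assume ce: "0 \<le> c" "e \<le> 1"
    let ?f = "\<lambda>n. plateau (real n) (c + 1 / Suc n) (e - 1 / Suc n)"
    have [measurable]: "?f n \<in> borel_measurable borel" for n
      by (rule Ck_borel_measurable) (rule Ck_plateau)
    have "(LINT t|unit_time. ?f n t * D t) = 0" for n
    \<comment> \<open>For small n the shrunk interval may be empty; then the plateau is identically
      0.\<close>
    proof (cases "c + 1 / Suc n < e - 1 / Suc n")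
      case True
      have "0 < 1 / real (Suc n)" by simp
      then have pos: "0 < c + 1 / real (Suc n)" "e - 1 / real (Suc n) < 1" using ce by linarith+
      show ?thesis
        unfolding D_def
      proof (rule weak_ode_tested[OF M N _ lim, where f="?f n" and a="c + 1 / real (Suc n)" and b="e - 1 / real (Suc n)"])
        show "?f n t = 0" if "t \<notin> {c + 1 / real (Suc n)..e - 1 / real (Suc n)}" for t
          using that by (intro plateau_zero) auto
        show "0 \<le> ?f n t" "?f n t \<le> 1" for t
          using plateau_range[of "real n"] by auto
        show "(LINT t|unit_time. \<psi>' t * M t + \<psi> t * N t) = 0"
          if "\<And>k. Ck k \<psi>" "\<And>t. (\<psi> has_real_derivative \<psi>' t) (at t)" "0 < a" "a < b" "b < 1"
            "\<And>t. t \<notin> {a..b} \<Longrightarrow> \<psi> t = 0" for \<psi> \<psi>' a b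
          by (rule H) fact+
      qed (use Ck_plateau True pos in auto)
    next
      case False
      then have "?f n t = 0" for t by (intro plateau_zero) auto
      then show ?thesis by simp
    qed
    moreover have "(\<lambda>n. LINT t|unit_time. ?f n t * D t) \<longlonglongrightarrow> (LINT t|unit_time. indicator {c<..<e} t * D t)"
    proof (rule integral_dominated_convergence[where w="\<lambda>t. \<bar>D t\<bar>"])
      show "AE t in unit_time. (\<lambda>n. ?f n t * D t) \<longlonglongrightarrow> indicator {c<..<e} t * D t"
        using plateau_tendsto[OF ce] by (intro AE_I2 tendsto_intros)
      show "AE t in unit_time. norm (?f n t * D t) \<le> \<bar>D t\<bar>" for n
        using plateau_range[of "real n"] by (intro AE_I2) (simp add: abs_mult mult_left_le_one_le)
      show "(\<lambda>t. ?f n t * D t) \<in> borel_measurable unit_time" for n by measurable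
    qed (use Di in auto)
    ultimately have "(\<lambda>n. 0) \<longlonglongrightarrow> (LINT t|unit_time. indicator {c<..<e} t * D t)"
      by simp
    then show "(LINT t|unit_time. indicator {c<..<e} t * D t) = 0"
      by (simp add: tendsto_const_iff)
  qed
  then show ?thesis by eventually_elim (simp add: D_def)
qed

lemma continuous_primitive:
  assumes f: "integrable unit_time f"
  shows "continuous_on UNIV (\<lambda>t. v0 + (LINT s|unit_time. indicator {..<t} s * (f s::real)))"
proof -
  have [measurable]: "f \<in> borel_measurable borel"
    using borel_measurable_integrable[OF f] by simp
  have "isCont (\<lambda>t. LINT s|unit_time. indicator {..<t} s * f s) t" for t
    unfolding continuous_at_sequentially comp_def
  proof (intro allI impI)
    fix X assume X: "X \<longlonglongrightarrow> t"
    show "(\<lambda>n. LINT s|unit_time. indicator {..<X n} s * f s) \<longlonglongrightarrow> (LINT s|unit_time. indicator {..<t} s * f s)"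
    proof (rule integral_dominated_convergence[where w="\<lambda>t. \<bar>f t\<bar>"])
      have "AE s in unit_time. s \<noteq> t"
        unfolding AE_unit_time_iff using AE_lborel_singleton[of t] by (auto elim: eventually_mono)
      then show "AE s in unit_time. (\<lambda>n. indicator {..<X n} s * f s) \<longlonglongrightarrow> indicator {..<t} s * f s"
      proof eventually_elim
        case (elim s)
        have "eventually (\<lambda>n. (s < X n) = (s < t)) sequentially"
        proof (cases "s < t")
          case True
          then show ?thesis using order_tendstoD(1)[OF X] by (auto elim: eventually_mono)
        next
          case False
          then have "t < s" using elim by simp
          then show ?thesis using order_tendstoD(2)[OF X, of s] by (auto elim: eventually_mono)
        qed
        then show ?case
          by (intro tendsto_eventually) (auto elim!: eventually_mono simp: indicator_def)
      qed
    qed (use f in \<open>auto simp: indicator_def\<close>)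
  qed
  then show ?thesis
    by (auto simp: continuous_on_eq_continuous_at intro!: continuous_intros)
qed

text \<open>Telescoping \<open>H (v t) - H (v s) \<le> h (v t) * (v t - v s)\<close> over fine partitions replaces
  the chain rule for absolutely continuous functions.\<close>

lemma convex_chain:
  fixes f H h :: "real \<Rightarrow> real"
  assumes f: "integrable unit_time f" and h: "continuous_on UNIV h"
    and convex: "\<And>y z. H y - H z \<le> h y * (y - z)"
    and v_def: "\<And>t. v t = v0 + (LINT s|unit_time. indicator {..<t} s * f s)"
    and T: "0 < T" "T < 1"
  shows "H (v T) - H v0 \<le> (LINT s|unit_time. indicator {..<T} s * (h (v s) * f s))"
proof -
  have [measurable]: "f \<in> borel_measurable borel"
    using borel_measurable_integrable[OF f] by simp
  have vc: "continuous_on UNIV v"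
    using continuous_primitive[OF f, of v0] by (simp add: v_def[abs_def])
  have hvc: "continuous_on UNIV (\<lambda>t. h (v t))"
    using continuous_on_compose2[OF h vc] by simp
  have [measurable]: "v \<in> borel_measurable borel" "h \<in> borel_measurable borel"
    using vc h borel_measurable_continuous_onI by auto
  define V where "V = \<bar>v0\<bar> + (LINT s|unit_time. \<bar>f s\<bar>)"
  have vV: "v t \<in> {-V..V}" for t
    using integrable_primitive(2)[OF f, of t] unfolding v_def V_def by auto
  have "bounded (h ` {-V..V})"
    by (intro compact_imp_bounded compact_continuous_image continuous_on_subset[OF h]) auto
  then obtain B where B: "\<And>y. y \<in> {-V..V} \<Longrightarrow> \<bar>h y\<bar> \<le> B"
    unfolding bounded_iff by fastforce
  have v0: "v 0 = v0"
  proof -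
    have "(LINT s|unit_time. indicator {..<0} s * f s) = (LINT s|unit_time. 0)"
    proof (rule integral_cong_AE)
      show "AE s in unit_time. indicator {..<0} s * f s = 0"
        using AE_unit_time by eventually_elim auto
    qed auto
    then show ?thesis by (simp add: v_def)
  qed
  \<comment> \<open>The value of h along v is taken at the right end of the partition cell of length
    T/n that contains s, because the convexity inequality evaluates \<open>h\<close> at the later of
    the two times. The cells shrink to s, so \<open>S n\<close> converges to the integrand by
    continuity.\<close>
  define S where "S n s = h (v (T * (of_int \<lfloor>real n * s / T\<rfloor> + 1) / n)) * (indicator {..<T} s * f s)" for n s
  have Sm [measurable]: "S n \<in> borel_measurable borel" for n
    unfolding S_def[abs_def] by measurable
  have Slim: "(\<lambda>n. LINT s|unit_time. S n s) \<longlonglongrightarrow> (LINT s|unit_time. h (v s) * (indicator {..<T} s * f s))"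
  proof (rule integral_dominated_convergence[where w="\<lambda>t. B * \<bar>f t\<bar>"])
    show "AE s in unit_time. (\<lambda>n. S n s) \<longlonglongrightarrow> h (v s) * (indicator {..<T} s * f s)"
    proof (rule AE_I2)
      fix s
      have "(\<lambda>n. T * (of_int \<lfloor>real n * s / T\<rfloor> + 1) / n) \<longlonglongrightarrow> s"
      proof (rule tendsto_sandwich[of "\<lambda>n. s" _ _ "\<lambda>n. s + T / real n"])
        have "s \<le> T * (of_int \<lfloor>real n * s / T\<rfloor> + 1) / n \<and> T * (of_int \<lfloor>real n * s / T\<rfloor> + 1) / n \<le> s + T / real n"
          if "n > 0" for n
        proof -
          have 1: "real n * s / T \<le> of_int \<lfloor>real n * s / T\<rfloor> + 1" "of_int \<lfloor>real n * s / T\<rfloor> \<le> real n * s / T"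
            by linarith+
          have "T * (real n * s / T) \<le> T * (of_int \<lfloor>real n * s / T\<rfloor> + 1)"
               "T * of_int \<lfloor>real n * s / T\<rfloor> \<le> T * (real n * s / T)"
            using T by (intro mult_left_mono 1; simp)+
          then show ?thesis using T that by (simp add: field_simps)
        qed
        then show "\<forall>\<^sub>F n in sequentially. s \<le> T * (of_int \<lfloor>real n * s / T\<rfloor> + 1) / n"
          "\<forall>\<^sub>F n in sequentially. T * (of_int \<lfloor>real n * s / T\<rfloor> + 1) / n \<le> s + T / real n"
          by (auto intro!: eventually_mono[OF eventually_gt_at_top[of 0]])
        show "(\<lambda>n. s + T / real n) \<longlonglongrightarrow> s"
          using tendsto_add[OF tendsto_const[of s] lim_const_over_n[of T]] by simp
      qed simp
      then have "(\<lambda>n. h (v (T * (of_int \<lfloor>real n * s / T\<rfloor> + 1) / n))) \<longlonglongrightarrow> h (v s)"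
        using hvc by (intro isCont_tendsto_compose[of s "\<lambda>t. h (v t)"]) (auto simp: continuous_on_eq_continuous_at)
      then show "(\<lambda>n. S n s) \<longlonglongrightarrow> h (v s) * (indicator {..<T} s * f s)"
        unfolding S_def by (intro tendsto_intros)
    qed
    show "AE s in unit_time. norm (S n s) \<le> B * \<bar>f s\<bar>" for n
      unfolding S_def using B[OF vV]
      using abs_ge_zero[THEN order_trans, OF B[OF vV[of 0]]]
      by (intro AE_I2) (auto simp: abs_mult indicator_def intro!: mult_right_mono)
  qed (use f in auto)
  moreover have "H (v T) - H v0 \<le> (LINT s|unit_time. S n s)" if n: "n > 0" for n
  proof -
    define t where "t i = T * real i / real n" for i
    have t_mono: "t i \<le> t (Suc i)" for i using T n by (simp add: t_def field_simps)
    have if_int: "integrable unit_time (\<lambda>s. indicator {t i..<t (Suc i)} s * f s)" 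
      "integrable unit_time (\<lambda>s. indicator {..<t i} s * f s)" for i
      by (rule Bochner_Integration.integrable_bound[OF f], simp, simp add: indicator_def)+
    have "H (v T) - H v0 = (\<Sum>i<n. H (v (t (Suc i))) - H (v (t i)))"
      by (subst sum_lessThan_telescope[of "\<lambda>i. H (v (t i))"]) (use n v0 in \<open>simp add: t_def\<close>)
    also have "\<dots> \<le> (\<Sum>i<n. h (v (t (Suc i))) * (v (t (Suc i)) - v (t i)))"
      by (intro sum_mono convex)
    also have "\<dots> = (\<Sum>i<n. h (v (t (Suc i))) * (LINT s|unit_time. indicator {t i..<t (Suc i)} s * f s))"
    proof (rule sum.cong)
      fix i
      have "v (t (Suc i)) - v (t i) = (LINT s|unit_time. indicator {..<t (Suc i)} s * f s - indicator {..<t i} s * f s)"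
        unfolding v_def using if_int(2)[of i] if_int(2)[of "Suc i"] by simp
      also have "\<dots> = (LINT s|unit_time. indicator {t i..<t (Suc i)} s * f s)"
        using t_mono[of i] by (intro Bochner_Integration.integral_cong) (auto simp: indicator_def)
      finally show "h (v (t (Suc i))) * (v (t (Suc i)) - v (t i))
        = h (v (t (Suc i))) * (LINT s|unit_time. indicator {t i..<t (Suc i)} s * f s)" by simp
    qed simp
    also have "\<dots> = (LINT s|unit_time. (\<Sum>i<n. h (v (t (Suc i))) * (indicator {t i..<t (Suc i)} s * f s)))"
      using if_int(1) by (subst Bochner_Integration.integral_sum) auto
    also have "\<dots> = (LINT s|unit_time. S n s)"
    proof (rule integral_cong_AE)
      show "AE s in unit_time. (\<Sum>i<n. h (v (t (Suc i))) * (indicator {t i..<t (Suc i)} s * f s)) = S n s"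
        using AE_unit_time
      proof eventually_elim
        case (elim s)
        define k where "k = nat \<lfloor>real n * s / T\<rfloor>"
        have k: "real k \<le> real n * s / T" "real n * s / T < real k + 1"
          using elim T unfolding k_def by (simp_all add: of_nat_nat)
        have ki: "indicator {t i..<t (Suc i)} s = (if i = k then 1 else 0 :: real)" for i
        proof -
          have "s \<in> {t i..<t (Suc i)} \<longleftrightarrow> real i \<le> real n * s / T \<and> real n * s / T < real i + 1"
            using T n by (auto simp: t_def field_simps)
          also have "\<dots> \<longleftrightarrow> i = k" using k by linarith
          finally show ?thesis by (simp add: indicator_def)
        qed
        have "k < n \<longleftrightarrow> s < T"
        proof -
          have "s < T \<longleftrightarrow> real n * s / T < real n" using T n by (simp add: field_simps)
          also have "\<dots> \<longleftrightarrow> k < n" using k by linarith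
          finally show ?thesis by simp
        qed
        moreover have "real_of_int \<lfloor>real n * s / T\<rfloor> = real k"
          using elim T unfolding k_def by (simp add: of_nat_nat)
        ultimately show ?case
          unfolding ki by (simp add: S_def t_def if_distrib if_distribR algebra_simps cong: if_cong)
      qed
    qed auto
    finally show ?thesis .
  qed
  ultimately have "H (v T) - H v0 \<le> (LINT s|unit_time. h (v s) * (indicator {..<T} s * f s))"
    by (intro LIMSEQ_le_const[of _ _ "H (v T) - H v0"]) (auto intro!: exI[of _ 1])
  then show ?thesis by (simp add: mult_ac)
qed

section \<open>Convolution\<close>

lemma nn_integral_lborel_translate:
  fixes f :: "'a::euclidean_space \<Rightarrow> ennreal"
  assumes [measurable]: "f \<in> borel_measurable borel"
  shows "(\<integral>\<^sup>+x. f (x + c) \<partial>lborel) = (\<integral>\<^sup>+x. f x \<partial>lborel)"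
  by (subst (2) lborel_distr_plus[of c, symmetric], subst nn_integral_distr) (auto simp: add.commute)

lemma integral_lborel_translate:
  fixes f :: "'a::euclidean_space \<Rightarrow> real"
  assumes [measurable]: "f \<in> borel_measurable borel"
  shows "(LINT x|lborel. f (x + c)) = (LINT x|lborel. f x)"
  by (subst (2) lborel_distr_plus[of c, symmetric], subst integral_distr) (auto simp: add.commute)

lemma integrable_lborel_translate:
  fixes f :: "'a::euclidean_space \<Rightarrow> real"
  assumes f: "integrable lborel f"
  shows "integrable lborel (\<lambda>x. f (x + c))"
proof -
  have "integrable (distr lborel borel ((+) c)) f" using f by (simp add: lborel_distr_plus)
  then have "integrable lborel (\<lambda>x. f (c + x))" by (rule integrable_distr[rotated]) simp
  then show ?thesis by (simp add: add.commute)
qed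

definition conv :: "('a::euclidean_space \<Rightarrow> real) \<Rightarrow> ('a \<Rightarrow> real) \<Rightarrow> 'a \<Rightarrow> real" where
  "conv w h x = (LINT z|lborel. w z * h (x - z))"

lemma integrable_conv:
  fixes w h :: "'a::euclidean_space \<Rightarrow> real"
  assumes w: "integrable lborel w" and h [measurable]: "h \<in> borel_measurable borel" and B: "\<And>y. \<bar>h y\<bar> \<le> B"
  shows "integrable lborel (\<lambda>z. w z * h (x - z))"
proof (rule Bochner_Integration.integrable_bound[where f="\<lambda>z. B * w z"])
  have [measurable]: "w \<in> borel_measurable borel" using w borel_measurable_integrable by auto
  show "(\<lambda>z. w z * h (x - z)) \<in> borel_measurable lborel" by measurable
  have "0 \<le> B" using B[of 0] by simp
  then show "AE z in lborel. norm (w z * h (x - z)) \<le> norm (B * w z)"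
    using B by (auto simp: abs_mult mult.commute[of B] intro!: mult_left_mono)
qed (use w in simp)

lemma isCont_conv:
  assumes w: "integrable lborel w" and hc: "continuous_on UNIV h" and B: "\<And>y. \<bar>h y\<bar> \<le> B"
  shows "isCont (conv w h) x"
  unfolding continuous_at_sequentially comp_def
proof (intro allI impI)
  fix X assume X: "X \<longlonglongrightarrow> x"
  have [measurable]: "w \<in> borel_measurable borel" using w borel_measurable_integrable by auto
  have [measurable]: "h \<in> borel_measurable borel" using hc by (rule borel_measurable_continuous_onI)
  have "0 \<le> B" using B[of 0] by simp
  show "(\<lambda>n. conv w h (X n)) \<longlonglongrightarrow> conv w h x"
    unfolding conv_def
  proof (rule integral_dominated_convergence[where w="\<lambda>z. B * \<bar>w z\<bar>"])
    show "AE z in lborel. (\<lambda>n. w z * h (X n - z)) \<longlonglongrightarrow> w z * h (x - z)"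
      by (intro AE_I2 tendsto_intros isCont_tendsto_compose[where g=h] X)
        (use hc in \<open>simp add: continuous_on_eq_continuous_at\<close>)
    show "AE z in lborel. norm (w z * h (X n - z)) \<le> B * \<bar>w z\<bar>" for n
      using B \<open>0 \<le> B\<close> by (auto simp: abs_mult mult.commute[of B] intro!: mult_left_mono)
  qed (use w in auto)
qed

lemma continuous_on_conv:
  assumes "integrable lborel w" "continuous_on UNIV h" "\<And>y. \<bar>h y\<bar> \<le> B"
  shows "continuous_on UNIV (conv w h)"
  using isCont_conv[OF assms] by (simp add: continuous_on_eq_continuous_at)

text \<open>The bound B on \<open>h'\<close> makes \<open>h\<close> Lipschitz along the line, so the
  difference quotients under the integral are dominated by B times |w|. Derivatives along lines are
  all that the later arguments use, so no total derivative of a convolution is formed.\<close>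

lemma conv_line_derivative:
  fixes h h' :: "'a::euclidean_space \<Rightarrow> real"
  assumes w: "integrable lborel w"
    and hc: "h \<in> borel_measurable borel" "h' \<in> borel_measurable borel"
    and B: "\<And>y. \<bar>h y\<bar> \<le> B" "\<And>y. \<bar>h' y\<bar> \<le> B"
    and d: "\<And>y s. ((\<lambda>s. h (y + s *\<^sub>R v)) has_real_derivative h' (y + s *\<^sub>R v)) (at s)"
  shows "((\<lambda>s. conv w h (x + s *\<^sub>R v)) has_real_derivative conv w h' (x + s *\<^sub>R v)) (at s)"
  unfolding DERIV_def tendsto_at_iff_sequentially comp_def
proof (intro allI impI)
  fix X assume X: "\<forall>i. X i \<in> UNIV - {0::real}" "X \<longlonglongrightarrow> 0"
  note [measurable] = hc
  have [measurable]: "w \<in> borel_measurable borel" using w borel_measurable_integrable by auto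
  have i1: "integrable lborel (\<lambda>z. w z * h (y - z))" for y
    by (rule integrable_conv[OF w]) (use B in auto)
  have eq: "(conv w h (x + (s + X n) *\<^sub>R v) - conv w h (x + s *\<^sub>R v)) / X n
    = (LINT z|lborel. w z * ((h (x + (s + X n) *\<^sub>R v - z) - h (x + s *\<^sub>R v - z)) / X n))" for n
  proof -
    have "conv w h (x + (s + X n) *\<^sub>R v) - conv w h (x + s *\<^sub>R v)
      = (LINT z|lborel. w z * (h (x + (s + X n) *\<^sub>R v - z) - h (x + s *\<^sub>R v - z)))"
      unfolding conv_def by (subst Bochner_Integration.integral_diff[symmetric, OF i1 i1]) (simp add: right_diff_distrib)
    then show ?thesis by (simp flip: integral_divide_zero)
  qed
  have lip: "\<bar>h (y + a *\<^sub>R v) - h (y + b *\<^sub>R v)\<bar> \<le> B * \<bar>a - b\<bar>" for y a b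
    using field_differentiable_bound[of UNIV "\<lambda>s. h (y + s *\<^sub>R v)" "\<lambda>s. h' (y + s *\<^sub>R v)" B a b] d B by auto
  show "(\<lambda>n. (conv w h (x + (s + X n) *\<^sub>R v) - conv w h (x + s *\<^sub>R v)) / X n) \<longlonglongrightarrow> conv w h' (x + s *\<^sub>R v)"
    unfolding eq unfolding conv_def
  proof (rule integral_dominated_convergence[where w="\<lambda>z. B * \<bar>w z\<bar>"])
    show "AE z in lborel. (\<lambda>n. w z * ((h (x + (s + X n) *\<^sub>R v - z) - h (x + s *\<^sub>R v - z)) / X n))
        \<longlonglongrightarrow> w z * h' (x + s *\<^sub>R v - z)"
    proof (intro AE_I2 tendsto_mult tendsto_const)
      fix z
      have "(\<lambda>n. (h ((x - z) + (s + X n) *\<^sub>R v) - h ((x - z) + s *\<^sub>R v)) / X n) \<longlonglongrightarrow> h' ((x - z) + s *\<^sub>R v)"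
        using d[of "x - z" s] X unfolding DERIV_def tendsto_at_iff_sequentially comp_def by blast
      then show "(\<lambda>n. (h (x + (s + X n) *\<^sub>R v - z) - h (x + s *\<^sub>R v - z)) / X n) \<longlonglongrightarrow> h' (x + s *\<^sub>R v - z)"
        by (simp add: algebra_simps)
    qed
    show "AE z in lborel. norm (w z * ((h (x + (s + X n) *\<^sub>R v - z) - h (x + s *\<^sub>R v - z)) / X n)) \<le> B * \<bar>w z\<bar>" for n
    proof (rule AE_I2)
      fix z
      have "\<bar>(h ((x - z) + (s + X n) *\<^sub>R v) - h ((x - z) + s *\<^sub>R v)) / X n\<bar> \<le> B"
        using lip[of "x - z" "s + X n" s] X(1)[rule_format, of n] by (simp add: abs_divide field_simps)
      then have "\<bar>w z\<bar> * \<bar>(h ((x - z) + (s + X n) *\<^sub>R v) - h ((x - z) + s *\<^sub>R v)) / X n\<bar> \<le> \<bar>w z\<bar> * B"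
        by (intro mult_left_mono) auto
      then show "norm (w z * ((h (x + (s + X n) *\<^sub>R v - z) - h (x + s *\<^sub>R v - z)) / X n)) \<le> B * \<bar>w z\<bar>"
        by (simp add: abs_mult add_diff_eq diff_add_eq mult.commute[of B])
    qed
  qed (use w in auto)
qed

lemma conv_L1:
  fixes w h :: "'a::euclidean_space \<Rightarrow> real"
  assumes w: "integrable lborel w" and h: "integrable lborel h"
  shows "integrable lborel (conv w h)" and "(LINT x|lborel. conv w h x) = (LINT z|lborel. w z) * (LINT y|lborel. h y)"
proof -
  have [measurable]: "w \<in> borel_measurable borel" "h \<in> borel_measurable borel"
    using w h borel_measurable_integrable by auto
  have tr: "(LINT x|lborel. h (x - z)) = (LINT y|lborel. h y)" "integrable lborel (\<lambda>x. h (x - z))"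
    "(LINT x|lborel. \<bar>h (x - z)\<bar>) = (LINT y|lborel. \<bar>h y\<bar>)" for z
    using integral_lborel_translate[of h "- z"] integrable_lborel_translate[OF h, of "- z"]
      integral_lborel_translate[of "\<lambda>x. \<bar>h x\<bar>" "- z"] by auto
  have *: "integrable (lborel \<Otimes>\<^sub>M lborel) (\<lambda>(z, x). w z * h (x - z))"
  proof (rule lborel_pair.Fubini_integrable)
    show "integrable lborel (\<lambda>z. LINT x|lborel. norm (case (z, x) of (z, x) \<Rightarrow> w z * h (x - z)))"
      using w by (simp add: abs_mult tr)
    show "AE z in lborel. integrable lborel (\<lambda>x. case (z, x) of (z, x) \<Rightarrow> w z * h (x - z))"
      using tr by simp
  qed measurable
  show "integrable lborel (conv w h)"
    using lborel_pair.integrable_snd[OF *] by (simp add: conv_def[abs_def])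
  show "(LINT x|lborel. conv w h x) = (LINT z|lborel. w z) * (LINT y|lborel. h y)"
    unfolding conv_def using lborel_pair.Fubini_integral[OF *] by (simp add: tr)
qed

text \<open>By translation invariance the increments h(x + v) - h(x) integrate to 0. By the
  fundamental theorem and Fubini they integrate to an average of translates of the integral of
  \<open>h'\<close>, all of which are equal. Integrability of \<open>h\<close> and \<open>h'\<close>
  thus replaces any decay at infinity, and there is no boundary term.\<close>

lemma integral_line_derivative_zero:
  fixes h h' :: "'a::euclidean_space \<Rightarrow> real"
  assumes h: "integrable lborel h" "integrable lborel h'" and hc: "continuous_on UNIV h'"
    and d: "\<And>y s. ((\<lambda>s. h (y + s *\<^sub>R v)) has_real_derivative h' (y + s *\<^sub>R v)) (at s)"
  shows "(LINT x|lborel. h' x) = 0"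
proof -
  have [measurable]: "h \<in> borel_measurable borel" "h' \<in> borel_measurable borel"
    using h borel_measurable_integrable by auto
  have ftc: "h (x + v) - h x = (LINT s|lborel. h' (x + s *\<^sub>R v) * indicator {0..1} s)" for x
  proof -
    have "continuous_on UNIV (\<lambda>s. h' (x + s *\<^sub>R v))"
      by (rule continuous_on_compose2[OF hc]) (auto intro!: continuous_intros)
    then have "isCont (\<lambda>s. h' (x + s *\<^sub>R v)) s" for s
      by (simp add: continuous_on_eq_continuous_at)
    then show ?thesis
      using integral_FTC_Icc_real[of 0 1 "\<lambda>s. h (x + s *\<^sub>R v)" "\<lambda>s. h' (x + s *\<^sub>R v)"] d by simp
  qed
  have tr: "(LINT x|lborel. h' (x + c)) = (LINT y|lborel. h' y)" "integrable lborel (\<lambda>x. h' (x + c))"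
    "(LINT x|lborel. \<bar>h' (x + c)\<bar>) = (LINT y|lborel. \<bar>h' y\<bar>)" for c
    using integral_lborel_translate[of h' "c"] integrable_lborel_translate[OF h(2), of "c"]
      integral_lborel_translate[of "\<lambda>x. \<bar>h' x\<bar>" "c"] by auto
  have *: "integrable (lborel \<Otimes>\<^sub>M lborel) (\<lambda>(s, x). h' (x + s *\<^sub>R v) * indicator {0..1::real} s)"
  proof (rule lborel_pair.Fubini_integrable)
    show "integrable lborel (\<lambda>s. LINT x|lborel. norm (case (s, x) of (s, x) \<Rightarrow> h' (x + s *\<^sub>R v) * indicator {0..1::real} s))"
      by (simp add: abs_mult tr)
    show "AE s in lborel. integrable lborel (\<lambda>x. case (s, x) of (s, x) \<Rightarrow> h' (x + s *\<^sub>R v) * indicator {0..1::real} s)"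
      using tr by simp
  qed measurable
  have "0 = (LINT x|lborel. h (x + v) - h x)"
    using integrable_lborel_translate[OF h(1)] h by (simp add: integral_lborel_translate)
  also have "\<dots> = (LINT s|lborel. (LINT x|lborel. h' (x + s *\<^sub>R v) * indicator {0..1} s))"
    unfolding ftc by (rule lborel_pair.Fubini_integral) (rule *)
  also have "\<dots> = (LINT x|lborel. h' x)" by (simp add: tr)
  finally show ?thesis by simp
qed

section \<open>A smoothing kernel with polynomial tails\<close>

text \<open>The kernel is normalised by its integral. Its tails are chosen polynomial, so that
  \<open>\<bar>y\<bar> * \<bar>D kern\<bar> \<le> 2 * DIM * kern\<close> pointwise: no compactly supported kernel has this property,
  on which the bounds uniform in \<open>\<epsilon>\<close> rest.\<close>

definition kden :: "real \<Rightarrow> 'a::euclidean_space \<Rightarrow> real" where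
  "kden \<epsilon> y = \<epsilon>\<^sup>2 + y \<bullet> y"

definition kern0 :: "real \<Rightarrow> 'a::euclidean_space \<Rightarrow> real" where
  "kern0 \<epsilon> y = kden \<epsilon> y powr (- real DIM('a))"

definition kern :: "real \<Rightarrow> 'a::euclidean_space \<Rightarrow> real" where
  "kern \<epsilon> y = kern0 \<epsilon> y / (LINT y|lborel. kern0 \<epsilon> (y::'a))"

text \<open>\<open>kern1\<close> and \<open>kern2\<close> are the first and second directional
  derivatives of \<open>kern\<close>. The factor \<open>kern\<close> is kept visible so that bounds
  relative to the kernel itself can be read off.\<close>

definition kern1 :: "real \<Rightarrow> 'a \<Rightarrow> 'a::euclidean_space \<Rightarrow> real" where
  "kern1 \<epsilon> v y = - (2 * real DIM('a)) * (y \<bullet> v) / kden \<epsilon> y * kern \<epsilon> y"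

definition kern2 :: "real \<Rightarrow> 'a \<Rightarrow> 'a \<Rightarrow> 'a::euclidean_space \<Rightarrow> real" where
  "kern2 \<epsilon> v w y = (- (2 * real DIM('a)) * (v \<bullet> w) / kden \<epsilon> y
     + (4 * real DIM('a) + 4 * (real DIM('a))\<^sup>2) * ((y \<bullet> v) / kden \<epsilon> y) * ((y \<bullet> w) / kden \<epsilon> y)) * kern \<epsilon> y"

lemma kden_pos: "\<epsilon> > 0 \<Longrightarrow> 0 < kden \<epsilon> y"
  by (simp add: kden_def add_pos_nonneg)

lemma kden_nonzero: "\<epsilon> > 0 \<Longrightarrow> kden \<epsilon> y \<noteq> 0"
  using kden_pos[of \<epsilon> y] by simp

lemma continuous_on_kden [continuous_intros]: "continuous_on S (kden \<epsilon>)"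
  unfolding kden_def[abs_def] by (intro continuous_intros)

lemma continuous_on_kern0: "\<epsilon> > 0 \<Longrightarrow> continuous_on S (kern0 \<epsilon>)"
  unfolding kern0_def[abs_def] by (intro continuous_intros ballI) (simp add: kden_nonzero)

lemma kern0_pos: "\<epsilon> > 0 \<Longrightarrow> 0 < kern0 \<epsilon> y"
  using kden_pos[of \<epsilon> y] by (simp add: kern0_def)

lemma kern0_nonneg: "\<epsilon> > 0 \<Longrightarrow> 0 \<le> kern0 \<epsilon> y"
  using kern0_pos[of \<epsilon> y] by simp

lemma borel_measurable_kern0 [measurable]: "kern0 \<epsilon> \<in> borel_measurable borel"
  unfolding kern0_def[abs_def] kden_def by measurable

lemma kern0_le: "\<epsilon> > 0 \<Longrightarrow> kern0 \<epsilon> (y::'a::euclidean_space) \<le> (\<epsilon>\<^sup>2) powr (- real DIM('a))"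
  unfolding kern0_def by (intro powr_mono2') (auto simp: kden_def)

text \<open>The decay is |y|^(-2d). For 2^k \<le> |y| < 2^(k+1) the kernel is at most 4^(-kd), and
  the ball of radius 2^(k+1) has volume of order 2^(kd), so the integral is dominated by a geometric
  series of ratio 2^(-d).\<close>

lemma integrable_kern0:
  assumes e: "\<epsilon> > 0"
  shows "integrable lborel (kern0 \<epsilon> :: 'a::euclidean_space \<Rightarrow> real)"
proof (rule integrableI_bounded)
  let ?d = "DIM('a)" and ?C = "(\<epsilon>\<^sup>2) powr (- real DIM('a))"
  define V where "V = unit_ball_vol (real ?d)"
  have V: "0 < V" by (simp add: V_def)
  have em: "emeasure lborel (ball (0::'a) r) = ennreal (V * r ^ ?d)" if "r > 0" for r
    using that by (simp add: emeasure_ball V_def)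
  \<comment> \<open>The maximum lets the term k = 0 also cover the unit ball, where the kernel is
    bounded by its value at the origin.\<close>
  define D where "D = max 1 ?C"
  have D: "1 \<le> D" "?C \<le> D" by (simp_all add: D_def)
  have pw: "\<exists>k. norm (kern0 \<epsilon> y) \<le> D * (1/4) ^ (k * ?d) \<and> y \<in> ball 0 (2 ^ Suc k)" for y :: 'a
  proof (cases "norm y < 1")
    case True
    then show ?thesis using kern0_le[OF e, of y] kern0_pos[OF e, of y] D
      by (intro exI[of _ 0]) (simp add: dist_norm)
  next
    case False
    define k where "k = nat \<lfloor>log 2 (norm y)\<rfloor>"
    have ny: "norm y \<ge> 1" "0 < norm y" using False by linarith+
    have k: "real k \<le> log 2 (norm y)" "log 2 (norm y) < real k + 1"
    proof -
      have "0 \<le> log 2 (norm y)" using ny by (subst zero_le_log_cancel_iff) auto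
      then show "real k \<le> log 2 (norm y)" "log 2 (norm y) < real k + 1"
        unfolding k_def by linarith+
    qed
    have k1: "2 ^ k \<le> norm y"
      using k(1) ny(2) le_log_iff[of 2 "norm y" "real k"] by (simp add: powr_realpow)
    have "norm y < 2 powr (real (Suc k))"
      using k(2) ny(2) log_less_iff[of 2 "norm y" "real (Suc k)"] by (simp add: add.commute)
    then have k2: "norm y < 2 ^ Suc k" by (simp only: powr_realpow zero_less_numeral)
    have "kern0 \<epsilon> y \<le> ((2 ^ k)\<^sup>2) powr (- real ?d)"
      unfolding kern0_def
    proof (rule powr_mono2')
      have "(2 ^ k)\<^sup>2 \<le> (norm y)\<^sup>2" using k1 by (intro power_mono) auto
      then show "(2 ^ k)\<^sup>2 \<le> kden \<epsilon> y"
        by (simp add: kden_def power2_norm_eq_inner add_increasing)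
    qed auto
    also have "\<dots> = (1/4) ^ (k * ?d)"
    proof -
      have "((2::real) ^ k)\<^sup>2 = 4 ^ k" by (simp add: power2_eq_square flip: power_mult_distrib)
      then show ?thesis
        by (simp add: powr_minus powr_realpow power_one_over flip: power_mult)
          (simp add: divide_simps)
    qed
    also have "\<dots> \<le> D * (1/4) ^ (k * ?d)"
      using mult_right_mono[OF D(1), of "(1/4) ^ (k * ?d)"] by simp
    finally show ?thesis
      using k2 kern0_pos[OF e, of y] by (intro exI[of _ k]) (simp add: dist_norm)
  qed
  have pw2: "ennreal (norm (kern0 \<epsilon> y)) \<le> (\<Sum>k. ennreal (D * (1/4) ^ (k * ?d)) * indicator (ball 0 (2 ^ Suc k)) y)" for y :: 'a
  proof -
    have le: "c k \<le> (\<Sum>k. c k)" for c :: "nat \<Rightarrow> ennreal" and k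
      using sum_le_suminf[of c "{k}"] by simp
    obtain k where k: "norm (kern0 \<epsilon> y) \<le> D * (1/4) ^ (k * ?d)" "y \<in> ball 0 (2 ^ Suc k)"
      using pw by blast
    have "ennreal (norm (kern0 \<epsilon> y)) \<le> ennreal (D * (1/4) ^ (k * ?d)) * indicator (ball 0 (2 ^ Suc k)) y"
      using k by (simp only: indicator_simps mult_1_right ennreal_leI)
    also note le[of "\<lambda>k. ennreal (D * (1/4) ^ (k * ?d)) * indicator (ball 0 (2 ^ Suc k)) y" k]
    finally show ?thesis .
  qed
  have [measurable]: "ball (0::'a) r \<in> sets borel" for r by simp
  have "(\<integral>\<^sup>+y. ennreal (norm (kern0 \<epsilon> (y::'a))) \<partial>lborel)
     \<le> (\<integral>\<^sup>+y. (\<Sum>k. ennreal (D * (1/4) ^ (k * ?d)) * indicator (ball 0 (2 ^ Suc k)) (y::'a)) \<partial>lborel)"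
    by (intro nn_integral_mono pw2)
  also have "\<dots> = (\<Sum>k. \<integral>\<^sup>+y. ennreal (D * (1/4) ^ (k * ?d)) * indicator (ball 0 (2 ^ Suc k)) (y::'a) \<partial>lborel)"
    by (rule nn_integral_suminf) measurable
  also have "\<dots> = (\<Sum>k. ennreal (D * V * 2 ^ ?d * ((1/2) ^ ?d) ^ k))"
  proof (rule suminf_cong)
    fix k
    have "(1/4) ^ (k * ?d) * (2 ^ Suc k) ^ ?d = 2 ^ ?d * ((1/4) ^ (k * ?d) * (2::real) ^ (k * ?d))"
      by (simp add: power_mult_distrib power_mult)
    also have "(1/4) ^ (k * ?d) * 2 ^ (k * ?d) = ((1/4) * 2 :: real) ^ (k * ?d)"
      by (rule power_mult_distrib[symmetric])
    also have "(1/4) * 2 = (1/2 :: real)" by simp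
    also have "(1/2 :: real) ^ (k * ?d) = ((1/2) ^ ?d) ^ k"
      by (subst power_mult[symmetric]) (simp add: mult.commute)
    finally have "(D * V) * ((1/4) ^ (k * ?d) * (2 ^ Suc k) ^ ?d) = (D * V) * (2 ^ ?d * ((1/2) ^ ?d) ^ k)" by (rule arg_cong)
    then have eq: "D * (1/4) ^ (k * ?d) * (V * (2 ^ Suc k) ^ ?d) = D * V * 2 ^ ?d * ((1/2) ^ ?d) ^ k"
      by (simp only: mult_ac)
    have "(\<integral>\<^sup>+y. ennreal (D * (1/4) ^ (k * ?d)) * indicator (ball 0 (2 ^ Suc k)) (y::'a) \<partial>lborel)
       = ennreal (D * (1/4) ^ (k * ?d)) * emeasure lborel (ball (0::'a) (2 ^ Suc k))"
      by (rule nn_integral_cmult_indicator) simp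
    also have "\<dots> = ennreal (D * (1/4) ^ (k * ?d)) * ennreal (V * (2 ^ Suc k) ^ ?d)"
      by (subst em) auto
    also have "\<dots> = ennreal (D * V * 2 ^ ?d * ((1/2) ^ ?d) ^ k)"
      unfolding eq[symmetric] using D V by (intro ennreal_mult[symmetric]) auto
    finally show "(\<integral>\<^sup>+y. ennreal (D * (1/4) ^ (k * ?d)) * indicator (ball 0 (2 ^ Suc k)) (y::'a) \<partial>lborel)
       = ennreal (D * V * 2 ^ ?d * ((1/2) ^ ?d) ^ k)" .
  qed
  also have "\<dots> < \<infinity>"
  proof -
    have "(1/2) ^ ?d < (1::real)" by (simp add: power_less_one_iff)
    then have "summable (\<lambda>k. D * V * 2 ^ ?d * ((1/2) ^ ?d) ^ k)"
      by (intro summable_mult summable_geometric) simp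
    then have "(\<Sum>k. ennreal (D * V * 2 ^ ?d * ((1/2) ^ ?d) ^ k)) = ennreal (\<Sum>k. D * V * 2 ^ ?d * ((1/2) ^ ?d) ^ k)"
      using V D by (intro suminf_ennreal2) auto
    then show ?thesis by simp
  qed
  finally show "(\<integral>\<^sup>+y. ennreal (norm (kern0 \<epsilon> (y::'a))) \<partial>lborel) < \<infinity>" .
qed simp

lemma integral_kern0_pos:
  assumes e: "\<epsilon> > 0"
  shows "0 < (LINT y|lborel. kern0 \<epsilon> (y::'a::euclidean_space))"
proof -
  have "0 \<le> (LINT y|lborel. kern0 \<epsilon> (y::'a))"
    by (intro Bochner_Integration.integral_nonneg) (simp add: kern0_nonneg e)
  moreover have "(LINT y|lborel. kern0 \<epsilon> (y::'a)) \<noteq> 0"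
  proof
    assume "(LINT y|lborel. kern0 \<epsilon> (y::'a)) = 0"
    then have "AE y::'a in lborel. kern0 \<epsilon> y = 0"
      using integral_nonneg_eq_0_iff_AE[OF integrable_kern0[OF e, where 'a='a]] by (simp add: kern0_nonneg e)
    then have "AE y::'a in lborel. False"
      by eventually_elim (metis less_irrefl kern0_pos[OF e])
    then show False by (simp add: AE_iff_null null_sets_def)
  qed
  ultimately show ?thesis by simp
qed

lemma kern_pos: "\<epsilon> > 0 \<Longrightarrow> 0 < kern \<epsilon> y"
  unfolding kern_def by (simp add: integral_kern0_pos kern0_pos)

lemma kern_nonneg: "\<epsilon> > 0 \<Longrightarrow> 0 \<le> kern \<epsilon> y"
  using kern_pos less_imp_le by blast

lemma borel_measurable_kern [measurable]:
  "kern \<epsilon> \<in> borel_measurable borel" "kern1 \<epsilon> v \<in> borel_measurable borel" "kern2 \<epsilon> v w \<in> borel_measurable borel"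
  unfolding kern_def[abs_def] kern1_def[abs_def] kern2_def[abs_def] kden_def by measurable

lemma integrable_kern: "\<epsilon> > 0 \<Longrightarrow> integrable lborel (kern \<epsilon>)"
  unfolding kern_def[abs_def] by (simp add: integrable_kern0)

lemma integral_kern: "\<epsilon> > 0 \<Longrightarrow> (LINT y|lborel. kern \<epsilon> (y::'a::euclidean_space)) = 1"
  unfolding kern_def[abs_def] using integral_kern0_pos[of \<epsilon>, where 'a='a] by simp

lemma kern_even: "kern \<epsilon> (- y) = kern \<epsilon> y"
  by (simp add: kern_def kern0_def kden_def)

lemma kern_minus_commute: "kern \<epsilon> (x - z) = kern \<epsilon> (z + (- x))"
  using kern_even[of \<epsilon> "x - z"] by simp

lemma integrable_kern_reflect: "\<epsilon> > 0 \<Longrightarrow> integrable lborel (\<lambda>z. kern \<epsilon> (x - z))"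
  unfolding kern_minus_commute by (rule integrable_lborel_translate[OF integrable_kern])

lemma integral_kern_reflect: "\<epsilon> > 0 \<Longrightarrow> (LINT z|lborel. kern \<epsilon> (x - z :: 'a::euclidean_space)) = 1"
  unfolding kern_minus_commute by (subst integral_lborel_translate) (simp_all add: integral_kern)

lemma continuous_on_kern:
  "\<epsilon> > 0 \<Longrightarrow> continuous_on S (kern \<epsilon>)"
  "\<epsilon> > 0 \<Longrightarrow> continuous_on S (kern1 \<epsilon> v)"
  "\<epsilon> > 0 \<Longrightarrow> continuous_on S (kern2 \<epsilon> v w)"
proof -
  assume e: "\<epsilon> > 0"
  note [simp] = kden_nonzero[OF e]
  show k: "continuous_on S (kern \<epsilon>)"
    unfolding kern_def[abs_def] using integral_kern0_pos[OF e, where 'a='a]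
    by (intro continuous_intros continuous_on_kern0 e) simp
  show "continuous_on S (kern1 \<epsilon> v)" "continuous_on S (kern2 \<epsilon> v w)"
    unfolding kern1_def[abs_def] kern2_def[abs_def] using k by (intro continuous_intros; simp)+
qed

lemma kern_bounded: "\<epsilon> > 0 \<Longrightarrow> \<exists>B. \<forall>y. kern \<epsilon> (y::'a::euclidean_space) \<le> B"
  using integral_kern0_pos[of \<epsilon>, where 'a='a]
  by (intro exI[of _ "(\<epsilon>\<^sup>2) powr (- real DIM('a)) / (LINT y|lborel. kern0 \<epsilon> (y::'a))"])
    (auto simp: kern_def kern0_le intro!: divide_right_mono)

lemma kden_line_derivative:
  "((\<lambda>s. kden \<epsilon> (y + s *\<^sub>R v)) has_real_derivative 2 * ((y + s *\<^sub>R v) \<bullet> v)) (at s)"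
proof -
  have "kden \<epsilon> (y + s *\<^sub>R v) = (\<epsilon>\<^sup>2 + y \<bullet> y) + 2 * s * (y \<bullet> v) + s * s * (v \<bullet> v)" for s
    by (simp add: kden_def algebra_simps inner_commute)
  then show ?thesis
    by (auto intro!: derivative_eq_intros simp: algebra_simps)
qed

lemma kern_line_derivative:
  fixes y v :: "'a::euclidean_space"
  assumes e: "\<epsilon> > 0"
  shows "((\<lambda>s. kern \<epsilon> (y + s *\<^sub>R v)) has_real_derivative kern1 \<epsilon> v (y + s *\<^sub>R v)) (at s)"
proof -
  let ?z = "y + s *\<^sub>R v" and ?d = "real DIM('a)"
  have p: "0 < kden \<epsilon> ?z" by (rule kden_pos[OF e])
  have "((\<lambda>s. kern0 \<epsilon> (y + s *\<^sub>R v)) has_real_derivative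
      (- ?d) * kden \<epsilon> ?z powr (- ?d - 1) * (2 * (?z \<bullet> v))) (at s)"
    unfolding kern0_def using p
    by (intro DERIV_chain2[where f="\<lambda>x. x powr (- ?d)"] kden_line_derivative has_real_derivative_powr)
  moreover have "kden \<epsilon> ?z powr (- ?d - 1) = kern0 \<epsilon> ?z / kden \<epsilon> ?z"
    using p by (simp add: powr_diff kern0_def)
  ultimately have "((\<lambda>s. kern0 \<epsilon> (y + s *\<^sub>R v)) has_real_derivative
      - (2 * ?d) * (?z \<bullet> v) / kden \<epsilon> ?z * kern0 \<epsilon> ?z) (at s)"
    by (elim DERIV_cong) simp
  from DERIV_cdivide[OF this, of "LINT y|lborel. kern0 \<epsilon> (y::'a)"]
  show ?thesis unfolding kern_def kern1_def by simp
qed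

lemma kern1_line_derivative:
  fixes y v :: "'a::euclidean_space"
  assumes e: "\<epsilon> > 0"
  shows "((\<lambda>s. kern1 \<epsilon> v (y + s *\<^sub>R w)) has_real_derivative kern2 \<epsilon> v w (y + s *\<^sub>R w)) (at s)"
proof -
  let ?z = "y + s *\<^sub>R w" and ?d = "real DIM('a)"
  have p: "kden \<epsilon> ?z \<noteq> 0" using kden_pos[OF e, of ?z] by simp
  have "((\<lambda>s. (y + s *\<^sub>R w) \<bullet> v) has_real_derivative w \<bullet> v) (at s)"
    by (auto simp: inner_add_left intro!: derivative_eq_intros)
  then have "((\<lambda>s. - (2 * ?d) * ((y + s *\<^sub>R w) \<bullet> v) / kden \<epsilon> (y + s *\<^sub>R w) * kern \<epsilon> (y + s *\<^sub>R w))
     has_real_derivative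
      (((- (2 * ?d) * (w \<bullet> v)) * kden \<epsilon> ?z - (- (2 * ?d) * (?z \<bullet> v)) * (2 * (?z \<bullet> w))) / (kden \<epsilon> ?z * kden \<epsilon> ?z) * kern \<epsilon> ?z
       + kern1 \<epsilon> w ?z * (- (2 * ?d) * (?z \<bullet> v) / kden \<epsilon> ?z))) (at s)"
    by (intro DERIV_mult DERIV_divide DERIV_cmult kden_line_derivative kern_line_derivative e p)
  moreover have "(((- (2 * ?d) * (w \<bullet> v)) * kden \<epsilon> ?z - (- (2 * ?d) * (?z \<bullet> v)) * (2 * (?z \<bullet> w))) / (kden \<epsilon> ?z * kden \<epsilon> ?z) * kern \<epsilon> ?z
       + kern1 \<epsilon> w ?z * (- (2 * ?d) * (?z \<bullet> v) / kden \<epsilon> ?z)) = kern2 \<epsilon> v w ?z"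
    unfolding kern1_def kern2_def using p
    by (simp add: divide_simps inner_commute[of w v]) (simp add: algebra_simps power2_eq_square)
  ultimately show ?thesis unfolding kern1_def by simp
qed

text \<open>The first bound comes from 2 \<epsilon> |y| \<le> \<epsilon>^2 + |y|^2, the second from
  |y|^2 \<le> \<epsilon>^2 + |y|^2; the second does not see \<epsilon>.\<close>

lemma inner_div_kden:
  assumes e: "\<epsilon> > 0"
  shows "\<bar>(y \<bullet> v) / kden \<epsilon> y\<bar> \<le> norm v / (2 * \<epsilon>)"
    and "norm y * \<bar>(y \<bullet> v) / kden \<epsilon> y\<bar> \<le> norm v"
proof -
  have p: "0 < kden \<epsilon> y" by (rule kden_pos[OF e])
  have cs: "\<bar>y \<bullet> v\<bar> \<le> norm y * norm v" by (rule Cauchy_Schwarz_ineq2)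
  have "0 \<le> (norm y - \<epsilon>)\<^sup>2" by simp
  then have "2 * \<epsilon> * norm y \<le> kden \<epsilon> y"
    by (simp add: kden_def power2_diff power2_norm_eq_inner algebra_simps)
  then have "2 * \<epsilon> * norm y * norm v \<le> kden \<epsilon> y * norm v" by (intro mult_right_mono) auto
  moreover have "2 * \<epsilon> * \<bar>y \<bullet> v\<bar> \<le> 2 * \<epsilon> * (norm y * norm v)" using cs e by simp
  ultimately have "2 * \<epsilon> * \<bar>y \<bullet> v\<bar> \<le> kden \<epsilon> y * norm v" by (simp add: mult_ac)
  then show "\<bar>(y \<bullet> v) / kden \<epsilon> y\<bar> \<le> norm v / (2 * \<epsilon>)"
    using p e by (simp add: abs_divide field_simps)
  have "norm y * \<bar>y \<bullet> v\<bar> \<le> norm y * (norm y * norm v)" using cs by (intro mult_left_mono) auto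
  also have "\<dots> = (norm y)\<^sup>2 * norm v" by (simp add: power2_eq_square)
  also have "\<dots> \<le> kden \<epsilon> y * norm v"
    by (intro mult_right_mono) (auto simp: kden_def power2_norm_eq_inner)
  finally show "norm y * \<bar>(y \<bullet> v) / kden \<epsilon> y\<bar> \<le> norm v"
    using p by (simp add: abs_divide field_simps)
qed

text \<open>The first bound degenerates as \<epsilon> tends to 0 and serves for finiteness of
  integrals. The second is uniform in \<epsilon> and is the one that absorbs the Lipschitz
  increments of A.\<close>

lemma kern1_bound:
  fixes v y :: "'a::euclidean_space"
  assumes e: "\<epsilon> > 0"
  shows "\<bar>kern1 \<epsilon> v y\<bar> \<le> real DIM('a) / \<epsilon> * norm v * kern \<epsilon> y"
    and "norm y * \<bar>kern1 \<epsilon> v y\<bar> \<le> 2 * real DIM('a) * norm v * kern \<epsilon> y"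
proof -
  have eq: "\<bar>kern1 \<epsilon> v y\<bar> = 2 * real DIM('a) * \<bar>(y \<bullet> v) / kden \<epsilon> y\<bar> * kern \<epsilon> y"
    unfolding kern1_def using kern_nonneg[OF e, of y] kden_pos[OF e, of y] by (simp add: abs_mult abs_divide)
  have "2 * real DIM('a) * \<bar>(y \<bullet> v) / kden \<epsilon> y\<bar> * kern \<epsilon> y \<le> 2 * real DIM('a) * (norm v / (2 * \<epsilon>)) * kern \<epsilon> y"
    using inner_div_kden(1)[OF e, of y v] kern_nonneg[OF e, of y] by (intro mult_right_mono mult_left_mono) auto
  then show "\<bar>kern1 \<epsilon> v y\<bar> \<le> real DIM('a) / \<epsilon> * norm v * kern \<epsilon> y" unfolding eq by simp
  have "(norm y * \<bar>(y \<bullet> v) / kden \<epsilon> y\<bar>) * (2 * real DIM('a) * kern \<epsilon> y) \<le> norm v * (2 * real DIM('a) * kern \<epsilon> y)"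
    using inner_div_kden(2)[OF e, of y v] kern_nonneg[OF e, of y] by (intro mult_right_mono) auto
  then show "norm y * \<bar>kern1 \<epsilon> v y\<bar> \<le> 2 * real DIM('a) * norm v * kern \<epsilon> y"
    unfolding eq by (simp only: mult_ac)
qed

text \<open>The constant is 2 d from the term with v . w plus a quarter of 4 d + 4 d^2, the quarter
  coming from the two factors 1/(2 \<epsilon>).\<close>

lemma kern2_bound:
  fixes v w y :: "'a::euclidean_space"
  assumes e: "\<epsilon> > 0"
  shows "\<bar>kern2 \<epsilon> v w y\<bar> \<le> (3 * real DIM('a) + (real DIM('a))\<^sup>2) / \<epsilon>\<^sup>2 * norm v * norm w * kern \<epsilon> y"
proof -
  let ?d = "real DIM('a)"
  have p: "0 < kden \<epsilon> y" by (rule kden_pos[OF e])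
  have 1: "\<bar>(v \<bullet> w) / kden \<epsilon> y\<bar> \<le> norm v * norm w / \<epsilon>\<^sup>2"
    using Cauchy_Schwarz_ineq2[of v w] e p
    by (auto simp: abs_divide kden_def intro!: frac_le)
  have 2: "\<bar>(y \<bullet> v) / kden \<epsilon> y\<bar> * \<bar>(y \<bullet> w) / kden \<epsilon> y\<bar> \<le> norm v / (2 * \<epsilon>) * (norm w / (2 * \<epsilon>))"
    using e by (intro mult_mono inner_div_kden) auto
  have "\<bar>- (2 * ?d) * (v \<bullet> w) / kden \<epsilon> y + (4 * ?d + 4 * ?d\<^sup>2) * ((y \<bullet> v) / kden \<epsilon> y) * ((y \<bullet> w) / kden \<epsilon> y)\<bar>
    \<le> 2 * ?d * \<bar>(v \<bullet> w) / kden \<epsilon> y\<bar> + (4 * ?d + 4 * ?d\<^sup>2) * (\<bar>(y \<bullet> v) / kden \<epsilon> y\<bar> * \<bar>(y \<bullet> w) / kden \<epsilon> y\<bar>)"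
    by (rule order_trans[OF abs_triangle_ineq]) (simp add: abs_mult abs_divide)
  also have "\<dots> \<le> 2 * ?d * (norm v * norm w / \<epsilon>\<^sup>2) + (4 * ?d + 4 * ?d\<^sup>2) * (norm v / (2 * \<epsilon>) * (norm w / (2 * \<epsilon>)))"
    using 1 2 by (intro add_mono mult_left_mono) auto
  also have "\<dots> = (3 * ?d + ?d\<^sup>2) / \<epsilon>\<^sup>2 * norm v * norm w"
    using e by (simp add: field_simps power2_eq_square)
  finally show ?thesis
    unfolding kern2_def abs_mult abs_of_nonneg[OF kern_nonneg[OF e]]
    by (rule mult_right_mono[OF _ kern_nonneg[OF e]])
qed

text \<open>The falling factorial: the coefficient that differentiating s^a n times puts in front of
  s^(a - n).\<close>

definition pochr :: "real \<Rightarrow> nat \<Rightarrow> real" where "pochr a n = (\<Prod>i<n. a - real i)"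

lemma Ck_kern:
  assumes e: "\<epsilon> > 0"
  shows "Ck k (kern \<epsilon> :: 'a::euclidean_space \<Rightarrow> real)"
proof -
  let ?d = "real DIM('a)"
  have "Ck k (\<lambda>y::'a. \<epsilon>\<^sup>2 + y \<bullet> y)" by (intro Ck_add Ck_const Ck_inner_self)
  then have "Ck k (\<lambda>y::'a. pochr (- ?d) 0 * (\<epsilon>\<^sup>2 + y \<bullet> y) powr (- ?d - real 0))"
  proof (rule Ck_compose_real[where S="{0<..}" and G="\<lambda>n s. pochr (- ?d) n * s powr (- ?d - real n)", rotated 2])
    fix n and s :: real assume "s \<in> {0<..}"
    then have "((\<lambda>s. s powr (- ?d - real n)) has_real_derivative (- ?d - real n) * s powr (- ?d - real n - 1)) (at s)"
      by (intro has_real_derivative_powr) simp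
    from DERIV_cmult[OF this, of "pochr (- ?d) n"]
    show "((\<lambda>s. pochr (- ?d) n * s powr (- ?d - real n)) has_real_derivative
        pochr (- ?d) (Suc n) * s powr (- ?d - real (Suc n))) (at s)"
      by (simp add: pochr_def algebra_simps)
  next
    show "\<epsilon>\<^sup>2 + y \<bullet> y \<in> {0<..}" for y :: 'a using kden_pos[OF e, of y] by (simp add: kden_def)
  qed
  then have "Ck k (kern0 \<epsilon> :: 'a \<Rightarrow> real)" by (simp add: kern0_def[abs_def] kden_def pochr_def)
  then have "Ck k (\<lambda>y::'a. kern0 \<epsilon> y * (1 / (LINT y|lborel. kern0 \<epsilon> (y::'a))))" by (intro Ck_mult Ck_const)
  then show ?thesis by (simp add: kern_def[abs_def])
qed

section \<open>A Gagliardo--Nirenberg--Sobolev inequality and Moser iteration\<close>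

text \<open>Young's inequality is applied to f and g divided by their integrals. If one of the
  integrals is 0, that function vanishes almost everywhere and so does the product.\<close>

lemma Holder_interpolation:
  fixes f g :: "'a \<Rightarrow> real"
  assumes f: "integrable M f" "\<And>x. 0 \<le> f x" and g: "integrable M g" "\<And>x. 0 \<le> g x"
    and \<theta>: "0 < \<theta>" "\<theta> < 1"
  shows "integrable M (\<lambda>x. f x powr \<theta> * g x powr (1 - \<theta>))" (is "integrable M ?h")
    and "(LINT x|M. f x powr \<theta> * g x powr (1 - \<theta>)) \<le> (LINT x|M. f x) powr \<theta> * (LINT x|M. g x) powr (1 - \<theta>)"
proof -
  have [measurable]: "f \<in> borel_measurable M" "g \<in> borel_measurable M"
    using f g by auto
  have young: "f x powr \<theta> * g x powr (1 - \<theta>) \<le> \<theta> * f x + (1 - \<theta>) * g x" for x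
    using Youngs_inequality_0[of \<theta> "1 - \<theta>" "f x" "g x"] \<theta> f(2)[of x] g(2)[of x]
    by (cases "f x = 0"; cases "g x = 0") auto
  show h: "integrable M ?h"
  proof (rule Bochner_Integration.integrable_bound)
    show "integrable M (\<lambda>x. \<theta> * f x + (1 - \<theta>) * g x)" using f g by simp
    show "AE x in M. norm (?h x) \<le> norm (\<theta> * f x + (1 - \<theta>) * g x)"
      using young f(2) g(2) \<theta> by (auto intro!: order_trans[OF _ abs_ge_self])
  qed simp
  let ?F = "LINT x|M. f x" and ?G = "LINT x|M. g x"
  have "0 \<le> ?F" "0 \<le> ?G" using f g by auto
  then consider "?F = 0 \<or> ?G = 0" | "0 < ?F" "0 < ?G" by linarith
  then show "(LINT x|M. ?h x) \<le> ?F powr \<theta> * ?G powr (1 - \<theta>)"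
  proof cases
    case 1
    then have "AE x in M. f x = 0 \<or> g x = 0"
    proof
      assume "?F = 0"
      then have "AE x in M. f x = 0"
        by (rule integral_nonneg_eq_0_iff_AE[THEN iffD1, rotated 2]) (use f in auto)
      then show ?thesis by eventually_elim simp
    next
      assume "?G = 0"
      then have "AE x in M. g x = 0"
        by (rule integral_nonneg_eq_0_iff_AE[THEN iffD1, rotated 2]) (use g in auto)
      then show ?thesis by eventually_elim simp
    qed
    then have "AE x in M. ?h x = 0" by eventually_elim auto
    then have "(LINT x|M. ?h x) = 0" by (rule integral_eq_zero_AE)
    then show ?thesis by simp
  next
    case 2
    have "?h x / (?F powr \<theta> * ?G powr (1 - \<theta>)) \<le> \<theta> * f x / ?F + (1 - \<theta>) * g x / ?G" for x
      using Youngs_inequality_0[of \<theta> "1 - \<theta>" "f x / ?F" "g x / ?G"] \<theta> f(2)[of x] g(2)[of x] 2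
      by (cases "f x = 0"; cases "g x = 0") (auto simp: powr_divide)
    then have "(LINT x|M. ?h x / (?F powr \<theta> * ?G powr (1 - \<theta>))) \<le> (LINT x|M. \<theta> * f x / ?F + (1 - \<theta>) * g x / ?G)"
      using f g h by (intro integral_mono) auto
    also have "\<dots> = \<theta> + (1 - \<theta>)" using f g 2 by simp
    finally show ?thesis using 2 by (simp add: field_simps)
  qed
qed

text \<open>The increment is the integral of the derivative along the segment from x to x + y;
  Cauchy-Schwarz in the segment parameter and translation invariance in x give the estimate. The
  function \<open>g\<close> plays the role of the norm of the gradient of \<open>w\<close>.\<close>

lemma translation_difference_L2:
  fixes w :: "'a::euclidean_space \<Rightarrow> real"
  assumes [measurable]: "w \<in> borel_measurable borel" "g \<in> borel_measurable borel"
    and d: "\<And>x s. ((\<lambda>s. w (x + s *\<^sub>R y)) has_real_derivative Dw (x + s *\<^sub>R y)) (at s)"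
    and Dc: "continuous_on UNIV Dw"
    and Dg: "\<And>x. \<bar>Dw x\<bar> \<le> norm y * g x"
  shows "(\<integral>\<^sup>+x. ennreal ((w (x + y) - w x)\<^sup>2) \<partial>lborel) \<le> ennreal ((norm y)\<^sup>2) * (\<integral>\<^sup>+x. ennreal ((g x)\<^sup>2) \<partial>lborel)"
proof -
  let ?I = "\<lambda>s. indicator {0..1::real} s :: ennreal"
  have pw: "ennreal ((w (x + y) - w x)\<^sup>2) \<le> (\<integral>\<^sup>+s. ennreal ((norm y)\<^sup>2) * ennreal ((g (x + s *\<^sub>R y))\<^sup>2) * ?I s \<partial>lborel)" for x
  proof -
    have [measurable]: "Dw \<in> borel_measurable borel" using Dc by (rule borel_measurable_continuous_onI)
    have "continuous_on UNIV (\<lambda>s. Dw (x + s *\<^sub>R y))"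
      by (rule continuous_on_compose2[OF Dc]) (auto intro!: continuous_intros)
    then have c: "isCont (\<lambda>s. Dw (x + s *\<^sub>R y)) s" for s
      by (simp add: continuous_on_eq_continuous_at)
    have "w (x + y) - w x = (LINT s|lborel. Dw (x + s *\<^sub>R y) * indicator {0..1} s)"
      using integral_FTC_Icc_real[of 0 1 "\<lambda>s. w (x + s *\<^sub>R y)" "\<lambda>s. Dw (x + s *\<^sub>R y)"] d c by simp
    moreover have "integrable lborel (\<lambda>s. Dw (x + s *\<^sub>R y) * indicator {0..1} s)"
      using has_bochner_integral_FTC_Icc_real[of 0 1 "\<lambda>s. w (x + s *\<^sub>R y)" "\<lambda>s. Dw (x + s *\<^sub>R y)"] d c
      by (auto simp: has_bochner_integral_iff)
    ultimately have "ennreal \<bar>w (x + y) - w x\<bar> \<le> (\<integral>\<^sup>+s. ennreal (norm (Dw (x + s *\<^sub>R y) * indicator {0..1} s)) \<partial>lborel)"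
      using integral_norm_bound_ennreal by (metis real_norm_def)
    \<comment> \<open>The indicator is idempotent; writing it twice gives Cauchy-Schwarz a second
      factor, whose square integrates to 1.\<close>
    also have "\<dots> = (\<integral>\<^sup>+s. (ennreal \<bar>Dw (x + s *\<^sub>R y)\<bar> * ?I s) * ?I s \<partial>lborel)"
      by (intro nn_integral_cong) (auto simp: indicator_def)
    finally have "(ennreal \<bar>w (x + y) - w x\<bar>)\<^sup>2 \<le> (\<integral>\<^sup>+s. (ennreal \<bar>Dw (x + s *\<^sub>R y)\<bar> * ?I s) * ?I s \<partial>lborel)\<^sup>2"
      by (rule power_mono) simp
    also have "\<dots> \<le> (\<integral>\<^sup>+s. (ennreal \<bar>Dw (x + s *\<^sub>R y)\<bar> * ?I s)\<^sup>2 \<partial>lborel) * (\<integral>\<^sup>+s. (?I s)\<^sup>2 \<partial>lborel)"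
      by (rule Cauchy_Schwarz_nn_integral) measurable
    also have "(\<integral>\<^sup>+s. (?I s)\<^sup>2 \<partial>lborel) = (\<integral>\<^sup>+s. ?I s \<partial>lborel)"
      by (intro nn_integral_cong) (auto simp: indicator_def)
    also have "\<dots> = 1" by simp
    also have "(\<integral>\<^sup>+s. (ennreal \<bar>Dw (x + s *\<^sub>R y)\<bar> * ?I s)\<^sup>2 \<partial>lborel) * 1
      \<le> (\<integral>\<^sup>+s. ennreal ((norm y)\<^sup>2) * ennreal ((g (x + s *\<^sub>R y))\<^sup>2) * ?I s \<partial>lborel)"
      unfolding mult_1_right
    proof (intro nn_integral_mono)
      fix s
      have "\<bar>Dw (x + s *\<^sub>R y)\<bar>\<^sup>2 \<le> (norm y * g (x + s *\<^sub>R y))\<^sup>2"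
        using Dg by (intro power_mono) auto
      then have "ennreal (\<bar>Dw (x + s *\<^sub>R y)\<bar>\<^sup>2) \<le> ennreal ((norm y)\<^sup>2 * (g (x + s *\<^sub>R y))\<^sup>2)"
        by (intro ennreal_leI) (simp add: power_mult_distrib)
      then show "(ennreal \<bar>Dw (x + s *\<^sub>R y)\<bar> * ?I s)\<^sup>2 \<le> ennreal ((norm y)\<^sup>2) * ennreal ((g (x + s *\<^sub>R y))\<^sup>2) * ?I s"
        by (auto simp: indicator_def ennreal_power ennreal_mult)
    qed
    finally show ?thesis by (simp add: ennreal_power)
  qed
  have "(\<integral>\<^sup>+x. ennreal ((w (x + y) - w x)\<^sup>2) \<partial>lborel)
    \<le> (\<integral>\<^sup>+x. (\<integral>\<^sup>+s. ennreal ((norm y)\<^sup>2) * ennreal ((g (x + s *\<^sub>R y))\<^sup>2) * ?I s \<partial>lborel) \<partial>lborel)"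
    by (intro nn_integral_mono pw)
  also have "\<dots> = (\<integral>\<^sup>+s. (\<integral>\<^sup>+x. ennreal ((norm y)\<^sup>2) * ennreal ((g (x + s *\<^sub>R y))\<^sup>2) * ?I s \<partial>lborel) \<partial>lborel)"
    by (rule lborel_pair.Fubini') measurable
  also have "\<dots> = (\<integral>\<^sup>+s. ennreal ((norm y)\<^sup>2) * (\<integral>\<^sup>+x. ennreal ((g x)\<^sup>2) \<partial>lborel) * ?I s \<partial>lborel)"
  proof (intro nn_integral_cong)
    fix s
    have "(\<integral>\<^sup>+x. ennreal ((g (x + s *\<^sub>R y))\<^sup>2) \<partial>lborel) = (\<integral>\<^sup>+x. ennreal ((g x)\<^sup>2) \<partial>lborel)"
      by (rule nn_integral_lborel_translate) measurable
    then show "(\<integral>\<^sup>+x. ennreal ((norm y)\<^sup>2) * ennreal ((g (x + s *\<^sub>R y))\<^sup>2) * ?I s \<partial>lborel)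
      = ennreal ((norm y)\<^sup>2) * (\<integral>\<^sup>+x. ennreal ((g x)\<^sup>2) \<partial>lborel) * ?I s"
      by (simp add: nn_integral_multc nn_integral_cmult)
  qed
  also have "\<dots> = ennreal ((norm y)\<^sup>2) * (\<integral>\<^sup>+x. ennreal ((g x)\<^sup>2) \<partial>lborel)"
    by (simp add: nn_integral_cmult)
  finally show ?thesis .
qed

lemma ball_average_L2:
  fixes w :: "'a::euclidean_space \<Rightarrow> real"
  assumes wm [measurable]: "w \<in> borel_measurable borel" and gm [measurable]: "g \<in> borel_measurable borel"
    and d: "\<And>x y s. ((\<lambda>s. w (x + s *\<^sub>R y)) has_real_derivative Dw y (x + s *\<^sub>R y)) (at s)"
    and Dc: "\<And>y. continuous_on UNIV (Dw y)"
    and Dg: "\<And>x y. \<bar>Dw y x\<bar> \<le> norm y * g x"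
    and r: "0 < r"
  shows "(\<integral>\<^sup>+x. (\<integral>\<^sup>+y. ennreal ((w (x + y) - w x)\<^sup>2) * indicator (ball 0 r) y \<partial>lborel) \<partial>lborel)
    \<le> ennreal (r\<^sup>2) * (\<integral>\<^sup>+x. ennreal ((g x)\<^sup>2) \<partial>lborel) * emeasure lborel (ball (0::'a) r)"
proof -
  have [measurable]: "ball (0::'a) r \<in> sets borel" by simp
  have "(\<integral>\<^sup>+x. (\<integral>\<^sup>+y. ennreal ((w (x + y) - w x)\<^sup>2) * indicator (ball 0 r) y \<partial>lborel) \<partial>lborel)
    = (\<integral>\<^sup>+y. (\<integral>\<^sup>+x. ennreal ((w (x + y) - w x)\<^sup>2) * indicator (ball 0 r) y \<partial>lborel) \<partial>lborel)"
    by (rule lborel_pair.Fubini') measurable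
  also have "\<dots> \<le> (\<integral>\<^sup>+y. ennreal (r\<^sup>2) * (\<integral>\<^sup>+x. ennreal ((g x)\<^sup>2) \<partial>lborel) * indicator (ball (0::'a) r) y \<partial>lborel)"
  proof (intro nn_integral_mono)
    fix y :: 'a
    have "(\<integral>\<^sup>+x. ennreal ((w (x + y) - w x)\<^sup>2) \<partial>lborel) \<le> ennreal ((norm y)\<^sup>2) * (\<integral>\<^sup>+x. ennreal ((g x)\<^sup>2) \<partial>lborel)"
      by (rule translation_difference_L2[OF wm gm d Dc Dg])
    also have "\<dots> \<le> ennreal (r\<^sup>2) * (\<integral>\<^sup>+x. ennreal ((g x)\<^sup>2) \<partial>lborel)" if "y \<in> ball 0 r"
      using that by (intro mult_right_mono ennreal_leI power_mono) auto
    finally have "(\<integral>\<^sup>+x. ennreal ((w (x + y) - w x)\<^sup>2) \<partial>lborel) \<le> ennreal (r\<^sup>2) * (\<integral>\<^sup>+x. ennreal ((g x)\<^sup>2) \<partial>lborel)"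
      if "y \<in> ball 0 r" using that .
    then show "(\<integral>\<^sup>+x. ennreal ((w (x + y) - w x)\<^sup>2) * indicator (ball 0 r) y \<partial>lborel)
      \<le> ennreal (r\<^sup>2) * (\<integral>\<^sup>+x. ennreal ((g x)\<^sup>2) \<partial>lborel) * indicator (ball (0::'a) r) y"
      by (cases "y \<in> ball 0 r") simp_all
  qed
  also have "\<dots> = ennreal (r\<^sup>2) * (\<integral>\<^sup>+x. ennreal ((g x)\<^sup>2) \<partial>lborel) * emeasure lborel (ball (0::'a) r)"
    by (rule nn_integral_cmult_indicator) simp
  finally show ?thesis .
qed

text \<open>Average w(x)^2 \<le> 2 (w(x+y) - w(x))^2 + 2 w(x+y)^2 over the ball. The last term
  contributes at most 2 W / v, which is less than half of w(x)^2 at a point where w(x)^2 exceeds 4 W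
  / v, and can be absorbed on the left.\<close>

lemma ball_average_pointwise:
  fixes w :: "'a::euclidean_space \<Rightarrow> real"
  assumes [measurable]: "w \<in> borel_measurable borel"
    and W: "(\<integral>\<^sup>+x. ennreal ((w x)\<^sup>2) \<partial>lborel) \<le> ennreal W" "0 \<le> W"
    and v: "emeasure lborel (ball (0::'a) r) = ennreal v" "0 < v"
    and large: "4 * W / v < (w x)\<^sup>2"
  shows "ennreal ((w x)\<^sup>2) \<le> ennreal (4 / v) * (\<integral>\<^sup>+y. ennreal ((w (x + y) - w x)\<^sup>2) * indicator (ball 0 r) y \<partial>lborel)"
proof -
  have [measurable]: "ball (0::'a) r \<in> sets borel" by simp
  define I where "I = (\<integral>\<^sup>+y. ennreal ((w (x + y) - w x)\<^sup>2) * indicator (ball 0 r) y \<partial>lborel)"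
  have "ennreal ((w x)\<^sup>2) * ennreal v = (\<integral>\<^sup>+y. ennreal ((w x)\<^sup>2) * indicator (ball (0::'a) r) y \<partial>lborel)"
    using v by (subst nn_integral_cmult_indicator) simp_all
  also have "\<dots> \<le> (\<integral>\<^sup>+y. 2 * (ennreal ((w (x + y) - w x)\<^sup>2) * indicator (ball 0 r) y) + 2 * ennreal ((w (x + y))\<^sup>2) \<partial>lborel)"
  proof (intro nn_integral_mono)
    fix y
    have "(w x)\<^sup>2 \<le> 2 * (w (x + y) - w x)\<^sup>2 + 2 * (w (x + y))\<^sup>2"
      using sum_squares_bound[of "w (x + y) - w x" "- w (x + y)"] zero_le_power2[of "2 * w (x + y) - w x"]
      by (simp add: power2_eq_square algebra_simps)
    then have "ennreal ((w x)\<^sup>2) \<le> ennreal (2 * (w (x + y) - w x)\<^sup>2 + 2 * (w (x + y))\<^sup>2)"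
      by (rule ennreal_leI)
    also have "\<dots> = 2 * ennreal ((w (x + y) - w x)\<^sup>2) + 2 * ennreal ((w (x + y))\<^sup>2)"
      by (simp add: ennreal_plus ennreal_mult')
    finally show "ennreal ((w x)\<^sup>2) * indicator (ball 0 r) y
      \<le> 2 * (ennreal ((w (x + y) - w x)\<^sup>2) * indicator (ball 0 r) y) + 2 * ennreal ((w (x + y))\<^sup>2)"
      by (cases "y \<in> ball 0 r") simp_all
  qed
  also have "\<dots> = 2 * I + 2 * (\<integral>\<^sup>+y. ennreal ((w (x + y))\<^sup>2) \<partial>lborel)"
    unfolding I_def by (subst nn_integral_add) (simp_all add: nn_integral_cmult)
  also have "(\<integral>\<^sup>+y. ennreal ((w (x + y))\<^sup>2) \<partial>lborel) = (\<integral>\<^sup>+y. ennreal ((w y)\<^sup>2) \<partial>lborel)"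
    using nn_integral_lborel_translate[of "\<lambda>y. ennreal ((w y)\<^sup>2)" x] by (simp add: add.commute)
  finally have le: "ennreal ((w x)\<^sup>2) * ennreal v \<le> 2 * I + 2 * ennreal W"
    using W(1) by (meson add_left_mono mult_left_mono order_trans zero_le)
  have "ennreal ((w x)\<^sup>2) \<le> ennreal (4 / v) * I"
  proof (cases "I = \<infinity>")
    case True
    then show ?thesis using v by (simp add: ennreal_mult_top)
  next
    case False
    then obtain i where i: "I = ennreal i" "0 \<le> i" by (cases I) auto
    have "ennreal ((w x)\<^sup>2 * v) \<le> ennreal (2 * i + 2 * W)"
      using le i W(2) v by (simp add: ennreal_mult' ennreal_plus)
    then have "(w x)\<^sup>2 * v \<le> 2 * i + 2 * W"
      using i W(2) by (subst (asm) ennreal_le_iff) auto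
    moreover have "4 * W < (w x)\<^sup>2 * v" using large v by (simp add: field_simps)
    ultimately have "(w x)\<^sup>2 * v \<le> 4 * i" by linarith
    then have "(w x)\<^sup>2 \<le> 4 / v * i" using v by (simp add: field_simps)
    then show ?thesis
      unfolding i(1) using i v by (subst ennreal_mult'[symmetric]) (auto intro: ennreal_leI)
  qed
  then show ?thesis by (simp add: I_def)
qed

text \<open>Where \<open>w\<^sup>2\<close> lies between consecutive levels \<open>T * 2^(j d)\<close> and \<open>T * 2^((j+1) d)\<close>, it is dominated
  by the mean oscillation of \<open>w\<close> over the ball of radius \<open>2^(-j)\<close>; the series over \<open>j\<close> converges
  because \<open>d (\<kappa> - 1) < 2\<close>.\<close>

lemma Sobolev_inequality:
  fixes \<kappa> :: real
  assumes \<kappa>: "1 < \<kappa>" "real DIM('a::euclidean_space) * (\<kappa> - 1) < 2"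
  shows "\<exists>C\<ge>1. \<forall>(w::'a \<Rightarrow> real) g Dw W G. w \<in> borel_measurable borel \<longrightarrow> g \<in> borel_measurable borel \<longrightarrow>
    (\<forall>x y s. ((\<lambda>s. w (x + s *\<^sub>R y)) has_real_derivative Dw y (x + s *\<^sub>R y)) (at s)) \<longrightarrow>
    (\<forall>y. continuous_on UNIV (Dw y)) \<longrightarrow> (\<forall>x y. \<bar>Dw y x\<bar> \<le> norm y * g x) \<longrightarrow> 0 < W \<longrightarrow> 0 \<le> G \<longrightarrow>
    (\<integral>\<^sup>+x. ennreal ((w x)\<^sup>2) \<partial>lborel) \<le> ennreal W \<longrightarrow> (\<integral>\<^sup>+x. ennreal ((g x)\<^sup>2) \<partial>lborel) \<le> ennreal G \<longrightarrow>
    (\<integral>\<^sup>+x. ennreal ((w x)\<^sup>2 powr \<kappa>) \<partial>lborel) \<le> ennreal (C * W powr (\<kappa> - 1) * (W + G))"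
proof -
  let ?d = "DIM('a)"
  define V where "V = unit_ball_vol (real ?d)"
  have V: "0 < V" by (simp add: V_def)
  define v where "v j = V * (1/2) ^ (j * ?d)" for j :: nat
  have v: "0 < v j" for j using V by (simp add: v_def)
  have em: "emeasure lborel (ball (0::'a) ((1/2) ^ j)) = ennreal (v j)" for j
    by (subst emeasure_ball) (simp_all add: v_def V_def flip: power_mult)
  \<comment> \<open>The factor by which the bound for (w^2)^(\<kappa> - 1) grows from one level to
    the next. The integrated oscillation contributes 1/4 per level, so the series converges because
    e < 4, which is the hypothesis on \<kappa>.\<close>
  define e where "e = 2 powr (real ?d * (\<kappa> - 1))"
  have e: "1 < e" "e < 4"
  proof -
    have "2 powr 0 < e" unfolding e_def using \<kappa> by (intro powr_less_mono) auto
    moreover have "e < 2 powr 2" unfolding e_def using \<kappa> by (intro powr_less_mono) auto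
    ultimately show "1 < e" "e < 4" by simp_all
  qed
  define S where "S = (\<Sum>j. 4 * e * (e / 4) ^ j)"
  have summ: "summable (\<lambda>j. 4 * e * (e / 4) ^ j)"
    using e by (intro summable_mult summable_geometric) auto
  have S0: "0 \<le> S" unfolding S_def using e by (intro suminf_nonneg summ) auto
  define C where "C = max 1 ((4 / V) powr (\<kappa> - 1) * max 1 S)"
  have "(\<integral>\<^sup>+x. ennreal ((w x)\<^sup>2 powr \<kappa>) \<partial>lborel) \<le> ennreal (C * W powr (\<kappa> - 1) * (W + G))"
    if wm [measurable]: "w \<in> borel_measurable borel" and gm [measurable]: "g \<in> borel_measurable borel"
    and d: "\<And>x y s. ((\<lambda>s. w (x + s *\<^sub>R y)) has_real_derivative Dw y (x + s *\<^sub>R y)) (at s)"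
    and Dc: "\<And>y. continuous_on UNIV (Dw y)"
    and Dg: "\<And>x y. \<bar>Dw y x\<bar> \<le> norm y * g x" and W: "0 < W" and G: "0 \<le> G"
    and Wi: "(\<integral>\<^sup>+x. ennreal ((w x)\<^sup>2) \<partial>lborel) \<le> ennreal W"
    and Gi: "(\<integral>\<^sup>+x. ennreal ((g x)\<^sup>2) \<partial>lborel) \<le> ennreal G"
    for w :: "'a \<Rightarrow> real" and g Dw W G
  proof -
    \<comment> \<open>With this T the threshold \<open>4 * W / v j\<close> of
      \<open>ball_average_pointwise\<close> for radius 2^(-j) is exactly the level
      \<open>T * 2 ^ (j * d)\<close>.\<close>
    define T where "T = 4 * W / V"
    have T: "0 < T" using W V by (simp add: T_def)
    define I where "I j x = (\<integral>\<^sup>+y. ennreal ((w (x + y) - w x)\<^sup>2) * indicator (ball 0 ((1/2) ^ j)) y \<partial>lborel)" for j :: nat and x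
    have [measurable]: "ball (0::'a) r \<in> sets borel" for r by simp
    have Im [measurable]: "I j \<in> borel_measurable borel" for j
      unfolding I_def[abs_def] by measurable
    define c where "c j = 4 / v j * e ^ Suc j" for j :: nat
    have c: "0 \<le> c j" for j using v[of j] e by (simp add: c_def)
    have le: "h k \<le> (\<Sum>k. h k)" for h :: "nat \<Rightarrow> ennreal" and k
      using sum_le_suminf[of h "{k}"] by simp
    have pw: "ennreal ((w x)\<^sup>2 powr \<kappa>) \<le> ennreal (T powr (\<kappa> - 1)) * (ennreal ((w x)\<^sup>2) + (\<Sum>j. ennreal (c j) * I j x))" for x
    proof (cases "(w x)\<^sup>2 \<le> T")
      case True
      have "(w x)\<^sup>2 powr \<kappa> = (w x)\<^sup>2 powr (\<kappa> - 1) * (w x)\<^sup>2"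
        using powr_mult_base[of "(w x)\<^sup>2" "\<kappa> - 1"] by (simp add: mult.commute)
      also have "\<dots> \<le> T powr (\<kappa> - 1) * (w x)\<^sup>2"
        using True \<kappa> by (intro mult_right_mono powr_mono2) auto
      finally have "ennreal ((w x)\<^sup>2 powr \<kappa>) \<le> ennreal (T powr (\<kappa> - 1) * (w x)\<^sup>2)"
        by (rule ennreal_leI)
      also have "\<dots> = ennreal (T powr (\<kappa> - 1)) * ennreal ((w x)\<^sup>2)"
        by (rule ennreal_mult') simp
      also have "\<dots> \<le> ennreal (T powr (\<kappa> - 1)) * (ennreal ((w x)\<^sup>2) + (\<Sum>j. ennreal (c j) * I j x))"
        by (intro mult_left_mono) auto
      finally show ?thesis .
    next
      case False
      have "\<exists>n. (w x)\<^sup>2 \<le> T * 2 ^ (n * ?d)"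
      proof -
        obtain n where "(w x)\<^sup>2 / T < 2 ^ n" using real_arch_pow[of 2 "(w x)\<^sup>2 / T"] by auto
        moreover have "(2::real) ^ n \<le> 2 ^ (n * ?d)" by (intro power_increasing) auto
        ultimately have "(w x)\<^sup>2 / T \<le> 2 ^ (n * ?d)" by linarith
        then show ?thesis using T by (intro exI[of _ n]) (simp add: field_simps)
      qed
      then obtain n where n: "(w x)\<^sup>2 \<le> T * 2 ^ (n * ?d)" "\<And>m. m < n \<Longrightarrow> \<not> (w x)\<^sup>2 \<le> T * 2 ^ (m * ?d)"
        using exists_least_iff[of "\<lambda>n. (w x)\<^sup>2 \<le> T * 2 ^ (n * ?d)"] by auto
      have "n \<noteq> 0" using n(1) False by (cases n) auto
      then obtain j where j: "n = Suc j" by (cases n) auto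
      have up: "(w x)\<^sup>2 \<le> T * 2 ^ (Suc j * ?d)" and lo: "T * 2 ^ (j * ?d) < (w x)\<^sup>2"
        using n(1) n(2)[of j] j by auto
      have "4 * W / v j = T * 2 ^ (j * ?d)"
        using V by (simp add: T_def v_def power_one_over)
      then have "4 * W / v j < (w x)\<^sup>2" using lo by simp
      from ball_average_pointwise[OF wm Wi less_imp_le[OF W] em v this]
      have *: "ennreal ((w x)\<^sup>2) \<le> ennreal (4 / v j) * I j x" by (simp add: I_def)
      have "(w x)\<^sup>2 powr (\<kappa> - 1) \<le> (T * 2 ^ (Suc j * ?d)) powr (\<kappa> - 1)"
        using up \<kappa> by (intro powr_mono2) auto
      also have "\<dots> = T powr (\<kappa> - 1) * e ^ Suc j"
      proof -
        have "((2::real) ^ (Suc j * ?d)) powr (\<kappa> - 1) = (2 powr (real (Suc j * ?d))) powr (\<kappa> - 1)"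
          by (subst powr_realpow) simp_all
        also have "\<dots> = e powr (real (Suc j))"
          unfolding e_def powr_powr by (simp add: algebra_simps)
        also have "\<dots> = e ^ Suc j" using e by (subst powr_realpow) auto
        finally show ?thesis using T by (subst powr_mult) auto
      qed
      finally have 2: "(w x)\<^sup>2 powr (\<kappa> - 1) \<le> T powr (\<kappa> - 1) * e ^ Suc j" .
      have "(w x)\<^sup>2 powr \<kappa> = (w x)\<^sup>2 powr (\<kappa> - 1) * (w x)\<^sup>2"
        using powr_mult_base[of "(w x)\<^sup>2" "\<kappa> - 1"] by (simp add: mult.commute)
      also have "\<dots> \<le> T powr (\<kappa> - 1) * e ^ Suc j * (w x)\<^sup>2"
        using 2 by (intro mult_right_mono) auto
      finally have "ennreal ((w x)\<^sup>2 powr \<kappa>) \<le> ennreal (T powr (\<kappa> - 1) * e ^ Suc j * (w x)\<^sup>2)"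
        by (rule ennreal_leI)
      also have "\<dots> = ennreal (T powr (\<kappa> - 1)) * (ennreal (e ^ Suc j) * ennreal ((w x)\<^sup>2))"
        using e by (simp add: ennreal_mult' mult.assoc)
      also have "\<dots> \<le> ennreal (T powr (\<kappa> - 1)) * (ennreal (e ^ Suc j) * (ennreal (4 / v j) * I j x))"
        by (intro mult_left_mono *) auto
      also have "ennreal (e ^ Suc j) * (ennreal (4 / v j) * I j x) = ennreal (c j) * I j x"
        unfolding c_def mult.assoc[symmetric] using e v[of j] by (subst ennreal_mult[symmetric]) (auto simp: mult.commute)
      also have "\<dots> \<le> (\<Sum>j. ennreal (c j) * I j x)" by (rule le)
      also have "\<dots> \<le> ennreal ((w x)\<^sup>2) + (\<Sum>j. ennreal (c j) * I j x)" by simp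
      finally show ?thesis by (simp add: mult_left_mono)
    qed
    have Ij: "(\<integral>\<^sup>+x. ennreal (c j) * I j x \<partial>lborel) \<le> ennreal (4 * e * (e / 4) ^ j * G)" for j
    proof -
      have "(\<integral>\<^sup>+x. I j x \<partial>lborel) \<le> ennreal (((1/2) ^ j)\<^sup>2) * (\<integral>\<^sup>+x. ennreal ((g x)\<^sup>2) \<partial>lborel) * emeasure lborel (ball (0::'a) ((1/2) ^ j))"
        unfolding I_def by (rule ball_average_L2[OF wm gm d Dc Dg]) simp
      also have "\<dots> \<le> ennreal (((1/2) ^ j)\<^sup>2) * ennreal G * ennreal (v j)"
        unfolding em by (intro mult_right_mono mult_left_mono Gi) auto
      finally have "(\<integral>\<^sup>+x. ennreal (c j) * I j x \<partial>lborel) \<le> ennreal (c j) * (ennreal (((1/2) ^ j)\<^sup>2) * ennreal G * ennreal (v j))"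
        by (simp add: nn_integral_cmult mult_left_mono)
      also have "\<dots> = ennreal (c j * (((1/2) ^ j)\<^sup>2 * G * v j))"
        using c G v[of j] by (simp add: ennreal_mult' mult.assoc)
      also have "c j * (((1/2) ^ j)\<^sup>2 * G * v j) = 4 * e * (e / 4) ^ j * G"
      proof -
        have "((1/2::real) ^ j)\<^sup>2 = (1/4) ^ j"
          by (simp add: power2_eq_square flip: power_mult_distrib)
        then have "c j * (((1/2) ^ j)\<^sup>2 * G * v j) = (4 / v j * v j) * e * (e ^ j * (1/4) ^ j) * G"
          by (simp add: c_def)
        also have "e ^ j * (1/4) ^ j = (e / 4) ^ j" by (simp add: power_divide power_one_over)
        finally show ?thesis using v[of j] by simp
      qed
      finally show ?thesis .
    qed
    have "(\<integral>\<^sup>+x. ennreal ((w x)\<^sup>2 powr \<kappa>) \<partial>lborel) \<le> (\<integral>\<^sup>+x. ennreal (T powr (\<kappa> - 1)) * (ennreal ((w x)\<^sup>2) + (\<Sum>j. ennreal (c j) * I j x)) \<partial>lborel)"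
      by (intro nn_integral_mono pw)
    also have "\<dots> = ennreal (T powr (\<kappa> - 1)) * ((\<integral>\<^sup>+x. ennreal ((w x)\<^sup>2) \<partial>lborel) + (\<integral>\<^sup>+x. (\<Sum>j. ennreal (c j) * I j x) \<partial>lborel))"
    proof -
      have m: "(\<lambda>x. \<Sum>j. ennreal (c j) * I j x) \<in> borel_measurable lborel" by measurable
      have m': "(\<lambda>x. ennreal ((w x)\<^sup>2)) \<in> borel_measurable lborel" by measurable
      show ?thesis
        by (subst nn_integral_cmult[OF borel_measurable_add[OF m' m]], subst nn_integral_add[OF m' m]) (rule refl)
    qed
    also have "(\<integral>\<^sup>+x. (\<Sum>j. ennreal (c j) * I j x) \<partial>lborel) = (\<Sum>j. \<integral>\<^sup>+x. ennreal (c j) * I j x \<partial>lborel)"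
      by (rule nn_integral_suminf) measurable
    also have "\<dots> \<le> (\<Sum>j. ennreal (4 * e * (e / 4) ^ j * G))"
      by (intro suminf_le Ij) auto
    also have "\<dots> = ennreal (S * G)"
      unfolding S_def using summ e G
      by (subst suminf_ennreal2) (auto intro!: summable_mult2 simp: suminf_mult2)
    finally have "(\<integral>\<^sup>+x. ennreal ((w x)\<^sup>2 powr \<kappa>) \<partial>lborel) \<le> ennreal (T powr (\<kappa> - 1)) * (ennreal W + ennreal (S * G))"
      using Wi by (simp add: add_mono mult_left_mono order_trans)
    also have "\<dots> = ennreal (T powr (\<kappa> - 1) * (W + S * G))"
      using W S0 G by (simp add: ennreal_mult' ennreal_plus)
    also have "\<dots> \<le> ennreal (C * W powr (\<kappa> - 1) * (W + G))"
    proof (rule ennreal_leI)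
      have "W + S * G \<le> max 1 S * (W + G)"
      proof -
        have "1 * W \<le> max 1 S * W" "S * G \<le> max 1 S * G"
          using W G by (intro mult_right_mono; simp)+
        then show ?thesis unfolding distrib_left by linarith
      qed
      then have "((4 / V) powr (\<kappa> - 1) * W powr (\<kappa> - 1)) * (W + S * G)
         \<le> ((4 / V) powr (\<kappa> - 1) * W powr (\<kappa> - 1)) * (max 1 S * (W + G))"
        by (intro mult_left_mono) auto
      also have "\<dots> = ((4 / V) powr (\<kappa> - 1) * max 1 S) * (W powr (\<kappa> - 1) * (W + G))" by simp
      also have "\<dots> \<le> C * (W powr (\<kappa> - 1) * (W + G))"
        using W G by (intro mult_right_mono) (auto simp: C_def)
      also have "(4 / V) powr (\<kappa> - 1) * W powr (\<kappa> - 1) = T powr (\<kappa> - 1)"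
        unfolding T_def using V W by (subst powr_mult[symmetric]) auto
      finally show "T powr (\<kappa> - 1) * (W + S * G) \<le> C * W powr (\<kappa> - 1) * (W + G)" by (simp only: mult.assoc)
    qed
    finally show ?thesis .
  qed
  note main = this
  show ?thesis
  proof (intro exI[of _ C] conjI allI impI)
    show "1 \<le> C" by (simp add: C_def)
    fix w :: "'a \<Rightarrow> real" and g Dw W G
    assume "w \<in> borel_measurable borel" "g \<in> borel_measurable borel"
      "\<forall>x y s. ((\<lambda>s. w (x + s *\<^sub>R y)) has_real_derivative Dw y (x + s *\<^sub>R y)) (at s)"
      "\<forall>y. continuous_on UNIV (Dw y)" "\<forall>x y. \<bar>Dw y x\<bar> \<le> norm y * g x" "0 < W" "0 \<le> G"
      "(\<integral>\<^sup>+x. ennreal ((w x)\<^sup>2) \<partial>lborel) \<le> ennreal W" "(\<integral>\<^sup>+x. ennreal ((g x)\<^sup>2) \<partial>lborel) \<le> ennreal G"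
    then show "(\<integral>\<^sup>+x. ennreal ((w x)\<^sup>2 powr \<kappa>) \<partial>lborel) \<le> ennreal (C * W powr (\<kappa> - 1) * (W + G))"
      by (intro main[of w g Dw W G]) blast+
  qed
qed

text \<open>J is universally quantified after K so that one K serves all mollifications. If J s is
  the s-th moment of u for a probability measure, then \<open>N s\<close> in the proof is an L^s
  norm and increases with s. As (k + 1) \<kappa> - 1 \<ge> k \<kappa>, a step bounds the norm of
  order k \<kappa> by that of order k \<gamma> up to a factor (A k^c)^(1/(k \<kappa>)). With k =
  (\<kappa>/\<gamma>)^n the orders grow geometrically and the product of the factors
  converges.\<close>

lemma Moser_iteration:
  fixes C c U \<kappa> \<gamma> :: real
  assumes C: "1 \<le> C" and c: "0 \<le> c" and U: "1 \<le> U" and \<gamma>: "1 < \<gamma>" and \<kappa>: "\<gamma> < \<kappa>"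
  shows "\<exists>K\<ge>1. \<forall>J :: real \<Rightarrow> real. (\<forall>s>0. 0 \<le> J s) \<longrightarrow> (\<forall>s>0. \<forall>s'\<ge>s. J s \<le> J s' powr (s / s')) \<longrightarrow>
     (\<forall>k\<ge>1. J ((k + 1) * \<kappa> - 1) \<le> C * (k + 1) powr c * (U powr k + J (k * \<gamma>) powr (1 / \<gamma>)) powr \<kappa>) \<longrightarrow>
     (\<forall>n. J (\<gamma> * (\<kappa> / \<gamma>) ^ n) \<le> K powr (\<gamma> * (\<kappa> / \<gamma>) ^ n))"
proof -
  define \<eta> where "\<eta> = \<kappa> / \<gamma>"
  have \<eta>: "1 < \<eta>" "\<gamma> * \<eta> = \<kappa>" using \<gamma> \<kappa> by (auto simp: \<eta>_def)
  \<comment> \<open>The factor 2^\<kappa> comes from replacing both summands by Y^k, the factor 2^c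
    from k + 1 \<le> 2 k.\<close>
  define A where "A = C * 2 powr \<kappa> * 2 powr c"
  have A1: "1 \<le> A"
  proof -
    have "1 * 1 * 1 \<le> C * 2 powr \<kappa> * 2 powr c"
      using C c \<gamma> \<kappa> by (intro mult_mono ge_one_powr_ge_zero) auto
    then show ?thesis by (simp add: A_def)
  qed
  define K0 where "K0 = max U (A powr (1 / (\<kappa> - 1)))"
  \<comment> \<open>B S dominates the sum of the logarithms of all step factors, because ln (A
    \<eta>^(n c)) \<le> B (n + 1).\<close>
  define B where "B = ln A + c * ln \<eta>"
  have B0: "0 \<le> B" using A1 c \<eta> by (simp add: B_def)
  define S where "S = (\<Sum>n. real (Suc n) * (1 / \<eta>) ^ n)"
  have q: "norm (1 / \<eta>) < 1" using \<eta> by simp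
  have summ: "summable (\<lambda>n. real (Suc n) * (1 / \<eta>) ^ n)"
    using geometric_deriv_sums[OF q] sums_summable by blast
  define K where "K = K0 * exp (B * S)"
  have K0: "1 \<le> K0" using U by (simp add: K0_def)
  have psum: "(\<Sum>i<n. real (Suc i) * (1 / \<eta>) ^ i) \<le> S" for n
    unfolding S_def using \<eta> by (intro sum_le_suminf summ) auto
  have S0: "0 \<le> S" using psum[of 0] by simp
  have K1: "1 \<le> K"
    unfolding K_def using K0 B0 S0 mult_mono[of 1 K0 1 "exp (B * S)"] by simp
  have "J (\<gamma> * \<eta> ^ n) \<le> K powr (\<gamma> * \<eta> ^ n)"
    if J0: "\<And>s. s > 0 \<Longrightarrow> 0 \<le> J s" and mono: "\<And>s s'. 0 < s \<Longrightarrow> s \<le> s' \<Longrightarrow> J s \<le> J s' powr (s / s')"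
      and step: "\<And>k. 1 \<le> k \<Longrightarrow> J ((k + 1) * \<kappa> - 1) \<le> C * (k + 1) powr c * (U powr k + J (k * \<gamma>) powr (1 / \<gamma>)) powr \<kappa>"
    for J :: "real \<Rightarrow> real" and n
  proof -
    define N where "N s = J s powr (1 / s)" for s
    have N_mono: "N s \<le> N s'" if "0 < s" "s \<le> s'" for s s'
    proof -
      have "J s powr (1 / s) \<le> (J s' powr (s / s')) powr (1 / s)"
        using mono[OF that] J0[OF that(1)] that by (intro powr_mono2) auto
      then show ?thesis using that by (simp add: N_def powr_powr)
    qed
    have JN: "J s = N s powr s" if "0 < s" for s
      using that J0[OF that] by (simp add: N_def powr_powr)
    have Nnn: "0 \<le> N s" for s by (simp add: N_def)
    have bound: "J ((k + 1) * \<kappa> - 1) \<le> A * k powr c * Y powr (k * \<kappa>)"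
      if k: "1 \<le> k" and Y: "N (k * \<gamma>) \<le> Y" "U \<le> Y" for k Y
    proof -
      have Y1: "1 \<le> Y" using Y U by simp
      have "J (k * \<gamma>) powr (1 / \<gamma>) = N (k * \<gamma>) powr k"
        using k \<gamma> by (subst JN) (auto simp: powr_powr)
      also have "\<dots> \<le> Y powr k" using Y k Nnn by (intro powr_mono2) auto
      finally have "U powr k + J (k * \<gamma>) powr (1 / \<gamma>) \<le> 2 * Y powr k"
        using powr_mono2[of k U Y] U Y k by simp
      then have "(U powr k + J (k * \<gamma>) powr (1 / \<gamma>)) powr \<kappa> \<le> (2 * Y powr k) powr \<kappa>"
        using \<gamma> \<kappa> by (intro powr_mono2) auto
      also have "\<dots> = 2 powr \<kappa> * Y powr (k * \<kappa>)" using Y1 by (simp add: powr_mult powr_powr)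
      finally have 1: "(U powr k + J (k * \<gamma>) powr (1 / \<gamma>)) powr \<kappa> \<le> 2 powr \<kappa> * Y powr (k * \<kappa>)" .
      have "(k + 1) powr c \<le> (2 * k) powr c" using k c by (intro powr_mono2) auto
      also have "\<dots> = 2 powr c * k powr c" using k by (simp add: powr_mult)
      finally have 2: "(k + 1) powr c \<le> 2 powr c * k powr c" .
      have "J ((k + 1) * \<kappa> - 1) \<le> C * (k + 1) powr c * (U powr k + J (k * \<gamma>) powr (1 / \<gamma>)) powr \<kappa>"
        by (rule step[OF k])
      also have "\<dots> \<le> C * (2 powr c * k powr c) * (2 powr \<kappa> * Y powr (k * \<kappa>))"
        using C 1 2 by (intro mult_mono) auto
      finally show ?thesis by (simp add: A_def mult_ac)
    qed
    \<comment> \<open>For k = 1 the recursion bounds N (2 \<kappa> - 1) through N \<gamma>, which is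
      no larger since \<gamma> \<le> 2 \<kappa> - 1. Unless U dominates, Y^(2 \<kappa> - 1) \<le> A
      Y^\<kappa>, and the smaller power on the right is absorbed; this is the origin of the second
      term in \<open>K0\<close>.\<close>
    have base: "N \<gamma> \<le> K0"
    proof -
      let ?s = "2 * \<kappa> - 1"
      have s: "\<gamma> \<le> ?s" "0 < ?s" using \<gamma> \<kappa> by auto
      define Y where "Y = max U (N ?s)"
      have Y1: "1 \<le> Y" using U by (simp add: Y_def)
      have "N \<gamma> \<le> Y" using N_mono[OF _ s(1)] \<gamma> by (simp add: Y_def)
      moreover have "Y \<le> K0"
      proof (cases "N ?s \<le> U")
        case False
        then have YN: "Y = N ?s" by (simp add: Y_def)
        have "Y powr ?s = J ?s" using JN[OF s(2)] YN by simp
        also have "\<dots> \<le> A * Y powr \<kappa>"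
          using bound[of 1 Y] \<open>N \<gamma> \<le> Y\<close> by (simp add: Y_def)
        also have "Y powr ?s = Y powr (\<kappa> - 1) * Y powr \<kappa>" by (simp flip: powr_add)
        finally have "Y powr (\<kappa> - 1) \<le> A" using Y1 by (subst (asm) mult_le_cancel_right_pos) auto
        then have "(Y powr (\<kappa> - 1)) powr (1 / (\<kappa> - 1)) \<le> A powr (1 / (\<kappa> - 1))"
          using \<gamma> \<kappa> by (intro powr_mono2) auto
        then show ?thesis using \<gamma> \<kappa> Y1 by (simp add: powr_powr K0_def)
      qed (simp add: Y_def K0_def)
      ultimately show ?thesis by simp
    qed
    have "N (\<gamma> * \<eta> ^ n) \<le> K0 * exp (B * (\<Sum>i<n. real (Suc i) * (1 / \<eta>) ^ i))" for n
    proof (induction n)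
      case 0 then show ?case using base by simp
    next
      case (Suc n)
      define Y where "Y = K0 * exp (B * (\<Sum>i<n. real (Suc i) * (1 / \<eta>) ^ i))"
      define k where "k = \<eta> ^ n"
      have k: "1 \<le> k" using \<eta> by (simp add: k_def)
      have Y0: "K0 \<le> Y"
        unfolding Y_def using K0 B0 \<eta>
        by (simp add: mult_le_cancel_left1 sum_nonneg)
      then have Y: "U \<le> Y" "1 \<le> Y" using K0 by (auto simp: K0_def)
      have kk: "1 \<le> k * \<kappa>" using mult_mono[of 1 k 1 \<kappa>] k \<gamma> \<kappa> by simp
      let ?s = "(k + 1) * \<kappa> - 1"
      have s: "k * \<kappa> \<le> ?s" using \<gamma> \<kappa> by (simp add: algebra_simps)
      have Ak: "1 \<le> A * k powr c"
        using mult_mono[of 1 A 1 "k powr c"] A1 ge_one_powr_ge_zero[OF k c] by simp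
      have "N (\<gamma> * \<eta> ^ Suc n) = N (k * \<kappa>)"
        using \<eta>(2) by (simp add: k_def mult_ac flip: mult.assoc)
      also have "\<dots> \<le> N ?s" using kk s by (intro N_mono) auto
      also have "\<dots> \<le> (A * k powr c * Y powr (k * \<kappa>)) powr (1 / ?s)"
        unfolding N_def using bound[OF k _ Y(1)] Suc J0[of ?s] kk s
        by (intro powr_mono2) (auto simp: Y_def k_def mult.commute)
      also have "\<dots> = (A * k powr c) powr (1 / ?s) * Y powr (k * \<kappa> / ?s)"
        using Ak Y by (simp add: powr_mult powr_powr)
      also have "\<dots> \<le> (A * k powr c) powr (1 / (k * \<kappa>)) * Y powr 1"
        using Ak Y s kk by (intro mult_mono powr_mono) (auto simp: frac_le)
      also have "(A * k powr c) powr (1 / (k * \<kappa>)) \<le> exp (B * (real (Suc n) * (1 / \<eta>) ^ n))"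
      proof -
        have lk: "ln k = n * ln \<eta>" using \<eta> by (simp add: k_def ln_realpow)
        have "ln (A * k powr c) = ln A + c * (n * ln \<eta>)"
          using A1 k lk by (simp add: ln_mult ln_powr)
        also have "\<dots> \<le> (ln A + c * ln \<eta>) * real (Suc n)"
          using A1 c \<eta> by (simp add: algebra_simps)
        finally have "ln (A * k powr c) \<le> B * real (Suc n)" by (simp add: B_def)
        then have "ln (A * k powr c) / (k * \<kappa>) \<le> B * real (Suc n) / (k * \<kappa>)"
          using kk by (intro divide_right_mono) auto
        also have "\<dots> \<le> B * real (Suc n) / k"
          using k \<gamma> \<kappa> B0 by (intro divide_left_mono) (auto simp: mult_le_cancel_left1)
        also have "\<dots> = B * (real (Suc n) * (1 / \<eta>) ^ n)" by (simp add: k_def power_one_over field_simps)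
        finally have "ln (A * k powr c) / (k * \<kappa>) \<le> B * (real (Suc n) * (1 / \<eta>) ^ n)" .
        moreover have "(A * k powr c) powr (1 / (k * \<kappa>)) = exp (ln (A * k powr c) / (k * \<kappa>))"
          using Ak A1 k by (simp add: powr_def)
        ultimately show ?thesis by simp
      qed
      finally have "N (\<gamma> * \<eta> ^ Suc n) \<le> exp (B * (real (Suc n) * (1 / \<eta>) ^ n)) * Y"
        using Y by (simp add: mult_right_mono)
      also have "\<dots> = K0 * exp (B * (\<Sum>i<Suc n. real (Suc i) * (1 / \<eta>) ^ i))"
        by (simp add: Y_def exp_add[symmetric] algebra_simps)
      finally show ?case .
    qed
    also have "K0 * exp (B * (\<Sum>i<n. real (Suc i) * (1 / \<eta>) ^ i)) \<le> K"
      unfolding K_def using K0 B0 psum[of n] by (intro mult_left_mono) (auto intro: mult_left_mono)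
    finally have "N (\<gamma> * \<eta> ^ n) powr (\<gamma> * \<eta> ^ n) \<le> K powr (\<gamma> * \<eta> ^ n)"
      using Nnn \<gamma> \<eta> by (intro powr_mono2) auto
    then show ?thesis using JN[of "\<gamma> * \<eta> ^ n"] \<gamma> \<eta> by simp
  qed
  note main = this
  show ?thesis
  proof (intro exI[of _ K] conjI allI impI)
    fix J :: "real \<Rightarrow> real" and n
    assume "\<forall>s>0. 0 \<le> J s" "\<forall>s>0. \<forall>s'\<ge>s. J s \<le> J s' powr (s / s')"
      "\<forall>k\<ge>1. J ((k + 1) * \<kappa> - 1) \<le> C * (k + 1) powr c * (U powr k + J (k * \<gamma>) powr (1 / \<gamma>)) powr \<kappa>"
    then show "J (\<gamma> * (\<kappa> / \<gamma>) ^ n) \<le> K powr (\<gamma> * (\<kappa> / \<gamma>) ^ n)"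
      unfolding \<eta>_def[symmetric] by (intro main) auto
  qed (rule K1)
qed

section \<open>The mollified equation\<close>

lemma borel_measurable_vec_component [measurable]: "(\<lambda>x::real^'n. x $ i) \<in> borel_measurable borel"
  by (intro borel_measurable_continuous_onI continuous_intros)

lemma inner_axis_1: "x \<bullet> axis i (1::real) = x $ i"
  by (simp add: inner_axis)

text \<open>All cutoffs are the flat function exp(-1/s) evaluated at 1 - |z|^2 / (n+1)^2, times e so
  that the pointwise limit is 1. \<open>cut1\<close> and \<open>cut2\<close> are their first and
  second partial derivatives, which tend to 0 uniformly.\<close>

lemma smooth_cutoffs:
  obtains D :: real and cut :: "nat \<Rightarrow> real^'n \<Rightarrow> real" and cut1 :: "nat \<Rightarrow> 'n \<Rightarrow> real^'n \<Rightarrow> real"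
    and cut2 :: "nat \<Rightarrow> 'n \<Rightarrow> 'n \<Rightarrow> real^'n \<Rightarrow> real"
  where "0 \<le> D" "\<And>n k. Ck k (cut n)" "\<And>n z. real (Suc n) \<le> norm z \<Longrightarrow> cut n z = 0"
    "\<And>n z. \<bar>cut n z\<bar> \<le> 1" "\<And>n i z. \<bar>cut1 n i z\<bar> \<le> D / Suc n" "\<And>n i j z. \<bar>cut2 n i j z\<bar> \<le> D / Suc n"
    "\<And>z. (\<lambda>n. cut n z) \<longlonglongrightarrow> 1"
    "\<And>n. cut n \<in> borel_measurable borel" "\<And>n i. cut1 n i \<in> borel_measurable borel"
    "\<And>n i j. cut2 n i j \<in> borel_measurable borel"
    "\<And>n i z. ((\<lambda>s. cut n (z + s *\<^sub>R axis i 1)) has_real_derivative cut1 n i z) (at 0)"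
    "\<And>n i j z. ((\<lambda>s. cut1 n j (z + s *\<^sub>R axis i 1)) has_real_derivative cut2 n i j z) (at 0)"
proof -
  obtain B1 where B1: "0 \<le> B1" "\<And>s. s \<le> 1 \<Longrightarrow> \<bar>flat_deriv 1 s\<bar> \<le> B1" using flat_deriv_bounded by blast
  obtain B2 where B2: "0 \<le> B2" "\<And>s. s \<le> 1 \<Longrightarrow> \<bar>flat_deriv 2 s\<bar> \<le> B2" using flat_deriv_bounded by blast
  \<comment> \<open>On the support |z| < n + 1 the inner derivative \<open>dd\<close> is at most
    2/(n+1): this gives 2 B1 for first derivatives, and 4 B2 + 2 B1 for second derivatives after
    1/(n+1)^2 is replaced by 1/(n+1).\<close>
  define D where "D = exp 1 * (2 * B1 + 4 * B2)"
  define sc :: "nat \<Rightarrow> real^'n \<Rightarrow> real" where "sc n z = 1 - (z \<bullet> z) / (real (Suc n))\<^sup>2" for n z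
  define cut where "cut n z = exp 1 * flat_deriv 0 (sc n z)" for n z
  define dd :: "nat \<Rightarrow> 'n \<Rightarrow> real^'n \<Rightarrow> real" where "dd n i z = - 2 * (z $ i) / (real (Suc n))\<^sup>2" for n i z
  define cut1 where "cut1 n i z = exp 1 * (flat_deriv 1 (sc n z) * dd n i z)" for n i z
  define cut2 where "cut2 n i j z = exp 1 * (flat_deriv 2 (sc n z) * dd n i z * dd n j z
      + flat_deriv 1 (sc n z) * (- 2 * (if i = j then 1 else 0) / (real (Suc n))\<^sup>2))" for n i j z
  have D0: "0 \<le> D" using B1 B2 by (simp add: D_def)
  have scS: "Ck k (sc n)" for n k
  proof -
    have "Ck k (\<lambda>z::real^'n. 1 + (- 1 / (real (Suc n))\<^sup>2) * (z \<bullet> z))"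
      by (intro Ck_add Ck_mult Ck_const Ck_inner_self)
    then show ?thesis by (simp add: sc_def[abs_def])
  qed
  have cutS: "Ck k (cut n)" for n k
    unfolding cut_def[abs_def] by (intro Ck_mult Ck_const Ck_flat_deriv scS)
  have sc1: "sc n z \<le> 1" for n z by (simp add: sc_def)
  have scz: "sc n z \<le> 0" if "real (Suc n) \<le> norm z" for n z
  proof -
    have "(real (Suc n))\<^sup>2 \<le> (norm z)\<^sup>2" using that by (intro power_mono) auto
    then show ?thesis by (simp add: sc_def power2_norm_eq_inner field_simps)
  qed
  have zero: "cut n z = 0" if "real (Suc n) \<le> norm z" for n z
    using flat_deriv_nonpos[OF scz[OF that]] by (simp add: cut_def)
  have c1: "\<bar>cut n z\<bar> \<le> 1" for n z
  proof (cases "sc n z \<le> 0")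
    case False
    then have "exp (- (1 / sc n z)) \<le> exp (- 1)" using sc1[of n z] by (simp add: field_simps)
    then have "exp 1 * exp (- (1 / sc n z)) \<le> exp 1 * exp (- 1)" by (intro mult_left_mono) auto
    also have "exp 1 * exp (- 1) = (1::real)" by (simp add: exp_minus)
    finally show ?thesis using False by (simp add: cut_def flat_deriv_0)
  qed (simp add: cut_def flat_deriv_0)
  have ddb: "\<bar>dd n i z\<bar> \<le> 2 / Suc n" if "norm z < real (Suc n)" for n i z
  proof -
    have "\<bar>z $ i\<bar> \<le> real (Suc n)" using component_le_norm_cart[of z i] that by linarith
    then have "2 * \<bar>z $ i\<bar> / (real (Suc n))\<^sup>2 \<le> 2 * real (Suc n) / (real (Suc n))\<^sup>2"
      by (intro divide_right_mono) auto
    also have "\<dots> = 2 / Suc n" by (simp add: power2_eq_square del: of_nat_Suc)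
    finally show ?thesis by (simp add: dd_def abs_mult del: of_nat_Suc)
  qed
  have fz: "flat_deriv m (sc n z) = 0" if "\<not> norm z < real (Suc n)" for m n z
    using that by (intro flat_deriv_nonpos scz) auto
  have inv: "1 / (real (Suc n))\<^sup>2 \<le> 1 / Suc n" for n
    by (intro frac_le self_le_power) auto
  have b1: "\<bar>cut1 n i z\<bar> \<le> D / Suc n" for n i z
  proof (cases "norm z < real (Suc n)")
    case True
    have "\<bar>flat_deriv 1 (sc n z)\<bar> * \<bar>dd n i z\<bar> \<le> B1 * (2 / Suc n)"
      using B1 sc1 ddb[OF True] by (intro mult_mono) auto
    from mult_left_mono[OF this, of "exp 1"]
    have "\<bar>cut1 n i z\<bar> \<le> exp 1 * (B1 * (2 / Suc n))"
      unfolding cut1_def abs_mult by simp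
    also have "\<dots> \<le> D / Suc n"
      using B2 by (simp add: D_def field_simps)
    finally show ?thesis .
  qed (use D0 in \<open>simp add: cut1_def fz\<close>)
  have b2: "\<bar>cut2 n i j z\<bar> \<le> D / Suc n" for n i j z
  proof (cases "norm z < real (Suc n)")
    case True
    have "\<bar>dd n i z\<bar> * \<bar>dd n j z\<bar> \<le> (2 / Suc n) * (2 / Suc n)"
      using ddb[OF True] by (intro mult_mono) auto
    also have "\<dots> = 4 * (1 / (real (Suc n))\<^sup>2)" by (simp add: power2_eq_square)
    also have "\<dots> \<le> 4 * (1 / Suc n)" using inv[of n] by linarith
    finally have 1: "\<bar>dd n i z\<bar> * \<bar>dd n j z\<bar> \<le> 4 * (1 / Suc n)" .
    have "\<bar>flat_deriv 2 (sc n z) * dd n i z * dd n j z\<bar> = \<bar>flat_deriv 2 (sc n z)\<bar> * (\<bar>dd n i z\<bar> * \<bar>dd n j z\<bar>)"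
      by (simp add: abs_mult)
    also have "\<dots> \<le> B2 * (4 * (1 / Suc n))" by (rule mult_mono[OF B2(2)[OF sc1] 1]) (use B2 in auto)
    finally have 2: "\<bar>flat_deriv 2 (sc n z) * dd n i z * dd n j z\<bar> \<le> B2 * (4 * (1 / Suc n))" .
    have "\<bar>- 2 * (if i = j then 1 else 0) / (real (Suc n))\<^sup>2\<bar> \<le> 2 * (1 / (real (Suc n))\<^sup>2)" by auto
    also have "\<dots> \<le> 2 * (1 / Suc n)" using inv[of n] by linarith
    finally have 4: "\<bar>- 2 * (if i = j then 1 else 0) / (real (Suc n))\<^sup>2\<bar> \<le> 2 * (1 / Suc n)" .
    have "\<bar>flat_deriv 1 (sc n z)\<bar> * \<bar>- 2 * (if i = j then 1 else 0) / (real (Suc n))\<^sup>2\<bar> \<le> B1 * (2 * (1 / Suc n))"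
      by (rule mult_mono[OF B1(2)[OF sc1] 4]) (use B1 in auto)
    then have 3: "\<bar>flat_deriv 1 (sc n z) * (- 2 * (if i = j then 1 else 0) / (real (Suc n))\<^sup>2)\<bar> \<le> B1 * (2 * (1 / Suc n))"
      by (simp only: abs_mult)
    have "\<bar>cut2 n i j z\<bar> \<le> exp 1 * (B2 * (4 * (1 / Suc n)) + B1 * (2 * (1 / Suc n)))"
      unfolding cut2_def abs_mult[of "exp 1"] using order_trans[OF abs_triangle_ineq add_mono[OF 2 3]]
      by (intro mult_mono) auto
    also have "\<dots> = D * (1 / Suc n)" unfolding D_def by (simp only: algebra_simps)
    finally show ?thesis by simp
  qed (use D0 in \<open>simp add: cut2_def fz\<close>)
  have lim: "(\<lambda>n. cut n z) \<longlonglongrightarrow> 1" for z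
  proof -
    have "(\<lambda>n. 1 / real (Suc n)) \<longlonglongrightarrow> 0"
      using LIMSEQ_inverse_real_of_nat by (simp add: inverse_eq_divide)
    then have "(\<lambda>n. 1 - (z \<bullet> z) * (1 / real (Suc n))\<^sup>2) \<longlonglongrightarrow> 1 - (z \<bullet> z) * 0\<^sup>2"
      by (intro tendsto_intros)
    then have l: "(\<lambda>n. sc n z) \<longlonglongrightarrow> 1" by (simp add: sc_def power_one_over)
    have "isCont (flat_deriv 0) 1" using flat_deriv_deriv DERIV_isCont by blast
    then have "(\<lambda>n. exp 1 * flat_deriv 0 (sc n z)) \<longlonglongrightarrow> exp 1 * flat_deriv 0 1"
      by (intro tendsto_intros isCont_tendsto_compose[OF _ l])
    then show ?thesis by (simp add: cut_def flat_deriv_0 exp_minus)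
  qed
  have [measurable]: "flat_deriv m \<in> borel_measurable borel" for m
    by (intro borel_measurable_continuous_onI continuous_on_flat_deriv)
  have [measurable]: "sc n \<in> borel_measurable borel" "dd n i \<in> borel_measurable borel" for n i
    unfolding sc_def[abs_def] dd_def[abs_def] by measurable
  have sc_d: "((\<lambda>s. sc n (z + s *\<^sub>R axis i 1)) has_real_derivative dd n i z) (at 0)" for n i z
  proof -
    have eq: "sc n (z + s *\<^sub>R axis i 1) = 1 - (z \<bullet> z + 2 * s * (z $ i) + s * s) / (real (Suc n))\<^sup>2" for s
      by (simp add: sc_def inner_axis_1 inner_add_left inner_add_right inner_axis' inner_commute[of "axis i 1"] algebra_simps)
    have "((\<lambda>s. 1 - (z \<bullet> z + 2 * s * (z $ i) + s * s) / (real (Suc n))\<^sup>2) has_real_derivative dd n i z) (at 0)"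
    proof -
      have "((\<lambda>s. z \<bullet> z + 2 * s * (z $ i) + s * s) has_real_derivative 2 * (z $ i)) (at 0)"
        by (auto intro!: derivative_eq_intros)
      from DERIV_diff[OF DERIV_const[of 1] DERIV_cdivide[OF this, of "(real (Suc n))\<^sup>2"]]
      show ?thesis by (simp add: dd_def del: of_nat_Suc)
    qed
    then show ?thesis unfolding eq .
  qed
  have fl: "((\<lambda>s. flat_deriv m (sc n (z + s *\<^sub>R axis i 1))) has_real_derivative flat_deriv (Suc m) (sc n z) * dd n i z) (at 0)" for m n i z
    using DERIV_chain2[OF _ sc_d, of "flat_deriv m" "flat_deriv (Suc m) (sc n z)" n z i] flat_deriv_deriv[of m "sc n z"] by simp
  have d1: "((\<lambda>s. cut n (z + s *\<^sub>R axis i 1)) has_real_derivative cut1 n i z) (at 0)" for n i z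
    unfolding cut_def cut1_def using fl[of 0 n z i] by (intro DERIV_cmult) simp
  have dd_d: "((\<lambda>s. dd n j (z + s *\<^sub>R axis i 1)) has_real_derivative - 2 * (if i = j then 1 else 0) / (real (Suc n))\<^sup>2) (at 0)" for n i j z
  proof -
    have "((\<lambda>s. - 2 * (z + s *\<^sub>R axis i 1) $ j) has_real_derivative - 2 * (if i = j then 1 else 0)) (at 0)"
      by (auto intro!: derivative_eq_intros simp: axis_def)
    from DERIV_cdivide[OF this, of "(real (Suc n))\<^sup>2"] show ?thesis unfolding dd_def .
  qed
  have d2: "((\<lambda>s. cut1 n j (z + s *\<^sub>R axis i 1)) has_real_derivative cut2 n i j z) (at 0)" for n i j z
  proof -
    have "((\<lambda>s. exp 1 * (flat_deriv 1 (sc n (z + s *\<^sub>R axis i 1)) * dd n j (z + s *\<^sub>R axis i 1))) has_real_derivative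
      exp 1 * ((flat_deriv (Suc 1) (sc n z) * dd n i z) * dd n j (z + 0 *\<^sub>R axis i 1)
        + (- 2 * (if i = j then 1 else 0) / (real (Suc n))\<^sup>2) * flat_deriv 1 (sc n (z + 0 *\<^sub>R axis i 1)))) (at 0)"
      by (intro DERIV_cmult DERIV_mult fl dd_d)
    then show ?thesis
      unfolding cut1_def cut2_def by (simp add: numeral_2_eq_2 mult.commute)
  qed
  show ?thesis
    by (rule that[of D cut cut1 cut2, OF D0 cutS zero c1 b1 b2 lim _ _ _ d1 d2])
      (unfold cut_def[abs_def] cut1_def[abs_def] cut2_def[abs_def], measurable)
qed

text \<open>The functions are total in time, ready for data extended by 0 outside (0,1); ellipticity
  and mass 1 are therefore demanded only inside. The initial density \<rho>0 is a separate parameter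
  because the extended \<rho> vanishes at t = 0. N is the dimension, U a bound of the initial
  density and B a bound of the integral of |b|^\<beta>. Taking U and B at least 1 makes their powers
  monotone in the exponent.\<close>

locale fokker_planck =
  fixes A :: "real \<Rightarrow> real^'n \<Rightarrow> real^'n^'n" and b :: "real \<Rightarrow> real^'n \<Rightarrow> real^'n"
    and \<rho> :: "real \<Rightarrow> real^'n \<Rightarrow> real" and \<rho>0 :: "real^'n \<Rightarrow> real"
    and \<alpha> \<kappa> \<beta> M B U N :: real
  assumes N_def: "N = real CARD('n)"
    and A_borel [measurable]: "\<And>i j. (\<lambda>(t, x). A t x $ i $ j) \<in> borel_measurable (borel \<Otimes>\<^sub>M borel)"
    and b_borel [measurable]: "case_prod b \<in> borel_measurable (borel \<Otimes>\<^sub>M borel)"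
    and rho_borel [measurable]: "case_prod \<rho> \<in> borel_measurable (borel \<Otimes>\<^sub>M borel)"
    and rho0_borel [measurable]: "\<rho>0 \<in> borel_measurable borel"
    and rho_nonneg: "\<And>t x. 0 \<le> \<rho> t x" and rho0_nonneg: "\<And>x. 0 \<le> \<rho>0 x"
    and rho_mass: "\<And>t. t \<in> {0<..<1} \<Longrightarrow> (\<integral>\<^sup>+x. ennreal (\<rho> t x) \<partial>lborel) = 1"
    and rho0_mass: "(\<integral>\<^sup>+x. ennreal (\<rho>0 x) \<partial>lborel) = 1"
    and rho0_le: "AE x in lborel. \<rho>0 x \<le> U" and U: "1 \<le> U"
    and A_bound: "\<And>t x i j. \<bar>A t x $ i $ j\<bar> \<le> M"
    and A_elliptic: "\<And>t x \<xi>. t \<in> {0<..<1} \<Longrightarrow> \<alpha> * (\<xi> \<bullet> \<xi>) \<le> \<xi> \<bullet> (A t x *v \<xi>)"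
    and A_lipschitz: "\<And>t i j x y. \<bar>A t x $ i $ j - A t y $ i $ j\<bar> \<le> \<kappa> * norm (x - y)"
    and alpha: "0 < \<alpha>" and kappa: "0 \<le> \<kappa>" and beta: "2 < \<beta>" and B: "1 \<le> B"
    and b_Lbeta: "(\<integral>\<^sup>+t. (\<integral>\<^sup>+x. ennreal (norm (b t x) powr \<beta> * \<rho> t x) \<partial>lborel) \<partial>unit_time) \<le> ennreal B"
    and equation: "\<And>u. test_function ({0<..<1} \<times> UNIV) u \<Longrightarrow>
        (LINT t|unit_time. (LINT x|lborel. \<rho> t x * parabolic_op A b u (t, x))) = 0"
    and initial: "\<And>\<zeta>. test_function UNIV \<zeta> \<Longrightarrow>
        ((\<lambda>t. LINT x|lborel. \<rho> t x * \<zeta> x) \<longlongrightarrow> (LINT x|lborel. \<rho>0 x * \<zeta> x)) (at_right 0)"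
begin

lemma M_nonneg: "0 \<le> M"
  using A_bound[of undefined undefined undefined undefined] by simp

text \<open>Finiteness of the double integral in \<open>b_Lbeta\<close> makes almost every time
  good, and at a good time all the integrals over space that follow converge.\<close>

definition good :: "real \<Rightarrow> bool" where
  "good t \<longleftrightarrow> t \<in> {0<..<1} \<and> integrable lborel (\<lambda>x. norm (b t x) powr \<beta> * \<rho> t x)"

lemma rho_slice [measurable]: "\<rho> t \<in> borel_measurable borel"
  by measurable

lemma integrable_rho: "t \<in> {0<..<1} \<Longrightarrow> integrable lborel (\<rho> t)"
  using rho_mass rho_nonneg by (intro integrableI_nonneg) auto

lemma integral_rho: "t \<in> {0<..<1} \<Longrightarrow> (LINT x|lborel. \<rho> t x) = 1"
  using rho_mass rho_nonneg by (subst integral_eq_nn_integral) auto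

lemma integrable_rho0: "integrable lborel \<rho>0"
  using rho0_mass rho0_nonneg by (intro integrableI_nonneg) auto

lemma integral_rho0: "(LINT x|lborel. \<rho>0 x) = 1"
  using rho0_mass rho0_nonneg by (subst integral_eq_nn_integral) auto

lemma AE_good: "AE t in unit_time. good t"
proof -
  have "AE t in unit_time. (\<integral>\<^sup>+x. ennreal (norm (b t x) powr \<beta> * \<rho> t x) \<partial>lborel) \<noteq> \<infinity>"
    by (rule nn_integral_PInf_AE) (use b_Lbeta in \<open>auto simp: top_unique\<close>)
  then show ?thesis
    using AE_unit_time
  proof eventually_elim
    case (elim t)
    then have "integrable lborel (\<lambda>x. norm (b t x) powr \<beta> * \<rho> t x)"
      using rho_nonneg by (intro integrableI_nonneg) (auto simp: less_top)
    then show ?case using elim by (simp add: good_def)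
  qed
qed

lemma norm_le_powr: "norm v \<le> 1 + norm v powr \<beta>"
proof (cases "norm v \<le> 1")
  case False
  then have "norm v powr 1 \<le> norm v powr \<beta>" using beta by (intro powr_mono) auto
  then show ?thesis using False by simp
qed (simp add: add_increasing2)

lemma integrable_b_rho: "good t \<Longrightarrow> integrable lborel (\<lambda>x. norm (b t x) * \<rho> t x)"
proof -
  assume g: "good t"
  show ?thesis
  proof (rule Bochner_Integration.integrable_bound)
    show "integrable lborel (\<lambda>x. \<rho> t x + norm (b t x) powr \<beta> * \<rho> t x)"
      using g integrable_rho by (simp add: good_def)
    show "AE x in lborel. norm (norm (b t x) * \<rho> t x) \<le> norm (\<rho> t x + norm (b t x) powr \<beta> * \<rho> t x)"
    proof (rule AE_I2)
      fix x
      show "norm (norm (b t x) * \<rho> t x) \<le> norm (\<rho> t x + norm (b t x) powr \<beta> * \<rho> t x)"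
        using mult_right_mono[OF norm_le_powr[of "b t x"] rho_nonneg[of t x]] rho_nonneg[of t x]
        by (simp add: abs_mult distrib_right)
    qed
  qed measurable
qed

lemma integrable_b_component: "good t \<Longrightarrow> integrable lborel (\<lambda>x. b t x $ i * \<rho> t x)"
  by (rule Bochner_Integration.integrable_bound[OF integrable_b_rho])
    (auto simp: abs_mult rho_nonneg component_le_norm_cart intro!: mult_right_mono)

lemma integrable_A_component: "t \<in> {0<..<1} \<Longrightarrow> integrable lborel (\<lambda>x. A t x $ i $ j * \<rho> t x)"
  by (rule Bochner_Integration.integrable_bound[where f="\<lambda>x. M * \<rho> t x"])
    (use A_bound in \<open>auto simp: abs_mult rho_nonneg M_nonneg integrable_rho intro!: mult_right_mono\<close>)

lemma integrable_b_mass: "integrable unit_time (\<lambda>t. LINT x|lborel. norm (b t x) * \<rho> t x)"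
proof (rule integrableI_bounded)
  have "(\<integral>\<^sup>+t. ennreal (norm (LINT x|lborel. norm (b t x) * \<rho> t x)) \<partial>unit_time)
     \<le> (\<integral>\<^sup>+t. 1 + (\<integral>\<^sup>+x. ennreal (norm (b t x) powr \<beta> * \<rho> t x) \<partial>lborel) \<partial>unit_time)"
  proof (rule nn_integral_mono_AE)
    show "AE t in unit_time. ennreal (norm (LINT x|lborel. norm (b t x) * \<rho> t x))
       \<le> 1 + (\<integral>\<^sup>+x. ennreal (norm (b t x) powr \<beta> * \<rho> t x) \<partial>lborel)"
      using AE_good
    proof eventually_elim
      case (elim t)
      then have t: "t \<in> {0<..<1}" by (simp add: good_def)
      have "ennreal (norm (LINT x|lborel. norm (b t x) * \<rho> t x)) \<le> (\<integral>\<^sup>+x. norm (norm (b t x) * \<rho> t x) \<partial>lborel)"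
        by (rule integral_norm_bound_ennreal[OF integrable_b_rho[OF elim]])
      also have "\<dots> \<le> (\<integral>\<^sup>+x. ennreal (\<rho> t x) + ennreal (norm (b t x) powr \<beta> * \<rho> t x) \<partial>lborel)"
      proof (intro nn_integral_mono)
        fix x
        show "ennreal (norm (norm (b t x) * \<rho> t x)) \<le> ennreal (\<rho> t x) + ennreal (norm (b t x) powr \<beta> * \<rho> t x)"
          using mult_right_mono[OF norm_le_powr[of "b t x"] rho_nonneg[of t x]] rho_nonneg[of t x]
          by (simp add: abs_mult distrib_right ennreal_leI flip: ennreal_plus)
      qed
      also have "\<dots> = 1 + (\<integral>\<^sup>+x. ennreal (norm (b t x) powr \<beta> * \<rho> t x) \<partial>lborel)"
        by (subst nn_integral_add) (auto simp: rho_mass[OF t])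
      finally show ?case .
    qed
  qed
  also have "\<dots> = 1 + (\<integral>\<^sup>+t. (\<integral>\<^sup>+x. ennreal (norm (b t x) powr \<beta> * \<rho> t x) \<partial>lborel) \<partial>unit_time)"
    by (subst nn_integral_add) (auto simp: emeasure_unit_time)
  also have "\<dots> < \<infinity>" using le_less_trans[OF b_Lbeta ennreal_less_top] by simp
  finally show "(\<integral>\<^sup>+t. ennreal (norm (LINT x|lborel. norm (b t x) * \<rho> t x)) \<partial>unit_time) < \<infinity>" .
qed measurable

end

lemma kern1_minus: "kern1 \<epsilon> (- v) y = - kern1 \<epsilon> v y"
  by (simp add: kern1_def)

lemma kern2_minus: "kern2 \<epsilon> v (- w) y = - kern2 \<epsilon> v w y"
  by (simp add: kern2_def left_diff_distrib)

context fokker_planck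
begin

definition b_mass :: "real \<Rightarrow> real" where
  "b_mass t = (LINT x|lborel. norm (b t x) * \<rho> t x)"

text \<open>The functions \<open>ca\<close> and \<open>cb\<close> stand for first and second
  derivatives, of a compactly supported test function or of the kernel itself; only their common
  bound Z matters. The estimate through mass and \<open>b_mass\<close> also supplies the dominating
  functions for the removal of the cutoffs.\<close>

lemma operator_integrable:
  fixes ca :: "'n \<Rightarrow> real^'n \<Rightarrow> real" and cb :: "'n \<Rightarrow> 'n \<Rightarrow> real^'n \<Rightarrow> real"
  assumes [measurable]: "\<And>i. ca i \<in> borel_measurable borel" "\<And>i j. cb i j \<in> borel_measurable borel"
    and ca: "\<And>i z. \<bar>ca i z\<bar> \<le> Z" and cb: "\<And>i j z. \<bar>cb i j z\<bar> \<le> Z"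
    and G_def: "\<And>t z. G t z = (\<Sum>i\<in>UNIV. \<Sum>j\<in>UNIV. A t z $ i $ j * cb i j z) + (\<Sum>i\<in>UNIV. b t z $ i * ca i z)"
  shows "\<And>t z. \<bar>\<rho> t z * G t z\<bar> \<le> (Z * (real CARD('n))\<^sup>2 * M) * \<rho> t z + (Z * real CARD('n)) * (norm (b t z) * \<rho> t z)"
    and "\<And>t. good t \<Longrightarrow> integrable lborel (\<lambda>z. \<rho> t z * G t z)"
    and "AE t in unit_time. \<bar>LINT z|lborel. \<rho> t z * G t z\<bar> \<le> Z * (real CARD('n))\<^sup>2 * M + Z * real CARD('n) * b_mass t"
    and "integrable unit_time (\<lambda>t. LINT z|lborel. \<rho> t z * G t z)"
proof -
  let ?N = "real CARD('n)"
  have Z0: "0 \<le> Z" using ca[of undefined undefined] by simp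
  have [measurable]: "case_prod G \<in> borel_measurable (borel \<Otimes>\<^sub>M borel)"
    unfolding G_def[abs_def] by measurable
  have Gb: "\<bar>G t z\<bar> \<le> Z * ?N\<^sup>2 * M + Z * ?N * norm (b t z)" for t z
  proof -
    have "\<bar>\<Sum>i\<in>UNIV. \<Sum>j\<in>UNIV. A t z $ i $ j * cb i j z\<bar> \<le> (\<Sum>i::'n\<in>UNIV. \<Sum>j::'n\<in>UNIV. M * Z)"
      by (rule order_trans[OF sum_abs] sum_mono)+ (use A_bound cb M_nonneg in \<open>auto simp: abs_mult intro!: mult_mono\<close>)
    moreover have "\<bar>\<Sum>i\<in>UNIV. b t z $ i * ca i z\<bar> \<le> (\<Sum>i::'n\<in>UNIV. norm (b t z) * Z)"
      by (rule order_trans[OF sum_abs] sum_mono)+ (use component_le_norm_cart ca in \<open>auto simp: abs_mult intro!: mult_mono\<close>)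
    ultimately show ?thesis
      unfolding G_def by (simp add: power2_eq_square mult_ac)
  qed
  show bd: "\<bar>\<rho> t z * G t z\<bar> \<le> (Z * ?N\<^sup>2 * M) * \<rho> t z + (Z * ?N) * (norm (b t z) * \<rho> t z)" for t z
  proof -
    have "\<rho> t z * \<bar>G t z\<bar> \<le> \<rho> t z * (Z * ?N\<^sup>2 * M + Z * ?N * norm (b t z))"
      by (intro mult_left_mono Gb rho_nonneg)
    then show ?thesis by (simp add: abs_mult rho_nonneg distrib_left mult_ac)
  qed
  have di: "integrable lborel (\<lambda>z. (Z * ?N\<^sup>2 * M) * \<rho> t z + (Z * ?N) * (norm (b t z) * \<rho> t z))" if "good t" for t
    using that integrable_rho integrable_b_rho by (auto simp: good_def)
  show gi: "integrable lborel (\<lambda>z. \<rho> t z * G t z)" if "good t" for t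
    by (rule Bochner_Integration.integrable_bound[OF di[OF that]])
      (use order_trans[OF bd abs_ge_self] in auto)
  show ae: "AE t in unit_time. \<bar>LINT z|lborel. \<rho> t z * G t z\<bar> \<le> Z * ?N\<^sup>2 * M + Z * ?N * b_mass t"
    using AE_good
  proof eventually_elim
    case (elim t)
    have "\<bar>LINT z|lborel. \<rho> t z * G t z\<bar> \<le> (LINT z|lborel. (Z * ?N\<^sup>2 * M) * \<rho> t z + (Z * ?N) * (norm (b t z) * \<rho> t z))"
      by (rule integral_abs_bound_integral[OF gi[OF elim] di[OF elim] bd])
    also have "\<dots> = Z * ?N\<^sup>2 * M + Z * ?N * b_mass t"
      using elim integrable_rho integrable_b_rho integral_rho by (simp add: good_def b_mass_def)
    finally show ?case .
  qed
  show "integrable unit_time (\<lambda>t. LINT z|lborel. \<rho> t z * G t z)"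
  proof (rule Bochner_Integration.integrable_bound)
    show "integrable unit_time (\<lambda>t. Z * ?N\<^sup>2 * M + Z * ?N * b_mass t)"
      using integrable_b_mass by (simp add: b_mass_def)
    show "AE t in unit_time. norm (LINT z|lborel. \<rho> t z * G t z) \<le> norm (Z * ?N\<^sup>2 * M + Z * ?N * b_mass t)"
      using ae by eventually_elim auto
  qed measurable
qed

text \<open>Inserting the products \<psi>(t) \<zeta>(x) into the weak equation leaves a weak
  ordinary differential equation for the integral of \<rho> \<zeta> over space, with the initial
  condition as its limit at 0, and \<open>weak_ode\<close> applies.\<close>

lemma tested_ode:
  fixes \<zeta> :: "real^'n \<Rightarrow> real"
  assumes smooth: "\<And>k. Ck k \<zeta>" and supp: "\<And>z. R \<le> norm z \<Longrightarrow> \<zeta> z = 0"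
    and Z: "\<And>z. \<bar>\<zeta> z\<bar> \<le> Z" "\<And>i z. \<bar>\<zeta>d i z\<bar> \<le> Z" "\<And>i j z. \<bar>\<zeta>dd i j z\<bar> \<le> Z"
    and \<zeta>_meas [measurable]: "\<And>i. \<zeta>d i \<in> borel_measurable borel" "\<And>i j. \<zeta>dd i j \<in> borel_measurable borel"
    and d1: "\<And>i z. ((\<lambda>s. \<zeta> (z + s *\<^sub>R axis i 1)) has_real_derivative \<zeta>d i z) (at 0)"
    and d2: "\<And>i j z. ((\<lambda>s. \<zeta>d j (z + s *\<^sub>R axis i 1)) has_real_derivative \<zeta>dd i j z) (at 0)"
    and G_def: "\<And>t z. G t z = (\<Sum>i\<in>UNIV. \<Sum>j\<in>UNIV. A t z $ i $ j * \<zeta>dd i j z) + (\<Sum>i\<in>UNIV. b t z $ i * \<zeta>d i z)"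
  shows "AE t in unit_time. (LINT z|lborel. \<rho> t z * \<zeta> z) = (LINT z|lborel. \<rho>0 z * \<zeta> z)
    + (LINT s|unit_time. indicator {..<t} s * (LINT z|lborel. \<rho> s z * G s z))"
proof (rule weak_ode)
  note op = operator_integrable[OF \<zeta>_meas Z(2,3) G_def]
  have Z0: "0 \<le> Z" using Z(1)[of undefined] by simp
  have [measurable]: "\<zeta> \<in> borel_measurable borel" using smooth by measurable
  have [measurable]: "case_prod G \<in> borel_measurable (borel \<Otimes>\<^sub>M borel)"
    unfolding G_def[abs_def] by measurable
  have \<zeta>i: "integrable lborel (\<lambda>z. \<rho> t z * \<zeta> z)" if "t \<in> {0<..<1}" for t
    by (rule Bochner_Integration.integrable_bound[where f="\<lambda>z. Z * \<rho> t z"])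
      (use Z Z0 integrable_rho[OF that] in \<open>auto simp: abs_mult rho_nonneg mult.commute[of Z] intro!: mult_left_mono\<close>)
  have Mb: "\<bar>LINT z|lborel. \<rho> t z * \<zeta> z\<bar> \<le> Z" if "t \<in> {0<..<1}" for t
  proof -
    have "\<bar>LINT z|lborel. \<rho> t z * \<zeta> z\<bar> \<le> (LINT z|lborel. Z * \<rho> t z)"
      by (rule integral_abs_bound_integral[OF \<zeta>i[OF that]])
        (use Z Z0 integrable_rho[OF that] in \<open>auto simp: abs_mult rho_nonneg mult.commute[of Z] intro!: mult_left_mono\<close>)
    then show ?thesis by (simp add: integral_rho[OF that])
  qed
  show "integrable unit_time (\<lambda>t. LINT z|lborel. \<rho> t z * \<zeta> z)"
    by (rule unit_time.integrable_const_bound[where B=Z])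
      (use Mb in \<open>auto intro!: eventually_mono[OF AE_unit_time]\<close>)
  show "integrable unit_time (\<lambda>s. LINT z|lborel. \<rho> s z * G s z)" by (rule op(4))
  have "closure {z. \<zeta> z \<noteq> 0} \<subseteq> cball 0 R"
    by (rule closure_minimal) (use supp in \<open>auto simp: dist_norm intro: ccontr\<close>)
  then have "test_function UNIV \<zeta>"
    unfolding test_function_def using smooth
    by (metis UNIV_I bounded_subset closed_closure bounded_cball compact_eq_bounded_closed subsetI)
  then show "((\<lambda>t. LINT z|lborel. \<rho> t z * \<zeta> z) \<longlongrightarrow> (LINT z|lborel. \<rho>0 z * \<zeta> z)) (at_right 0)"
    by (rule initial)
  fix \<psi> \<psi>' :: "real \<Rightarrow> real" and a c
  assume \<psi>: "\<And>k. Ck k \<psi>" "\<And>t. (\<psi> has_real_derivative \<psi>' t) (at t)" "0 < a" "a < c" "c < 1"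
    "\<And>t. t \<notin> {a..c} \<Longrightarrow> \<psi> t = 0"
  define u where "u = (\<lambda>p. \<psi> (fst p) * \<zeta> (snd p))"
  have uS: "Ck k u" for k
  proof -
    have "Ck k (\<lambda>p. \<psi> (0 + fst p))" "Ck k (\<lambda>p. \<zeta> (0 + snd p))"
      by (intro Ck_compose_linear bounded_linear_fst bounded_linear_snd \<psi> smooth)+
    then show ?thesis unfolding u_def by (intro Ck_mult) simp_all
  qed
  have cl: "closure {p. u p \<noteq> 0} \<subseteq> {a..c} \<times> cball 0 R"
  proof (rule closure_minimal)
    show "{p. u p \<noteq> 0} \<subseteq> {a..c} \<times> cball 0 R"
    proof (clarsimp simp: u_def)
      fix t z assume "\<psi> t \<noteq> 0" "\<zeta> z \<noteq> 0"
      then show "a \<le> t \<and> t \<le> c \<and> norm z \<le> R"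
        using \<psi>(6)[of t] supp[of z] by fastforce
    qed
    show "closed ({a..c} \<times> cball (0::real^'n) R)" by (intro closed_Times) auto
  qed
  have "test_function ({0<..<1} \<times> UNIV) u"
    unfolding test_function_def
  proof (intro conjI allI uS)
    show "compact (closure {p. u p \<noteq> 0})"
      using cl compact_Times[OF compact_Icc compact_cball, of a c "0::real^'n" R]
      by (metis closed_closure compact_Int_closed inf.absorb_iff2)
    show "closure {p. u p \<noteq> 0} \<subseteq> {0<..<1} \<times> UNIV"
      using cl \<psi>(3-5) by fastforce
  qed
  note eq0 = equation[OF this]
  have px: "partial_x i u (t, z) = \<psi> t * \<zeta>d i z" for i t z
  proof -
    have "((\<lambda>s. \<psi> t * \<zeta> (z + s *\<^sub>R axis i 1)) has_real_derivative \<psi> t * \<zeta>d i z) (at 0)"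
      by (intro DERIV_cmult d1)
    then show ?thesis by (simp add: partial_x_def u_def DERIV_imp_deriv)
  qed
  have pxx: "partial_x i (partial_x j u) (t, z) = \<psi> t * \<zeta>dd i j z" for i j t z
  proof -
    have "((\<lambda>s. \<psi> t * \<zeta>d j (z + s *\<^sub>R axis i 1)) has_real_derivative \<psi> t * \<zeta>dd i j z) (at 0)"
      by (intro DERIV_cmult d2)
    then show ?thesis by (subst partial_x_def) (simp add: px DERIV_imp_deriv)
  qed
  have pt: "partial_t u (t, z) = \<psi>' t * \<zeta> z" for t z
  proof -
    have "((\<lambda>s. \<psi> s * \<zeta> z) has_real_derivative \<psi>' t * \<zeta> z) (at t)"
      by (intro DERIV_cmult_right \<psi>)
    then show ?thesis by (simp add: partial_t_def u_def DERIV_imp_deriv)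
  qed
  have op_eq: "parabolic_op A b u (t, z) = \<psi>' t * \<zeta> z + \<psi> t * G t z" for t z
    unfolding parabolic_op_def G_def
    by (simp add: px pxx pt sum_distrib_left distrib_left mult_ac)
  have \<psi>c: "continuous_on UNIV \<psi>" using Ck_continuous \<psi>(1) by blast
  have [measurable]: "\<psi> \<in> borel_measurable borel"
    using \<psi>c by (rule borel_measurable_continuous_onI)
  have "\<psi>' = (\<lambda>t. frechet_derivative \<psi> (at t) 1)"
    using frechet_derivative_at[OF \<psi>(2)[unfolded has_field_derivative_def]] by (metis mult_1_right)
  moreover have "Ck 0 (\<lambda>t. frechet_derivative \<psi> (at t) 1)" using \<psi>(1)[of "Suc 0"] by (metis Ck.simps(2))
  ultimately have [measurable]: "\<psi>' \<in> borel_measurable borel"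
    by (simp add: borel_measurable_continuous_onI)
  have "(LINT t|unit_time. \<psi>' t * (LINT z|lborel. \<rho> t z * \<zeta> z) + \<psi> t * (LINT z|lborel. \<rho> t z * G t z))
    = (LINT t|unit_time. (LINT z|lborel. \<rho> t z * parabolic_op A b u (t, z)))"
  proof (rule integral_cong_AE)
    show "AE t in unit_time. \<psi>' t * (LINT z|lborel. \<rho> t z * \<zeta> z) + \<psi> t * (LINT z|lborel. \<rho> t z * G t z)
      = (LINT z|lborel. \<rho> t z * parabolic_op A b u (t, z))"
      using AE_good
    proof eventually_elim
      case (elim t)
      have "(LINT z|lborel. \<rho> t z * parabolic_op A b u (t, z))
        = (LINT z|lborel. \<psi>' t * (\<rho> t z * \<zeta> z) + \<psi> t * (\<rho> t z * G t z))"
        unfolding op_eq by (simp add: algebra_simps)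
      also have "\<dots> = \<psi>' t * (LINT z|lborel. \<rho> t z * \<zeta> z) + \<psi> t * (LINT z|lborel. \<rho> t z * G t z)"
        using \<zeta>i op(2)[OF elim] elim by (subst Bochner_Integration.integral_add) (auto simp: good_def)
      finally show ?case by simp
    qed
    show "(\<lambda>t. LINT z|lborel. \<rho> t z * parabolic_op A b u (t, z)) \<in> borel_measurable unit_time"
      unfolding op_eq by measurable
  qed measurable
  then show "(LINT t|unit_time. \<psi>' t * (LINT z|lborel. \<rho> t z * \<zeta> z) + \<psi> t * (LINT z|lborel. \<rho> t z * G t z)) = 0"
    using eq0 by simp
qed

section \<open>The mollified density and its evolution equation\<close>

definition moll :: "real \<Rightarrow> real \<Rightarrow> real^'n \<Rightarrow> real" where
  "moll \<epsilon> t = conv (\<rho> t) (kern \<epsilon>)"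

text \<open>The spatial part of the operator applied to the kernel as a function of z at distance x
  - z: the reflection changes the sign of first derivatives and leaves second derivatives as they
  are. By \<open>mollified_ode\<close> this is the time derivative of \<open>moll\<close>.\<close>

definition rate :: "real \<Rightarrow> real \<Rightarrow> real^'n \<Rightarrow> real" where
  "rate \<epsilon> t x = (LINT z|lborel. \<rho> t z *
     ((\<Sum>i\<in>UNIV. \<Sum>j\<in>UNIV. A t z $ i $ j * kern2 \<epsilon> (axis j 1) (axis i 1) (x - z))
      + (\<Sum>i\<in>UNIV. b t z $ i * (- kern1 \<epsilon> (axis i 1) (x - z)))))"

lemma kern_derivs_bounded:
  assumes e: "\<epsilon> > 0"
  obtains Q where "0 \<le> Q" "\<And>y::real^'n. \<bar>kern \<epsilon> y\<bar> \<le> Q" "\<And>i y::real^'n. \<bar>kern1 \<epsilon> (axis i 1) y\<bar> \<le> Q"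
    "\<And>i j y::real^'n. \<bar>kern2 \<epsilon> (axis i 1) (axis j 1) y\<bar> \<le> Q"
proof -
  obtain B where B: "\<And>y::real^'n. kern \<epsilon> y \<le> B" using kern_bounded[OF e] by blast
  let ?d = "real DIM(real^'n)"
  define Q where "Q = B + ?d / \<epsilon> * B + (3 * ?d + ?d\<^sup>2) / \<epsilon>\<^sup>2 * B"
  have B0: "0 \<le> B" using kern_nonneg[OF e, of "0::real^'n"] B[of 0] by linarith
  have parts: "0 \<le> ?d / \<epsilon> * B" "0 \<le> (3 * ?d + ?d\<^sup>2) / \<epsilon>\<^sup>2 * B" using e B0 by auto
  show ?thesis
  proof (rule that[of Q])
    show "0 \<le> Q" using parts B0 unfolding Q_def by linarith
    show "\<bar>kern \<epsilon> y\<bar> \<le> Q" for y :: "real^'n"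
      using parts B[of y] kern_nonneg[OF e, of y] unfolding Q_def by linarith
    show "\<bar>kern1 \<epsilon> (axis i 1) y\<bar> \<le> Q" for i and y :: "real^'n"
    proof -
      have "?d / \<epsilon> * kern \<epsilon> y \<le> ?d / \<epsilon> * B" using B e by (intro mult_left_mono) auto
      then show ?thesis
        using parts B0 kern1_bound(1)[OF e, of "axis i 1" y] unfolding Q_def norm_axis_1 mult_1_right by linarith
    qed
    show "\<bar>kern2 \<epsilon> (axis i 1) (axis j 1) y\<bar> \<le> Q" for i j and y :: "real^'n"
    proof -
      have "(3 * ?d + ?d\<^sup>2) / \<epsilon>\<^sup>2 * kern \<epsilon> y \<le> (3 * ?d + ?d\<^sup>2) / \<epsilon>\<^sup>2 * B" using B e by (intro mult_left_mono) auto
      then show ?thesis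
        using parts B0 kern2_bound[OF e, of "axis i 1" "axis j 1" y] unfolding Q_def norm_axis_1 mult_1_right by linarith
    qed
  qed
qed

lemma integrable_rate: "\<epsilon> > 0 \<Longrightarrow> integrable unit_time (\<lambda>t. rate \<epsilon> t x)"
proof -
  assume e: "\<epsilon> > 0"
  obtain Q where Q: "0 \<le> Q" "\<And>y::real^'n. \<bar>kern \<epsilon> y\<bar> \<le> Q" "\<And>i y::real^'n. \<bar>kern1 \<epsilon> (axis i 1) y\<bar> \<le> Q"
    "\<And>i j y::real^'n. \<bar>kern2 \<epsilon> (axis i 1) (axis j 1) y\<bar> \<le> Q" using kern_derivs_bounded[OF e] by blast
  show ?thesis unfolding rate_def
    by (rule operator_integrable(4)[where Z=Q and ca="\<lambda>i z. - kern1 \<epsilon> (axis i 1) (x - z)" and cb="\<lambda>i j z. kern2 \<epsilon> (axis j 1) (axis i 1) (x - z)"])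
      (use Q in auto)
qed

text \<open>The kernel is multiplied by a space cutoff to become a test function, and then n tends
  to infinity: the terms with derivatives of the cutoff vanish and dominated convergence handles the
  rest. The exceptional null set of times depends on x.\<close>

lemma mollified_ode:
  assumes e: "\<epsilon> > 0"
  shows "AE t in unit_time. moll \<epsilon> t x = conv \<rho>0 (kern \<epsilon>) x + (LINT s|unit_time. indicator {..<t} s * rate \<epsilon> s x)"
proof -
  obtain Q where Q: "0 \<le> Q" "\<And>y::real^'n. \<bar>kern \<epsilon> y\<bar> \<le> Q" "\<And>i y::real^'n. \<bar>kern1 \<epsilon> (axis i 1) y\<bar> \<le> Q"
    "\<And>i j y::real^'n. \<bar>kern2 \<epsilon> (axis i 1) (axis j 1) y\<bar> \<le> Q" using kern_derivs_bounded[OF e] by blast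
  obtain D cut cut1 cut2 where cut: "0 \<le> D" "\<And>n k. Ck k (cut n)" "\<And>n (z::real^'n). real (Suc n) \<le> norm z \<Longrightarrow> cut n z = 0"
    "\<And>n z. \<bar>cut n z\<bar> \<le> 1" "\<And>n i z. \<bar>cut1 n i z\<bar> \<le> D / Suc n" "\<And>n i j z. \<bar>cut2 n i j z\<bar> \<le> D / Suc n"
    "\<And>z. (\<lambda>n. cut n z) \<longlonglongrightarrow> 1"
    and cut_meas [measurable]: "\<And>n. cut n \<in> borel_measurable borel" "\<And>n i. cut1 n i \<in> borel_measurable borel"
    "\<And>n i j. cut2 n i j \<in> borel_measurable borel"
    and cut_d: "\<And>n i z. ((\<lambda>s. cut n (z + s *\<^sub>R axis i 1)) has_real_derivative cut1 n i z) (at 0)"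
    "\<And>n i j z. ((\<lambda>s. cut1 n j (z + s *\<^sub>R axis i 1)) has_real_derivative cut2 n i j z) (at 0)"
    by (rule smooth_cutoffs) blast
  have cutD: "\<bar>cut1 n i z\<bar> \<le> D" "\<bar>cut2 n i j z\<bar> \<le> D" for n i j z
  proof -
    have "D / Suc n \<le> D" using cut(1) by (simp add: field_simps)
    then show "\<bar>cut1 n i z\<bar> \<le> D" "\<bar>cut2 n i j z\<bar> \<le> D" using cut(5,6) order_trans by blast+
  qed
  have lim0: "(\<lambda>n. D / real (Suc n)) \<longlonglongrightarrow> 0"
    using tendsto_mult[OF tendsto_const[of D] LIMSEQ_inverse_real_of_nat] by (simp add: divide_inverse)
  have cut_lim: "(\<lambda>n. cut1 n i z) \<longlonglongrightarrow> 0" "(\<lambda>n. cut2 n i j z) \<longlonglongrightarrow> 0" for i j z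
    using cut(5,6) by (auto intro!: Lim_null_comparison[OF _ lim0] always_eventually)
  define \<xi> where "\<xi> z = kern \<epsilon> (x - z)" for z
  define \<xi>1 where "\<xi>1 i z = - kern1 \<epsilon> (axis i 1) (x - z)" for i z
  define \<xi>2 where "\<xi>2 i j z = kern2 \<epsilon> (axis j 1) (axis i 1) (x - z)" for i j z
  have [measurable]: "\<xi> \<in> borel_measurable borel" "\<xi>1 i \<in> borel_measurable borel" "\<xi>2 i j \<in> borel_measurable borel" for i j
    unfolding \<xi>_def[abs_def] \<xi>1_def[abs_def] \<xi>2_def[abs_def] by measurable
  have \<xi>Q: "\<bar>\<xi> z\<bar> \<le> Q" "\<bar>\<xi>1 i z\<bar> \<le> Q" "\<bar>\<xi>2 i j z\<bar> \<le> Q" for i j z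
    using Q by (auto simp: \<xi>_def \<xi>1_def \<xi>2_def)
  have \<xi>_d1: "((\<lambda>s. \<xi> (z + s *\<^sub>R axis i 1)) has_real_derivative \<xi>1 i z) (at 0)" for i z
    using kern_line_derivative[OF e, of "x - z" "- axis i 1" 0]
    by (simp add: \<xi>_def \<xi>1_def kern1_minus algebra_simps)
  have \<xi>_d2: "((\<lambda>s. \<xi>1 j (z + s *\<^sub>R axis i 1)) has_real_derivative \<xi>2 i j z) (at 0)" for i j z
    using DERIV_minus[OF kern1_line_derivative[OF e, of "axis j 1" "x - z" "- axis i 1" 0]]
    by (simp add: \<xi>2_def \<xi>1_def kern2_minus algebra_simps)
  have \<xi>S: "Ck k \<xi>" for k
    using Ck_compose_linear[OF bounded_linear_minus[OF bounded_linear_ident] Ck_kern[OF e], of k x]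
    by (simp add: \<xi>_def[abs_def])
  define \<zeta> where "\<zeta> n z = cut n z * \<xi> z" for n z
  define \<zeta>1 where "\<zeta>1 n i z = cut1 n i z * \<xi> z + cut n z * \<xi>1 i z" for n i z
  define \<zeta>2 where "\<zeta>2 n i j z = (cut2 n i j z * \<xi> z + cut1 n j z * \<xi>1 i z) + (cut1 n i z * \<xi>1 j z + cut n z * \<xi>2 i j z)" for n i j z
  have [measurable]: "\<zeta> n \<in> borel_measurable borel" and m1: "\<zeta>1 n i \<in> borel_measurable borel"
    and m2: "\<zeta>2 n i j \<in> borel_measurable borel" for n i j
    unfolding \<zeta>_def[abs_def] \<zeta>1_def[abs_def] \<zeta>2_def[abs_def] by measurable
  note [measurable] = m1 m2
  \<comment> \<open>Of the four products in \<open>\<zeta>2\<close>, three contain a derivative of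
    the cutoff, bounded by D, and one the cutoff itself, bounded by 1; every kernel factor is at
    most Q.\<close>
  define Z where "Z = (3 * D + 1) * Q"
  have p: "\<bar>c * w\<bar> \<le> C * Q" if "\<bar>c\<bar> \<le> C" "\<bar>w\<bar> \<le> Q" for c w C
    unfolding abs_mult using that by (intro mult_mono) auto
  have DQ: "0 \<le> D * Q" using cut(1) Q(1) by simp
  have ZZ: "Z = D * Q + D * Q + D * Q + Q" by (simp add: Z_def algebra_simps)
  have Zb: "\<bar>\<zeta> n z\<bar> \<le> Z" "\<bar>\<zeta>1 n i z\<bar> \<le> Z" "\<bar>\<zeta>2 n i j z\<bar> \<le> Z" for n i j z
    using p[OF cut(4)[of n z] \<xi>Q(1)[of z]] p[OF cut(4)[of n z] \<xi>Q(2)[of i z]] p[OF cutD(1)[of n i z] \<xi>Q(1)[of z]]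
      p[OF cutD(2)[of n i j z] \<xi>Q(1)[of z]] p[OF cutD(1)[of n j z] \<xi>Q(2)[of i z]]
      p[OF cutD(1)[of n i z] \<xi>Q(2)[of j z]] p[OF cut(4)[of n z] \<xi>Q(3)[of i j z]] DQ Q(1)
    unfolding \<zeta>_def \<zeta>1_def \<zeta>2_def ZZ by linarith+
  define G where "G n t z = (\<Sum>i\<in>UNIV. \<Sum>j\<in>UNIV. A t z $ i $ j * \<zeta>2 n i j z) + (\<Sum>i\<in>UNIV. b t z $ i * \<zeta>1 n i z)" for n t z
  define G' where "G' t z = (\<Sum>i\<in>UNIV. \<Sum>j\<in>UNIV. A t z $ i $ j * \<xi>2 i j z) + (\<Sum>i\<in>UNIV. b t z $ i * \<xi>1 i z)" for t z
  have [measurable]: "case_prod (G n) \<in> borel_measurable (borel \<Otimes>\<^sub>M borel)" "case_prod G' \<in> borel_measurable (borel \<Otimes>\<^sub>M borel)" for n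
    unfolding G_def[abs_def] G'_def[abs_def] by measurable
  have "AE t in unit_time. (LINT z|lborel. \<rho> t z * \<zeta> n z) = (LINT z|lborel. \<rho>0 z * \<zeta> n z)
    + (LINT s|unit_time. indicator {..<t} s * (LINT z|lborel. \<rho> s z * G n s z))" for n
  proof (rule tested_ode[where R="real (Suc n)" and Z=Z and \<zeta>d="\<zeta>1 n" and \<zeta>dd="\<zeta>2 n"])
    show "Ck k (\<zeta> n)" for k unfolding \<zeta>_def[abs_def] by (intro Ck_mult cut \<xi>S)
    show "\<zeta> n z = 0" if "real (Suc n) \<le> norm z" for z using cut(3)[OF that] by (simp add: \<zeta>_def)
    show "((\<lambda>s. \<zeta> n (z + s *\<^sub>R axis i 1)) has_real_derivative \<zeta>1 n i z) (at 0)" for i z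
      using DERIV_mult[OF cut_d(1) \<xi>_d1, of n z i z i] by (simp add: \<zeta>_def \<zeta>1_def mult.commute)
    show "((\<lambda>s. \<zeta>1 n j (z + s *\<^sub>R axis i 1)) has_real_derivative \<zeta>2 n i j z) (at 0)" for i j z
      using DERIV_add[OF DERIV_mult[OF cut_d(2)[of n j z i] \<xi>_d1[of z i]] DERIV_mult[OF cut_d(1)[of n z i] \<xi>_d2[of j z i]]]
      by (simp add: \<zeta>1_def \<zeta>2_def mult.commute)
  qed (use Zb in \<open>auto simp: G_def\<close>)
  then have "AE t in unit_time. \<forall>n. (LINT z|lborel. \<rho> t z * \<zeta> n z) = (LINT z|lborel. \<rho>0 z * \<zeta> n z)
    + (LINT s|unit_time. indicator {..<t} s * (LINT z|lborel. \<rho> s z * G n s z))"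
    by (simp add: AE_all_countable)
  then show ?thesis
    using AE_unit_time
  proof eventually_elim
    case (elim t)
    have \<zeta>_lim: "(\<lambda>n. \<zeta> n z) \<longlonglongrightarrow> \<xi> z" for z
      using tendsto_mult[OF cut(7) tendsto_const, of z "\<xi> z"] by (simp add: \<zeta>_def)
    have lim\<rho>: "(\<lambda>n. LINT z|lborel. r z * \<zeta> n z) \<longlonglongrightarrow> (LINT z|lborel. r z * \<xi> z)"
      if r: "integrable lborel r" for r :: "real^'n \<Rightarrow> real"
    proof (rule integral_dominated_convergence[where w="\<lambda>z. Z * \<bar>r z\<bar>"])
      have [measurable]: "r \<in> borel_measurable borel" using borel_measurable_integrable[OF r] by simp
      show "(\<lambda>z. r z * \<xi> z) \<in> borel_measurable lborel" "(\<lambda>z. r z * \<zeta> n z) \<in> borel_measurable lborel" for n by measurable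
      show "AE z in lborel. (\<lambda>n. r z * \<zeta> n z) \<longlonglongrightarrow> r z * \<xi> z" by (intro AE_I2 tendsto_intros \<zeta>_lim)
      show "AE z in lborel. norm (r z * \<zeta> n z) \<le> Z * \<bar>r z\<bar>" for n
        using Zb(1) by (intro AE_I2) (simp add: abs_mult mult.commute[of Z] mult_left_mono)
    qed (use r in auto)
    have limG: "(\<lambda>n. LINT z|lborel. \<rho> s z * G n s z) \<longlonglongrightarrow> (LINT z|lborel. \<rho> s z * G' s z)" if g: "good s" for s
    proof (rule integral_dominated_convergence)
      show "integrable lborel (\<lambda>z. (Z * (real CARD('n))\<^sup>2 * M) * \<rho> s z + (Z * real CARD('n)) * (norm (b s z) * \<rho> s z))"
        using integrable_rho integrable_b_rho g by (auto simp: good_def)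
      show "AE z in lborel. norm (\<rho> s z * G n s z) \<le> (Z * (real CARD('n))\<^sup>2 * M) * \<rho> s z + (Z * real CARD('n)) * (norm (b s z) * \<rho> s z)" for n
        using operator_integrable(1)[OF m1 m2 Zb(2,3) G_def] by (intro AE_I2) simp
      have "(\<lambda>n. \<zeta>1 n i z) \<longlonglongrightarrow> 0 * \<xi> z + 1 * \<xi>1 i z" for i z
        unfolding \<zeta>1_def by (intro tendsto_intros cut_lim cut)
      moreover have "(\<lambda>n. \<zeta>2 n i j z) \<longlonglongrightarrow> (0 * \<xi> z + 0 * \<xi>1 i z) + (0 * \<xi>1 j z + 1 * \<xi>2 i j z)" for i j z
        unfolding \<zeta>2_def by (intro tendsto_intros cut_lim cut)
      ultimately have l: "(\<lambda>n. \<zeta>1 n i z) \<longlonglongrightarrow> \<xi>1 i z" "(\<lambda>n. \<zeta>2 n i j z) \<longlonglongrightarrow> \<xi>2 i j z" for i j z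
        by simp_all
      show "AE z in lborel. (\<lambda>n. \<rho> s z * G n s z) \<longlonglongrightarrow> \<rho> s z * G' s z"
        unfolding G_def G'_def by (intro AE_I2 tendsto_intros l)
    qed measurable
    have limN: "(\<lambda>n. LINT s|unit_time. indicator {..<t} s * (LINT z|lborel. \<rho> s z * G n s z))
      \<longlonglongrightarrow> (LINT s|unit_time. indicator {..<t} s * (LINT z|lborel. \<rho> s z * G' s z))"
    proof (rule integral_dominated_convergence)
      show "integrable unit_time (\<lambda>t. Z * (real CARD('n))\<^sup>2 * M + Z * real CARD('n) * b_mass t)"
        using integrable_b_mass by (simp add: b_mass_def)
      show "AE s in unit_time. (\<lambda>n. indicator {..<t} s * (LINT z|lborel. \<rho> s z * G n s z))
         \<longlonglongrightarrow> indicator {..<t} s * (LINT z|lborel. \<rho> s z * G' s z)"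
        using AE_good by eventually_elim (intro tendsto_intros limG)
      show "AE s in unit_time. norm (indicator {..<t} s * (LINT z|lborel. \<rho> s z * G n s z))
         \<le> Z * (real CARD('n))\<^sup>2 * M + Z * real CARD('n) * b_mass s" for n
        using operator_integrable(3)[OF m1 m2 Zb(2,3) G_def]
        by eventually_elim (auto simp: indicator_def)
    qed measurable
    have "(LINT z|lborel. \<rho> t z * \<xi> z) = (LINT z|lborel. \<rho>0 z * \<xi> z)
      + (LINT s|unit_time. indicator {..<t} s * (LINT z|lborel. \<rho> s z * G' s z))"
      by (rule LIMSEQ_unique[OF lim\<rho>[OF integrable_rho[OF elim(2)]]])
        (use tendsto_add[OF lim\<rho>[OF integrable_rho0] limN] elim(1) in simp)
    then show ?case
      by (simp add: moll_def conv_def rate_def \<xi>_def \<xi>1_def \<xi>2_def G'_def)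
  qed
qed

end

section \<open>Energy estimates for the mollified density\<close>

lemma integrable_dominated:
  fixes f g :: "'a \<Rightarrow> real"
  assumes "integrable M g" "f \<in> borel_measurable M" "\<And>x. \<bar>f x\<bar> \<le> g x"
  shows "integrable M f"
  by (rule Bochner_Integration.integrable_bound[OF assms(1,2)])
    (use assms(3) in \<open>auto intro!: order_trans[OF _ abs_ge_self]\<close>)

text \<open>Carries a pointwise bound of a kernel derivative by a multiple of the kernel over to the
  convolutions. The bound Q on k provides integrability only and does not enter the
  conclusion.\<close>

lemma abs_conv_le:
  assumes W: "integrable lborel W" and w [measurable]: "w \<in> borel_measurable borel" "\<And>z. \<bar>w z\<bar> \<le> W z"
    and h [measurable]: "h \<in> borel_measurable borel" "k \<in> borel_measurable borel"
    and hk: "\<And>y. \<bar>h y\<bar> \<le> C * k y" "\<And>y. 0 \<le> k y" "\<And>y. k y \<le> Q" "0 \<le> C"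
  shows "\<bar>conv w h x\<bar> \<le> C * conv W k x"
proof -
  have iw: "integrable lborel w"
    by (rule Bochner_Integration.integrable_bound[OF W]) (use w order_trans[OF w(2) abs_ge_self] in auto)
  have hb: "\<bar>h y\<bar> \<le> C * Q" for y
    using hk(1)[of y] mult_left_mono[OF hk(3)[of y] hk(4)] by linarith
  have kb: "\<bar>k y\<bar> \<le> Q" for y using hk(2,3)[of y] by simp
  have i2: "integrable lborel (\<lambda>z. C * (W z * k (x - z)))"
    using integrable_conv[OF W h(2) kb] by simp
  have "\<bar>conv w h x\<bar> \<le> (LINT z|lborel. C * (W z * k (x - z)))"
    unfolding conv_def
  proof (rule integral_abs_bound_integral[OF integrable_conv[OF iw h(1) hb] i2])
    fix z
    have "\<bar>w z\<bar> * \<bar>h (x - z)\<bar> \<le> W z * (C * k (x - z))"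
      using w(2)[of z] hk(1)[of "x - z"] abs_ge_zero[of "w z"] by (intro mult_mono) auto
    then show "\<bar>w z * h (x - z)\<bar> \<le> C * (W z * k (x - z))" by (simp add: abs_mult mult_ac)
  qed
  then show ?thesis by (simp add: conv_def)
qed

lemma powr_line_derivative:
  fixes u :: "'a::real_vector \<Rightarrow> real"
  assumes "((\<lambda>s. u (x + s *\<^sub>R v)) has_real_derivative du (x + s *\<^sub>R v)) (at s)" "0 < u (x + s *\<^sub>R v)"
  shows "((\<lambda>s. u (x + s *\<^sub>R v) powr r) has_real_derivative r * u (x + s *\<^sub>R v) powr (r - 1) * du (x + s *\<^sub>R v)) (at s)"
  using assms by (intro DERIV_chain2[where f="\<lambda>y. y powr r"] has_real_derivative_powr) auto

context fokker_planck
begin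

lemma N_nonneg [simp]: "0 \<le> N"
  unfolding N_def by simp

lemma card_N [simp]: "real CARD('n) = N"
  by (rule N_def[symmetric])

section \<open>Gradient and flux of the mollified density\<close>

definition dmoll :: "real \<Rightarrow> real \<Rightarrow> real^'n \<Rightarrow> real^'n \<Rightarrow> real" where
  "dmoll \<epsilon> t v = conv (\<rho> t) (kern1 \<epsilon> v)"

definition grad :: "real \<Rightarrow> real \<Rightarrow> real^'n \<Rightarrow> real^'n" where
  "grad \<epsilon> t x = (\<chi> i. dmoll \<epsilon> t (axis i 1) x)"

text \<open>The vector field A \<nabla> u + R of the overview: of the two derivatives that fall on
  the kernel in \<open>rate\<close>, one is left outside as a divergence. \<open>dflux\<close> is
  the partial derivative of the i-th component in direction i, so these sum to
  \<open>rate\<close>.\<close>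

definition flux :: "real \<Rightarrow> real \<Rightarrow> 'n \<Rightarrow> real^'n \<Rightarrow> real" where
  "flux \<epsilon> t i x = (\<Sum>j\<in>UNIV. conv (\<lambda>z. A t z $ i $ j * \<rho> t z) (kern1 \<epsilon> (axis j 1)) x)
     - conv (\<lambda>z. b t z $ i * \<rho> t z) (kern \<epsilon>) x"

definition dflux :: "real \<Rightarrow> real \<Rightarrow> 'n \<Rightarrow> real^'n \<Rightarrow> real" where
  "dflux \<epsilon> t i x = (\<Sum>j\<in>UNIV. conv (\<lambda>z. A t z $ i $ j * \<rho> t z) (kern2 \<epsilon> (axis j 1) (axis i 1)) x)
     - conv (\<lambda>z. b t z $ i * \<rho> t z) (kern1 \<epsilon> (axis i 1)) x"

definition bmoll :: "real \<Rightarrow> real \<Rightarrow> real^'n \<Rightarrow> real" where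
  "bmoll \<epsilon> t = conv (\<lambda>z. norm (b t z) * \<rho> t z) (kern \<epsilon>)"

definition bpow :: "real \<Rightarrow> real \<Rightarrow> real^'n \<Rightarrow> real" where
  "bpow \<epsilon> t = conv (\<lambda>z. norm (b t z) powr \<beta> * \<rho> t z) (kern \<epsilon>)"

lemma borel_slices [measurable]:
  "(\<lambda>z. A t z $ i $ j) \<in> borel_measurable borel" "b t \<in> borel_measurable borel"
  by measurable

lemma flux_measurable [measurable]:
  "case_prod (moll \<epsilon>) \<in> borel_measurable (borel \<Otimes>\<^sub>M borel)"
  "case_prod (bpow \<epsilon>) \<in> borel_measurable (borel \<Otimes>\<^sub>M borel)"
  "case_prod (bmoll \<epsilon>) \<in> borel_measurable (borel \<Otimes>\<^sub>M borel)"
  "case_prod (rate \<epsilon>) \<in> borel_measurable (borel \<Otimes>\<^sub>M borel)"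
  "case_prod (grad \<epsilon>) \<in> borel_measurable (borel \<Otimes>\<^sub>M borel)"
  "moll \<epsilon> t \<in> borel_measurable borel" "bpow \<epsilon> t \<in> borel_measurable borel" "bmoll \<epsilon> t \<in> borel_measurable borel"
  "dmoll \<epsilon> t v \<in> borel_measurable borel" "flux \<epsilon> t i \<in> borel_measurable borel" "dflux \<epsilon> t i \<in> borel_measurable borel"
  "rate \<epsilon> t \<in> borel_measurable borel" "grad \<epsilon> t \<in> borel_measurable borel"
proof -
  show m: "case_prod (grad \<epsilon>) \<in> borel_measurable (borel \<Otimes>\<^sub>M borel)"
    unfolding grad_def[abs_def] dmoll_def conv_def
    by (subst borel_measurable_euclidean_space) (auto simp: Basis_vec_def inner_axis case_prod_beta)
  show "grad \<epsilon> t \<in> borel_measurable borel" using m by measurable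
qed (unfold moll_def[abs_def] bpow_def[abs_def] bmoll_def[abs_def] rate_def[abs_def] dmoll_def[abs_def]
    flux_def[abs_def] dflux_def[abs_def] conv_def[abs_def], measurable)

lemma moll_nonneg: "\<epsilon> > 0 \<Longrightarrow> 0 \<le> moll \<epsilon> t x"
  unfolding moll_def conv_def by (intro Bochner_Integration.integral_nonneg) (simp add: rho_nonneg kern_nonneg)

lemma bpow_nonneg: "\<epsilon> > 0 \<Longrightarrow> 0 \<le> bpow \<epsilon> t x"
  unfolding bpow_def conv_def by (intro Bochner_Integration.integral_nonneg) (simp add: rho_nonneg kern_nonneg)

end

text \<open>Everything here happens at one good time and concerns functions of x alone. Q bounds the
  kernel and therefore u; Q and the constants \<open>c1\<close>, \<open>c2\<close> blow up as
  \<epsilon> tends to 0 and provide integrability, while \<open>rem_le\<close> and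
  \<open>energy_slice\<close> carry constants free of \<epsilon>.\<close>

locale mollified_slice = fokker_planck A b \<rho> \<rho>0 \<alpha> \<kappa> \<beta> M B U N
  for A :: "real \<Rightarrow> real^'n \<Rightarrow> real^'n^'n" and b \<rho> \<rho>0 \<alpha> \<kappa> \<beta> M B U N +
  fixes \<epsilon> t Q :: real
  assumes e: "\<epsilon> > 0" and good_t: "good t" and Q: "\<And>y::real^'n. kern \<epsilon> y \<le> Q"
begin

abbreviation "u \<equiv> moll \<epsilon> t"
abbreviation "e i \<equiv> axis i (1::real) :: real^'n"

lemmas k_nonneg = kern_nonneg[OF e, where 'a="real^'n"]
lemmas k_pos = kern_pos[OF e, where 'a="real^'n"]
lemmas k_line = kern_line_derivative[OF e, where 'a="real^'n"]
lemmas k1_line = kern1_line_derivative[OF e, where 'a="real^'n"]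

lemma t01: "t \<in> {0<..<1}" using good_t by (simp add: good_def)

lemma kern_abs: "\<bar>kern \<epsilon> (y::real^'n)\<bar> \<le> Q"
  using kern_nonneg[OF e, of y] Q[of y] by simp

lemmas i_rho = integrable_rho[OF t01]
lemmas i_b = integrable_b_rho[OF good_t]
lemmas i_bi = integrable_b_component[OF good_t]
lemmas i_A = integrable_A_component[OF t01]

lemma i_bpow: "integrable lborel (\<lambda>z. norm (b t z) powr \<beta> * \<rho> t z)"
  using good_t by (simp add: good_def)

definition c1 :: real where "c1 = N / \<epsilon>"
definition c2 :: real where "c2 = (3 * N + N\<^sup>2) / \<epsilon>\<^sup>2"

lemma c_nonneg: "0 \<le> c1" "0 \<le> c2" using e by (auto simp: c1_def c2_def)

lemma k1_le: "\<bar>kern1 \<epsilon> (e i) y\<bar> \<le> c1 * kern \<epsilon> y"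
  using kern1_bound(1)[OF e, of "e i" y] by (simp add: c1_def)

lemma k2_le: "\<bar>kern2 \<epsilon> (e j) (e i) y\<bar> \<le> c2 * kern \<epsilon> y"
  using kern2_bound[OF e, of "e j" "e i" y] by (simp add: c2_def)

lemma k_bound: 
  "\<bar>kern1 \<epsilon> (e i) y\<bar> \<le> c1 * Q" "\<bar>kern2 \<epsilon> (e j) (e i) y\<bar> \<le> c2 * Q"
  using k1_le[of i y] mult_left_mono[OF Q[of y] c_nonneg(1)] k2_le[of j i y] mult_left_mono[OF Q[of y] c_nonneg(2)]
  by linarith+

lemma k1_bound_general: fixes v y :: "real^'n" shows "\<bar>kern1 \<epsilon> v y\<bar> \<le> c1 * norm v * Q"
  using kern1_bound(1)[OF e, of v y] mult_left_mono[OF Q[of y], of "c1 * norm v"] e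
  by (simp add: c1_def)

lemma u_line: "((\<lambda>s. u (x + s *\<^sub>R v)) has_real_derivative dmoll \<epsilon> t v (x + s *\<^sub>R v)) (at s)"
  unfolding moll_def dmoll_def
  by (rule conv_line_derivative[OF i_rho, where B="max Q (c1 * norm v * Q)"])
    (use kern_abs k1_bound_general k_line in \<open>auto intro: le_max_iff_disj[THEN iffD2]\<close>)

lemma continuous_dmoll: "continuous_on UNIV (dmoll \<epsilon> t v)"
  unfolding dmoll_def by (rule continuous_on_conv[OF i_rho continuous_on_kern(2)[OF e] k1_bound_general])

lemma continuous_u: "continuous_on UNIV u"
  unfolding moll_def by (rule continuous_on_conv[OF i_rho continuous_on_kern(1)[OF e] kern_abs])

text \<open>The kernel is positive everywhere and \<rho> has mass 1, so u vanishes nowhere. This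
  permits derivatives and continuity of arbitrary real powers of u.\<close>

lemma u_pos: "0 < u x"
proof -
  have i: "integrable lborel (\<lambda>z. \<rho> t z * kern \<epsilon> (x - z))"
    by (rule integrable_conv[OF i_rho _ kern_abs]) simp
  have "u x \<noteq> 0"
  proof
    assume "u x = 0"
    then have "(LINT z|lborel. \<rho> t z * kern \<epsilon> (x - z)) = 0" by (simp add: moll_def conv_def)
    then have "AE z in lborel. \<rho> t z * kern \<epsilon> (x - z) = 0"
      by (rule integral_nonneg_eq_0_iff_AE[THEN iffD1, rotated 2])
        (use i rho_nonneg k_nonneg in auto)
    then have "AE z in lborel. \<rho> t z = 0"
      by eventually_elim (use k_pos in \<open>metis mult_eq_0_iff less_irrefl\<close>)
    then have "(LINT z|lborel. \<rho> t z) = 0" by (rule integral_eq_zero_AE)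
    then show False using integral_rho[OF t01] by simp
  qed
  then show ?thesis using moll_nonneg[OF e, of t x] by simp
qed

lemma u_le: "u x \<le> Q"
proof -
  have "u x \<le> (LINT z|lborel. \<rho> t z * Q)"
    unfolding moll_def conv_def
    by (rule integral_mono[OF integrable_conv[OF i_rho _ kern_abs]])
      (use i_rho Q rho_nonneg in \<open>auto intro: mult_left_mono\<close>)
  then show ?thesis by (simp add: integral_rho[OF t01])
qed

lemma integrable_u: "integrable lborel u" and integral_u: "(LINT x|lborel. u x) = 1"
  unfolding moll_def using conv_L1[OF i_rho integrable_kern[OF e]] integral_rho[OF t01] integral_kern[OF e, where 'a="real^'n"]
  by simp_all

lemma integrable_bmoll: "integrable lborel (bmoll \<epsilon> t)"
  unfolding bmoll_def by (rule conv_L1(1)[OF i_b integrable_kern[OF e]])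

lemma integrable_bpow: "integrable lborel (bpow \<epsilon> t)"
  and integral_bpow: "(LINT x|lborel. bpow \<epsilon> t x) = (LINT z|lborel. norm (b t z) powr \<beta> * \<rho> t z)"
  unfolding bpow_def using conv_L1[OF i_bpow integrable_kern[OF e]] integral_kern[OF e, where 'a="real^'n"]
  by simp_all

lemma u_powr_split: "u x powr (1 + s) = u x powr s * u x"
  using u_pos[of x] by (simp add: powr_add)

lemma integrable_u_powr: "0 \<le> s \<Longrightarrow> integrable lborel (\<lambda>x. u x powr (1 + s))"
  and integral_u_powr_le: "0 \<le> s \<Longrightarrow> (LINT x|lborel. u x powr (1 + s)) \<le> Q powr s"
proof -
  assume s: "0 \<le> s"
  have le: "u x powr (1 + s) \<le> Q powr s * u x" for x
    unfolding u_powr_split using u_pos[of x] u_le[of x] s by (intro mult_right_mono powr_mono2) auto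
  show i: "integrable lborel (\<lambda>x. u x powr (1 + s))"
    by (rule Bochner_Integration.integrable_bound[of _ "\<lambda>x. Q powr s * u x"])
      (use le integrable_u in \<open>auto intro!: order_trans[OF _ abs_ge_self]\<close>)
  have "(LINT x|lborel. u x powr (1 + s)) \<le> (LINT x|lborel. Q powr s * u x)"
    by (rule integral_mono[OF i]) (use le integrable_u in auto)
  then show "(LINT x|lborel. u x powr (1 + s)) \<le> Q powr s" by (simp add: integral_u)
qed

lemma dmoll_le: "\<bar>dmoll \<epsilon> t v x\<bar> \<le> c1 * norm v * u x"
  unfolding dmoll_def moll_def
  by (rule abs_conv_le[OF i_rho _ _ _ _ _ _ Q])
    (use rho_nonneg k_nonneg kern1_bound(1)[OF e, of v] e in \<open>auto simp: c1_def\<close>)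

text \<open>\<open>kern1\<close> is linear in its direction, which yields a gradient vector
  representing all directional derivatives at once.\<close>

lemma dmoll_grad: "dmoll \<epsilon> t v x = grad \<epsilon> t x \<bullet> v"
proof -
  have lin: "kern1 \<epsilon> v y = (\<Sum>i\<in>UNIV. v $ i * kern1 \<epsilon> (e i) y)" for y
  proof -
    have "y \<bullet> v = (\<Sum>i\<in>UNIV. v $ i * (y \<bullet> e i))" by (simp only: inner_axis_1) (simp add: inner_vec_def mult.commute)
    then show ?thesis
      unfolding kern1_def by (simp add: sum_distrib_left sum_distrib_right sum_divide_distrib mult_ac)
  qed
  have i: "integrable lborel (\<lambda>z. \<rho> t z * kern1 \<epsilon> (e i) (x - z))" for i
    by (rule integrable_conv[OF i_rho _ k_bound(1)]) simp
  have "dmoll \<epsilon> t v x = (LINT z|lborel. (\<Sum>i\<in>UNIV. v $ i * (\<rho> t z * kern1 \<epsilon> (e i) (x - z))))"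
    unfolding dmoll_def conv_def by (simp add: lin sum_distrib_left mult_ac)
  also have "\<dots> = (\<Sum>i\<in>UNIV. v $ i * dmoll \<epsilon> t (e i) x)"
    using i by (subst Bochner_Integration.integral_sum) (auto simp: dmoll_def conv_def)
  also have "\<dots> = grad \<epsilon> t x \<bullet> v" by (simp add: grad_def inner_vec_def mult.commute)
  finally show ?thesis .
qed

lemma norm_grad_le: "norm (grad \<epsilon> t x) \<le> N * c1 * u x"
proof -
  have "norm (grad \<epsilon> t x) \<le> (\<Sum>i\<in>UNIV. \<bar>grad \<epsilon> t x $ i\<bar>)" by (rule norm_le_l1_cart)
  also have "\<dots> \<le> (\<Sum>i::'n\<in>UNIV. c1 * u x)"
    by (intro sum_mono) (use dmoll_le[of "e _" x] in \<open>auto simp: grad_def\<close>)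
  finally show ?thesis by (simp add: mult_ac)
qed

lemma A_conv_le: "\<bar>conv (\<lambda>z. A t z $ i $ j * \<rho> t z) (kern1 \<epsilon> (e l)) x\<bar> \<le> c1 * (M * u x)"
  "\<bar>conv (\<lambda>z. A t z $ i $ j * \<rho> t z) (kern2 \<epsilon> (e l) (e m)) x\<bar> \<le> c2 * (M * u x)"
proof -
  have eq: "conv (\<lambda>z. M * \<rho> t z) (kern \<epsilon>) x = M * u x"
    by (simp add: conv_def moll_def mult.assoc)
  have Ab: "\<bar>A t z $ i $ j * \<rho> t z\<bar> \<le> M * \<rho> t z" for z
    using mult_right_mono[OF A_bound rho_nonneg] rho_nonneg by (simp add: abs_mult)
  show "\<bar>conv (\<lambda>z. A t z $ i $ j * \<rho> t z) (kern1 \<epsilon> (e l)) x\<bar> \<le> c1 * (M * u x)"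
    unfolding eq[symmetric]
    by (rule abs_conv_le[OF _ _ Ab _ _ k1_le _ Q]) (use i_rho k_nonneg c_nonneg in auto)
  show "\<bar>conv (\<lambda>z. A t z $ i $ j * \<rho> t z) (kern2 \<epsilon> (e l) (e m)) x\<bar> \<le> c2 * (M * u x)"
    unfolding eq[symmetric]
    by (rule abs_conv_le[OF _ _ Ab _ _ k2_le _ Q]) (use i_rho k_nonneg c_nonneg in auto)
qed

lemma b_conv_le: "\<bar>conv (\<lambda>z. b t z $ i * \<rho> t z) (kern \<epsilon>) x\<bar> \<le> bmoll \<epsilon> t x"
  "\<bar>conv (\<lambda>z. b t z $ i * \<rho> t z) (kern1 \<epsilon> (e l)) x\<bar> \<le> c1 * bmoll \<epsilon> t x"
proof -
  have bb: "\<bar>b t z $ i * \<rho> t z\<bar> \<le> norm (b t z) * \<rho> t z" for z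
    using mult_right_mono[OF component_le_norm_cart rho_nonneg] rho_nonneg by (simp add: abs_mult)
  have "\<bar>conv (\<lambda>z. b t z $ i * \<rho> t z) (kern \<epsilon>) x\<bar> \<le> 1 * bmoll \<epsilon> t x"
    unfolding bmoll_def
    by (rule abs_conv_le[OF i_b _ bb _ _ _ _ Q]) (use k_nonneg in auto)
  then show "\<bar>conv (\<lambda>z. b t z $ i * \<rho> t z) (kern \<epsilon>) x\<bar> \<le> bmoll \<epsilon> t x" by simp
  show "\<bar>conv (\<lambda>z. b t z $ i * \<rho> t z) (kern1 \<epsilon> (e l)) x\<bar> \<le> c1 * bmoll \<epsilon> t x"
    unfolding bmoll_def
    by (rule abs_conv_le[OF i_b _ bb _ _ k1_le _ Q]) (use k_nonneg c_nonneg in auto)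
qed

lemma flux_le: "\<bar>flux \<epsilon> t i x\<bar> \<le> N * c1 * M * u x + bmoll \<epsilon> t x"
proof -
  have "\<bar>\<Sum>j\<in>UNIV. conv (\<lambda>z. A t z $ i $ j * \<rho> t z) (kern1 \<epsilon> (e j)) x\<bar> \<le> (\<Sum>j::'n\<in>UNIV. c1 * (M * u x))"
    by (rule order_trans[OF sum_abs]) (intro sum_mono A_conv_le)
  then show ?thesis using b_conv_le(1)[of i x] unfolding flux_def by (simp add: mult_ac)
qed

lemma dflux_le: "\<bar>dflux \<epsilon> t i x\<bar> \<le> N * c2 * M * u x + c1 * bmoll \<epsilon> t x"
proof -
  have "\<bar>\<Sum>j\<in>UNIV. conv (\<lambda>z. A t z $ i $ j * \<rho> t z) (kern2 \<epsilon> (e j) (e i)) x\<bar> \<le> (\<Sum>j::'n\<in>UNIV. c2 * (M * u x))"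
    by (rule order_trans[OF sum_abs]) (intro sum_mono A_conv_le)
  then show ?thesis using b_conv_le(2)[of i i x] unfolding dflux_def by (simp add: mult_ac)
qed

lemma flux_line: "((\<lambda>s. flux \<epsilon> t i (x + s *\<^sub>R e i)) has_real_derivative dflux \<epsilon> t i (x + s *\<^sub>R e i)) (at s)"
  unfolding flux_def dflux_def
proof (intro DERIV_diff DERIV_sum)
  fix j
  show "((\<lambda>s. conv (\<lambda>z. A t z $ i $ j * \<rho> t z) (kern1 \<epsilon> (e j)) (x + s *\<^sub>R e i)) has_real_derivative
      conv (\<lambda>z. A t z $ i $ j * \<rho> t z) (kern2 \<epsilon> (e j) (e i)) (x + s *\<^sub>R e i)) (at s)"
    by (rule conv_line_derivative[OF i_A, where B="max (c1 * Q) (c2 * Q)"])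
      (use k_bound k1_line in \<open>auto intro: le_max_iff_disj[THEN iffD2]\<close>)
next
  show "((\<lambda>s. conv (\<lambda>z. b t z $ i * \<rho> t z) (kern \<epsilon>) (x + s *\<^sub>R e i)) has_real_derivative
      conv (\<lambda>z. b t z $ i * \<rho> t z) (kern1 \<epsilon> (e i)) (x + s *\<^sub>R e i)) (at s)"
    by (rule conv_line_derivative[OF i_bi, where B="max Q (c1 * Q)"])
      (use kern_abs k_bound k_line in \<open>auto intro: le_max_iff_disj[THEN iffD2]\<close>)
qed

lemma continuous_flux: "continuous_on UNIV (flux \<epsilon> t i)" "continuous_on UNIV (dflux \<epsilon> t i)"
  unfolding flux_def[abs_def] dflux_def[abs_def]
  by (intro continuous_on_diff continuous_on_sum continuous_on_conv[OF i_A continuous_on_kern(2)[OF e] k_bound(1)]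
      continuous_on_conv[OF i_bi continuous_on_kern(1)[OF e] kern_abs]
      continuous_on_conv[OF i_A continuous_on_kern(3)[OF e] k_bound(2)]
      continuous_on_conv[OF i_bi continuous_on_kern(2)[OF e] k_bound(1)])+

lemma rate_dflux: "rate \<epsilon> t x = (\<Sum>i\<in>UNIV. dflux \<epsilon> t i x)"
proof -
  have iA: "integrable lborel (\<lambda>z. (A t z $ i $ j * \<rho> t z) * kern2 \<epsilon> (e j) (e i) (x - z))" for i j
    by (rule integrable_conv[OF i_A _ k_bound(2)]) simp
  have iB: "integrable lborel (\<lambda>z. (b t z $ i * \<rho> t z) * kern1 \<epsilon> (e i) (x - z))" for i
    by (rule integrable_conv[OF i_bi _ k_bound(1)]) simp
  have "rate \<epsilon> t x = (LINT z|lborel. (\<Sum>i\<in>UNIV. (\<Sum>j\<in>UNIV. (A t z $ i $ j * \<rho> t z) * kern2 \<epsilon> (e j) (e i) (x - z))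
      - (b t z $ i * \<rho> t z) * kern1 \<epsilon> (e i) (x - z)))"
    unfolding rate_def
  proof (intro Bochner_Integration.integral_cong refl)
    fix z
    have "\<rho> t z * (\<Sum>i\<in>UNIV. b t z $ i * (- kern1 \<epsilon> (e i) (x - z))) = - (\<Sum>i\<in>UNIV. (b t z $ i * \<rho> t z) * kern1 \<epsilon> (e i) (x - z))"
      by (simp add: sum_distrib_left sum_negf mult_ac)
    moreover have "\<rho> t z * (\<Sum>i\<in>UNIV. \<Sum>j\<in>UNIV. A t z $ i $ j * kern2 \<epsilon> (e j) (e i) (x - z))
       = (\<Sum>i\<in>UNIV. \<Sum>j\<in>UNIV. (A t z $ i $ j * \<rho> t z) * kern2 \<epsilon> (e j) (e i) (x - z))"
      by (simp add: sum_distrib_left mult_ac)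
    ultimately show "\<rho> t z * ((\<Sum>i\<in>UNIV. \<Sum>j\<in>UNIV. A t z $ i $ j * kern2 \<epsilon> (e j) (e i) (x - z))
      + (\<Sum>i\<in>UNIV. b t z $ i * (- kern1 \<epsilon> (e i) (x - z))))
      = (\<Sum>i\<in>UNIV. (\<Sum>j\<in>UNIV. (A t z $ i $ j * \<rho> t z) * kern2 \<epsilon> (e j) (e i) (x - z))
      - (b t z $ i * \<rho> t z) * kern1 \<epsilon> (e i) (x - z))"
      by (simp only: distrib_left sum_subtractf)
  qed
  also have "\<dots> = (\<Sum>i\<in>UNIV. dflux \<epsilon> t i x)"
    using iA iB by (simp add: dflux_def conv_def)
  finally show ?thesis .
qed

text \<open>The coefficients are frozen at \<open>x\<close>: the Lipschitz bound is absorbed by the decay of the kernel.\<close>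

definition rem :: "real^'n \<Rightarrow> real^'n" where
  "rem x = (\<chi> i. flux \<epsilon> t i x - (A t x *v grad \<epsilon> t x) $ i)"

text \<open>Hoelder's inequality with exponents \<beta> and \<beta>/(\<beta> - 1) for the measure
  \<rho>(z) kern(x - z) dz, applied to |b| and the constant 1.\<close>

lemma bmoll_Holder: "bmoll \<epsilon> t x \<le> bpow \<epsilon> t x powr (1 / \<beta>) * u x powr (1 - 1 / \<beta>)"
proof -
  let ?f = "\<lambda>z. (norm (b t z) powr \<beta> * \<rho> t z) * kern \<epsilon> (x - z)" and ?g = "\<lambda>z. \<rho> t z * kern \<epsilon> (x - z)"
  have eq: "?f z powr (1 / \<beta>) * ?g z powr (1 - 1 / \<beta>) = norm (b t z) * \<rho> t z * kern \<epsilon> (x - z)" for z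
  proof -
    have "?f z powr (1 / \<beta>) = norm (b t z) * ?g z powr (1 / \<beta>)"
      using beta rho_nonneg[of t z] kern_nonneg[OF e, of "x - z"] by (simp add: powr_mult powr_powr mult.assoc)
    then have "?f z powr (1 / \<beta>) * ?g z powr (1 - 1 / \<beta>) = norm (b t z) * (?g z powr (1 / \<beta>) * ?g z powr (1 - 1 / \<beta>))"
      by simp
    also have "?g z powr (1 / \<beta>) * ?g z powr (1 - 1 / \<beta>) = ?g z"
      using rho_nonneg[of t z] kern_nonneg[OF e, of "x - z"] by (simp flip: powr_add)
    finally show ?thesis by simp
  qed
  have "(LINT z|lborel. ?f z powr (1 / \<beta>) * ?g z powr (1 - 1 / \<beta>))
     \<le> (LINT z|lborel. ?f z) powr (1 / \<beta>) * (LINT z|lborel. ?g z) powr (1 - 1 / \<beta>)"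
  proof (rule Holder_interpolation)
    show "integrable lborel ?f" by (rule integrable_conv[OF i_bpow _ kern_abs]) simp
    show "integrable lborel ?g" by (rule integrable_conv[OF i_rho _ kern_abs]) simp
  qed (use beta rho_nonneg k_nonneg in auto)
  then show ?thesis by (simp add: eq bmoll_def bpow_def moll_def conv_def)
qed

text \<open>Each entry contributes (a(z) - a(x)) against \<rho>(z) times a first derivative of the
  kernel; the increment is at most \<kappa> |x - z|, and \<open>kern1_bound\<close>(2) turns the
  factor |x - z| into 2 N times the kernel, without \<epsilon>. Summing over both indices gives
  N^3.\<close>

lemma rem_le: "norm (rem x) \<le> (2 * N ^ 3 * \<kappa>) * u x + N * bmoll \<epsilon> t x"
proof -
  have comp: "\<bar>rem x $ i\<bar> \<le> N * (2 * N * \<kappa> * u x) + bmoll \<epsilon> t x" for i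
  proof -
    have iA: "integrable lborel (\<lambda>z. (A t z $ i $ j * \<rho> t z) * kern1 \<epsilon> (e j) (x - z))" for j
      by (rule integrable_conv[OF i_A _ k_bound(1)]) simp
    have ir: "integrable lborel (\<lambda>z. \<rho> t z * kern1 \<epsilon> (e j) (x - z))" for j
      by (rule integrable_conv[OF i_rho _ k_bound(1)]) simp
    have one: "\<bar>conv (\<lambda>z. A t z $ i $ j * \<rho> t z) (kern1 \<epsilon> (e j)) x - A t x $ i $ j * dmoll \<epsilon> t (e j) x\<bar> \<le> 2 * N * \<kappa> * u x" for j
    proof -
      have "conv (\<lambda>z. A t z $ i $ j * \<rho> t z) (kern1 \<epsilon> (e j)) x - A t x $ i $ j * dmoll \<epsilon> t (e j) x
        = (LINT z|lborel. (A t z $ i $ j - A t x $ i $ j) * (\<rho> t z * kern1 \<epsilon> (e j) (x - z)))"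
      proof -
        have "(LINT z|lborel. (A t z $ i $ j - A t x $ i $ j) * (\<rho> t z * kern1 \<epsilon> (e j) (x - z)))
          = (LINT z|lborel. (A t z $ i $ j * \<rho> t z) * kern1 \<epsilon> (e j) (x - z) - A t x $ i $ j * (\<rho> t z * kern1 \<epsilon> (e j) (x - z)))"
          by (simp add: left_diff_distrib mult.assoc)
        also have "\<dots> = conv (\<lambda>z. A t z $ i $ j * \<rho> t z) (kern1 \<epsilon> (e j)) x - A t x $ i $ j * dmoll \<epsilon> t (e j) x"
          unfolding conv_def dmoll_def
          by (subst Bochner_Integration.integral_diff[OF iA[of j] integrable_mult_right[OF ir[of j]]]) simp
        finally show ?thesis by simp
      qed
      also have "\<bar>\<dots>\<bar> \<le> (LINT z|lborel. (2 * N * \<kappa>) * (\<rho> t z * kern \<epsilon> (x - z)))"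
      proof (rule integral_abs_bound_integral)
        show "integrable lborel (\<lambda>z. (A t z $ i $ j - A t x $ i $ j) * (\<rho> t z * kern1 \<epsilon> (e j) (x - z)))"
          using Bochner_Integration.integrable_diff[OF iA[of j] integrable_mult_right[OF ir[of j], of "A t x $ i $ j"]]
          by (simp add: left_diff_distrib mult.assoc)
        show "integrable lborel (\<lambda>z. (2 * N * \<kappa>) * (\<rho> t z * kern \<epsilon> (x - z)))"
          by (intro integrable_mult_right integrable_conv[OF i_rho _ kern_abs]) simp
        fix z
        have "\<bar>A t z $ i $ j - A t x $ i $ j\<bar> * \<bar>kern1 \<epsilon> (e j) (x - z)\<bar> \<le> (\<kappa> * norm (x - z)) * \<bar>kern1 \<epsilon> (e j) (x - z)\<bar>"
          using A_lipschitz[of t z i j x] by (intro mult_right_mono) (auto simp: norm_minus_commute)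
        also have "\<dots> = \<kappa> * (norm (x - z) * \<bar>kern1 \<epsilon> (e j) (x - z)\<bar>)" by simp
        also have "\<dots> \<le> \<kappa> * (2 * N * kern \<epsilon> (x - z))"
          using kern1_bound(2)[OF e, of "x - z" "e j"] kappa by (intro mult_left_mono) auto
        finally have "\<rho> t z * (\<bar>A t z $ i $ j - A t x $ i $ j\<bar> * \<bar>kern1 \<epsilon> (e j) (x - z)\<bar>) \<le> \<rho> t z * (\<kappa> * (2 * N * kern \<epsilon> (x - z)))"
          by (intro mult_left_mono rho_nonneg)
        then show "\<bar>(A t z $ i $ j - A t x $ i $ j) * (\<rho> t z * kern1 \<epsilon> (e j) (x - z))\<bar> \<le> (2 * N * \<kappa>) * (\<rho> t z * kern \<epsilon> (x - z))"
          using rho_nonneg[of t z] by (simp add: abs_mult mult_ac)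
      qed
      also have "\<dots> = 2 * N * \<kappa> * u x" by (simp add: moll_def conv_def)
      finally show ?thesis .
    qed
    have "rem x $ i = (\<Sum>j\<in>UNIV. conv (\<lambda>z. A t z $ i $ j * \<rho> t z) (kern1 \<epsilon> (e j)) x - A t x $ i $ j * dmoll \<epsilon> t (e j) x)
       - conv (\<lambda>z. b t z $ i * \<rho> t z) (kern \<epsilon>) x"
      by (simp add: rem_def flux_def matrix_vector_mult_def grad_def sum_subtractf)
    moreover have "\<bar>\<Sum>j\<in>UNIV. conv (\<lambda>z. A t z $ i $ j * \<rho> t z) (kern1 \<epsilon> (e j)) x - A t x $ i $ j * dmoll \<epsilon> t (e j) x\<bar>
      \<le> (\<Sum>j::'n\<in>UNIV. 2 * N * \<kappa> * u x)"
      by (rule order_trans[OF sum_abs]) (intro sum_mono one)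
    ultimately show ?thesis using b_conv_le(1)[of i x] by simp
  qed
  have "norm (rem x) \<le> (\<Sum>i\<in>UNIV. \<bar>rem x $ i\<bar>)" by (rule norm_le_l1_cart)
  also have "\<dots> \<le> (\<Sum>i::'n\<in>UNIV. N * (2 * N * \<kappa> * u x) + bmoll \<epsilon> t x)" by (intro sum_mono comp)
  finally show ?thesis by (simp add: power3_eq_cube algebra_simps)
qed

text \<open>The coefficients of the bound for \<open>rem\<close> enter squared; the factor 2 from
  squaring a sum of two terms cancels against the 2 in the 1/(2 \<alpha>) of the Young step in
  \<open>energy_slice\<close>.\<close>

definition C1 :: real where "C1 = ((2 * N ^ 3 * \<kappa>)\<^sup>2 + N\<^sup>2) / \<alpha>"

text \<open>Up to a constant this dominates u^(k-1) |R|^2: the two summands are the squares of the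
  two terms in the bound for R, multiplied by u^(k-1).\<close>

definition src :: "real \<Rightarrow> real^'n \<Rightarrow> real" where
  "src k x = u x powr (1 + k) + bpow \<epsilon> t x powr (2 / \<beta>) * u x powr (1 + k - 2 / \<beta>)"

lemma rem_sq_le: "u x powr (k - 1) * (norm (rem x))\<^sup>2 / (2 * \<alpha>) \<le> C1 * src k x"
proof -
  let ?a = "2 * N ^ 3 * \<kappa>" and ?h = "bpow \<epsilon> t x powr (1 / \<beta>) * u x powr (1 - 1 / \<beta>)"
  have a0: "0 \<le> ?a" using kappa by simp
  have h0: "0 \<le> ?h" by simp
  have "norm (rem x) \<le> ?a * u x + N * ?h"
    using rem_le[of x] mult_left_mono[OF bmoll_Holder[of x], of N] by simp
  then have "(norm (rem x))\<^sup>2 \<le> (?a * u x + N * ?h)\<^sup>2" by (intro power_mono) auto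
  also have "\<dots> \<le> 2 * (?a * u x)\<^sup>2 + 2 * (N * ?h)\<^sup>2"
    using sum_squares_bound[of "?a * u x" "N * ?h"] unfolding power2_sum by linarith
  also have "\<dots> = 2 * (?a\<^sup>2 * (u x)\<^sup>2) + 2 * (N\<^sup>2 * ?h\<^sup>2)"
    by (simp only: power_mult_distrib)
  also have "\<dots> \<le> 2 * (?a\<^sup>2 + N\<^sup>2) * ((u x)\<^sup>2 + ?h\<^sup>2)"
  proof -
    have "2 * (p * q) + 2 * (r * w) \<le> 2 * (p + r) * (q + w)" if "0 \<le> p" "0 \<le> q" "0 \<le> r" "0 \<le> w" for p q r w :: real
      using mult_nonneg_nonneg[OF that(1,4)] mult_nonneg_nonneg[OF that(3,2)] by (simp add: algebra_simps)
    from this[of "?a\<^sup>2" "(u x)\<^sup>2" "N\<^sup>2" "?h\<^sup>2"] show ?thesis by (simp only: zero_le_power2 simp_thms)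
  qed
  finally have 1: "(norm (rem x))\<^sup>2 \<le> 2 * (?a\<^sup>2 + N\<^sup>2) * ((u x)\<^sup>2 + ?h\<^sup>2)" .
  have u2: "(u x)\<^sup>2 = u x powr 2" using u_pos[of x] by (simp add: powr_numeral)
  have h2: "?h\<^sup>2 = bpow \<epsilon> t x powr (2 / \<beta>) * u x powr (2 - 2 / \<beta>)"
    by (simp add: power2_eq_square algebra_simps flip: powr_add)
  have s: "u x powr (k - 1) * ((u x)\<^sup>2 + ?h\<^sup>2) = src k x"
  proof -
    have "u x powr (k - 1) * u x powr 2 = u x powr (1 + k)" by (simp flip: powr_add add: add.commute)
    moreover have "u x powr (k - 1) * u x powr (2 - 2 / \<beta>) = u x powr (1 + k - 2 / \<beta>)"
      by (simp flip: powr_add add: algebra_simps)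
    ultimately show ?thesis
      unfolding src_def h2 u2 by (simp add: distrib_left mult.left_commute)
  qed
  have "u x powr (k - 1) * (norm (rem x))\<^sup>2 \<le> u x powr (k - 1) * (2 * (?a\<^sup>2 + N\<^sup>2) * ((u x)\<^sup>2 + ?h\<^sup>2))"
    by (intro mult_left_mono 1) auto
  also have "\<dots> = 2 * (?a\<^sup>2 + N\<^sup>2) * src k x" unfolding s[symmetric] by (simp only: mult_ac)
  finally show ?thesis using alpha by (simp add: C1_def field_simps)
qed

text \<open>Young's inequality with exponents \<beta>/2 and \<beta>/(\<beta> - 2) separates
  \<open>bpow\<close> from a power of u, whose order 1 + k \<beta>/(\<beta> - 2) is forced by the
  exponent 1 + k - 2/\<beta>. The bound contains Q and serves integrability in time; the uniform
  estimate is \<open>src_total\<close>.\<close>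

lemma integrable_src:
  assumes k: "0 < k"
  shows "integrable lborel (src k)"
    and "(LINT x|lborel. src k x) \<le> Q powr k + (LINT z|lborel. norm (b t z) powr \<beta> * \<rho> t z) + Q powr (k * \<beta> / (\<beta> - 2))"
proof -
  let ?s = "k * \<beta> / (\<beta> - 2)"
  have s0: "0 \<le> ?s" using beta k by simp
  have young: "bpow \<epsilon> t x powr (2 / \<beta>) * u x powr (1 + k - 2 / \<beta>) \<le> bpow \<epsilon> t x + u x powr (1 + ?s)" for x
  proof (cases "bpow \<epsilon> t x = 0")
    case False
    then have p: "0 < bpow \<epsilon> t x" using bpow_nonneg[OF e, of t x] by simp
    have ex: "(1 + ?s) * (1 - 2 / \<beta>) = 1 + k - 2 / \<beta>" using beta by (simp add: field_simps)
    have "bpow \<epsilon> t x powr (2 / \<beta>) * (u x powr (1 + ?s)) powr (1 - 2 / \<beta>) \<le> 2 / \<beta> * bpow \<epsilon> t x + (1 - 2 / \<beta>) * u x powr (1 + ?s)"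
      by (rule Youngs_inequality_0) (use beta p u_pos[of x] in auto)
    also have "\<dots> \<le> 1 * bpow \<epsilon> t x + 1 * u x powr (1 + ?s)"
      using beta p by (intro add_mono mult_right_mono) auto
    finally show ?thesis by (simp add: powr_powr ex)
  qed (use beta in simp)
  let ?D = "\<lambda>x. u x powr (1 + k) + bpow \<epsilon> t x + u x powr (1 + ?s)"
  have le: "0 \<le> src k x" "src k x \<le> ?D x" for x
    using young[of x] by (simp_all add: src_def)
  have iD: "integrable lborel ?D"
    using integrable_u_powr[OF s0] integrable_u_powr[of k] k integrable_bpow by simp
  have [measurable]: "src k \<in> borel_measurable borel" unfolding src_def[abs_def] by measurable
  show i: "integrable lborel (src k)"
    by (rule Bochner_Integration.integrable_bound[OF iD]) (use le in \<open>auto intro!: order_trans[OF _ abs_ge_self]\<close>)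
  have "(LINT x|lborel. src k x) \<le> (LINT x|lborel. ?D x)"
    by (rule integral_mono[OF i iD le(2)])
  also have "\<dots> = (LINT x|lborel. u x powr (1 + k)) + (LINT x|lborel. bpow \<epsilon> t x) + (LINT x|lborel. u x powr (1 + ?s))"
    using integrable_u_powr[OF s0] integrable_u_powr[of k] k integrable_bpow by simp
  also have "\<dots> \<le> Q powr k + (LINT z|lborel. norm (b t z) powr \<beta> * \<rho> t z) + Q powr ?s"
    unfolding integral_bpow using integral_u_powr_le[of k] integral_u_powr_le[OF s0] k by simp
  finally show "(LINT x|lborel. src k x) \<le> Q powr k + (LINT z|lborel. norm (b t z) powr \<beta> * \<rho> t z) + Q powr ?s" .
qed

lemma integrable_dissipation:
  assumes k: "0 < k"
  shows "integrable lborel (\<lambda>x. u x powr (k - 1) * (norm (grad \<epsilon> t x))\<^sup>2)"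
    and "(LINT x|lborel. u x powr (k - 1) * (norm (grad \<epsilon> t x))\<^sup>2) \<le> (N * c1)\<^sup>2 * Q powr k"
proof -
  have le: "u x powr (k - 1) * (norm (grad \<epsilon> t x))\<^sup>2 \<le> (N * c1)\<^sup>2 * u x powr (1 + k)" for x
  proof -
    have "(norm (grad \<epsilon> t x))\<^sup>2 \<le> (N * c1 * u x)\<^sup>2" by (intro power_mono norm_grad_le) auto
    then have "u x powr (k - 1) * (norm (grad \<epsilon> t x))\<^sup>2 \<le> u x powr (k - 1) * ((N * c1)\<^sup>2 * u x powr 2)"
      using u_pos[of x] by (intro mult_left_mono) (auto simp: power_mult_distrib powr_numeral)
    also have "\<dots> = (N * c1)\<^sup>2 * (u x powr (k - 1) * u x powr 2)" by simp
    also have "u x powr (k - 1) * u x powr 2 = u x powr (1 + k)" by (simp flip: powr_add add: add.commute)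
    finally show ?thesis .
  qed
  have iD: "integrable lborel (\<lambda>x. (N * c1)\<^sup>2 * u x powr (1 + k))" using integrable_u_powr[of k] k by simp
  show i: "integrable lborel (\<lambda>x. u x powr (k - 1) * (norm (grad \<epsilon> t x))\<^sup>2)"
    by (rule Bochner_Integration.integrable_bound[OF iD]) (use le in \<open>auto intro!: order_trans[OF _ abs_ge_self]\<close>)
  have "(LINT x|lborel. u x powr (k - 1) * (norm (grad \<epsilon> t x))\<^sup>2) \<le> (LINT x|lborel. (N * c1)\<^sup>2 * u x powr (1 + k))"
    by (rule integral_mono[OF i iD le])
  also have "\<dots> \<le> (N * c1)\<^sup>2 * Q powr k" using integral_u_powr_le[of k] k by (simp add: mult_left_mono)
  finally show "(LINT x|lborel. u x powr (k - 1) * (norm (grad \<epsilon> t x))\<^sup>2) \<le> (N * c1)\<^sup>2 * Q powr k" .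
qed

lemma rate_le: "\<bar>rate \<epsilon> t x\<bar> \<le> N * (N * c2 * M * u x + c1 * bmoll \<epsilon> t x)"
proof -
  have "\<bar>rate \<epsilon> t x\<bar> \<le> (\<Sum>i::'n\<in>UNIV. N * c2 * M * u x + c1 * bmoll \<epsilon> t x)"
    unfolding rate_dflux by (rule order_trans[OF sum_abs]) (intro sum_mono dflux_le)
  then show ?thesis by simp
qed

text \<open>A bound depending on \<epsilon> whose purpose is the interchange of space and time
  integrals in \<open>energy\<close>.\<close>

lemma integrable_rate_power:
  assumes k: "0 < k"
  shows "integrable lborel (\<lambda>x. u x powr k * rate \<epsilon> t x)"
    and "(LINT x|lborel. \<bar>u x powr k * rate \<epsilon> t x\<bar>) \<le> Q powr k * (N * (N * c2 * M + c1 * b_mass t))"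
proof -
  have uk: "u x powr k \<le> Q powr k" for x using u_le[of x] u_pos[of x] k by (intro powr_mono2) auto
  let ?D = "\<lambda>x. Q powr k * (N * (N * c2 * M * u x + c1 * bmoll \<epsilon> t x))"
  have le: "\<bar>u x powr k * rate \<epsilon> t x\<bar> \<le> ?D x" for x
    unfolding abs_mult using uk[of x] rate_le[of x] by (intro mult_mono) auto
  have iD: "integrable lborel ?D" using integrable_u integrable_bmoll by simp
  show i: "integrable lborel (\<lambda>x. u x powr k * rate \<epsilon> t x)"
    by (rule Bochner_Integration.integrable_bound[OF iD]) (use le in \<open>auto intro!: order_trans[OF _ abs_ge_self]\<close>)
  have "(LINT x|lborel. bmoll \<epsilon> t x) = b_mass t"
    unfolding bmoll_def b_mass_def using conv_L1(2)[OF i_b integrable_kern[OF e]] integral_kern[OF e, where 'a="real^'n"] by simp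
  then have "(LINT x|lborel. N * c2 * M * u x + c1 * bmoll \<epsilon> t x) = N * c2 * M + c1 * b_mass t"
    using integrable_u integrable_bmoll by (subst Bochner_Integration.integral_add) (simp_all add: integral_u)
  then have eq: "(LINT x|lborel. ?D x) = Q powr k * (N * (N * c2 * M + c1 * b_mass t))"
    by (simp only: integral_mult_right_zero)
  have "(LINT x|lborel. \<bar>u x powr k * rate \<epsilon> t x\<bar>) \<le> (LINT x|lborel. ?D x)"
    by (rule integral_mono[OF integrable_abs[OF i] iD le])
  then show "(LINT x|lborel. \<bar>u x powr k * rate \<epsilon> t x\<bar>) \<le> Q powr k * (N * (N * c2 * M + c1 * b_mass t))"
    by (rule ord_le_eq_trans[OF _ eq])
qed

text \<open>The product of u^k with a flux component and its derivative along the axis are both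
  integrable, so \<open>integral_line_derivative_zero\<close> applies without a boundary
  term.\<close>

lemma integration_by_parts:
  assumes k: "0 < k"
  shows "(LINT x|lborel. u x powr k * dflux \<epsilon> t i x) = - (LINT x|lborel. k * u x powr (k - 1) * dmoll \<epsilon> t (e i) x * flux \<epsilon> t i x)"
    and "integrable lborel (\<lambda>x. u x powr k * dflux \<epsilon> t i x)"
    and "integrable lborel (\<lambda>x. k * u x powr (k - 1) * dmoll \<epsilon> t (e i) x * flux \<epsilon> t i x)"
proof -
  have uk: "u x powr k \<le> Q powr k" for x using u_le[of x] u_pos[of x] k by (intro powr_mono2) auto
  have dk: "\<bar>k * u x powr (k - 1) * dmoll \<epsilon> t (e i) x\<bar> \<le> k * c1 * Q powr k" for x
  proof -
    have "\<bar>dmoll \<epsilon> t (e i) x\<bar> \<le> c1 * u x" using dmoll_le[of "e i" x] by simp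
    then have "k * u x powr (k - 1) * \<bar>dmoll \<epsilon> t (e i) x\<bar> \<le> k * u x powr (k - 1) * (c1 * u x)"
      using k by (intro mult_left_mono) auto
    also have "\<dots> = k * c1 * (u x powr (k - 1) * u x powr 1)" using u_pos[of x] by simp
    also have "u x powr (k - 1) * u x powr 1 = u x powr k" by (simp only: powr_add[symmetric]) simp
    also have "k * c1 * u x powr k \<le> k * c1 * Q powr k" using uk k c_nonneg by (intro mult_left_mono) auto
    finally show ?thesis using k by (simp add: abs_mult)
  qed
  have "integrable lborel (\<lambda>x. Q powr k * (N * c2 * M * u x + c1 * bmoll \<epsilon> t x))"
    using integrable_u integrable_bmoll by simp
  then show i1: "integrable lborel (\<lambda>x. u x powr k * dflux \<epsilon> t i x)"
    by (rule integrable_dominated)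
      (use uk dflux_le in \<open>auto simp: abs_mult intro!: mult_mono\<close>)
  have iF: "integrable lborel (\<lambda>x. C * (N * c1 * M * u x + bmoll \<epsilon> t x))" for C
    using integrable_u integrable_bmoll by simp
  have i0: "integrable lborel (\<lambda>x. u x powr k * flux \<epsilon> t i x)"
    by (rule integrable_dominated[OF iF[of "Q powr k"]])
      (use uk flux_le in \<open>auto simp: abs_mult intro!: mult_mono\<close>)
  show i2: "integrable lborel (\<lambda>x. k * u x powr (k - 1) * dmoll \<epsilon> t (e i) x * flux \<epsilon> t i x)"
  proof (rule Bochner_Integration.integrable_bound[OF iF[of "k * c1 * Q powr k"]])
    show "AE x in lborel. norm (k * u x powr (k - 1) * dmoll \<epsilon> t (e i) x * flux \<epsilon> t i x)
      \<le> norm (k * c1 * Q powr k * (N * c1 * M * u x + bmoll \<epsilon> t x))"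
    proof (rule AE_I2)
      fix x
      have "\<bar>k * u x powr (k - 1) * dmoll \<epsilon> t (e i) x\<bar> * \<bar>flux \<epsilon> t i x\<bar> \<le> (k * c1 * Q powr k) * (N * c1 * M * u x + bmoll \<epsilon> t x)"
        using dk[of x] flux_le[of i x] by (intro mult_mono) auto
      then show "norm (k * u x powr (k - 1) * dmoll \<epsilon> t (e i) x * flux \<epsilon> t i x)
        \<le> norm (k * c1 * Q powr k * (N * c1 * M * u x + bmoll \<epsilon> t x))"
        unfolding abs_mult[symmetric] real_norm_def by linarith
    qed
  qed measurable
  have "(LINT x|lborel. k * u x powr (k - 1) * dmoll \<epsilon> t (e i) x * flux \<epsilon> t i x + u x powr k * dflux \<epsilon> t i x) = 0"
  proof (rule integral_line_derivative_zero[OF i0, where v="e i"])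
    show "integrable lborel (\<lambda>x. k * u x powr (k - 1) * dmoll \<epsilon> t (e i) x * flux \<epsilon> t i x + u x powr k * dflux \<epsilon> t i x)"
      using i1 i2 by simp
    have "u x \<noteq> 0" for x using u_pos[of x] by simp
    then show "continuous_on UNIV (\<lambda>x. k * u x powr (k - 1) * dmoll \<epsilon> t (e i) x * flux \<epsilon> t i x + u x powr k * dflux \<epsilon> t i x)"
      by (intro continuous_intros continuous_u continuous_dmoll continuous_flux) auto
    show "((\<lambda>s. u (y + s *\<^sub>R e i) powr k * flux \<epsilon> t i (y + s *\<^sub>R e i)) has_real_derivative
      k * u (y + s *\<^sub>R e i) powr (k - 1) * dmoll \<epsilon> t (e i) (y + s *\<^sub>R e i) * flux \<epsilon> t i (y + s *\<^sub>R e i)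
        + u (y + s *\<^sub>R e i) powr k * dflux \<epsilon> t i (y + s *\<^sub>R e i)) (at s)" for y s
      using DERIV_mult[OF powr_line_derivative[where u=u and x=y and v="e i" and du="dmoll \<epsilon> t (e i)" and s=s and r=k, OF u_line u_pos] flux_line[of i y s]] by (simp add: mult_ac)
  qed
  then show "(LINT x|lborel. u x powr k * dflux \<epsilon> t i x) = - (LINT x|lborel. k * u x powr (k - 1) * dmoll \<epsilon> t (e i) x * flux \<epsilon> t i x)"
    using i1 i2 by simp
qed

text \<open>After integration by parts the integrand is -k u^(k-1) times the inner product of
  \<nabla> u with A \<nabla> u + R. Ellipticity gives \<alpha> |\<nabla> u|^2, and Young's
  inequality spends half of it on the inner product with R, leaving |R|^2/(2 \<alpha>).\<close>

lemma energy_slice: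
  assumes k: "0 < k"
  shows "(LINT x|lborel. u x powr k * rate \<epsilon> t x)
    \<le> k * (C1 * (LINT x|lborel. src k x) - \<alpha> / 2 * (LINT x|lborel. u x powr (k - 1) * (norm (grad \<epsilon> t x))\<^sup>2))"
proof -
  note ibp = integration_by_parts[OF k]
  have pw: "- (\<Sum>i\<in>UNIV. k * u x powr (k - 1) * dmoll \<epsilon> t (e i) x * flux \<epsilon> t i x)
    \<le> k * (C1 * src k x - \<alpha> / 2 * (u x powr (k - 1) * (norm (grad \<epsilon> t x))\<^sup>2))" for x
  proof -
    let ?g = "grad \<epsilon> t x"
    have "(\<Sum>i\<in>UNIV. dmoll \<epsilon> t (e i) x * flux \<epsilon> t i x) = ?g \<bullet> (A t x *v ?g) + ?g \<bullet> rem x"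
      by (simp add: inner_vec_def rem_def grad_def algebra_simps sum.distrib sum_subtractf)
    moreover have "\<alpha> * (norm ?g)\<^sup>2 \<le> ?g \<bullet> (A t x *v ?g)"
      using A_elliptic[OF t01, of ?g x] by (simp add: power2_norm_eq_inner)
    moreover have "- (?g \<bullet> rem x) \<le> \<alpha> / 2 * (norm ?g)\<^sup>2 + (norm (rem x))\<^sup>2 / (2 * \<alpha>)"
    proof -
      have "0 \<le> (\<alpha> * norm ?g - norm (rem x))\<^sup>2 / (2 * \<alpha>)" using alpha by simp
      then have "norm ?g * norm (rem x) \<le> \<alpha> / 2 * (norm ?g)\<^sup>2 + (norm (rem x))\<^sup>2 / (2 * \<alpha>)"
        using alpha by (simp add: power2_eq_square field_simps)
      then show ?thesis using Cauchy_Schwarz_ineq2[of ?g "rem x"] by linarith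
    qed
    ultimately have "- (\<Sum>i\<in>UNIV. dmoll \<epsilon> t (e i) x * flux \<epsilon> t i x) \<le> (norm (rem x))\<^sup>2 / (2 * \<alpha>) - \<alpha> / 2 * (norm ?g)\<^sup>2"
      by (simp add: field_simps)
    then have "u x powr (k - 1) * - (\<Sum>i\<in>UNIV. dmoll \<epsilon> t (e i) x * flux \<epsilon> t i x)
       \<le> u x powr (k - 1) * ((norm (rem x))\<^sup>2 / (2 * \<alpha>) - \<alpha> / 2 * (norm ?g)\<^sup>2)"
      by (intro mult_left_mono) auto
    also have "\<dots> = u x powr (k - 1) * (norm (rem x))\<^sup>2 / (2 * \<alpha>) - \<alpha> / 2 * (u x powr (k - 1) * (norm ?g)\<^sup>2)"
      by (simp add: right_diff_distrib)
    also have "\<dots> \<le> C1 * src k x - \<alpha> / 2 * (u x powr (k - 1) * (norm ?g)\<^sup>2)"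
      using rem_sq_le[of x k] by simp
    finally have "k * (u x powr (k - 1) * - (\<Sum>i\<in>UNIV. dmoll \<epsilon> t (e i) x * flux \<epsilon> t i x))
       \<le> k * (C1 * src k x - \<alpha> / 2 * (u x powr (k - 1) * (norm ?g)\<^sup>2))"
      using k by (intro mult_left_mono) auto
    then show ?thesis by (simp add: sum_distrib_left mult_ac)
  qed
  have "(LINT x|lborel. u x powr k * rate \<epsilon> t x) = (LINT x|lborel. (\<Sum>i\<in>UNIV. u x powr k * dflux \<epsilon> t i x))"
    by (simp add: rate_dflux sum_distrib_left)
  also have "\<dots> = (\<Sum>i\<in>UNIV. - (LINT x|lborel. k * u x powr (k - 1) * dmoll \<epsilon> t (e i) x * flux \<epsilon> t i x))"
    using ibp(2) by (subst Bochner_Integration.integral_sum) (auto simp: ibp(1))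
  also have "\<dots> = (LINT x|lborel. - (\<Sum>i\<in>UNIV. k * u x powr (k - 1) * dmoll \<epsilon> t (e i) x * flux \<epsilon> t i x))"
    using ibp(3) by (simp add: sum_negf)
  also have "\<dots> \<le> (LINT x|lborel. k * (C1 * src k x - \<alpha> / 2 * (u x powr (k - 1) * (norm (grad \<epsilon> t x))\<^sup>2)))"
    by (rule integral_mono[OF _ _ pw]) (use ibp(3) integrable_src[OF k] integrable_dissipation[OF k] in auto)
  also have "\<dots> = k * (C1 * (LINT x|lborel. src k x) - \<alpha> / 2 * (LINT x|lborel. u x powr (k - 1) * (norm (grad \<epsilon> t x))\<^sup>2))"
    using integrable_src[OF k] integrable_dissipation[OF k] by simp
  finally show ?thesis .
qed

end

section \<open>Uniform bounds for the mollified densities\<close>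

text \<open>The tangent inequality for a convex function. The positive part makes the power defined
  and differentiable on the whole line, as \<open>convex_chain\<close> requires: the primitive to
  which it is applied equals u only at almost every time.\<close>

lemma convex_power:
  fixes y z k :: real
  assumes k: "0 < k"
  shows "(max 0 y) powr (1 + k) - (max 0 z) powr (1 + k) \<le> (1 + k) * (max 0 y) powr k * (y - z)"
proof -
  let ?Y = "max 0 y" and ?Z = "max 0 z"
  have split: "?Y powr (1 + k) = ?Y powr k * ?Y"
    by (cases "?Y = 0") (auto simp: powr_add)
  have young: "(1 + k) * (?Y powr k * ?Z) \<le> k * ?Y powr (1 + k) + ?Z powr (1 + k)"
  proof (cases "?Y = 0 \<or> ?Z = 0")
    case False
    then have "0 < ?Y" "0 < ?Z" by auto
    then have "(?Y powr (1 + k)) powr (k / (1 + k)) * (?Z powr (1 + k)) powr (1 / (1 + k))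
        \<le> k / (1 + k) * ?Y powr (1 + k) + 1 / (1 + k) * ?Z powr (1 + k)"
      using k by (intro Youngs_inequality_0) (auto simp: field_simps)
    then have "?Y powr k * ?Z \<le> k / (1 + k) * ?Y powr (1 + k) + 1 / (1 + k) * ?Z powr (1 + k)"
      using k \<open>0 < ?Z\<close> by (simp add: powr_powr)
    then have "(1 + k) * (?Y powr k * ?Z) \<le> (1 + k) * (k / (1 + k) * ?Y powr (1 + k) + 1 / (1 + k) * ?Z powr (1 + k))"
      using k by (intro mult_left_mono) auto
    also have "\<dots> = k * ?Y powr (1 + k) + ?Z powr (1 + k)" using k by (simp add: distrib_left)
    finally show ?thesis .
  qed (use k in auto)
  have "?Y powr k * (?Y - ?Z) \<le> ?Y powr k * (y - z)"
    by (cases "y \<le> 0") (auto intro!: mult_left_mono)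
  then have "(1 + k) * (?Y powr k * (?Y - ?Z)) \<le> (1 + k) * (?Y powr k * (y - z))"
    by (rule mult_left_mono) (use k in simp)
  moreover have "(1 + k) * (?Y powr k * (?Y - ?Z)) = ?Y powr (1 + k) + k * ?Y powr (1 + k) - (1 + k) * (?Y powr k * ?Z)"
    unfolding split by (simp only: right_diff_distrib distrib_right mult_1_left)
  ultimately show ?thesis using young unfolding mult.assoc by linarith
qed

lemma AE_unit_time_near_1:
  assumes "AE t in unit_time. P t" "0 < \<delta>" "\<delta> \<le> 1"
  shows "\<exists>t\<in>{1 - \<delta><..<1}. P t"
proof (rule ccontr)
  assume n: "\<not> ?thesis"
  have "AE t in lborel. t \<in> {0<..<1} \<longrightarrow> P t"
    using assms(1) by (simp only: AE_unit_time_iff)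
  then have "AE t in lborel. t \<notin> {1 - \<delta><..<1}"
    by eventually_elim (use n assms in auto)
  then have "emeasure lborel {1 - \<delta><..<1} = 0"
    by (subst (asm) AE_iff_measurable[OF _ refl]) (auto simp: set_eq_iff elim: back_subst[of "\<lambda>A. emeasure lborel A = 0"])
  then show False using assms by simp
qed

section \<open>Estimates integrated over time, at a fixed mollification scale\<close>

interpretation time_space: pair_sigma_finite unit_time "lborel :: ('a::euclidean_space) measure" ..

locale mollified = fokker_planck A b \<rho> \<rho>0 \<alpha> \<kappa> \<beta> M B U N
  for A :: "real \<Rightarrow> real^'n \<Rightarrow> real^'n^'n" and b \<rho> \<rho>0 \<alpha> \<kappa> \<beta> M B U N +
  fixes \<epsilon> Q :: real
  assumes eps: "\<epsilon> > 0" and Q: "\<And>y::real^'n. kern \<epsilon> y \<le> Q"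
begin

abbreviation "MM \<equiv> unit_time \<Otimes>\<^sub>M (lborel :: (real^'n) measure)"
abbreviation "u \<equiv> moll \<epsilon>"
definition "u0 = conv \<rho>0 (kern \<epsilon>)"

lemma slice: "good t \<Longrightarrow> mollified_slice A b \<rho> \<rho>0 \<alpha> \<kappa> \<beta> M B U N \<epsilon> t Q"
  by unfold_locales (auto simp: eps Q)

lemma kern_abs_le: "\<bar>kern \<epsilon> (y::real^'n)\<bar> \<le> Q"
  using kern_nonneg[OF eps, of y] Q[of y] by simp

text \<open>\<open>srcp\<close> and the constant \<open>Cr\<close> restate \<open>src\<close> and
  \<open>C1\<close> of the fixed-time locale with time as an argument, so that they can be
  integrated over time.\<close>

definition srcp :: "real \<Rightarrow> real \<Rightarrow> real^'n \<Rightarrow> real" where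
  "srcp k t x = u t x powr (1 + k) + bpow \<epsilon> t x powr (2 / \<beta>) * u t x powr (1 + k - 2 / \<beta>)"

definition diss :: "real \<Rightarrow> real \<Rightarrow> real" where
  "diss k t = (LINT x|lborel. u t x powr (k - 1) * (norm (grad \<epsilon> t x))\<^sup>2)"

definition bbeta :: "real \<Rightarrow> real" where
  "bbeta t = (LINT z|lborel. norm (b t z) powr \<beta> * \<rho> t z)"

definition Cr :: real where "Cr = ((2 * N ^ 3 * \<kappa>)\<^sup>2 + N\<^sup>2) / \<alpha>"

lemma Cr_nonneg: "0 \<le> Cr" using alpha by (simp add: Cr_def)

lemma srcp_measurable [measurable]: "case_prod (srcp k) \<in> borel_measurable (borel \<Otimes>\<^sub>M borel)"
  unfolding srcp_def[abs_def] by measurable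

lemma srcp_nonneg: "0 \<le> srcp k t x" by (simp add: srcp_def)

lemma diss_nonneg: "0 \<le> diss k t" by (simp add: diss_def)

lemma bbeta_nonneg: "0 \<le> bbeta t"
  unfolding bbeta_def using rho_nonneg by (intro Bochner_Integration.integral_nonneg) simp

lemma bbeta_integrable: "integrable unit_time bbeta" "(LINT t|unit_time. bbeta t) \<le> B"
proof -
  have "(\<integral>\<^sup>+t. ennreal (bbeta t) \<partial>unit_time) = (\<integral>\<^sup>+t. (\<integral>\<^sup>+x. ennreal (norm (b t x) powr \<beta> * \<rho> t x) \<partial>lborel) \<partial>unit_time)"
  proof (rule nn_integral_cong_AE)
    show "AE t in unit_time. ennreal (bbeta t) = (\<integral>\<^sup>+x. ennreal (norm (b t x) powr \<beta> * \<rho> t x) \<partial>lborel)"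
      using AE_good by eventually_elim
        (auto simp: good_def bbeta_def rho_nonneg intro!: nn_integral_eq_integral[symmetric])
  qed
  then have *: "(\<integral>\<^sup>+t. ennreal (bbeta t) \<partial>unit_time) \<le> ennreal B" using b_Lbeta by simp
  have m: "bbeta \<in> borel_measurable unit_time" unfolding bbeta_def[abs_def] by measurable
  show i: "integrable unit_time bbeta"
    using m bbeta_nonneg le_less_trans[OF * ennreal_less_top] by (intro integrableI_nonneg) auto
  have "ennreal (LINT t|unit_time. bbeta t) \<le> ennreal B"
    using * nn_integral_eq_integral[OF i] bbeta_nonneg by simp
  then show "(LINT t|unit_time. bbeta t) \<le> B" using B by (subst (asm) ennreal_le_iff) auto
qed

lemma src_slice:
  assumes "good t" "0 < k"
  shows "integrable lborel (srcp k t)"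
    and "(LINT x|lborel. srcp k t x) \<le> Q powr k + bbeta t + Q powr (k * \<beta> / (\<beta> - 2))"
    and "(LINT x|lborel. u t x powr k * rate \<epsilon> t x) \<le> k * (Cr * (LINT x|lborel. srcp k t x) - \<alpha> / 2 * diss k t)"
proof -
  interpret S: mollified_slice A b \<rho> \<rho>0 \<alpha> \<kappa> \<beta> M B U N \<epsilon> t Q by (rule slice[OF assms(1)])
  have eq: "S.src k = srcp k t" by (simp add: fun_eq_iff S.src_def srcp_def)
  have eq2: "S.C1 = Cr" by (simp add: S.C1_def Cr_def)
  show "integrable lborel (srcp k t)" using S.integrable_src(1)[OF assms(2)] by (simp only: eq)
  show "(LINT x|lborel. srcp k t x) \<le> Q powr k + bbeta t + Q powr (k * \<beta> / (\<beta> - 2))"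
    using S.integrable_src(2)[OF assms(2)] by (simp only: eq bbeta_def)
  show "(LINT x|lborel. u t x powr k * rate \<epsilon> t x) \<le> k * (Cr * (LINT x|lborel. srcp k t x) - \<alpha> / 2 * diss k t)"
    using S.energy_slice[OF assms(2)] by (simp only: eq eq2 diss_def)
qed

lemma integrable_MM:
  fixes f :: "real \<Rightarrow> real^'n \<Rightarrow> real"
  assumes [measurable]: "case_prod f \<in> borel_measurable (borel \<Otimes>\<^sub>M borel)"
    and i: "\<And>t. good t \<Longrightarrow> integrable lborel (f t)"
    and le: "\<And>t. good t \<Longrightarrow> (LINT x|lborel. \<bar>f t x\<bar>) \<le> C t" and C: "integrable unit_time C"
  shows "integrable MM (\<lambda>(t, x). f t x)"
proof (rule time_space.Fubini_integrable)
  show "integrable unit_time (\<lambda>t. LINT x|lborel. norm (case (t, x) of (t, x) \<Rightarrow> f t x))"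
    by (rule Bochner_Integration.integrable_bound[OF C])
      (use AE_good le in \<open>auto elim!: eventually_mono intro: order_trans[OF _ abs_ge_self]\<close>)
  show "AE t in unit_time. integrable lborel (\<lambda>x. case (t, x) of (t, x) \<Rightarrow> f t x)"
    using AE_good i by (auto elim: eventually_mono)
qed measurable

lemma integrable_MM_u: "0 \<le> s \<Longrightarrow> integrable MM (\<lambda>(t, x). u t x powr (1 + s))"
proof (rule integrable_MM[where C="\<lambda>t. Q powr s"])
  assume s: "0 \<le> s"
  fix t assume g: "good t"
  interpret S: mollified_slice A b \<rho> \<rho>0 \<alpha> \<kappa> \<beta> M B U N \<epsilon> t Q by (rule slice[OF g])
  show "integrable lborel (\<lambda>x. u t x powr (1 + s))" "(LINT x|lborel. \<bar>u t x powr (1 + s)\<bar>) \<le> Q powr s"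
    using S.integrable_u_powr[OF s] S.integral_u_powr_le[OF s] by auto
qed auto

lemma integrable_MM_bpow: "integrable MM (\<lambda>(t, x). bpow \<epsilon> t x)"
proof (rule integrable_MM[OF _ _ _ bbeta_integrable(1)])
  fix t assume g: "good t"
  interpret S: mollified_slice A b \<rho> \<rho>0 \<alpha> \<kappa> \<beta> M B U N \<epsilon> t Q by (rule slice[OF g])
  show "integrable lborel (bpow \<epsilon> t)" by (rule S.integrable_bpow)
  show "(LINT x|lborel. \<bar>bpow \<epsilon> t x\<bar>) \<le> bbeta t"
    using S.integral_bpow bpow_nonneg[OF eps] by (simp add: bbeta_def)
qed measurable

lemma integral_MM_bpow: "(LINT (t, x)|MM. bpow \<epsilon> t x) \<le> B"
proof -
  have "(LINT (t, x)|MM. bpow \<epsilon> t x) = (LINT t|unit_time. LINT x|lborel. bpow \<epsilon> t x)"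
    using time_space.integral_fst'[OF integrable_MM_bpow] by simp
  also have "\<dots> = (LINT t|unit_time. bbeta t)"
  proof (rule integral_cong_AE)
    show "AE t in unit_time. (LINT x|lborel. bpow \<epsilon> t x) = bbeta t"
      using AE_good
    proof eventually_elim
      case (elim t)
      interpret S: mollified_slice A b \<rho> \<rho>0 \<alpha> \<kappa> \<beta> M B U N \<epsilon> t Q by (rule slice[OF elim])
      show ?case using S.integral_bpow by (simp add: bbeta_def)
    qed
  qed (use bbeta_integrable in auto)
  also have "\<dots> \<le> B" by (rule bbeta_integrable(2))
  finally show ?thesis .
qed

text \<open>The s-th moment of u for the probability measure u dx dt. The shift by one is what makes
  J 0 = 1 the conserved mass and lets \<open>J_mono\<close> express monotonicity of L^s
  norms.\<close>

definition J :: "real \<Rightarrow> real" where "J s = (LINT (t, x)|MM. u t x powr (1 + s))"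

lemma J_nonneg: "0 \<le> J s"
  unfolding J_def by (intro Bochner_Integration.integral_nonneg) auto

lemma abs_u: "\<bar>u t x\<bar> = u t x"
  using moll_nonneg[OF eps, of t x] by simp

lemma integrable_MM_1: "integrable MM (\<lambda>p. u (fst p) (snd p))"
  using integrable_MM_u[of 0] by (simp add: abs_u case_prod_beta')

lemma J_0: "J 0 = 1"
proof -
  have "J 0 = (LINT t|unit_time. LINT x|lborel. u t x powr (1 + 0))"
    unfolding J_def using time_space.integral_fst'[OF integrable_MM_u[of 0]] by simp
  also have "\<dots> = (LINT t|unit_time. 1)"
  proof (rule integral_cong_AE)
    show "AE t in unit_time. (LINT x|lborel. u t x powr (1 + 0)) = 1"
      using AE_good
    proof eventually_elim
      case (elim t)
      interpret S: mollified_slice A b \<rho> \<rho>0 \<alpha> \<kappa> \<beta> M B U N \<epsilon> t Q by (rule slice[OF elim])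
      show ?case using S.integral_u by (simp add: abs_u)
    qed
  qed auto
  also have "\<dots> = 1" by (simp add: measure_def emeasure_unit_time)
  finally show ?thesis .
qed

text \<open>Hoelder interpolation of the order s between 0 and s': the factor of order 0 is the
  total mass, equal to 1.\<close>

lemma J_mono:
  assumes s: "0 < s" "s \<le> s'"
  shows "J s \<le> J s' powr (s / s')"
proof (cases "s = s'")
  case True
  then show ?thesis using s J_nonneg[of s] by simp
next
  case False
  let ?\<theta> = "1 - s / s'"
  have \<theta>: "0 < ?\<theta>" "?\<theta> < 1" using s False by auto
  note i0 = integrable_MM_1
  have i1: "integrable MM (\<lambda>p. u (fst p) (snd p) powr (1 + s'))"
    using integrable_MM_u[of s'] s by (simp add: case_prod_beta')
  have eq: "u t x powr ?\<theta> * (u t x powr (1 + s')) powr (1 - ?\<theta>) = u t x powr (1 + s)" for t x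
  proof -
    have ex: "?\<theta> + (1 + s') * (1 - ?\<theta>) = 1 + s" using s by (simp add: field_simps)
    show ?thesis by (simp only: powr_powr powr_add[symmetric] ex)
  qed
  have "(LINT p|MM. u (fst p) (snd p) powr ?\<theta> * (u (fst p) (snd p) powr (1 + s')) powr (1 - ?\<theta>))
    \<le> (LINT p|MM. u (fst p) (snd p)) powr ?\<theta> * (LINT p|MM. u (fst p) (snd p) powr (1 + s')) powr (1 - ?\<theta>)"
    by (rule Holder_interpolation(2)[OF i0 _ i1 _ \<theta>]) (use moll_nonneg[OF eps] in auto)
  moreover have "(LINT p|MM. u (fst p) (snd p)) = 1"
    using J_0 by (simp add: J_def abs_u case_prod_beta')
  ultimately show ?thesis by (simp only: eq) (simp add: J_def case_prod_beta')
qed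

text \<open>Hoelder in space-time with weight 2/\<beta>: the first summand of the source
  interpolates between the mass and J (k \<gamma>), the second between the integral of
  \<open>bpow\<close>, at most B, and the same J (k \<gamma>), where \<gamma> = \<beta>/(\<beta> -
  2). Both leave the power 1 - 2/\<beta> = 1/\<gamma>, which is the form required by
  \<open>Moser_iteration\<close>.\<close>

lemma src_total:
  assumes k: "0 < k"
  shows "integrable MM (\<lambda>(t, x). srcp k t x)"
    and "integrable unit_time (\<lambda>t. LINT x|lborel. srcp k t x)"
    and "(LINT t|unit_time. LINT x|lborel. srcp k t x) \<le> 2 * B * J (k * (\<beta> / (\<beta> - 2))) powr (1 / (\<beta> / (\<beta> - 2)))"
proof -
  show i: "integrable MM (\<lambda>(t, x). srcp k t x)"
  proof (rule integrable_MM[where C="\<lambda>t. Q powr k + bbeta t + Q powr (k * \<beta> / (\<beta> - 2))"])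
    fix t assume g: "good t"
    show "integrable lborel (srcp k t)" by (rule src_slice(1)[OF g k])
    show "(LINT x|lborel. \<bar>srcp k t x\<bar>) \<le> Q powr k + bbeta t + Q powr (k * \<beta> / (\<beta> - 2))"
      using src_slice(2)[OF g k] by (simp add: srcp_nonneg)
  qed (use bbeta_integrable in auto)
  show "integrable unit_time (\<lambda>t. LINT x|lborel. srcp k t x)"
    using time_space.integrable_fst'[OF i] by simp
  let ?\<theta> = "2 / \<beta>" and ?s = "k * (\<beta> / (\<beta> - 2))"
  have \<theta>: "0 < ?\<theta>" "?\<theta> < 1" using beta by auto
  have s0: "0 \<le> ?s" using k beta by simp
  have inv: "1 / (\<beta> / (\<beta> - 2)) = 1 - ?\<theta>" using beta by (simp add: field_simps)
  have ex: "(1 + ?s) * (1 - ?\<theta>) = 1 + k - ?\<theta>" using beta by (simp add: field_simps)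
  note iu = integrable_MM_1
  have iss: "integrable MM (\<lambda>p. u (fst p) (snd p) powr (1 + ?s))"
    using integrable_MM_u[OF s0] by (simp add: case_prod_beta')
  have ib: "integrable MM (\<lambda>p. bpow \<epsilon> (fst p) (snd p))"
    using integrable_MM_bpow by (simp add: case_prod_beta')
  have eq1: "u t x powr ?\<theta> * (u t x powr (1 + ?s)) powr (1 - ?\<theta>) = u t x powr (1 + k)" for t x
    unfolding powr_powr ex powr_add[symmetric] by simp
  have eq2: "bpow \<epsilon> t x powr ?\<theta> * (u t x powr (1 + ?s)) powr (1 - ?\<theta>) = bpow \<epsilon> t x powr ?\<theta> * u t x powr (1 + k - ?\<theta>)" for t x
    unfolding powr_powr ex by simp
  note h1 = Holder_interpolation[OF iu _ iss _ \<theta>, unfolded eq1]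
  note h2 = Holder_interpolation[OF ib _ iss _ \<theta>, unfolded eq2]
  have nn: "0 \<le> u (fst p) (snd p)" "0 \<le> bpow \<epsilon> (fst p) (snd p)" "0 \<le> u (fst p) (snd p) powr r" for p r
    using moll_nonneg[OF eps] bpow_nonneg[OF eps] by auto
  have Js: "(LINT p|MM. u (fst p) (snd p) powr (1 + ?s)) = J ?s" by (simp add: J_def case_prod_beta')
  have J1: "(LINT p|MM. u (fst p) (snd p)) = 1"
    using J_0 by (simp add: J_def abs_u case_prod_beta')
  have "(LINT t|unit_time. LINT x|lborel. srcp k t x) = (LINT p|MM. srcp k (fst p) (snd p))"
    using time_space.integral_fst'[OF i] by (simp add: case_prod_beta')
  also have "\<dots> = (LINT p|MM. u (fst p) (snd p) powr (1 + k)) + (LINT p|MM. bpow \<epsilon> (fst p) (snd p) powr ?\<theta> * u (fst p) (snd p) powr (1 + k - ?\<theta>))"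
    unfolding srcp_def by (rule Bochner_Integration.integral_add[OF h1(1) h2(1)]) (use nn in auto)
  also have "\<dots> \<le> 1 powr ?\<theta> * J ?s powr (1 - ?\<theta>) + (LINT p|MM. bpow \<epsilon> (fst p) (snd p)) powr ?\<theta> * J ?s powr (1 - ?\<theta>)"
    using h1(2)[OF nn(1) nn(3)] h2(2)[OF nn(2) nn(3)] unfolding Js J1 by (rule add_mono)
  \<comment> \<open>B \<ge> 1 lets the single constant B replace both the mass, which is 1, and the
    power 2/\<beta> of the integral of \<open>bpow\<close>.\<close>
  also have "\<dots> \<le> B * J ?s powr (1 - ?\<theta>) + B * J ?s powr (1 - ?\<theta>)"
  proof (intro add_mono mult_right_mono)
    have "(LINT p|MM. bpow \<epsilon> (fst p) (snd p)) powr ?\<theta> \<le> B powr ?\<theta>"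
      using integral_MM_bpow \<theta> nn(2) by (intro powr_mono2) (auto simp: case_prod_beta')
    also have "\<dots> \<le> B powr 1" using B \<theta> by (intro powr_mono) auto
    finally show "(LINT p|MM. bpow \<epsilon> (fst p) (snd p)) powr ?\<theta> \<le> B" using B by simp
  qed (use B in auto)
  finally show "(LINT t|unit_time. LINT x|lborel. srcp k t x) \<le> 2 * B * J ?s powr (1 / (\<beta> / (\<beta> - 2)))"
    unfolding inv by simp
qed

lemma diss_integrable: "0 < k \<Longrightarrow> integrable unit_time (diss k)"
proof -
  assume k: "0 < k"
  show ?thesis
  proof (rule unit_time.integrable_const_bound[where B="(N * (N / \<epsilon>))\<^sup>2 * Q powr k"])
    show "AE t in unit_time. norm (diss k t) \<le> (N * (N / \<epsilon>))\<^sup>2 * Q powr k"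
      using AE_good
    proof eventually_elim
      case (elim t)
      interpret S: mollified_slice A b \<rho> \<rho>0 \<alpha> \<kappa> \<beta> M B U N \<epsilon> t Q by (rule slice[OF elim])
      show ?case using S.integrable_dissipation(2)[OF k] diss_nonneg[of k t] by (simp add: S.c1_def diss_def)
    qed
    show "diss k \<in> borel_measurable unit_time" unfolding diss_def[abs_def] by measurable
  qed
qed

lemma u0_bounds: "0 \<le> u0 x" "u0 x \<le> U" "integrable lborel u0" "(LINT x|lborel. u0 x) = 1"
proof -
  have [measurable]: "u0 \<in> borel_measurable borel" unfolding u0_def conv_def[abs_def] by measurable
  show "0 \<le> u0 x" unfolding u0_def conv_def
    by (intro Bochner_Integration.integral_nonneg) (simp add: rho0_nonneg kern_nonneg[OF eps])
  have "u0 x \<le> (LINT z|lborel. U * kern \<epsilon> (x - z))"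
    unfolding u0_def conv_def
  proof (rule integral_mono_AE)
    show "integrable lborel (\<lambda>z. \<rho>0 z * kern \<epsilon> (x - z))"
      by (rule integrable_conv[OF integrable_rho0 _ kern_abs_le]) simp
    show "AE z in lborel. \<rho>0 z * kern \<epsilon> (x - z) \<le> U * kern \<epsilon> (x - z)"
      using rho0_le by eventually_elim (simp add: mult_right_mono kern_nonneg[OF eps])
  qed (use integrable_kern_reflect[OF eps, of x] in simp)
  then show "u0 x \<le> U" by (simp add: integral_kern_reflect[OF eps])
  show "integrable lborel u0" "(LINT x|lborel. u0 x) = 1"
    unfolding u0_def using conv_L1[OF integrable_rho0 integrable_kern[OF eps]] integral_kern[OF eps, where 'a="real^'n"] integral_rho0
    by simp_all
qed

text \<open>For fixed x, \<open>convex_chain\<close> bounds the growth of u(t,x)^(1+k) by the time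
  integral of (1 + k) u^k times the rate. Integrating in x and interchanging the integrals brings in
  the fixed-time estimate \<open>energy_slice\<close>.\<close>

lemma energy:
  assumes k: "0 < k"
  defines "W \<equiv> U powr k + (1 + k) * k * Cr * (LINT t|unit_time. LINT x|lborel. srcp k t x)"
  shows "AE T in unit_time. (LINT x|lborel. u T x powr (1 + k))
      + (1 + k) * k * (\<alpha> / 2) * (LINT s|unit_time. indicator {..<T} s * diss k s) \<le> W"
proof -
  have [measurable]: "u0 \<in> borel_measurable borel" unfolding u0_def conv_def[abs_def] by measurable
  define R where "R s x = u s x powr k * rate \<epsilon> s x" for s x
  have Rm [measurable]: "case_prod R \<in> borel_measurable (borel \<Otimes>\<^sub>M borel)"
    unfolding R_def[abs_def] by measurable
  define cc where "cc t = Q powr k * (N * (N * ((3 * N + N\<^sup>2) / \<epsilon>\<^sup>2) * M + N / \<epsilon> * b_mass t))" for t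
  have RI: "integrable MM (\<lambda>(t, x). R t x)"
  proof (rule integrable_MM[where C=cc])
    fix t assume g: "good t"
    interpret S: mollified_slice A b \<rho> \<rho>0 \<alpha> \<kappa> \<beta> M B U N \<epsilon> t Q by (rule slice[OF g])
    show "integrable lborel (R t)" "(LINT x|lborel. \<bar>R t x\<bar>) \<le> cc t"
      using S.integrable_rate_power[OF k] by (simp_all add: R_def[abs_def] cc_def S.c1_def S.c2_def)
  next
    show "integrable unit_time cc"
      unfolding cc_def using integrable_b_mass by (simp add: b_mass_def)
  qed measurable
  have pt: "AE T in unit_time. u T x powr (1 + k) - u0 x powr (1 + k) \<le> (LINT s|unit_time. (if s < T then (1 + k) * R s x else 0))" for x
  proof -
    define v where "v t = u0 x + (LINT s|unit_time. indicator {..<t} s * rate \<epsilon> s x)" for t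
    have ode: "AE t in unit_time. u t x = v t"
      using mollified_ode[OF eps, of x] by (simp add: v_def u0_def)
    have vm: "v \<in> borel_measurable borel"
      unfolding v_def[abs_def] using integrable_primitive(1)[OF integrable_rate[OF eps]] by measurable
    show ?thesis using ode AE_unit_time
    proof eventually_elim
      case (elim T)
      have "(max 0 (v T)) powr (1 + k) - (max 0 (u0 x)) powr (1 + k)
        \<le> (LINT s|unit_time. indicator {..<T} s * (((1 + k) * (max 0 (v s)) powr k) * rate \<epsilon> s x))"
      proof (rule convex_chain[OF integrable_rate[OF eps], where h="\<lambda>y. (1 + k) * (max 0 y) powr k" and H="\<lambda>y. (max 0 y) powr (1 + k)"])
        show "continuous_on UNIV (\<lambda>y. (1 + k) * (max 0 y) powr k)"
          using k by (intro continuous_intros continuous_on_powr') auto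
      qed (use convex_power[OF k] elim in \<open>auto simp: v_def\<close>)
      also have "\<dots> = (LINT s|unit_time. (if s < T then (1 + k) * R s x else 0))"
      proof (rule integral_cong_AE)
        show "AE s in unit_time. indicator {..<T} s * (((1 + k) * (max 0 (v s)) powr k) * rate \<epsilon> s x) = (if s < T then (1 + k) * R s x else 0)"
          using ode
        proof eventually_elim
          case (elim s)
          have "max 0 (v s) = u s x" using elim moll_nonneg[OF eps, of s x] by simp
          then show ?case by (simp add: R_def indicator_def)
        qed
      qed (use vm in measurable)
      also have "max 0 (v T) = u T x" using elim(1) moll_nonneg[OF eps, of T x] by simp
      also have "max 0 (u0 x) = u0 x" using u0_bounds(1) by simp
      finally show ?case .
    qed
  qed
  define P where "P T x \<longleftrightarrow> u T x powr (1 + k) - u0 x powr (1 + k) \<le> (LINT s|unit_time. (if s < T then (1 + k) * R s x else 0))" for T x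
  \<comment> \<open>The inequality was obtained for each x outside a null set of times depending on
    x; joint measurability allows the two almost-everywhere quantifiers to be exchanged, so that x
    can be integrated out at a fixed T.\<close>
  have "AE T in unit_time. AE x in lborel. P T x"
  proof (subst time_space.AE_commute)
    show "{p \<in> space MM. P (fst p) (snd p)} \<in> sets MM"
      unfolding P_def by measurable
    show "AE x in lborel. AE T in unit_time. P T x" unfolding P_def using pt by simp
  qed
  then show ?thesis
    using AE_good
  proof eventually_elim
    case (elim T)
    interpret S: mollified_slice A b \<rho> \<rho>0 \<alpha> \<kappa> \<beta> M B U N \<epsilon> T Q by (rule slice[OF elim(2)])
    have RT: "integrable MM (\<lambda>(s, x). if s < T then (1 + k) * R s x else 0)"
    proof (rule Bochner_Integration.integrable_bound)
      show "integrable MM (\<lambda>p. (1 + k) * (case p of (s, x) \<Rightarrow> R s x))" by (rule integrable_mult_right[OF RI])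
      show "(\<lambda>(s, x). if s < T then (1 + k) * R s x else 0) \<in> borel_measurable MM" by measurable
    qed (auto simp: case_prod_beta')
    \<comment> \<open>The initial term interpolates between the bound U and mass 1, which costs only
      U^k.\<close>
    have i0: "integrable lborel (\<lambda>x. u0 x powr (1 + k))" and I0: "(LINT x|lborel. u0 x powr (1 + k)) \<le> U powr k"
    proof -
      have le: "u0 x powr (1 + k) \<le> U powr k * u0 x" for x
      proof -
        have "u0 x powr (1 + k) = u0 x powr k * u0 x"
          using u0_bounds(1)[of x] k by (cases "u0 x = 0") (auto simp: powr_add)
        also have "\<dots> \<le> U powr k * u0 x"
          using u0_bounds(1,2)[of x] k by (intro mult_right_mono powr_mono2) auto
        finally show ?thesis .
      qed
      show i: "integrable lborel (\<lambda>x. u0 x powr (1 + k))"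
        by (rule integrable_dominated[of _ "\<lambda>x. U powr k * u0 x"]) (use u0_bounds(3) le in auto)
      have "(LINT x|lborel. u0 x powr (1 + k)) \<le> (LINT x|lborel. U powr k * u0 x)"
        by (rule integral_mono[OF i _ le]) (use u0_bounds(3) in simp)
      then show "(LINT x|lborel. u0 x powr (1 + k)) \<le> U powr k" by (simp add: u0_bounds(4))
    qed
    have iu: "integrable lborel (\<lambda>x. u T x powr (1 + k))" using S.integrable_u_powr[of k] k by simp
    have "(LINT x|lborel. u T x powr (1 + k)) - (LINT x|lborel. u0 x powr (1 + k))
       = (LINT x|lborel. u T x powr (1 + k) - u0 x powr (1 + k))"
      using iu i0 by simp
    also have "\<dots> \<le> (LINT x|lborel. (LINT s|unit_time. (if s < T then (1 + k) * R s x else 0)))"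
    proof (rule integral_mono_AE)
      show "integrable lborel (\<lambda>x. LINT s|unit_time. (if s < T then (1 + k) * R s x else 0))"
        by (rule time_space.integrable_snd[OF RT])
    qed (use iu i0 elim(1) in \<open>auto simp: P_def\<close>)
    also have "\<dots> = (LINT s|unit_time. (LINT x|lborel. (if s < T then (1 + k) * R s x else 0)))"
      by (rule time_space.Fubini_integral[OF RT])
    \<comment> \<open>The source is kept also for s \<ge> T, where the left side is 0 and the source
      is nonnegative; this makes W independent of T. The dissipation is counted only up to
      T.\<close>
    also have "\<dots> \<le> (LINT s|unit_time. (1 + k) * k * (Cr * (LINT x|lborel. srcp k s x)) - (1 + k) * k * (\<alpha> / 2) * (indicator {..<T} s * diss k s))"
    proof (rule integral_mono_AE)
      show "integrable unit_time (\<lambda>s. LINT x|lborel. (if s < T then (1 + k) * R s x else 0))"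
        using time_space.integrable_fst'[OF RT] by simp
      have "integrable unit_time (\<lambda>s. indicator {..<T} s * diss k s)"
        using integrable_mult_indicator[OF _ diss_integrable[OF k], of "{..<T}"] by simp
      then show "integrable unit_time (\<lambda>s. (1 + k) * k * (Cr * (LINT x|lborel. srcp k s x)) - (1 + k) * k * (\<alpha> / 2) * (indicator {..<T} s * diss k s))"
        using src_total(2)[OF k] by simp
      show "AE s in unit_time. (LINT x|lborel. (if s < T then (1 + k) * R s x else 0))
        \<le> (1 + k) * k * (Cr * (LINT x|lborel. srcp k s x)) - (1 + k) * k * (\<alpha> / 2) * (indicator {..<T} s * diss k s)"
        using AE_good
      proof eventually_elim
        case (elim s)
        have src0: "0 \<le> (LINT x|lborel. srcp k s x)"
          by (intro Bochner_Integration.integral_nonneg) (simp add: srcp_nonneg)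
        show ?case
        proof (cases "s < T")
          case True
          have "(1 + k) * (LINT x|lborel. u s x powr k * rate \<epsilon> s x) \<le> (1 + k) * (k * (Cr * (LINT x|lborel. srcp k s x) - \<alpha> / 2 * diss k s))"
            using k src_slice(3)[OF elim k] by (intro mult_left_mono) auto
          moreover have "(LINT x|lborel. (if s < T then (1 + k) * R s x else 0)) = (1 + k) * (LINT x|lborel. u s x powr k * rate \<epsilon> s x)"
            using True by (simp add: R_def)
          moreover have "indicator {..<T} s * diss k s = diss k s" using True by simp
          moreover have "(1 + k) * (k * (Cr * (LINT x|lborel. srcp k s x) - \<alpha> / 2 * diss k s))
            = (1 + k) * k * (Cr * (LINT x|lborel. srcp k s x)) - (1 + k) * k * (\<alpha> / 2) * diss k s"
            by (simp only: right_diff_distrib mult.assoc)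
          ultimately show ?thesis by (simp only:)
        next
          case False
          have "0 \<le> (1 + k) * k * (Cr * (LINT x|lborel. srcp k s x))" using src0 k Cr_nonneg by simp
          moreover have "(LINT x|lborel. (if s < T then (1 + k) * R s x else 0)) = 0" "indicator {..<T} s * diss k s = 0"
            using False by simp_all
          ultimately show ?thesis by (simp only: mult_zero_right diff_zero)
        qed
      qed
    qed
    also have "\<dots> = (1 + k) * k * Cr * (LINT t|unit_time. LINT x|lborel. srcp k t x)
        - (1 + k) * k * (\<alpha> / 2) * (LINT s|unit_time. indicator {..<T} s * diss k s)"
      using src_total(2)[OF k] integrable_mult_indicator[OF _ diss_integrable[OF k], of "{..<T}"]
      by (subst Bochner_Integration.integral_diff) (simp_all add: mult.assoc)
    finally show ?case using I0 unfolding W_def by linarith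
  qed
qed

text \<open>The energy bound holds for almost every T and hence along a sequence of times tending to
  1. The primitive of the dissipation is continuous in T, so the bound extends to the dissipation
  over the whole interval.\<close>

lemma energy_consequences:
  assumes k: "0 < k"
  defines "W \<equiv> U powr k + (1 + k) * k * Cr * (LINT t|unit_time. LINT x|lborel. srcp k t x)"
  shows "1 \<le> W" and "AE T in unit_time. (LINT x|lborel. u T x powr (1 + k)) \<le> W"
    and "(1 + k) * k * (\<alpha> / 2) * (LINT s|unit_time. diss k s) \<le> W"
proof -
  have s0: "0 \<le> (LINT t|unit_time. LINT x|lborel. srcp k t x)"
    by (intro Bochner_Integration.integral_nonneg) (simp add: srcp_nonneg)
  have "1 \<le> U powr k" using U k by (intro ge_one_powr_ge_zero) auto
  moreover have "0 \<le> (1 + k) * k * Cr * (LINT t|unit_time. LINT x|lborel. srcp k t x)"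
    using s0 k Cr_nonneg by simp
  ultimately show W1: "1 \<le> W" unfolding W_def by linarith
  have en: "AE T in unit_time. (LINT x|lborel. u T x powr (1 + k))
      + (1 + k) * k * (\<alpha> / 2) * (LINT s|unit_time. indicator {..<T} s * diss k s) \<le> W"
    unfolding W_def by (rule energy[OF k])
  have a0: "0 \<le> (1 + k) * k * (\<alpha> / 2)" using k alpha by simp
  have d0: "0 \<le> (LINT s|unit_time. indicator {..<T} s * diss k s)" for T
    by (intro Bochner_Integration.integral_nonneg) (simp add: diss_nonneg)
  show "AE T in unit_time. (LINT x|lborel. u T x powr (1 + k)) \<le> W"
    using en
  proof eventually_elim
    case (elim T)
    then show ?case using mult_nonneg_nonneg[OF a0 d0[of T]] by linarith
  qed
  define f where "f T = 0 + (LINT s|unit_time. indicator {..<T} s * diss k s)" for T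
  have fc: "isCont f 1"
    using continuous_primitive[OF diss_integrable[OF k], of 0] by (simp add: f_def[abs_def] continuous_on_eq_continuous_at)
  have ae: "AE T in unit_time. (1 + k) * k * (\<alpha> / 2) * f T \<le> W"
    using en
  proof eventually_elim
    case (elim T)
    have "0 \<le> (LINT x|lborel. u T x powr (1 + k))" by (intro Bochner_Integration.integral_nonneg) auto
    moreover have "(LINT x|lborel. u T x powr (1 + k)) + (1 + k) * k * (\<alpha> / 2) * f T \<le> W"
      using elim by (simp only: f_def add_0)
    ultimately show ?case by linarith
  qed
  have "\<exists>T. \<forall>n. T n \<in> {1 - 1 / Suc n<..<1} \<and> (1 + k) * k * (\<alpha> / 2) * f (T n) \<le> W"
  proof (rule choice, rule allI)
    fix n :: nat
    show "\<exists>T. T \<in> {1 - 1 / Suc n<..<1} \<and> (1 + k) * k * (\<alpha> / 2) * f T \<le> W"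
      using AE_unit_time_near_1[OF ae, of "1 / Suc n"] by (auto simp: field_simps)
  qed
  then obtain T where T: "\<And>n. T n \<in> {1 - 1 / Suc n<..<1}" "\<And>n. (1 + k) * k * (\<alpha> / 2) * f (T n) \<le> W" by blast
  have "T \<longlonglongrightarrow> 1"
  proof (rule tendsto_sandwich[of "\<lambda>n. 1 - 1 / real (Suc n)" _ _ "\<lambda>n. 1"])
    show "(\<lambda>n. 1 - 1 / real (Suc n)) \<longlonglongrightarrow> 1"
      using tendsto_diff[OF tendsto_const[of 1] LIMSEQ_inverse_real_of_nat] by (simp add: inverse_eq_divide)
  qed (use T(1) in \<open>auto intro!: always_eventually less_imp_le\<close>)
  then have "(\<lambda>n. (1 + k) * k * (\<alpha> / 2) * f (T n)) \<longlonglongrightarrow> (1 + k) * k * (\<alpha> / 2) * f 1"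
    by (intro tendsto_intros isCont_tendsto_compose[OF fc])
  then have "(1 + k) * k * (\<alpha> / 2) * f 1 \<le> W"
    by (rule LIMSEQ_le_const2) (use T(2) in blast)
  moreover have "f 1 = (LINT s|unit_time. diss k s)"
  proof -
    have [measurable]: "diss k \<in> borel_measurable borel"
      using borel_measurable_integrable[OF diss_integrable[OF k]] by simp
    have "(LINT s|unit_time. indicator {..<1} s * diss k s) = (LINT s|unit_time. diss k s)"
    proof (rule integral_cong_AE)
      show "AE s in unit_time. indicator {..<1} s * diss k s = diss k s"
        using AE_unit_time by eventually_elim (auto simp: indicator_def)
    qed auto
    then show ?thesis by (simp add: f_def)
  qed
  ultimately show "(1 + k) * k * (\<alpha> / 2) * (LINT s|unit_time. diss k s) \<le> W" by simp
qed

end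

section \<open>The moment recursion and the passage from moments to a supremum bound\<close>

context mollified
begin

text \<open>At almost every time the Sobolev inequality is applied to w = u^((1+k)/2): the square of
  w is u^(1+k), with integral at most W, and the squared gradient of w integrates to a multiple of
  the dissipation. The Sobolev inequality is a hypothesis here so that its constant C can be chosen
  before \<epsilon>.\<close>

lemma Sobolev_step:
  assumes k: "1 \<le> k" and q: "1 < q" and C: "1 \<le> C"
    and sobolev: "\<And>(w::real^'n \<Rightarrow> real) g Dw W G. \<lbrakk>w \<in> borel_measurable borel; g \<in> borel_measurable borel;
      \<And>x y s. ((\<lambda>s. w (x + s *\<^sub>R y)) has_real_derivative Dw y (x + s *\<^sub>R y)) (at s);
      \<And>y. continuous_on UNIV (Dw y); \<And>x y. \<bar>Dw y x\<bar> \<le> norm y * g x; 0 < W; 0 \<le> G;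
      (\<integral>\<^sup>+x. ennreal ((w x)\<^sup>2) \<partial>lborel) \<le> ennreal W; (\<integral>\<^sup>+x. ennreal ((g x)\<^sup>2) \<partial>lborel) \<le> ennreal G\<rbrakk> \<Longrightarrow>
      (\<integral>\<^sup>+x. ennreal ((w x)\<^sup>2 powr q) \<partial>lborel) \<le> ennreal (C * W powr (q - 1) * (W + G))"
  defines "W \<equiv> U powr k + (1 + k) * k * Cr * (LINT t|unit_time. LINT x|lborel. srcp k t x)"
  shows "J ((k + 1) * q - 1) \<le> C * (1 + 1 / \<alpha>) * W powr q"
proof -
  have k0: "0 < k" using k by simp
  note ec = energy_consequences[OF k0, folded W_def]
  define s where "s = (k + 1) * q - 1"
  have s: "0 \<le> s" "1 + s = (1 + k) * q"
  proof -
    have "1 * 1 \<le> (k + 1) * q" using k q by (intro mult_mono) auto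
    then show "0 \<le> s" by (simp add: s_def)
  qed (simp add: s_def add.commute)
  define G where "G T = (1 + k)\<^sup>2 / 4 * diss k T" for T
  have G0: "0 \<le> G T" for T by (simp add: G_def diss_nonneg)
  have "AE T in unit_time. (LINT x|lborel. u T x powr (1 + s)) \<le> C * W powr (q - 1) * (W + G T)"
    using ec(2) AE_good
  proof eventually_elim
    case (elim T)
    interpret S: mollified_slice A b \<rho> \<rho>0 \<alpha> \<kappa> \<beta> M B U N \<epsilon> T Q by (rule slice[OF elim(2)])
    let ?w = "\<lambda>x. u T x powr ((1 + k) / 2)"
    let ?g = "\<lambda>x. (1 + k) / 2 * (u T x powr ((k - 1) / 2) * norm (grad \<epsilon> T x))"
    let ?D = "\<lambda>y x. (1 + k) / 2 * u T x powr ((1 + k) / 2 - 1) * dmoll \<epsilon> T y x"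
    have w2: "(?w x)\<^sup>2 = u T x powr (1 + k)" for x
      by (simp add: power2_eq_square flip: powr_add)
    have g2: "(?g x)\<^sup>2 = (1 + k)\<^sup>2 / 4 * (u T x powr (k - 1) * (norm (grad \<epsilon> T x))\<^sup>2)" for x
    proof -
      have "(u T x powr ((k - 1) / 2))\<^sup>2 = u T x powr (k - 1)" by (simp add: power2_eq_square flip: powr_add)
      then show ?thesis by (simp add: power_mult_distrib power_divide)
    qed
    have "(\<integral>\<^sup>+x. ennreal ((?w x)\<^sup>2 powr q) \<partial>lborel) \<le> ennreal (C * W powr (q - 1) * (W + G T))"
    proof (rule sobolev[where g="?g" and Dw="?D"])
      show "((\<lambda>s. ?w (x + s *\<^sub>R y)) has_real_derivative ?D y (x + s *\<^sub>R y)) (at s)" for x y s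
        by (rule powr_line_derivative[where u="u T" and x=x and v=y and du="dmoll \<epsilon> T y" and s=s and r="(1 + k) / 2", OF S.u_line S.u_pos])
      have "u T x \<noteq> 0" for x using S.u_pos[of x] by simp
      then show "continuous_on UNIV (?D y)" for y
        by (intro continuous_intros S.continuous_u S.continuous_dmoll) auto
      show "\<bar>?D y x\<bar> \<le> norm y * ?g x" for x y
      proof -
        have e: "(1 + k) / 2 - 1 = (k - 1) / 2" by (simp add: field_simps)
        have "\<bar>dmoll \<epsilon> T y x\<bar> \<le> norm (grad \<epsilon> T x) * norm y"
          unfolding S.dmoll_grad by (rule Cauchy_Schwarz_ineq2)
        then have "((1 + k) / 2 * u T x powr ((k - 1) / 2)) * \<bar>dmoll \<epsilon> T y x\<bar> \<le> ((1 + k) / 2 * u T x powr ((k - 1) / 2)) * (norm (grad \<epsilon> T x) * norm y)"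
          using k by (intro mult_left_mono) auto
        moreover have "\<bar>?D y x\<bar> = ((1 + k) / 2 * u T x powr ((k - 1) / 2)) * \<bar>dmoll \<epsilon> T y x\<bar>"
          unfolding e using k by (simp add: abs_mult)
        ultimately show ?thesis by (simp only: mult_ac)
      qed
      show "0 < W" using ec(1) by simp
      show "0 \<le> G T" by (rule G0)
      have "(\<integral>\<^sup>+x. ennreal ((?w x)\<^sup>2) \<partial>lborel) = ennreal (LINT x|lborel. u T x powr (1 + k))"
        unfolding w2 using S.integrable_u_powr[of k] k by (intro nn_integral_eq_integral) auto
      then show "(\<integral>\<^sup>+x. ennreal ((?w x)\<^sup>2) \<partial>lborel) \<le> ennreal W" using elim(1) by (simp add: ennreal_leI)
      have "(\<integral>\<^sup>+x. ennreal ((?g x)\<^sup>2) \<partial>lborel) = ennreal (LINT x|lborel. (1 + k)\<^sup>2 / 4 * (u T x powr (k - 1) * (norm (grad \<epsilon> T x))\<^sup>2))"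
        unfolding g2 using S.integrable_dissipation(1)[OF k0] by (intro nn_integral_eq_integral integrable_mult_right) auto
      also have "(LINT x|lborel. (1 + k)\<^sup>2 / 4 * (u T x powr (k - 1) * (norm (grad \<epsilon> T x))\<^sup>2)) = G T"
        unfolding G_def diss_def by (rule integral_mult_right_zero)
      finally show "(\<integral>\<^sup>+x. ennreal ((?g x)\<^sup>2) \<partial>lborel) \<le> ennreal (G T)" by simp
    qed measurable
    moreover have "(\<integral>\<^sup>+x. ennreal ((?w x)\<^sup>2 powr q) \<partial>lborel) = ennreal (LINT x|lborel. u T x powr (1 + s))"
      unfolding w2 powr_powr s(2)[symmetric] using S.integrable_u_powr[OF s(1)] by (intro nn_integral_eq_integral) auto
    moreover have "0 \<le> C * W powr (q - 1) * (W + G T)" using C ec(1) G0[of T] by simp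
    ultimately show ?case by (simp add: ennreal_le_iff)
  qed
  note ae = this
  have Gi: "integrable unit_time G" unfolding G_def using diss_integrable[OF k0] by simp
  have "J s = (LINT T|unit_time. LINT x|lborel. u T x powr (1 + s))"
    unfolding J_def using time_space.integral_fst'[OF integrable_MM_u[OF s(1)]] by simp
  also have "\<dots> \<le> (LINT T|unit_time. C * W powr (q - 1) * (W + G T))"
  proof (rule integral_mono_AE[OF _ _ ae])
    show "integrable unit_time (\<lambda>T. LINT x|lborel. u T x powr (1 + s))"
      using time_space.integrable_fst'[OF integrable_MM_u[OF s(1)]] by simp
  qed (use Gi in simp)
  also have "\<dots> = C * W powr (q - 1) * (W + (LINT T|unit_time. G T))"
    using Gi by (simp add: measure_def emeasure_unit_time)
  also have "\<dots> \<le> C * W powr (q - 1) * (W + W / \<alpha>)"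
  proof (intro mult_left_mono add_left_mono)
    let ?D = "LINT T|unit_time. diss k T"
    \<comment> \<open>Rewrites the factor (1+k)^2/4 of the gradient so that the dissipation appears
      with its weight in the energy inequality. The remaining quotient (1 + k)/(2 k \<alpha>) is at
      most 1/\<alpha> because k \<ge> 1.\<close>
    have "(LINT T|unit_time. G T) = (1 + k) / (2 * k * \<alpha>) * ((1 + k) * k * (\<alpha> / 2) * ?D)"
    proof -
      have "(LINT T|unit_time. G T) = (1 + k)\<^sup>2 / 4 * ?D"
        unfolding G_def by (rule integral_mult_right_zero)
      also have "(1 + k)\<^sup>2 / 4 = (1 + k) / (2 * k * \<alpha>) * ((1 + k) * k * (\<alpha> / 2))"
        using k alpha by (simp add: field_simps power2_eq_square)
      finally show ?thesis by (simp only: mult.assoc)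
    qed
    also have "\<dots> \<le> (1 + k) / (2 * k * \<alpha>) * W"
      using ec(3) k alpha by (intro mult_left_mono) auto
    also have "\<dots> \<le> 1 / \<alpha> * W"
      using k alpha ec(1) by (intro mult_right_mono) (auto simp: field_simps)
    finally show "(LINT T|unit_time. G T) \<le> W / \<alpha>" by simp
  qed (use C in auto)
  also have "\<dots> = C * (1 + 1 / \<alpha>) * (W powr (q - 1) * W)" by (simp add: algebra_simps)
  also have "W powr (q - 1) * W = W powr q"
  proof -
    have "W powr 1 = W" using ec(1) by simp
    then show ?thesis using powr_add[of W "q - 1" 1] by simp
  qed
  finally show ?thesis by (simp add: s_def)
qed

text \<open>Brings W into the shape expected by \<open>Moser_iteration\<close>: the growth in k is
  only polynomial, since (1 + k) k \<le> (k + 1)^2, and all else is a constant independent of k and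
  \<epsilon>.\<close>

lemma source_bound:
  assumes k: "1 \<le> k"
  shows "U powr k + (1 + k) * k * Cr * (LINT t|unit_time. LINT x|lborel. srcp k t x)
    \<le> (k + 1) powr 2 * (1 + 2 * Cr * B) * (U powr k + J (k * (\<beta> / (\<beta> - 2))) powr (1 / (\<beta> / (\<beta> - 2))))"
proof -
  let ?S = "LINT t|unit_time. LINT x|lborel. srcp k t x" and ?J = "J (k * (\<beta> / (\<beta> - 2))) powr (1 / (\<beta> / (\<beta> - 2)))"
  have S: "0 \<le> ?S" "?S \<le> 2 * B * ?J"
    using src_total(3)[of k] k by (auto intro!: Bochner_Integration.integral_nonneg simp: srcp_nonneg)
  have kk: "(1 + k) * k \<le> (k + 1) powr 2" "1 \<le> (k + 1) powr 2"
    using k by (auto simp: powr_numeral power2_eq_square algebra_simps intro: add_increasing)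
  have "(1 + k) * k * Cr * ?S \<le> (k + 1) powr 2 * Cr * (2 * B * ?J)"
    using kk S Cr_nonneg k by (intro mult_mono) auto
  moreover have "U powr k \<le> (k + 1) powr 2 * U powr k"
    using mult_right_mono[OF kk(2), of "U powr k"] by simp
  ultimately have "U powr k + (1 + k) * k * Cr * ?S \<le> (k + 1) powr 2 * (U powr k + 2 * Cr * B * ?J)"
    by (simp add: algebra_simps)
  also have "\<dots> \<le> (k + 1) powr 2 * ((1 + 2 * Cr * B) * (U powr k + ?J))"
  proof (intro mult_left_mono)
    have "0 \<le> 2 * Cr * B * U powr k" "0 \<le> ?J" using Cr_nonneg B by auto
    then show "U powr k + 2 * Cr * B * ?J \<le> (1 + 2 * Cr * B) * (U powr k + ?J)"
      by (simp add: algebra_simps)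
  qed simp
  finally show ?thesis by (simp add: mult.assoc)
qed

text \<open>Chebyshev's inequality: where u > 2 K one has u \<le> u^(1+s) / (2 K)^s, so the integral
  of u over that set is at most J s / (2 K)^s \<le> 2^(-s), which tends to 0 along the given
  orders.\<close>

lemma bounded_of_moments:
  assumes K: "1 \<le> K" and s: "filterlim s at_top sequentially" and le: "\<And>n. J (s n) \<le> K powr s n" and s0: "\<And>n. 0 < s n"
  shows "AE p in MM. u (fst p) (snd p) \<le> 2 * K"
proof -
  let ?S = "{p. 2 * K < u (fst p) (snd p)}"
  have Sm [measurable]: "?S \<in> sets MM" 
  proof -
    have "{p \<in> space MM. 2 * K < u (fst p) (snd p)} \<in> sets MM" by measurable
    then show ?thesis by (simp add: space_pair_measure)
  qed
  let ?f = "\<lambda>p. indicator ?S p * u (fst p) (snd p)"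
  have i: "integrable MM ?f"
    using integrable_mult_indicator[OF Sm integrable_MM_1] by simp
  have le2: "(LINT p|MM. ?f p) \<le> (1 / 2) powr s n" for n
  proof -
    have "(LINT p|MM. ?f p) \<le> (LINT p|MM. u (fst p) (snd p) powr (1 + s n) / (2 * K) powr s n)"
    proof (rule integral_mono[OF i])
      show "integrable MM (\<lambda>p. u (fst p) (snd p) powr (1 + s n) / (2 * K) powr s n)"
        using integrable_MM_u[of "s n"] s0[of n] by (simp add: case_prod_beta')
      fix p
      show "?f p \<le> u (fst p) (snd p) powr (1 + s n) / (2 * K) powr s n"
      proof (cases "p \<in> ?S")
        case True
        then have g: "2 * K < u (fst p) (snd p)" by simp
        then have "(2 * K) powr s n \<le> u (fst p) (snd p) powr s n"
          using K s0[of n] by (intro powr_mono2) auto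
        then have "(2 * K) powr s n * u (fst p) (snd p) \<le> u (fst p) (snd p) powr s n * u (fst p) (snd p)"
          using g K by (intro mult_right_mono) auto
        also have "\<dots> = u (fst p) (snd p) powr (1 + s n)" using g K by (simp add: powr_add)
        finally show ?thesis using True K by (simp add: field_simps)
      qed simp
    qed
    also have "\<dots> = J (s n) / (2 * K) powr s n" by (simp add: J_def case_prod_beta')
    also have "\<dots> \<le> K powr s n / (2 * K) powr s n" using le[of n] by (intro divide_right_mono) auto
    also have "\<dots> = (1 / 2) powr s n" using K by (simp add: powr_mult powr_divide)
    finally show ?thesis .
  qed
  have "((\<lambda>x::real. (1 / 2) powr x) \<longlongrightarrow> 0) at_top"
  proof -
    have "LIM x at_top. ln (1 / 2 :: real) * x :> at_bot"
      by (rule filterlim_tendsto_neg_mult_at_bot[OF tendsto_const]) (auto simp: filterlim_ident ln_div)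
    then have "((\<lambda>x. exp (ln (1 / 2 :: real) * x)) \<longlongrightarrow> 0) at_top"
      by (rule filterlim_compose[OF exp_at_bot])
    then show ?thesis by (simp add: powr_def mult.commute)
  qed
  then have "(\<lambda>n. (1 / 2) powr s n) \<longlonglongrightarrow> 0" using s by (rule filterlim_compose)
  then have "(LINT p|MM. ?f p) \<le> 0"
    by (rule LIMSEQ_le_const) (use le2 in blast)
  moreover have nn: "0 \<le> ?f p" for p using moll_nonneg[OF eps] by simp
  ultimately have "(LINT p|MM. ?f p) = 0"
    by (meson Bochner_Integration.integral_nonneg order_antisym)
  then have "AE p in MM. ?f p = 0"
    by (rule integral_nonneg_eq_0_iff_AE[THEN iffD1, rotated 2]) (use i nn in auto)
  then show ?thesis
  proof eventually_elim
    case (elim p)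
    then show ?case using K by (cases "p \<in> ?S") auto
  qed
qed

end

section \<open>The bound uniform in the mollification scale\<close>

context fokker_planck
begin

text \<open>The hypothesis says that \<gamma> = \<beta>/(\<beta> - 2) lies below 1 + 2/N, so a
  number q fits strictly between: q < 1 + 2/N is the range of the Sobolev inequality and q >
  \<gamma> makes the orders in Moser's iteration grow. The constants C, C' and K are all fixed
  before \<epsilon> is.\<close>

lemma uniform_bound:
  assumes big: "N + 2 < \<beta>"
  shows "\<exists>K\<ge>0. \<forall>\<epsilon>>0. AE p in unit_time \<Otimes>\<^sub>M lborel. moll \<epsilon> (fst p) (snd p) \<le> K"
proof -
  define \<gamma> where "\<gamma> = \<beta> / (\<beta> - 2)"
  have N1: "1 \<le> N" unfolding N_def by (simp add: Suc_le_eq del: card_N)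
  have \<gamma>: "1 < \<gamma>" "\<gamma> < 1 + 2 / N"
    using beta big N1 by (auto simp: \<gamma>_def field_simps)
  define q where "q = (\<gamma> + (1 + 2 / N)) / 2"
  have q: "\<gamma> < q" "q < 1 + 2 / N" using \<gamma> by (auto simp: q_def)
  have q2: "1 < q" "real DIM(real^'n) * (q - 1) < 2"
  proof -
    show "1 < q" using \<gamma> q by simp
    have "N * (q - 1) < N * (2 / N)" using q N1 by (intro mult_strict_left_mono) auto
    then show "real DIM(real^'n) * (q - 1) < 2" using N1 by simp
  qed
  from Sobolev_inequality[OF q2] obtain C where sobC: "1 \<le> C \<and> (\<forall>(w::real^'n \<Rightarrow> real) g Dw W G. w \<in> borel_measurable borel \<longrightarrow> g \<in> borel_measurable borel \<longrightarrow>
    (\<forall>x y s. ((\<lambda>s. w (x + s *\<^sub>R y)) has_real_derivative Dw y (x + s *\<^sub>R y)) (at s)) \<longrightarrow>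
    (\<forall>y. continuous_on UNIV (Dw y)) \<longrightarrow> (\<forall>x y. \<bar>Dw y x\<bar> \<le> norm y * g x) \<longrightarrow> 0 < W \<longrightarrow> 0 \<le> G \<longrightarrow>
    (\<integral>\<^sup>+x. ennreal ((w x)\<^sup>2) \<partial>lborel) \<le> ennreal W \<longrightarrow> (\<integral>\<^sup>+x. ennreal ((g x)\<^sup>2) \<partial>lborel) \<le> ennreal G \<longrightarrow>
    (\<integral>\<^sup>+x. ennreal ((w x)\<^sup>2 powr q) \<partial>lborel) \<le> ennreal (C * W powr (q - 1) * (W + G)))"
    by (elim exE)
  note C = sobC[THEN conjunct1] and sob = sobC[THEN conjunct2]
  define cr where "cr = ((2 * N ^ 3 * \<kappa>)\<^sup>2 + N\<^sup>2) / \<alpha>"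
  have cr: "0 \<le> cr" using alpha by (simp add: cr_def)
  define D where "D = 1 + 2 * cr * B"
  have D: "1 \<le> D" using cr B by (simp add: D_def)
  \<comment> \<open>The power D^q comes from raising the bound of \<open>source_bound\<close> to the
    power q; the factor (k+1)^2 there becomes (k+1)^(2q), so \<open>Moser_iteration\<close> is used
    with c = 2 q.\<close>
  define C' where "C' = C * (1 + 1 / \<alpha>) * D powr q"
  have C': "1 \<le> C'"
  proof -
    have "1 * 1 * 1 \<le> C * (1 + 1 / \<alpha>) * D powr q"
      using C alpha D q2 by (intro mult_mono ge_one_powr_ge_zero) auto
    then show ?thesis by (simp add: C'_def)
  qed
  have "0 \<le> 2 * q" using q2 by simp
  from Moser_iteration[OF C' this U \<gamma>(1) q(1)]
  obtain K where KM: "1 \<le> K \<and> (\<forall>J :: real \<Rightarrow> real. (\<forall>s>0. 0 \<le> J s) \<longrightarrow> (\<forall>s>0. \<forall>s'\<ge>s. J s \<le> J s' powr (s / s')) \<longrightarrow>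
     (\<forall>k\<ge>1. J ((k + 1) * q - 1) \<le> C' * (k + 1) powr (2 * q) * (U powr k + J (k * \<gamma>) powr (1 / \<gamma>)) powr q) \<longrightarrow>
     (\<forall>n. J (\<gamma> * (q / \<gamma>) ^ n) \<le> K powr (\<gamma> * (q / \<gamma>) ^ n)))"
    by (elim exE)
  note K = KM[THEN conjunct1] and moser = KM[THEN conjunct2, THEN spec, THEN mp, THEN mp, THEN mp]
  have "AE p in unit_time \<Otimes>\<^sub>M lborel. moll \<epsilon> (fst p) (snd p) \<le> 2 * K" if e: "0 < \<epsilon>" for \<epsilon>
  proof -
    obtain Q where Q: "\<And>y::real^'n. kern \<epsilon> y \<le> Q" using kern_bounded[OF e] by blast
    interpret S: mollified A b \<rho> \<rho>0 \<alpha> \<kappa> \<beta> M B U N \<epsilon> Q by unfold_locales (use e Q in auto)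
    have "\<forall>n. S.J (\<gamma> * (q / \<gamma>) ^ n) \<le> K powr (\<gamma> * (q / \<gamma>) ^ n)"
    proof (rule moser)
      show "\<forall>s>0. 0 \<le> S.J s" using S.J_nonneg by blast
      show "\<forall>s>0. \<forall>s'\<ge>s. S.J s \<le> S.J s' powr (s / s')" using S.J_mono by blast
      show "\<forall>k\<ge>1. S.J ((k + 1) * q - 1) \<le> C' * (k + 1) powr (2 * q) * (U powr k + S.J (k * \<gamma>) powr (1 / \<gamma>)) powr q"
      proof (intro allI impI)
        fix k :: real assume k: "1 \<le> k"
        let ?W = "U powr k + (1 + k) * k * S.Cr * (LINT t|unit_time. LINT x|lborel. S.srcp k t x)"
        let ?E = "U powr k + S.J (k * \<gamma>) powr (1 / \<gamma>)"
        have "S.J ((k + 1) * q - 1) \<le> C * (1 + 1 / \<alpha>) * ?W powr q"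
        proof (rule S.Sobolev_step[OF k q2(1) C])
          fix w :: "real^'n \<Rightarrow> real" and g Dw W G
          assume "w \<in> borel_measurable borel" "g \<in> borel_measurable borel"
            "\<And>x y s. ((\<lambda>s. w (x + s *\<^sub>R y)) has_real_derivative Dw y (x + s *\<^sub>R y)) (at s)"
            "\<And>y. continuous_on UNIV (Dw y)" "\<And>x y. \<bar>Dw y x\<bar> \<le> norm y * g x" "0 < W" "0 \<le> G"
            "(\<integral>\<^sup>+x. ennreal ((w x)\<^sup>2) \<partial>lborel) \<le> ennreal W" "(\<integral>\<^sup>+x. ennreal ((g x)\<^sup>2) \<partial>lborel) \<le> ennreal G"
          then show "(\<integral>\<^sup>+x. ennreal ((w x)\<^sup>2 powr q) \<partial>lborel) \<le> ennreal (C * W powr (q - 1) * (W + G))"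
            by (intro sob[rule_format, of w g Dw W G]) auto
        qed
        also have "?W powr q \<le> ((k + 1) powr 2 * D * ?E) powr q"
        proof (rule powr_mono2)
          show "0 \<le> ?W" using S.energy_consequences(1)[of k] k by simp
          have "S.Cr = cr" by (simp add: S.Cr_def cr_def)
          then show "?W \<le> (k + 1) powr 2 * D * ?E"
            using S.source_bound[OF k] by (simp add: D_def \<gamma>_def)
        qed (use q2 in simp)
        also have "((k + 1) powr 2 * D * ?E) powr q = (k + 1) powr (2 * q) * (D powr q * ?E powr q)"
        proof -
          have "((k + 1) powr 2 * D * ?E) powr q = ((k + 1) powr 2) powr q * D powr q * ?E powr q"
            using k D by (subst powr_mult, simp, simp, subst powr_mult) simp_all
          then show ?thesis using k by (simp only: powr_powr mult.assoc)
        qed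
        finally have "S.J ((k + 1) * q - 1) \<le> C * (1 + 1 / \<alpha>) * ((k + 1) powr (2 * q) * (D powr q * ?E powr q))"
          using C alpha by (simp add: mult_left_mono)
        then show "S.J ((k + 1) * q - 1) \<le> C' * (k + 1) powr (2 * q) * ?E powr q"
          by (simp only: C'_def mult_ac)
      qed
    qed
    moreover have "filterlim (\<lambda>n. \<gamma> * (q / \<gamma>) ^ n) at_top sequentially"
    proof -
      have "LIM n sequentially. (q / \<gamma>) ^ n :> at_top"
        by (rule filterlim_at_infinity_imp_filterlim_at_top[OF filterlim_realpow_sequentially_gt1])
          (use \<gamma> q in \<open>auto intro!: always_eventually\<close>)
      then show ?thesis
        using \<gamma> by (intro filterlim_tendsto_pos_mult_at_top[OF tendsto_const]) auto
    qed
    ultimately show ?thesis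
      using \<gamma> q by (intro S.bounded_of_moments[OF K, of "\<lambda>n. \<gamma> * (q / \<gamma>) ^ n"]) auto
  qed
  then show ?thesis using K by (intro exI[of _ "2 * K"]) auto
qed

end

section \<open>Removal of the mollification\<close>

text \<open>Off the ball of radius \<delta> the unnormalised kernel is at most (1 + 1/\<delta>^2)^d
  times the one for \<epsilon> = 1, uniformly in \<epsilon>. On the ball of radius \<epsilon> it is
  at least (2 \<epsilon>^2)^(-d), so the normalising integral is at least a constant over
  \<epsilon>^d, and in particular over \<epsilon>. The quotient is of order \<epsilon>.\<close>

lemma kern_tail:
  assumes \<delta>: "0 < \<delta>"
  shows "\<exists>c\<ge>0. \<forall>\<epsilon>. 0 < \<epsilon> \<longrightarrow> \<epsilon> \<le> 1 \<longrightarrow>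
    (LINT y|lborel. indicator {y. \<delta> \<le> norm y} y * kern \<epsilon> (y::'a::euclidean_space)) \<le> c * \<epsilon>"
proof -
  let ?d = "DIM('a)"
  define V where "V = unit_ball_vol (real ?d)"
  have V: "0 < V" by (simp add: V_def)
  define I where "I \<epsilon> = (LINT y|lborel. kern0 \<epsilon> (y::'a))" for \<epsilon>
  have low: "V / 2 ^ ?d / \<epsilon> \<le> I \<epsilon>" if e: "0 < \<epsilon>" "\<epsilon> \<le> 1" for \<epsilon>
  proof -
    have fin: "emeasure lborel (ball (0::'a) \<epsilon>) < \<infinity>" by (rule emeasure_lborel_ball_finite)
    have i: "integrable lborel (\<lambda>y::'a. indicator (ball 0 \<epsilon>) y * (2 * \<epsilon>\<^sup>2) powr (- real ?d))"
      using fin by (intro integrable_mult_left integrable_real_indicator) auto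
    have "(LINT y|lborel. indicator (ball (0::'a) \<epsilon>) y * (2 * \<epsilon>\<^sup>2) powr (- real ?d)) \<le> I \<epsilon>"
      unfolding I_def
    proof (rule integral_mono[OF i integrable_kern0[OF e(1)]])
      fix y :: 'a
      show "indicator (ball 0 \<epsilon>) y * (2 * \<epsilon>\<^sup>2) powr (- real ?d) \<le> kern0 \<epsilon> y"
      proof (cases "y \<in> ball 0 \<epsilon>")
        case True
        then have "(norm y)\<^sup>2 \<le> \<epsilon>\<^sup>2" by (intro power_mono) auto
        then have "kden \<epsilon> y \<le> 2 * \<epsilon>\<^sup>2" by (simp add: kden_def power2_norm_eq_inner)
        then have "(2 * \<epsilon>\<^sup>2) powr (- real ?d) \<le> kern0 \<epsilon> y"
          unfolding kern0_def using kden_pos[OF e(1), of y] by (intro powr_mono2') auto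
        then show ?thesis using True by simp
      qed (simp add: kern0_nonneg[OF e(1)])
    qed
    moreover have "(LINT y|lborel. indicator (ball (0::'a) \<epsilon>) y * (2 * \<epsilon>\<^sup>2) powr (- real ?d)) = (V * \<epsilon> ^ ?d) * (2 * \<epsilon>\<^sup>2) powr (- real ?d)"
    proof -
      have "measure lborel (ball (0::'a) \<epsilon>) = V * \<epsilon> ^ ?d"
        using e V by (simp add: measure_def emeasure_ball V_def)
      then show ?thesis by simp
    qed
    moreover have "(V * \<epsilon> ^ ?d) * (2 * \<epsilon>\<^sup>2) powr (- real ?d) = V / 2 ^ ?d / \<epsilon> ^ ?d"
    proof -
      have "(2 * \<epsilon>\<^sup>2) powr (- real ?d) = 1 / (2 * \<epsilon>\<^sup>2) ^ ?d"
        using e by (simp add: powr_minus_divide powr_realpow)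
      also have "\<dots> = 1 / (2 ^ ?d * (\<epsilon> ^ ?d * \<epsilon> ^ ?d))"
        by (simp add: power_mult_distrib power2_eq_square)
      finally show ?thesis using e by simp
    qed
    moreover have "V / 2 ^ ?d / \<epsilon> \<le> V / 2 ^ ?d / \<epsilon> ^ ?d"
    proof (rule divide_left_mono)
      show "\<epsilon> ^ ?d \<le> \<epsilon>" using e DIM_positive[where 'a='a] power_decreasing[of 1 ?d \<epsilon>] by (simp add: Suc_leI)
    qed (use V e in auto)
    ultimately show ?thesis by linarith
  qed
  define c0 where "c0 = (1 + 1 / \<delta>\<^sup>2) powr real ?d * I 1"
  have I1: "0 \<le> I 1" unfolding I_def by (intro Bochner_Integration.integral_nonneg) (simp add: kern0_nonneg)
  have c0: "0 \<le> c0" using I1 by (simp add: c0_def)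
  have up: "(LINT y|lborel. indicator {y. \<delta> \<le> norm y} y * kern0 \<epsilon> (y::'a)) \<le> c0" if e: "0 < \<epsilon>" for \<epsilon>
  proof -
    have m: "{y::'a. \<delta> \<le> norm y} \<in> sets lborel" by simp
    have "(LINT y|lborel. indicator {y. \<delta> \<le> norm y} y * kern0 \<epsilon> (y::'a)) \<le> (LINT y|lborel. (1 + 1 / \<delta>\<^sup>2) powr real ?d * kern0 1 (y::'a))"
    proof (rule integral_mono)
      show "integrable lborel (\<lambda>y::'a. indicator {y. \<delta> \<le> norm y} y * kern0 \<epsilon> y)"
        using integrable_mult_indicator[OF m integrable_kern0[OF e]] by simp
      show "integrable lborel (\<lambda>y::'a. (1 + 1 / \<delta>\<^sup>2) powr real ?d * kern0 1 y)" using integrable_kern0[of 1, where 'a='a] by simp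
      fix y :: 'a
      show "indicator {y. \<delta> \<le> norm y} y * kern0 \<epsilon> y \<le> (1 + 1 / \<delta>\<^sup>2) powr real ?d * kern0 1 y"
      proof (cases "\<delta> \<le> norm y")
        case True
        have "\<delta>\<^sup>2 \<le> y \<bullet> y" using True \<delta> power_mono[of \<delta> "norm y" 2] by (simp add: power2_norm_eq_inner)
        then have "kden 1 y \<le> (1 + 1 / \<delta>\<^sup>2) * (y \<bullet> y)"
          using \<delta> by (simp add: kden_def field_simps)
        also have "\<dots> \<le> (1 + 1 / \<delta>\<^sup>2) * kden \<epsilon> y" by (intro mult_left_mono) (auto simp: kden_def)
        finally have a: "kden 1 y \<le> (1 + 1 / \<delta>\<^sup>2) * kden \<epsilon> y" .
        have p: "0 < 1 + 1 / \<delta>\<^sup>2" using \<delta> by (simp add: add_pos_nonneg)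
        have "((1 + 1 / \<delta>\<^sup>2) * kden \<epsilon> y) powr (- real ?d) \<le> kern0 1 y"
          unfolding kern0_def using a kden_pos[of 1 y] by (intro powr_mono2') auto
        then have "(1 + 1 / \<delta>\<^sup>2) powr real ?d * ((1 + 1 / \<delta>\<^sup>2) * kden \<epsilon> y) powr (- real ?d) \<le> (1 + 1 / \<delta>\<^sup>2) powr real ?d * kern0 1 y"
          by (intro mult_left_mono) auto
        also have "(1 + 1 / \<delta>\<^sup>2) powr real ?d * ((1 + 1 / \<delta>\<^sup>2) * kden \<epsilon> y) powr (- real ?d) = kern0 \<epsilon> y"
          unfolding kern0_def using p kden_pos[OF e, of y]
          by (subst powr_mult) (simp_all add: powr_minus field_simps)
        finally show ?thesis using True by simp
      qed (simp add: kern0_nonneg)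
    qed
    then show ?thesis by (simp add: c0_def I_def)
  qed
  show ?thesis
  proof (intro exI[of _ "c0 / (V / 2 ^ ?d)"] conjI allI impI)
    show "0 \<le> c0 / (V / 2 ^ ?d)" using c0 V by simp
    fix \<epsilon> :: real assume e: "0 < \<epsilon>" "\<epsilon> \<le> 1"
    have Ip: "0 < V / 2 ^ ?d / \<epsilon>" using V e by simp
    have "(LINT y|lborel. indicator {y. \<delta> \<le> norm y} y * kern \<epsilon> (y::'a)) = (LINT y|lborel. indicator {y. \<delta> \<le> norm y} y * kern0 \<epsilon> (y::'a)) / I \<epsilon>"
      by (simp add: kern_def I_def)
    also have "\<dots> \<le> c0 / (V / 2 ^ ?d / \<epsilon>)"
      using up[OF e(1)] low[OF e] c0 Ip by (intro frac_le) auto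
    finally show "(LINT y|lborel. indicator {y. \<delta> \<le> norm y} y * kern \<epsilon> (y::'a)) \<le> c0 / (V / 2 ^ ?d) * \<epsilon>" by simp
  qed
qed

text \<open>The missing mass is carried by points outside a ball around z contained in the open set,
  and there \<open>kern_tail\<close> applies.\<close>

lemma conv_indicator_tendsto:
  fixes z :: "'a::euclidean_space"
  assumes O: "open O'" "z \<in> O'" and fin: "emeasure lborel O' < \<infinity>"
  shows "(\<lambda>n. conv (indicator O') (kern (1 / real (Suc n))) z) \<longlonglongrightarrow> 1"
proof -
  obtain \<delta> where \<delta>: "0 < \<delta>" "ball z \<delta> \<subseteq> O'" using O by (meson open_contains_ball)
  obtain c where c: "0 \<le> c" "\<And>\<epsilon>. 0 < \<epsilon> \<Longrightarrow> \<epsilon> \<le> 1 \<Longrightarrow> (LINT y|lborel. indicator {y. \<delta> \<le> norm y} y * kern \<epsilon> (y::'a)) \<le> c * \<epsilon>"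
    using kern_tail[OF \<delta>(1)] by blast
  have Om [measurable]: "O' \<in> sets borel" using O(1) by simp
  have bounds: "1 - c * \<epsilon> \<le> conv (indicator O') (kern \<epsilon>) z \<and> conv (indicator O') (kern \<epsilon>) z \<le> 1" if e: "0 < \<epsilon>" "\<epsilon> \<le> 1" for \<epsilon>
  proof -
    note sym = kern_minus_commute
    note ik = integrable_kern_reflect[OF e(1), of z] and Ik = integral_kern_reflect[OF e(1), of z]
    have iO: "integrable lborel (\<lambda>x. indicator O' x * kern \<epsilon> (z - x))"
      using integrable_mult_indicator[OF _ ik, of O'] by simp
    have "conv (indicator O') (kern \<epsilon>) z \<le> (LINT x|lborel. kern \<epsilon> (z - x))"
      unfolding conv_def by (rule integral_mono[OF iO ik]) (simp add: indicator_def kern_nonneg[OF e(1)])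
    then have 1: "conv (indicator O') (kern \<epsilon>) z \<le> 1" by (simp add: Ik)
    have it: "integrable lborel (\<lambda>x. indicator {y. \<delta> \<le> norm y} (x + (- z)) * kern \<epsilon> (x + (- z)))"
    proof (rule integrable_lborel_translate[of "\<lambda>y. indicator {y. \<delta> \<le> norm y} y * kern \<epsilon> y"])
      show "integrable lborel (\<lambda>y::'a. indicator {y. \<delta> \<le> norm y} y * kern \<epsilon> y)"
        using integrable_mult_indicator[OF _ integrable_kern[OF e(1)], of "{y::'a. \<delta> \<le> norm y}"] by simp
    qed
    have tr: "(LINT x|lborel. indicator {y. \<delta> \<le> norm y} (x + (- z)) * kern \<epsilon> (x + (- z))) = (LINT y|lborel. indicator {y. \<delta> \<le> norm y} y * kern \<epsilon> (y::'a))"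
      by (rule integral_lborel_translate[of "\<lambda>y. indicator {y. \<delta> \<le> norm y} y * kern \<epsilon> y"]) measurable
    have "1 - conv (indicator O') (kern \<epsilon>) z = (LINT x|lborel. kern \<epsilon> (z - x) - indicator O' x * kern \<epsilon> (z - x))"
      unfolding conv_def using ik iO by (simp add: Ik)
    also have "\<dots> \<le> (LINT x|lborel. indicator {y. \<delta> \<le> norm y} (x + (- z)) * kern \<epsilon> (x + (- z)))"
    proof (rule integral_mono[OF _ it])
      show "integrable lborel (\<lambda>x. kern \<epsilon> (z - x) - indicator O' x * kern \<epsilon> (z - x))" using ik iO by simp
      fix x
      show "kern \<epsilon> (z - x) - indicator O' x * kern \<epsilon> (z - x) \<le> indicator {y. \<delta> \<le> norm y} (x + (- z)) * kern \<epsilon> (x + (- z))"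
      proof (cases "x \<in> O'")
        case True
        then show ?thesis by (simp add: kern_nonneg[OF e(1)])
      next
        case False
        then have "x \<notin> ball z \<delta>" using \<delta>(2) by blast
        then have "\<delta> \<le> norm (x + (- z))" by (simp add: dist_norm norm_minus_commute)
        then show ?thesis using False unfolding sym by simp
      qed
    qed
    also have "\<dots> \<le> c * \<epsilon>" unfolding tr by (rule c(2)[OF e])
    finally show ?thesis using 1 by simp
  qed
  show ?thesis
  proof (rule tendsto_sandwich[of "\<lambda>n. 1 - c * (1 / real (Suc n))" _ _ "\<lambda>n. 1"])
    have "(\<lambda>n. 1 - c * inverse (real (Suc n))) \<longlonglongrightarrow> 1 - c * 0"
      by (intro tendsto_intros LIMSEQ_inverse_real_of_nat)
    then show "(\<lambda>n. 1 - c * (1 / real (Suc n))) \<longlonglongrightarrow> 1" by (simp add: inverse_eq_divide)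
    have small: "1 / real (Suc n) \<le> 1" "0 < 1 / real (Suc n)" for n by (auto simp: field_simps)
    then show "\<forall>\<^sub>F n in sequentially. 1 - c * (1 / real (Suc n)) \<le> conv (indicator O') (kern (1 / real (Suc n))) z"
      "\<forall>\<^sub>F n in sequentially. conv (indicator O') (kern (1 / real (Suc n))) z \<le> 1"
      using bounds[OF small(2,1)] by (auto intro!: always_eventually simp del: of_nat_Suc)
  qed simp
qed

text \<open>Duality avoids pointwise convergence of the mollified functions: the kernel is even, so
  it can be moved from r to the indicator of an open set, where convergence on the set is
  elementary. This gives the integral of r over open sets of finite measure at most K times the
  measure. Outer regularity extends it to Borel sets of finite measure, in particular to the parts
  of {r > K} in balls, which are then null.\<close>

lemma bounded_of_mollifications:
  fixes r :: "'a::euclidean_space \<Rightarrow> real"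
  assumes r: "integrable lborel r" "\<And>z. 0 \<le> r z" and K: "0 \<le> K"
    and le: "\<And>n. AE x in lborel. conv r (kern (1 / real (Suc n))) x \<le> K"
  shows "AE x in lborel. r x \<le> K"
proof -
  have [measurable]: "r \<in> borel_measurable borel" using borel_measurable_integrable[OF r(1)] by simp
  have open_le: "(LINT x|lborel. indicator O' x * r x) \<le> K * measure lborel O'"
    if O: "open O'" and fin: "emeasure lborel O' < \<infinity>" for O' :: "'a set"
  proof -
    have Om [measurable]: "O' \<in> sets borel" using O by simp
    have iO: "integrable lborel (indicator O' :: 'a \<Rightarrow> real)" using fin by (intro integrable_real_indicator) auto
    let ?e = "\<lambda>n. 1 / real (Suc n)"
    have e: "0 < ?e n" for n by simp
    let ?c = "\<lambda>n z. conv (indicator O') (kern (?e n)) z"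
    have cb: "0 \<le> ?c n z \<and> ?c n z \<le> 1" for n z
    proof -
      note ik = integrable_kern_reflect[OF e[of n], of z] and Ik = integral_kern_reflect[OF e[of n], of z]
      have "?c n z \<le> (LINT x|lborel. kern (?e n) (z - x))"
        unfolding conv_def
      proof (rule integral_mono[OF _ ik])
        show "integrable lborel (\<lambda>x. indicator O' x * kern (?e n) (z - x))"
          using integrable_mult_indicator[OF _ ik, of O'] by simp
      qed (simp add: indicator_def kern_nonneg[OF e] del: of_nat_Suc)
      moreover have "0 \<le> ?c n z"
        unfolding conv_def by (intro Bochner_Integration.integral_nonneg) (simp add: kern_nonneg[OF e] del: of_nat_Suc)
      ultimately show ?thesis by (simp add: Ik del: of_nat_Suc)
    qed
    have cm [measurable]: "?c n \<in> borel_measurable borel" for n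
      unfolding conv_def[abs_def] by measurable
    have i1: "integrable lborel (\<lambda>z. r z * ?c n z)" for n
    proof (rule integrable_dominated[OF r(1)])
      show "(\<lambda>z. r z * ?c n z) \<in> borel_measurable lborel" by measurable
    qed (use cb r(2) in \<open>auto simp: abs_mult mult_left_le\<close>)
    have lim: "(\<lambda>n. LINT z|lborel. indicator O' z * (r z * ?c n z)) \<longlonglongrightarrow> (LINT z|lborel. indicator O' z * (r z * 1))"
    proof (rule integral_dominated_convergence[where w=r])
      show "AE z in lborel. (\<lambda>n. indicator O' z * (r z * ?c n z)) \<longlonglongrightarrow> indicator O' z * (r z * 1)"
      proof (rule AE_I2)
        fix z
        show "(\<lambda>n. indicator O' z * (r z * ?c n z)) \<longlonglongrightarrow> indicator O' z * (r z * 1)"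
        proof (cases "z \<in> O'")
          case True
          show ?thesis by (intro tendsto_intros conv_indicator_tendsto[OF O True fin])
        qed simp
      qed
      show "AE z in lborel. norm (indicator O' z * (r z * ?c n z)) \<le> r z" for n
        using cb r(2) by (intro AE_I2) (auto simp: indicator_def abs_mult mult_left_le)
    qed (use r in measurable)
    have le1: "(LINT z|lborel. indicator O' z * (r z * ?c n z)) \<le> K * measure lborel O'" for n
    proof -
      obtain Q where Q: "\<And>y::'a. kern (?e n) y \<le> Q" using kern_bounded[OF e] by blast
      have prod: "integrable (lborel \<Otimes>\<^sub>M lborel) (\<lambda>(z, x). r z * (indicator O' x * kern (?e n) (z - x)))"
      proof (rule Bochner_Integration.integrable_bound)
        show "integrable (lborel \<Otimes>\<^sub>M lborel) (\<lambda>p. Q * (case p of (z, x) \<Rightarrow> r z * indicator O' x))"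
          by (intro integrable_mult_right lborel_pair.integrable_product_mult r iO)
        show "AE p in lborel \<Otimes>\<^sub>M lborel. norm (case p of (z, x) \<Rightarrow> r z * (indicator O' x * kern (?e n) (z - x)))
          \<le> norm (Q * (case p of (z, x) \<Rightarrow> r z * indicator O' x))"
        proof (rule AE_I2)
          fix p :: "'a \<times> 'a"
          obtain z x where p: "p = (z, x)" by (cases p)
          have "r z * kern (?e n) (z - x) \<le> \<bar>Q\<bar> * r z"
            using mult_left_mono[OF order_trans[OF Q abs_ge_self], of "r z"] r(2)[of z] by (simp add: mult.commute)
          then show "norm (case p of (z, x) \<Rightarrow> r z * (indicator O' x * kern (?e n) (z - x)))
            \<le> norm (Q * (case p of (z, x) \<Rightarrow> r z * indicator O' x))"
            using r(2)[of z] kern_nonneg[OF e, of n "z - x"] unfolding p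
            by (simp add: abs_mult indicator_def)
        qed
      qed measurable
      have "(LINT z|lborel. indicator O' z * (r z * ?c n z)) \<le> (LINT z|lborel. r z * ?c n z)"
      proof (rule integral_mono[OF _ i1])
        show "integrable lborel (\<lambda>z. indicator O' z * (r z * ?c n z))"
          using integrable_mult_indicator[OF _ i1, of O' n] by simp
      qed (use cb r(2) in \<open>auto simp: indicator_def\<close>)
      also have "\<dots> = (LINT z|lborel. LINT x|lborel. r z * (indicator O' x * kern (?e n) (z - x)))"
        by (simp add: conv_def)
      also have "\<dots> = (LINT x|lborel. LINT z|lborel. r z * (indicator O' x * kern (?e n) (z - x)))"
        by (rule lborel_pair.Fubini_integral[symmetric]) (rule prod)
      also have "\<dots> = (LINT x|lborel. indicator O' x * conv r (kern (?e n)) x)"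
      proof (rule Bochner_Integration.integral_cong)
        fix x
        have "(LINT z|lborel. r z * (indicator O' x * kern (?e n) (z - x))) = (LINT z|lborel. indicator O' x * (r z * kern (?e n) (x - z)))"
          using kern_even[of "?e n" "x - _"] by (simp add: mult_ac)
        then show "(LINT z|lborel. r z * (indicator O' x * kern (?e n) (z - x))) = indicator O' x * conv r (kern (?e n)) x"
          by (simp add: conv_def)
      qed simp
      also have "\<dots> \<le> (LINT x|lborel. K * indicator O' x)"
      proof (rule integral_mono_AE)
        show "integrable lborel (\<lambda>x. indicator O' x * conv r (kern (?e n)) x)"
          using integrable_mult_indicator[OF _ conv_L1(1)[OF r(1) integrable_kern[OF e]], of O' n] by simp
        show "AE x in lborel. indicator O' x * conv r (kern (?e n)) x \<le> K * indicator O' x"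
          using le[of n] by eventually_elim (simp add: indicator_def)
      qed (use iO in simp)
      also have "\<dots> = K * measure lborel O'" by simp
      finally show ?thesis .
    qed
    show ?thesis using LIMSEQ_le_const2[OF lim] le1 by auto
  qed
  have set_le: "(LINT x|lborel. indicator S x * r x) \<le> K * measure lborel S"
    if [measurable]: "S \<in> sets borel" and fin: "emeasure lborel S < \<infinity>" for S :: "'a set"
  proof (rule field_le_epsilon)
    fix d :: real assume d: "0 < d"
    define d' where "d' = d / (K + 1)"
    have d': "0 < d'" "K * d' \<le> d" using d K by (auto simp: d'_def field_simps)
    obtain T where T: "open T" "S \<subseteq> T" "emeasure lborel (T - S) < ennreal d'"
      using outer_regular_lborel[of S d'] d' that by auto
    have [measurable]: "T \<in> sets borel" using T(1) by simp
    have eT: "emeasure lborel T = emeasure lborel S + emeasure lborel (T - S)"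
      using T(2) by (subst plus_emeasure) (auto simp: Un_absorb1)
    then have finT: "emeasure lborel T < \<infinity>" using fin less_trans[OF T(3) ennreal_less_top] by simp
    have mT: "measure lborel T \<le> measure lborel S + d'"
    proof -
      have "measure lborel T = measure lborel S + measure lborel (T - S)"
        using fin less_trans[OF T(3) ennreal_less_top] unfolding measure_def eT
        by (subst enn2real_plus) simp_all
      moreover have "measure lborel (T - S) \<le> d'"
        using T(3) d' by (simp add: measure_def enn2real_leI less_imp_le)
      ultimately show ?thesis by simp
    qed
    have "(LINT x|lborel. indicator S x * r x) \<le> (LINT x|lborel. indicator T x * r x)"
    proof (rule integral_mono)
      show "integrable lborel (\<lambda>x. indicator S x * r x)" "integrable lborel (\<lambda>x. indicator T x * r x)"
        using integrable_mult_indicator[OF _ r(1), of S] integrable_mult_indicator[OF _ r(1), of T] by simp_all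
    qed (use T(2) r(2) in \<open>auto simp: indicator_def\<close>)
    also have "\<dots> \<le> K * measure lborel T" by (rule open_le[OF T(1) finT])
    also have "\<dots> \<le> K * (measure lborel S + d')" using mT K by (intro mult_left_mono) auto
    also have "\<dots> \<le> K * measure lborel S + d" using d' by (simp add: distrib_left)
    finally show "(LINT x|lborel. indicator S x * r x) \<le> K * measure lborel S + d" .
  qed
  have "AE x in lborel. x \<in> ball 0 (real m) \<longrightarrow> r x \<le> K" for m :: nat
  proof -
    define S where "S = {x. K < r x} \<inter> ball 0 (real m)"
    have Sm [measurable]: "S \<in> sets borel" unfolding S_def by simp
    have fin: "emeasure lborel S < \<infinity>"
      by (rule le_less_trans[OF emeasure_mono[of S "ball 0 (real m)"] emeasure_lborel_ball_finite]) (auto simp: S_def)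
    have iS: "integrable lborel (\<lambda>x. indicator S x * r x)"
      using integrable_mult_indicator[OF _ r(1), of S] by simp
    have iK: "integrable lborel (\<lambda>x. K * indicator S x)" using fin by (intro integrable_mult_right integrable_real_indicator) auto
    have nn: "0 \<le> indicator S x * r x - K * indicator S x" for x
      by (auto simp: S_def indicator_def)
    have "(LINT x|lborel. indicator S x * r x - K * indicator S x) \<le> 0"
      using set_le[OF Sm fin] iS iK by simp
    then have "(LINT x|lborel. indicator S x * r x - K * indicator S x) = 0"
      using nn by (meson Bochner_Integration.integral_nonneg order_antisym)
    then have "AE x in lborel. indicator S x * r x - K * indicator S x = 0"
      by (rule integral_nonneg_eq_0_iff_AE[THEN iffD1, rotated 2]) (use iS iK nn in auto)
    then show ?thesis
    proof eventually_elim
      case (elim x)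
      then show ?case by (cases "x \<in> S") (auto simp: S_def)
    qed
  qed
  then have "AE x in lborel. \<forall>m::nat. x \<in> ball 0 (real m) \<longrightarrow> r x \<le> K" by (subst AE_all_countable) blast
  then show ?thesis
  proof eventually_elim
    case (elim x)
    obtain m :: nat where "norm x < real m" using reals_Archimedean2 by blast
    then show ?case using elim by auto
  qed
qed

context fokker_planck
begin

lemma density_bounded:
  assumes big: "N + 2 < \<beta>"
  shows "\<exists>K\<ge>0. AE t in unit_time. AE x in lborel. \<rho> t x \<le> K"
proof -
  obtain K where K: "0 \<le> K" "\<And>\<epsilon>. 0 < \<epsilon> \<Longrightarrow> AE p in unit_time \<Otimes>\<^sub>M lborel. moll \<epsilon> (fst p) (snd p) \<le> K"
    using uniform_bound[OF big] by blast
  have "AE t in unit_time. AE x in lborel. moll (1 / real (Suc n)) t x \<le> K" for n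
    using time_space.AE_pair[OF K(2)[of "1 / real (Suc n)"]] by simp
  then have "AE t in unit_time. \<forall>n. AE x in lborel. moll (1 / real (Suc n)) t x \<le> K"
    by (subst AE_all_countable) blast
  then have "AE t in unit_time. AE x in lborel. \<rho> t x \<le> K"
    using AE_unit_time
  proof eventually_elim
    case (elim t)
    then show ?case
      by (intro bounded_of_mollifications[OF integrable_rho rho_nonneg K(1)]) (auto simp: moll_def)
  qed
  then show ?thesis using K(1) by blast
qed

end

section \<open>The boundedness theorem\<close>

text \<open>Identifies the one-variable \<open>deriv\<close> with the Frechet derivative in a
  coordinate direction. Smoothness of the partial derivatives supplies the Borel measurability of
  \<open>parabolic_op\<close> on arbitrary test functions.\<close>

lemma partial_x_Ck:
  fixes u :: "real \<times> (real^'n) \<Rightarrow> real"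
  assumes u: "\<And>k. Ck k u"
  shows "Ck k (partial_x i u)"
proof -
  have d: "(u has_derivative frechet_derivative u (at p)) (at p)" for p
    using Ck_has_derivative[OF u[of "Suc 0"]] .
  have "partial_x i u p = frechet_derivative u (at p) (0, axis i 1)" for p
  proof -
    obtain t x where p: "p = (t, x)" by (cases p)
    have "((\<lambda>s::real. (t, x + s *\<^sub>R axis i 1)) has_derivative (\<lambda>s. (0, s *\<^sub>R axis i 1))) (at 0)"
      by (auto intro!: derivative_eq_intros)
    then have h: "((\<lambda>s. u (t, x + s *\<^sub>R axis i 1)) has_derivative (\<lambda>s. frechet_derivative u (at p) (0, s *\<^sub>R axis i 1))) (at 0)"
      using has_derivative_compose[of "\<lambda>s::real. (t, x + s *\<^sub>R axis i 1)" "\<lambda>s. (0, s *\<^sub>R axis i 1)" 0 UNIV u "frechet_derivative u (at p)"] d[of p]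
      by (simp add: p)
    have lin: "frechet_derivative u (at p) (0, s *\<^sub>R axis i 1) = s * frechet_derivative u (at p) (0, axis i 1)" for s
    proof -
      show ?thesis using linear_cmul[OF has_derivative_linear[OF d[of p]], of s "(0, axis i 1)"] by simp
    qed
    have "((\<lambda>s. u (t, x + s *\<^sub>R axis i 1)) has_real_derivative frechet_derivative u (at p) (0, axis i 1)) (at 0)"
      unfolding has_field_derivative_def
      by (rule has_derivative_eq_rhs[OF h]) (rule ext, subst lin, rule mult.commute)
    then show ?thesis by (simp add: partial_x_def p DERIV_imp_deriv)
  qed
  then have "partial_x i u = (\<lambda>p. frechet_derivative u (at p) (0, axis i 1))" by (rule ext)
  then show ?thesis using u[of "Suc k"] by simp
qed

lemma partial_t_Ck:
  fixes u :: "real \<times> (real^'n) \<Rightarrow> real"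
  assumes u: "\<And>k. Ck k u"
  shows "Ck k (partial_t u)"
proof -
  have d: "(u has_derivative frechet_derivative u (at p)) (at p)" for p
    using Ck_has_derivative[OF u[of "Suc 0"]] .
  have "partial_t u p = frechet_derivative u (at p) (1, 0)" for p
  proof -
    obtain t x where p: "p = (t, x)" by (cases p)
    have "((\<lambda>s::real. (s, x)) has_derivative (\<lambda>s. (s, 0))) (at t)"
      by (auto intro!: derivative_eq_intros)
    then have h: "((\<lambda>s. u (s, x)) has_derivative (\<lambda>s. frechet_derivative u (at p) (s, 0))) (at t)"
      using has_derivative_compose[of "\<lambda>s::real. (s, x)" "\<lambda>s. (s, 0)" t UNIV u "frechet_derivative u (at p)"] d[of p]
      by (simp add: p)
    have lin: "frechet_derivative u (at p) (s, 0) = s * frechet_derivative u (at p) (1, 0)" for s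
    proof -
      show ?thesis using linear_cmul[OF has_derivative_linear[OF d[of p]], of s "(1, 0)"] by simp
    qed
    have "((\<lambda>s. u (s, x)) has_real_derivative frechet_derivative u (at p) (1, 0)) (at t)"
      unfolding has_field_derivative_def
      by (rule has_derivative_eq_rhs[OF h]) (rule ext, subst lin, rule mult.commute)
    then show ?thesis by (simp add: partial_t_def p DERIV_imp_deriv)
  qed
  then have "partial_t u = (\<lambda>p. frechet_derivative u (at p) (1, 0))" by (rule ext)
  then show ?thesis using u[of "Suc k"] by simp
qed

lemma borel_measurable_restrict_total:
  fixes f :: "'a::topological_space \<Rightarrow> real"
  assumes f: "f \<in> borel_measurable (restrict_space borel S)" and S: "S \<in> sets borel" and T: "T \<in> sets borel" "T \<subseteq> S"
  shows "(\<lambda>p. indicator T p * f p) \<in> borel_measurable borel"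
proof -
  have 1: "(\<lambda>p. indicator S p * f p) \<in> borel_measurable borel"
    using f S by (subst (asm) borel_measurable_restrict_space_iff) auto
  have "(\<lambda>p. indicator T p * (indicator S p * f p)) \<in> borel_measurable borel"
    using T(1) by (intro borel_measurable_times borel_measurable_indicator 1)
  moreover have "indicator T p * (indicator S p * f p) = indicator T p * f p" for p
    using T(2) by (auto simp: indicator_def)
  ultimately show ?thesis by simp
qed

theorem theorem3p2:
  fixes A :: "real \<Rightarrow> real^'n \<Rightarrow> real^'n^'n"
    and b :: "real \<Rightarrow> real^'n \<Rightarrow> real^'n"
    and \<rho> :: "real \<Rightarrow> real^'n \<Rightarrow> real"
    and \<alpha> \<kappa> \<beta> :: real
  assumes A_borel: "\<And>i j. (\<lambda>(t, x). A t x $ i $ j)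
        \<in> borel_measurable (restrict_space borel ({0..1} \<times> UNIV))"
    and b_borel: "\<And>i. (\<lambda>(t, x). b t x $ i)
        \<in> borel_measurable (restrict_space borel ({0..1} \<times> UNIV))"
    and A_symmetric: "\<And>t x. t \<in> {0..1} \<Longrightarrow> transpose (A t x) = A t x"
    and A_nonneg: "\<And>t x \<xi>. t \<in> {0..1} \<Longrightarrow> 0 \<le> \<xi> \<bullet> (A t x *v \<xi>)"
    and rho_borel: "(\<lambda>(t, x). \<rho> t x)
        \<in> borel_measurable (restrict_space borel ({0<..<1} \<times> UNIV))"
    and rho_density: "\<And>t. t \<in> {0..<1} \<Longrightarrow> prob_density (\<rho> t)"
    and equation: "weak_parabolic_solution A b \<rho>"
    and initial: "initial_condition (slice_measure \<rho>) (slice_measure \<rho> 0)"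
    and A_bounded: "\<exists>M. \<forall>t\<in>{0..1}. \<forall>x. norm (A t x) \<le> M"
    and alpha_pos: "\<alpha> > 0"
    and A_elliptic: "\<And>t x \<xi>. t \<in> {0..1} \<Longrightarrow> \<alpha> * (\<xi> \<bullet> \<xi>) \<le> \<xi> \<bullet> (A t x *v \<xi>)"
    and A_lipschitz: "\<And>t i j. t \<in> {0..1} \<Longrightarrow> \<kappa>-lipschitz_on UNIV (\<lambda>x. A t x $ i $ j)"
    and b_L2: "in_Lp 2 (spacetime_measure \<rho>) (\<lambda>(t, x). norm (b t x))"
    and Lambda_L2: "in_Lp 2 (spacetime_measure \<rho>) (\<lambda>(t, x). ln (max (norm x) 1))"
    and entropy: "finite_entropy (\<rho> 0)"
    and beta: "\<beta> > real CARD('n) + 2"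
    and b_Lbeta: "in_Lp \<beta> (spacetime_measure \<rho>) (\<lambda>(t, x). norm (b t x))"
    and rho0_Linf: "in_Linf lborel (\<rho> 0)"
    and alternative:
      "((\<forall>t\<in>{0..<1}. in_Lp (real CARD('n)) (slice_measure \<rho> t) (\<lambda>x. norm (b t x))) \<and>
        bdd_above ((\<lambda>t. Lp_norm (real CARD('n)) (slice_measure \<rho> t) (\<lambda>x. norm (b t x))) ` {0..<1}))
       \<or> (\<exists>p>1. \<forall>\<tau><1. in_Lp p (restrict_space lborel ({0..\<tau>} \<times> UNIV)) (\<lambda>(t, x). \<rho> t x))"
  shows "\<forall>\<tau><1. in_Linf (restrict_space lborel ({0..\<tau>} \<times> UNIV)) (\<lambda>(t, x). \<rho> t x)"
proof -
  \<comment> \<open>Extension by 0 outside the open time interval makes the functions Borel on all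
    of space-time and preserves boundedness and the Lipschitz condition; inside (0,1) nothing
    changes. The initial density is handed to the locale as \<rho> 0 itself.\<close>
  define A' where "A' t x = (if t \<in> {0<..<1} then A t x else 0)" for t x
  define b' where "b' t x = (if t \<in> {0<..<1} then b t x else 0)" for t x
  define \<rho>' where "\<rho>' t x = (if t \<in> {0<..<1} then \<rho> t x else 0)" for t x
  have strip [simp, measurable]: "{0..1} \<times> UNIV \<in> sets (borel :: (real \<times> (real^'n)) measure)"
      "{0<..<1} \<times> UNIV \<in> sets (borel :: (real \<times> (real^'n)) measure)"
    by (simp_all add: borel_closed borel_open closed_Times open_Times)
  have A'_borel: "(\<lambda>(t, x). A' t x $ i $ j) \<in> borel_measurable (borel \<Otimes>\<^sub>M borel)" for i j
  proof -
    have "(\<lambda>p. indicator ({0<..<1} \<times> UNIV) p * (case p of (t, x) \<Rightarrow> A t x $ i $ j)) \<in> borel_measurable borel"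
      by (rule borel_measurable_restrict_total[OF A_borel]) auto
    moreover have "(\<lambda>p. indicator ({0<..<1} \<times> UNIV) p * (case p of (t, x) \<Rightarrow> A t x $ i $ j)) = (\<lambda>(t, x). A' t x $ i $ j)"
      by (auto simp: A'_def indicator_def fun_eq_iff)
    ultimately show ?thesis by (simp add: borel_prod)
  qed
  have b'_borel: "case_prod b' \<in> borel_measurable (borel \<Otimes>\<^sub>M borel)"
  proof -
    have "(\<lambda>p. indicator ({0<..<1} \<times> UNIV) p * (case p of (t, x) \<Rightarrow> b t x $ i)) \<in> borel_measurable borel" for i
      by (rule borel_measurable_restrict_total[OF b_borel]) auto
    moreover have "(\<lambda>p. indicator ({0<..<1} \<times> UNIV) p * (case p of (t, x) \<Rightarrow> b t x $ i)) = (\<lambda>p. case_prod b' p $ i)" for i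
      by (auto simp: b'_def indicator_def fun_eq_iff)
    ultimately have "(\<lambda>p. case_prod b' p $ i) \<in> borel_measurable borel" for i by simp
    then show ?thesis
      unfolding borel_prod by (subst borel_measurable_euclidean_space) (auto simp: Basis_vec_def inner_axis)
  qed
  have \<rho>'_borel: "case_prod \<rho>' \<in> borel_measurable (borel \<Otimes>\<^sub>M borel)"
  proof -
    have "(\<lambda>p. indicator ({0<..<1} \<times> UNIV) p * (case p of (t, x) \<Rightarrow> \<rho> t x)) \<in> borel_measurable borel"
      by (rule borel_measurable_restrict_total[OF rho_borel]) auto
    moreover have "(\<lambda>p. indicator ({0<..<1} \<times> UNIV) p * (case p of (t, x) \<Rightarrow> \<rho> t x)) = case_prod \<rho>'"
      by (auto simp: \<rho>'_def indicator_def fun_eq_iff)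
    ultimately show ?thesis by (simp add: borel_prod)
  qed
  have dens: "\<rho> t \<in> borel_measurable borel" "0 \<le> \<rho> t x" "(\<integral>\<^sup>+x. ennreal (\<rho> t x) \<partial>lborel) = 1" if "t \<in> {0..<1}" for t x
    using rho_density[OF that] by (auto simp: prob_density_def)
  have slice_int: "(LINT x|slice_measure \<rho> t. f x) = (LINT x|lborel. \<rho> t x * f x)"
    if "t \<in> {0..<1}" "f \<in> borel_measurable borel" for t and f :: "real^'n \<Rightarrow> real"
    unfolding slice_measure_def using that dens[OF that(1)] by (subst integral_real_density) auto
  obtain M where M: "\<And>t x. t \<in> {0..1} \<Longrightarrow> norm (A t x) \<le> M" using A_bounded by blast
  have M0: "0 \<le> M" using order_trans[OF norm_ge_zero M[of 0 0]] by simp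
  obtain U0 where U0: "AE x in lborel. \<bar>\<rho> 0 x\<bar> \<le> U0" using rho0_Linf by (auto simp: in_Linf_def)
  have \<kappa>0: "0 \<le> \<kappa>" using A_lipschitz[of 0] by (auto simp: lipschitz_on_def)
  have beta2: "2 < \<beta>" using beta of_nat_0_le_iff[of "CARD('n)"] by linarith
  let ?Bn = "\<integral>\<^sup>+t. (\<integral>\<^sup>+x. ennreal (norm (b' t x) powr \<beta> * \<rho>' t x) \<partial>lborel) \<partial>unit_time"
  \<comment> \<open>Translates \<beta>-integrability of b for the space-time measure into the
    iterated nonnegative integral of the locale: unfold the density and the restriction, then apply
    Tonelli.\<close>
  have Bfin: "?Bn < \<infinity>"
  proof -
    let ?R = "restrict_space lborel ({0<..<1} \<times> UNIV) :: (real \<times> (real^'n)) measure"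
    let ?f = "\<lambda>p::real \<times> (real^'n). \<bar>case p of (t, x) \<Rightarrow> norm (b t x)\<bar> powr \<beta>"
    have i: "integrable (density ?R (\<lambda>(t, x). ennreal (\<rho> t x))) ?f"
      using b_Lbeta by (simp add: in_Lp_def spacetime_measure_def)
    have fm: "?f \<in> borel_measurable ?R" using borel_measurable_integrable[OF i] by simp
    have sets_R: "sets ?R = sets (restrict_space borel ({0<..<1} \<times> UNIV))"
      by (rule sets_restrict_space_cong) simp
    have rm: "(\<lambda>(t, x). ennreal (\<rho> t x)) \<in> borel_measurable ?R"
    proof -
      have "(\<lambda>p. ennreal (case p of (t, x) \<Rightarrow> \<rho> t x)) \<in> borel_measurable ?R"
        unfolding measurable_cong_sets[OF sets_R refl] by (intro measurable_compose[OF rho_borel] measurable_ennreal)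
      then show ?thesis by (simp add: case_prod_beta')
    qed
    have "(\<integral>\<^sup>+p. ennreal (norm (?f p)) \<partial>density ?R (\<lambda>(t, x). ennreal (\<rho> t x))) < \<infinity>"
      using i by (simp add: integrable_iff_bounded)
    also have "(\<integral>\<^sup>+p. ennreal (norm (?f p)) \<partial>density ?R (\<lambda>(t, x). ennreal (\<rho> t x)))
      = (\<integral>\<^sup>+p. (case p of (t, x) \<Rightarrow> ennreal (\<rho> t x)) * ennreal (norm (?f p)) \<partial>?R)"
      using rm fm by (subst nn_integral_density) auto
    also have "\<dots> = (\<integral>\<^sup>+p. (case p of (t, x) \<Rightarrow> ennreal (\<rho> t x)) * ennreal (norm (?f p)) * indicator ({0<..<1} \<times> UNIV) p \<partial>lborel)"
      by (subst nn_integral_restrict_space) auto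
    also have "\<dots> = (\<integral>\<^sup>+p. ennreal (norm (b' (fst p) (snd p)) powr \<beta> * \<rho>' (fst p) (snd p)) \<partial>lborel)"
      using dens(2) by (intro nn_integral_cong)
        (auto simp: indicator_def b'_def \<rho>'_def ennreal_mult' mult.commute split: prod.splits)
    also have "\<dots> = (\<integral>\<^sup>+p. ennreal (norm (b' (fst p) (snd p)) powr \<beta> * \<rho>' (fst p) (snd p)) \<partial>(lborel \<Otimes>\<^sub>M lborel))"
      by (simp only: lborel_prod)
    also have "\<dots> = (\<integral>\<^sup>+t. (\<integral>\<^sup>+x. ennreal (norm (b' t x) powr \<beta> * \<rho>' t x) \<partial>lborel) \<partial>lborel)"
    proof -
      note [measurable] = b'_borel \<rho>'_borel
      have "(\<lambda>p. ennreal (norm (b' (fst p) (snd p)) powr \<beta> * \<rho>' (fst p) (snd p))) \<in> borel_measurable (lborel \<Otimes>\<^sub>M lborel)"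
        by measurable
      from lborel.nn_integral_fst[OF this] show ?thesis by simp
    qed
    also have "\<dots> = ?Bn"
    proof -
      note [measurable] = b'_borel \<rho>'_borel
      have "(\<lambda>t. \<integral>\<^sup>+x. ennreal (norm (b' t x) powr \<beta> * \<rho>' t x) \<partial>lborel) \<in> borel_measurable borel"
        by measurable
      then show ?thesis
        by (subst nn_integral_unit_time)
          (assumption, auto intro!: nn_integral_cong simp: indicator_def \<rho>'_def)
    qed
    finally show ?thesis .
  qed
  define B where "B = max 1 (enn2real ?Bn)"
  have BB: "?Bn \<le> ennreal B"
  proof -
    have "?Bn = ennreal (enn2real ?Bn)" using Bfin by simp
    also have "\<dots> \<le> ennreal B" by (rule ennreal_leI) (simp add: B_def)
    finally show ?thesis .
  qed
  have weak: "(LINT t|unit_time. (LINT x|lborel. \<rho>' t x * parabolic_op A' b' u (t, x))) = 0"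
    if u: "test_function ({0<..<1} \<times> UNIV) u" for u
  proof -
    note [measurable] = A'_borel b'_borel \<rho>'_borel
    have uS: "Ck k u" for k using u by (simp add: test_function_def)
    have cm: "f \<in> borel_measurable (borel \<Otimes>\<^sub>M borel)" if "\<And>k. Ck k f" for f :: "real \<times> (real^'n) \<Rightarrow> real"
      unfolding borel_prod using that Ck_borel_measurable by blast
    have pm: "partial_t u \<in> borel_measurable (borel \<Otimes>\<^sub>M borel)" "partial_x i u \<in> borel_measurable (borel \<Otimes>\<^sub>M borel)"
      "partial_x i (partial_x j u) \<in> borel_measurable (borel \<Otimes>\<^sub>M borel)" for i j
      by (intro cm partial_t_Ck partial_x_Ck uS)+
    note [measurable] = pm
    have om [measurable]: "parabolic_op A' b' u \<in> borel_measurable (borel \<Otimes>\<^sub>M borel)"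
      unfolding parabolic_op_def[abs_def] by measurable
    have "(LINT t|unit_time. (LINT x|lborel. \<rho>' t x * parabolic_op A' b' u (t, x)))
      = (LINT t|lborel. indicator {0<..<1} t * (LINT x|lborel. \<rho>' t x * parabolic_op A' b' u (t, x)))"
      by (intro integral_unit_time) measurable
    also have "\<dots> = (LINT t:{0<..<1}|lborel. (LINT x|slice_measure \<rho> t. parabolic_op A b u (t, x)))"
      unfolding set_lebesgue_integral_def real_scaleR_def
    proof (intro Bochner_Integration.integral_cong refl)
      fix t :: real
      show "indicator {0<..<1} t * (LINT x|lborel. \<rho>' t x * parabolic_op A' b' u (t, x))
        = indicator {0<..<1} t * (LINT x|slice_measure \<rho> t. parabolic_op A b u (t, x))"
      proof (cases "t \<in> {0<..<1}")
        case True
        have eq: "parabolic_op A b u (t, x) = parabolic_op A' b' u (t, x)" for x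
          using True by (simp add: parabolic_op_def A'_def b'_def)
        have "(\<lambda>x. parabolic_op A' b' u (t, x)) \<in> borel_measurable borel" by measurable
        then have "(LINT x|slice_measure \<rho> t. parabolic_op A b u (t, x)) = (LINT x|lborel. \<rho> t x * parabolic_op A' b' u (t, x))"
          unfolding eq using True by (intro slice_int) auto
        then show ?thesis using True by (simp add: \<rho>'_def)
      qed simp
    qed
    also have "\<dots> = 0" using equation u by (simp add: weak_parabolic_solution_def)
    finally show ?thesis .
  qed
  \<comment> \<open>The right-hand limit at 0 sees only t in (0,1), where the extended density
    agrees with the original one.\<close>
  have init: "((\<lambda>t. LINT x|lborel. \<rho>' t x * \<zeta> x) \<longlongrightarrow> (LINT x|lborel. \<rho> 0 x * \<zeta> x)) (at_right 0)"
    if z: "test_function UNIV \<zeta>" for \<zeta>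
  proof -
    have zm: "\<zeta> \<in> borel_measurable borel"
      using z Ck_borel_measurable by (auto simp: test_function_def)
    have "((\<lambda>t. LINT x|slice_measure \<rho> t. \<zeta> x) \<longlongrightarrow> (LINT x|slice_measure \<rho> 0. \<zeta> x)) (at_right 0)"
      using initial z by (simp add: initial_condition_def)
    then have "((\<lambda>t. LINT x|slice_measure \<rho> t. \<zeta> x) \<longlongrightarrow> (LINT x|lborel. \<rho> 0 x * \<zeta> x)) (at_right 0)"
      using slice_int[OF _ zm, of 0] by simp
    moreover have "\<forall>\<^sub>F t in at_right 0. (LINT x|slice_measure \<rho> t. \<zeta> x) = (LINT x|lborel. \<rho>' t x * \<zeta> x)"
      using eventually_at_right_real[OF zero_less_one]
      by eventually_elim (simp add: slice_int zm \<rho>'_def)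
    ultimately show ?thesis by (rule Lim_transform_eventually)
  qed
  have fp: "fokker_planck A' b' \<rho>' (\<rho> 0) \<alpha> \<kappa> \<beta> M B (max 1 U0) (real CARD('n))"
  proof
    show "(\<lambda>(t, x). A' t x $ i $ j) \<in> borel_measurable (borel \<Otimes>\<^sub>M borel)" for i j by (rule A'_borel)
    show "case_prod b' \<in> borel_measurable (borel \<Otimes>\<^sub>M borel)" by (rule b'_borel)
    show "case_prod \<rho>' \<in> borel_measurable (borel \<Otimes>\<^sub>M borel)" by (rule \<rho>'_borel)
    show "\<rho> 0 \<in> borel_measurable borel" using dens[of 0] by simp
    show "0 \<le> \<rho>' t x" for t x using dens(2)[of t x] by (simp add: \<rho>'_def)
    show "0 \<le> \<rho> 0 x" for x using dens(2)[of 0 x] by simp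
    show "(\<integral>\<^sup>+x. ennreal (\<rho>' t x) \<partial>lborel) = 1" if "t \<in> {0<..<1}" for t using dens(3)[of t] that by (simp add: \<rho>'_def)
    show "(\<integral>\<^sup>+x. ennreal (\<rho> 0 x) \<partial>lborel) = 1" using dens(3)[of 0] by simp
    show "AE x in lborel. \<rho> 0 x \<le> max 1 U0" using U0 by eventually_elim simp
    show "\<bar>A' t x $ i $ j\<bar> \<le> M" for t x i j
    proof (cases "t \<in> {0<..<1}")
      case True
      have "\<bar>A t x $ i $ j\<bar> \<le> norm (A t x $ i)" by (rule component_le_norm_cart)
      also have "\<dots> \<le> norm (A t x)" by (rule Finite_Cartesian_Product.norm_nth_le)
      also have "\<dots> \<le> M" using True by (intro M) auto
      finally show ?thesis using True by (simp add: A'_def)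
    next
      case False
      then show ?thesis using M0 by (auto simp: A'_def)
    qed
    show "\<alpha> * (\<xi> \<bullet> \<xi>) \<le> \<xi> \<bullet> (A' t x *v \<xi>)" if "t \<in> {0<..<1}" for t x \<xi>
      using A_elliptic[of t \<xi> x] that by (simp add: A'_def)
    show "\<bar>A' t x $ i $ j - A' t y $ i $ j\<bar> \<le> \<kappa> * norm (x - y)" for t i j x y
    proof (cases "t \<in> {0<..<1}")
      case True
      then have "\<kappa>-lipschitz_on UNIV (\<lambda>x. A t x $ i $ j)" by (intro A_lipschitz) auto
      then have "dist (A t x $ i $ j) (A t y $ i $ j) \<le> \<kappa> * dist x y" by (rule lipschitz_onD) auto
      then show ?thesis using True by (simp add: A'_def dist_norm)
    next
      case False
      then show ?thesis using \<kappa>0 by (auto simp: A'_def)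
    qed
  qed (use alpha_pos \<kappa>0 beta2 BB weak init in \<open>auto simp: B_def\<close>)
  from fokker_planck.density_bounded[OF fp beta]
  obtain K where K: "0 \<le> K" "AE t in unit_time. AE x in lborel. \<rho>' t x \<le> K" by blast
  show ?thesis
  proof (intro allI impI)
    fix \<tau> :: real assume \<tau>: "\<tau> < 1"
    let ?S = "{0..\<tau>} \<times> (UNIV :: (real^'n) set)"
    have Sm [measurable]: "?S \<in> sets borel" by (intro borel_closed closed_Times) auto
    define F where "F p = indicator ?S p * (case p of (t, x) \<Rightarrow> \<rho> t x)" for p
    have Fm: "F \<in> borel_measurable borel"
    proof -
      \<comment> \<open>The closed strip contains t = 0, where the extended density is 0; the slice
        \<rho> 0 is added back there, and its own measurability yields joint measurability on the
        whole strip. For the bound itself this slice is negligible.\<close>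
      have "(\<lambda>p. indicator ?S p * (case_prod \<rho>' p + indicator {0} (fst p) * \<rho> 0 (snd p))) \<in> borel_measurable (borel \<Otimes>\<^sub>M borel)"
      proof -
        note [measurable] = \<rho>'_borel
        have [measurable]: "\<rho> 0 \<in> borel_measurable borel" using dens(1)[of 0] by simp
        have [measurable]: "?S \<in> sets (borel \<Otimes>\<^sub>M borel)" unfolding borel_prod by (rule Sm)
        show ?thesis by measurable
      qed
      moreover have "F p = indicator ?S p * (case_prod \<rho>' p + indicator {0} (fst p) * \<rho> 0 (snd p))" for p
        using \<tau> by (cases p) (auto simp: F_def \<rho>'_def indicator_def)
      then have "F = (\<lambda>p. indicator ?S p * (case_prod \<rho>' p + indicator {0} (fst p) * \<rho> 0 (snd p)))" by (rule ext)
      ultimately show ?thesis by (simp only: borel_prod)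
    qed
    have "AE t in lborel. AE x in lborel. \<bar>F (t, x)\<bar> \<le> K"
      using K(2)[unfolded AE_unit_time_iff] AE_lborel_singleton[of "0::real"]
    proof eventually_elim
      case (elim t)
      show ?case
      proof (cases "t \<in> {0..\<tau>}")
        case True
        then have t: "t \<in> {0<..<1}" using elim \<tau> by auto
        then have "AE x in lborel. \<rho>' t x \<le> K" using elim by blast
        then show ?thesis
          by eventually_elim (use t True dens(2)[of t] K(1) in \<open>auto simp: F_def \<rho>'_def\<close>)
      next
        case False
        then show ?thesis using K(1) by (auto simp: F_def)
      qed
    qed
    then have "AE p in lborel \<Otimes>\<^sub>M lborel. \<bar>F p\<bar> \<le> K"
    proof (rule lborel_pair.AE_pair_measure[rotated])
      have "{p \<in> space borel. \<bar>F p\<bar> \<le> K} \<in> sets borel" using Fm by measurable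
      then show "{p \<in> space (lborel \<Otimes>\<^sub>M lborel). \<bar>F p\<bar> \<le> K} \<in> sets (lborel \<Otimes>\<^sub>M lborel)"
        by (simp only: lborel_prod sets_lborel space_lborel)
    qed
    then have ae: "AE p in lborel. \<bar>F p\<bar> \<le> K" by (simp only: lborel_prod)
    have "AE p in restrict_space lborel ?S. \<bar>case p of (t, x) \<Rightarrow> \<rho> t x\<bar> \<le> K"
      using Sm by (subst AE_restrict_space_iff) (use ae in \<open>auto elim!: eventually_mono simp: F_def\<close>)
    moreover have "(\<lambda>(t, x). \<rho> t x) \<in> borel_measurable (restrict_space lborel ?S)"
      using Fm Sm by (subst borel_measurable_restrict_space_iff) (auto simp: F_def[abs_def])
    ultimately show "in_Linf (restrict_space lborel ?S) (\<lambda>(t, x). \<rho> t x)"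
      unfolding in_Linf_def by blast
  qed
qed

end
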